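(* The $\mathrm{Aff}_3$-module $V$ spanned by the $90$ quintics that vanish on $\mathcal{M}_{[3]}(\Delta_3)\subset\mathbb{P}^{19}$ (i.e. the $90$-dimensional space of homogeneous degree-$5$ polynomials in the moment coordinates vanishing on this variety) is the direct sum of two indecomposable $\mathrm{Aff}_3$-modules $V_1$ and $V_2$, each of dimension $45$. As a $\mathrm{GL}_3$-module, $V$ decomposes into $12$ irreducibles: $V_1$ and $V_2$ split into six irreducible $\mathrm{GL}_3$-modules each. The highest weights of these irreducible $\mathrm{GL}_3$-modules are for $V_1$: $(3,3,4),\ (3,4,4),\ (2,4,4),\ (2,3,4),\ (1,4,4),\ (1,3,4)$; for $V_2$: $(2,2,3),\ (2,3,3),\ (2,2,4),\ (2,3,4),\ (2,2,5),\ (2,3,5)$; and in both lists the dimensions are, in order, $3,3,6,8,10,15$.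
   Context: $\Delta_3$ denotes the tetrahedron $\mathrm{conv}(x_1,x_2,x_3,x_4)\subset\mathbb{R}^3$, with uniform probability distribution $\mu_{\Delta_3}$ and moments $m_{I}=\int w_1^{i_1}w_2^{i_2}w_3^{i_3}\,d\mu_{\Delta_3}$, $I=(i_1,i_2,i_3)\in\mathbb{N}^3$, which are polynomials in the $12$ vertex coordinates. $\mathcal{M}_{[3]}(\Delta_3)\subset\mathbb{P}^{19}$ is the Zariski closure of the image of the map from $\mathbb{C}^{4\times3}$ sending the vertex matrix $X=(x_{kl})$ to $(m_I(X):|I|\le3)$. The group $\mathrm{Aff}_3=\mathbb{R}^3\rtimes\mathrm{GL}_3(\mathbb{R})$ of affine transformations $x\mapsto Ax+b$ acts linearly on the moment coordinates by $m_I\mapsto\sum_{|J|\le|I|}\nu_{IJ}(A,b)\,m_J$, where $\nu_{IJ}(A,b)$ is the coefficient of $x^J$ in the expansion of $(Ax+b)^I$, and hence on polynomials in the $m_I$. $\mathrm{GL}_3$ is the subgroup $b=0$. Weights of $\mathrm{GL}_3$ are with respect to the grading in which $m_{i_1i_2i_3}$ has weight $(i_1,i_2,i_3)$; highest weights are written with weakly increasing entries (so $(a,b,c)$ denotes the irreducible module with highest weight $(c,b,a)$ in the usual weakly decreasing convention). *)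

theory Defs
  imports "HOL-Analysis.Analysis" "HOL-Library.Poly_Mapping"
begin

section \<open>Multivariate polynomials\<close>

text \<open>Polynomials in variables \<open>'v\<close>: finitely supported coefficient functions on monomials, the
  product being the convolution product of \<open>Poly_Mapping\<close>.\<close>

type_synonym 'v monomial = "'v \<Rightarrow>\<^sub>0 nat"
type_synonym ('v, 'a) poly_ring = "'v monomial \<Rightarrow>\<^sub>0 'a"

definition mdegree :: "'v monomial \<Rightarrow> nat" where
  "mdegree m = (\<Sum>v\<in>Poly_Mapping.keys m. Poly_Mapping.lookup m v)"

definition Const :: "'a \<Rightarrow> ('v, 'a::zero) poly_ring" where
  "Const c = Poly_Mapping.single 0 c"

definition Var :: "'v \<Rightarrow> ('v, 'a::zero_neq_one) poly_ring" where
  "Var v = Poly_Mapping.single (Poly_Mapping.single v 1) 1"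

text \<open>Substitution of \<open>s v\<close> for each variable \<open>v\<close>, with coefficients transported by \<open>h\<close>.\<close>

definition peval :: "('a::zero \<Rightarrow> 'r::comm_semiring_1) \<Rightarrow> ('v \<Rightarrow> 'r) \<Rightarrow> ('v, 'a) poly_ring \<Rightarrow> 'r" where
  "peval h s f = (\<Sum>m\<in>Poly_Mapping.keys f.
     h (Poly_Mapping.lookup f m) *
     (\<Prod>v\<in>Poly_Mapping.keys m. s v ^ Poly_Mapping.lookup m v))"

definition pscale :: "'a \<Rightarrow> ('v, 'a::comm_ring_1) poly_ring \<Rightarrow> ('v, 'a) poly_ring" where
  "pscale c f = Const c * f"

global_interpretation pvs: vector_space "pscale :: 'a::field \<Rightarrow> ('v, 'a) poly_ring \<Rightarrow> _"
  by unfold_locales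
    (simp_all add: pscale_def Const_def distrib_left distrib_right single_add mult_single
      mult.assoc [symmetric])

section \<open>Moments of tetrahedra\<close>

text \<open>A moment index \<open>I = (i\<^sub>1, i\<^sub>2, i\<^sub>3)\<close> is identified with the monomial \<open>x\<^sup>I\<close>. Vertices are the rows
  of \<open>X\<close>, so \<open>X $ k $ l\<close> is \<open>x\<^sub>k\<^sub>l\<close>.\<close>

type_synonym mindex = "3 monomial"

definition tetrahedron :: "real^3^4 \<Rightarrow> (real^3) set" where
  "tetrahedron X = convex hull (range (($) X))"

definition nondegenerate :: "real^3^4 \<Rightarrow> bool" where
  "nondegenerate X \<longleftrightarrow> inj (($) X) \<and> \<not> affine_dependent (range (($) X))"

definition moment :: "real^3^4 \<Rightarrow> mindex \<Rightarrow> real" where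
  "moment X I =
    (\<integral>w. (\<Prod>l\<in>UNIV. (w $ l) ^ Poly_Mapping.lookup I l) \<partial>uniform_measure lborel (tetrahedron X))"

text \<open>The moment \<open>m\<^sub>I\<close> as a polynomial in the 12 vertex coordinates. It is unique because the
  nondegenerate \<open>X\<close> are Zariski dense.\<close>

definition moment_poly :: "mindex \<Rightarrow> (4 \<times> 3, real) poly_ring" where
  "moment_poly I =
    (THE f. \<forall>X. nondegenerate X \<longrightarrow> peval id (\<lambda>(k, l). X $ k $ l) f = moment X I)"

definition moment_map :: "complex^3^4 \<Rightarrow> mindex \<Rightarrow> complex" where
  "moment_map X I = peval of_real (\<lambda>(k, l). X $ k $ l) (moment_poly I)"

section \<open>The moment variety and its quintics\<close>

text \<open>The variable with index \<open>I\<close> of the polynomials below is the moment coordinate \<open>m\<^sub>I\<close>; the 20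
  coordinates of the projective space are those with \<open>I\<close> in \<open>indices\<close>.\<close>

type_synonym moment_polynomial = "(mindex, complex) poly_ring"

definition indices :: "mindex set" where
  "indices = {I. mdegree I \<le> 3}"

definition forms :: "nat \<Rightarrow> moment_polynomial set" where
  "forms d = {f. \<forall>m\<in>Poly_Mapping.keys f. Poly_Mapping.keys m \<subseteq> indices \<and> mdegree m = d}"

text \<open>Projective Zariski closure of the image of \<open>moment_map\<close>, given by the homogeneous coordinate
  vectors of its points; only the entries with index in \<open>indices\<close> matter.\<close>

definition moment_variety :: "(mindex \<Rightarrow> complex) set" where
  "moment_variety = {p. (\<exists>I\<in>indices. p I \<noteq> 0) \<and>
     (\<forall>d. \<forall>f\<in>forms d. (\<forall>X. peval id (moment_map X) f = 0) \<longrightarrow> peval id p f = 0)}"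

definition vanishing_quintics :: "moment_polynomial set" where
  "vanishing_quintics = {f \<in> forms 5. \<forall>p\<in>moment_variety. peval id p f = 0}"

section \<open>The action of the affine group\<close>

definition affine_form :: "real^3^3 \<Rightarrow> real^3 \<Rightarrow> 3 \<Rightarrow> (3, real) poly_ring" where
  "affine_form A b l = (\<Sum>k\<in>UNIV. Const (A $ l $ k) * Var k) + Const (b $ l)"

definition nu :: "real^3^3 \<Rightarrow> real^3 \<Rightarrow> mindex \<Rightarrow> mindex \<Rightarrow> real" where
  "nu A b I J = Poly_Mapping.lookup (\<Prod>l\<in>UNIV. affine_form A b l ^ Poly_Mapping.lookup I l) J"

definition act :: "real^3^3 \<Rightarrow> real^3 \<Rightarrow> moment_polynomial \<Rightarrow> moment_polynomial" where
  "act A b = peval Const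
     (\<lambda>I. \<Sum>J | mdegree J \<le> mdegree I. Const (of_real (nu A b I J)) * Var J)"

definition aff_submodule :: "moment_polynomial set \<Rightarrow> bool" where
  "aff_submodule W \<longleftrightarrow> pvs.subspace W \<and> (\<forall>A b. invertible A \<longrightarrow> act A b ` W \<subseteq> W)"

definition gl_submodule :: "moment_polynomial set \<Rightarrow> bool" where
  "gl_submodule W \<longleftrightarrow> pvs.subspace W \<and> (\<forall>A. invertible A \<longrightarrow> act A 0 ` W \<subseteq> W)"

text \<open>Internal direct sum of a list of subspaces.\<close>

definition direct_sum :: "moment_polynomial set \<Rightarrow> moment_polynomial set list \<Rightarrow> bool" where
  "direct_sum W Us \<longleftrightarrow>
     (\<forall>U\<in>set Us. pvs.subspace U) \<and>
     W = {\<Sum>i<length Us. u i | u. \<forall>i<length Us. u i \<in> Us ! i} \<and>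
     (\<forall>u. (\<forall>i<length Us. u i \<in> Us ! i) \<and> (\<Sum>i<length Us. u i) = 0
        \<longrightarrow> (\<forall>i<length Us. u i = 0))"

definition aff_indecomposable :: "moment_polynomial set \<Rightarrow> bool" where
  "aff_indecomposable W \<longleftrightarrow> aff_submodule W \<and> W \<noteq> {0} \<and>
     (\<forall>W1 W2. aff_submodule W1 \<and> aff_submodule W2 \<and> direct_sum W [W1, W2]
        \<longrightarrow> W1 = {0} \<or> W2 = {0})"

definition gl_irreducible :: "moment_polynomial set \<Rightarrow> bool" where
  "gl_irreducible W \<longleftrightarrow> gl_submodule W \<and> W \<noteq> {0} \<and>
     (\<forall>U. gl_submodule U \<and> U \<subseteq> W \<longrightarrow> U = {0} \<or> U = W)"

text \<open>A diagonal matrix with entries \<open>t\<close> multiplies \<open>m\<^sub>I\<close> by \<open>t\<^sup>I\<close>, so weights for this torus are those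
  of the grading in which \<open>m\<^sub>I\<close> has weight \<open>I\<close>.\<close>

definition diag_mat :: "real^3 \<Rightarrow> real^3^3" where
  "diag_mat t = (\<chi> i j. if i = j then t $ i else 0)"

definition has_weight :: "moment_polynomial \<Rightarrow> nat^3 \<Rightarrow> bool" where
  "has_weight f wt \<longleftrightarrow> (\<forall>t. (\<forall>i. t $ i \<noteq> 0) \<longrightarrow>
     act (diag_mat t) 0 f = pscale (of_real (\<Prod>i\<in>UNIV. (t $ i) ^ (wt $ i))) f)"

text \<open>Entries are written out because \<open>3 = 0 < 1 < 2\<close> in the index type \<open>3\<close>.\<close>

definition upper_unitriangular :: "real^3^3 \<Rightarrow> bool" where
  "upper_unitriangular A \<longleftrightarrow>
     A $ 1 $ 1 = 1 \<and> A $ 2 $ 2 = 1 \<and> A $ 3 $ 3 = 1 \<and>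
     A $ 2 $ 1 = 0 \<and> A $ 3 $ 1 = 0 \<and> A $ 3 $ 2 = 0"

text \<open>The substitution \<open>x \<mapsto> A x\<close> with \<open>A\<close> upper unitriangular moves weights from earlier to later
  coordinates (it fixes \<open>m\<^sub>0\<^sub>0\<^sub>1\<close>). Hence highest weights for this Borel subgroup have weakly increasing
  entries, and \<open>(a, b, c)\<close> is the module with highest weight \<open>(c, b, a)\<close> in the decreasing convention.\<close>

definition has_highest_weight :: "moment_polynomial set \<Rightarrow> nat^3 \<Rightarrow> bool" where
  "has_highest_weight W wt \<longleftrightarrow>
     (\<exists>f\<in>W. f \<noteq> 0 \<and> has_weight f wt \<and> (\<forall>A. upper_unitriangular A \<longrightarrow> act A 0 f = f))"

definition gl_irreducible_of_type :: "moment_polynomial set \<Rightarrow> (nat^3) \<times> nat \<Rightarrow> bool" where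
  "gl_irreducible_of_type W = (\<lambda>(wt, d).
     gl_irreducible W \<and> has_highest_weight W wt \<and> pvs.dim W = d)"

end

theory Submission
  imports Defs "HOL-Computational_Algebra.Polynomial"
begin

text \<open>A cubature rule of degree three for tetrahedra turns the moments up to order three into an explicit
  polynomial map, and every nondegenerate tetrahedron is an affine image of a regular one. Hence the vanishing
  quintics are the largest affinely stable space of quintic forms that vanish at the moments of the regular
  tetrahedron. Differentiating the group action gives first order operators \<open>R a b\<close> that span a copy of
  \<open>gl\<^sub>4\<close>, and \<open>R a b\<close> and \<open>R b a\<close> are adjoint for a Fischer inner product, so submodules have orthogonal
  complements and are controlled by highest weight vectors. Exact linear algebra on weight spaces shows that
  the translation invariant highest weight vectors have weight \<open>(1,3,4)\<close> or \<open>(2,2,3)\<close>, each unique up to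
  scalars; lowering to them by translations bounds all highest weight vectors. Two explicit quintics of weights
  \<open>(3,4,4)\<close> and \<open>(2,3,5)\<close> attain the bound, and the affine modules that they generate are indecomposable
  because each nonzero submodule contains the unique translation invariant highest weight vector.\<close>

section \<open>Multivariate polynomials\<close>

subsection \<open>Evaluation and induction\<close>

abbreviation lkp :: "('a \<Rightarrow>\<^sub>0 'b::zero) \<Rightarrow> 'a \<Rightarrow> 'b" where "lkp \<equiv> Poly_Mapping.lookup"
abbreviation kys :: "('a \<Rightarrow>\<^sub>0 'b::zero) \<Rightarrow> 'a set" where "kys \<equiv> Poly_Mapping.keys"
abbreviation sgl :: "'a \<Rightarrow> 'b \<Rightarrow> 'a \<Rightarrow>\<^sub>0 'b::zero" where "sgl \<equiv> Poly_Mapping.single"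

lemma Const_0 [simp]: "Const 0 = 0" and Const_1 [simp]: "Const 1 = 1"
  by (simp_all add: Const_def)

lemma Const_add: "Const (a + b) = Const a + Const b"
  by (simp add: Const_def single_add)

lemma Const_mult: "Const (a * b) = Const a * Const (b :: 'a::comm_ring_1)"
  by (simp add: Const_def mult_single)

lemma Const_power: "Const (a ^ n) = Const (a :: 'a::comm_ring_1) ^ n"
  by (induct n) (auto simp: Const_mult)

lemma poly_sum_single: "f = (\<Sum>m\<in>kys f. sgl m (lkp f m))"
  by (rule poly_mapping_eqI)
     (auto simp: lookup_sum lookup_single "when_def" in_keys_iff sum.delta)

lemma Const_mult_single: "Const c * sgl m a = sgl m (c * (a :: 'a::comm_ring_1))"
  by (simp add: Const_def mult_single)

lemma pscale_single: "pscale c (sgl m a) = sgl m (c * a)"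
  by (simp add: pscale_def Const_mult_single)

lemma lookup_pscale [simp]: "lkp (pscale c f) m = c * lkp f m"
proof -
  have "pscale c f = (\<Sum>m\<in>kys f. sgl m (c * lkp f m))"
    by (subst poly_sum_single[of f]) (simp add: pscale_def sum_distrib_left Const_mult_single)
  then show ?thesis
    by (auto simp: lookup_sum lookup_single "when_def" in_keys_iff sum.delta)
qed

lemma single_monom_insert: "sgl (sgl v n + m) (1 :: 'a::comm_ring_1) = Var v ^ n * sgl m 1"
proof (induct n)
  case 0 then show ?case by simp
next
  case (Suc n)
  have "sgl (sgl v (Suc n) + m) (1::'a) = sgl (sgl v 1) 1 * sgl (sgl v n + m) 1"
    by (simp add: mult_single flip: single_add add.assoc)
  then show ?case by (simp add: Suc Var_def mult.assoc)
qed

lemma poly_induct [case_names Const Var add mult]: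
  fixes f :: "('v, 'a::comm_ring_1) poly_ring"
  assumes C: "\<And>c. P (Const c)" and V: "\<And>v. P (Var v)"
    and A: "\<And>f g. P f \<Longrightarrow> P g \<Longrightarrow> P (f + g)" and M: "\<And>f g. P f \<Longrightarrow> P g \<Longrightarrow> P (f * g)"
  shows "P f"
proof -
  have P1: "P 1" using C[of 1] by simp
  have P0: "P 0" using C[of 0] by simp
  have pow: "P (Var v ^ n)" for v n by (induct n) (auto intro: P1 M V)
  have mon: "P (sgl m 1)" for m
  proof (induct m rule: update_induct)
    case const then show ?case using P1 by simp
  next
    case (update m v b)
    have "Poly_Mapping.update v b m = sgl v b + m"
      using update(1) by (intro poly_mapping_eqI)
        (auto simp: lookup_update lookup_add lookup_single "when_def" in_keys_iff)
    then show ?case using update by (simp add: single_monom_insert M pow)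
  qed
  have sg: "P (sgl m c)" for m c
    using M[OF C[of c] mon[of m]] by (simp add: Const_mult_single)
  have "P (\<Sum>m\<in>S. sgl m (lkp f m))" if "finite S" for S
    using that by (induct S rule: finite_induct) (auto intro: P0 A sg)
  then show ?thesis by (subst poly_sum_single) simp
qed

definition coeff_hom :: "('a::comm_ring_1 \<Rightarrow> 'b::comm_ring_1) \<Rightarrow> bool" where
  "coeff_hom h \<longleftrightarrow> h 1 = 1 \<and> (\<forall>a b. h (a + b) = h a + h b) \<and> (\<forall>a b. h (a * b) = h a * h b)"

lemma coeff_homD:
  assumes "coeff_hom h"
  shows "h 0 = 0" "h 1 = 1" "h (a + b) = h a + h b" "h (a * b) = h a * h b"
  using assms unfolding coeff_hom_def by (auto, metis add_cancel_right_right)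

lemma coeff_hom_Const [simp]: "coeff_hom Const"
  by (simp add: coeff_hom_def Const_add Const_mult)

lemma coeff_hom_id [simp]: "coeff_hom id" "coeff_hom (\<lambda>x. x)"
  by (simp_all add: coeff_hom_def)

lemma coeff_hom_of_real [simp]: "coeff_hom (of_real :: real \<Rightarrow> complex)"
  by (simp add: coeff_hom_def)

definition meval :: "('v \<Rightarrow> 'r::comm_semiring_1) \<Rightarrow> 'v monomial \<Rightarrow> 'r" where
  "meval s m = (\<Prod>v\<in>kys m. s v ^ lkp m v)"

lemma meval_superset: "finite A \<Longrightarrow> kys m \<subseteq> A \<Longrightarrow> meval s m = (\<Prod>v\<in>A. s v ^ lkp m v)"
  unfolding meval_def by (rule prod.mono_neutral_left) (auto simp: in_keys_iff)

lemma meval_add: "meval s (m + n) = meval s m * meval s n"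
  by (simp add: meval_superset[of "kys m \<union> kys n"] keys_add lookup_add power_add prod.distrib)

lemma meval_0 [simp]: "meval s 0 = 1"
  by (simp add: meval_def)

lemma meval_single [simp]: "meval s (sgl v n) = s v ^ n"
  by (simp add: meval_superset[of "{v}"] keys_single)

lemma peval_meval: "peval h s f = (\<Sum>m\<in>kys f. h (lkp f m) * meval s m)"
  by (simp add: peval_def meval_def)

lemma peval_superset:
  "h 0 = 0 \<Longrightarrow> finite A \<Longrightarrow> kys f \<subseteq> A \<Longrightarrow> peval h s f = (\<Sum>m\<in>A. h (lkp f m) * meval s m)"
  unfolding peval_meval by (rule sum.mono_neutral_left) (auto simp: in_keys_iff)

context
  fixes h :: "'a::comm_ring_1 \<Rightarrow> 'b::comm_ring_1"
  assumes h: "coeff_hom h"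
begin

lemma peval_0 [simp]: "peval h s 0 = 0"
  by (simp add: peval_def)

lemma peval_add: "peval h s (f + g) = peval h s f + peval h s g"
  by (simp add: peval_superset[of h "kys f \<union> kys g"] keys_add lookup_add coeff_homD[OF h]
      distrib_right sum.distrib)

lemma peval_single: "peval h s (sgl m c) = h c * meval s m"
  by (simp add: peval_superset[of h "{m}"] coeff_homD[OF h])

lemma peval_Const [simp]: "peval h s (Const c) = h c"
  by (simp add: Const_def peval_single)

lemma peval_1 [simp]: "peval h s 1 = 1"
  using peval_Const[of s 1] by (simp add: coeff_homD[OF h])

lemma peval_Var [simp]: "peval h s (Var v) = s v"
  by (simp add: Var_def peval_single coeff_homD[OF h])

lemma peval_sum: "peval h s (sum f A) = (\<Sum>x\<in>A. peval h s (f x))"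
  by (induct A rule: infinite_finite_induct) (auto simp: peval_add)

lemma peval_mult: "peval h s (f * g) = peval h s f * peval h s g"
proof -
  have "peval h s (f * g) = peval h s (\<Sum>m\<in>kys f. \<Sum>n\<in>kys g. sgl (m + n) (lkp f m * lkp g n))"
    by (subst (1) poly_sum_single[of f], subst (1) poly_sum_single[of g])
       (simp add: sum_product mult_single)
  also have "\<dots> = (\<Sum>m\<in>kys f. \<Sum>n\<in>kys g. (h (lkp f m) * meval s m) * (h (lkp g n) * meval s n))"
    by (simp add: peval_sum peval_single meval_add coeff_homD[OF h] mult_ac)
  also have "\<dots> = peval h s f * peval h s g"
    by (simp add: peval_meval sum_product)
  finally show ?thesis .
qed

lemma peval_power: "peval h s (f ^ n) = peval h s f ^ n"
  by (induct n) (auto simp: peval_mult)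

lemma peval_prod: "peval h s (prod f A) = (\<Prod>x\<in>A. peval h s (f x))"
  by (induct A rule: infinite_finite_induct) (auto simp: peval_mult)

lemma peval_pscale: "peval h s (pscale c f) = h c * peval h s f"
  by (simp add: pscale_def peval_mult)

end

lemma peval_peval:
  assumes "coeff_hom h" "coeff_hom k" "coeff_hom l" "\<And>c. peval k t (h c) = l c"
  shows "peval k t (peval h s f) = peval l (\<lambda>v. peval k t (s v)) f"
  by (induct f rule: poly_induct)
     (simp_all add: assms peval_add peval_mult)

lemma peval_cong: "(\<And>m v. m \<in> kys f \<Longrightarrow> v \<in> kys m \<Longrightarrow> s v = t v) \<Longrightarrow> peval h s f = peval h t f"
  unfolding peval_def by (intro sum.cong prod.cong arg_cong2[where f="(*)"]) auto

lemma pscale_add: "pscale c (f + g) = pscale c f + pscale c g"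
  and pscale_minus: "pscale c (f - g) = pscale c f - pscale c g"
  and pscale_pscale: "pscale a (pscale b f) = pscale (a * b) f"
  and pscale_1 [simp]: "pscale 1 f = f"
  and pscale_0 [simp]: "pscale 0 f = 0"
  and pscale_right_0 [simp]: "pscale c 0 = 0"
  and pscale_left_add: "pscale (a + b) f = pscale a f + pscale b f"
  and pscale_mult_left: "pscale c f * g = pscale c (f * g)"
  and pscale_mult_right: "f * pscale c g = pscale c (f * g)"
  by (simp_all add: pscale_def Const_mult Const_add algebra_simps)

lemma pscale_sum: "pscale c (sum f A) = (\<Sum>x\<in>A. pscale c (f x))"
  by (simp add: pscale_def sum_distrib_left)

lemma keys_pscale: "kys (pscale c f) \<subseteq> kys f"
  by (auto simp: in_keys_iff)

subsection \<open>Polynomials vanishing as functions\<close>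

text \<open>Scaling one variable separates the monomials by their exponent in it.\<close>

lemma poly_coeffs_zero:
  fixes a :: "nat \<Rightarrow> complex"
  assumes "infinite S" "\<And>t. t \<in> S \<Longrightarrow> (\<Sum>k\<le>N. a k * t ^ k) = 0"
  shows "k \<le> N \<Longrightarrow> a k = 0"
proof -
  have "\<not> finite {z. (\<Sum>k\<le>N. a k * z ^ k) = 0}"
    using assms finite_subset[of S "{z. (\<Sum>k\<le>N. a k * z ^ k) = 0}"] by blast
  then show "a k = 0" if "k \<le> N"
    using polyfun_finite_roots[of a N] that by blast
qed

subsection \<open>Partial derivatives\<close>

definition pd :: "'v \<Rightarrow> ('v, 'a::comm_ring_1) poly_ring \<Rightarrow> ('v, 'a) poly_ring" where
  "pd v f = (\<Sum>m\<in>kys f. sgl (m - sgl v 1) (lkp f m * of_nat (lkp m v)))"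

lemma monom_minus_add: "lkp m v \<noteq> 0 \<Longrightarrow> m - sgl v (1::nat) + sgl v 1 = m"
  by (intro poly_mapping_eqI) (auto simp: lookup_add lookup_minus lookup_single "when_def")

lemma monom_add_minus [simp]: "m + sgl v (1::nat) - sgl v 1 = m"
  by (intro poly_mapping_eqI) (auto simp: lookup_add lookup_minus)

lemma lookup_pd: "lkp (pd v f) m = of_nat (lkp m v + 1) * lkp f (m + sgl v 1)"
proof -
  have "lkp (pd v f) m = (\<Sum>m'\<in>kys f. if m' = m + sgl v 1 then of_nat (lkp m v + 1) * lkp f m' else 0)"
    unfolding pd_def lookup_sum
  proof (intro sum.cong refl)
    fix m' assume "m' \<in> kys f"
    show "lkp (sgl (m' - sgl v 1) (lkp f m' * of_nat (lkp m' v))) m =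
      (if m' = m + sgl v 1 then of_nat (lkp m v + 1) * lkp f m' else 0)"
    proof (cases "lkp m' v = 0")
      case True
      then have "m' \<noteq> m + sgl v 1" by (auto simp: lookup_add)
      then show ?thesis using True by simp
    next
      case False
      then have "m' - sgl v 1 = m \<longleftrightarrow> m' = m + sgl v 1"
        using monom_minus_add[of m' v] by auto
      then show ?thesis by (auto simp: lookup_single "when_def" lookup_add mult.commute)
    qed
  qed
  then show ?thesis by (auto simp: sum.delta in_keys_iff)
qed

lemma pd_add: "pd v (f + g) = pd v f + pd v g"
  by (rule poly_mapping_eqI) (simp add: lookup_pd lookup_add distrib_left)

lemma pd_0 [simp]: "pd v 0 = 0"
  by (rule poly_mapping_eqI) (simp add: lookup_pd)

lemma pd_sum: "pd v (sum f A) = (\<Sum>x\<in>A. pd v (f x))"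
  by (induct A rule: infinite_finite_induct) (auto simp: pd_add)

lemma pd_pscale: "pd v (pscale c f) = pscale c (pd v f)"
  by (rule poly_mapping_eqI) (simp add: lookup_pd mult_ac)

lemma pd_single: "pd v (sgl m c) = sgl (m - sgl v 1) (c * of_nat (lkp m v))"
proof (cases "c = 0")
  case False
  then show ?thesis by (simp add: pd_def)
qed simp

lemma pd_Const [simp]: "pd v (Const c) = 0"
  by (simp add: Const_def pd_single)

lemma pd_Var: "pd v (Var w) = (if v = w then 1 else 0)"
  by (auto simp: Var_def pd_single lookup_single "when_def")

lemma pd_Var_mult: "pd v (Var w * g) = pd v (Var w) * g + Var w * pd v g"
proof -
  have *: "pd v (Var w * sgl m c) = pd v (Var w) * sgl m c + Var w * pd v (sgl m c)" for m c
  proof (cases "lkp m v = 0")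
    case True
    then show ?thesis
      by (auto simp: Var_def pd_single mult_single lookup_add lookup_single "when_def" add.commute)
  next
    case False
    have "sgl w 1 + m - sgl v 1 = sgl w 1 + (m - sgl v (1::nat))"
      using False by (intro poly_mapping_eqI)
        (auto simp: lookup_add lookup_minus lookup_single "when_def")
    moreover have "sgl v 1 + (m - sgl v (1::nat)) = m"
      using monom_minus_add[OF False] by (simp add: add.commute)
    ultimately show ?thesis
      by (auto simp: Var_def pd_single mult_single lookup_add lookup_single "when_def" single_add distrib_left
          simp flip: single_add)
  qed
  show ?thesis
    by (subst (1 2 3) poly_sum_single[of g])
       (simp add: sum_distrib_left pd_sum * sum.distrib)
qed

lemma pd_mult: "pd v (f * g) = pd v f * g + f * pd v g"
proof (induct f arbitrary: g rule: poly_induct)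
  case (Const c)
  then show ?case using pd_pscale[of v c g] by (simp add: pscale_def)
next
  case (Var w)
  then show ?case by (rule pd_Var_mult)
next
  case (add f1 f2)
  then show ?case by (simp add: distrib_right pd_add)
next
  case (mult f1 f2)
  then show ?case by (simp add: mult.assoc distrib_right distrib_left)
qed

section \<open>The action of the Lie algebra on forms\<close>

text \<open>A moment index \<open>I\<close> is completed to the four exponents of a cubic monomial in
  \<open>x\<^sub>0 = 1, x\<^sub>1, x\<^sub>2, x\<^sub>3\<close>. The derivation \<open>R a b\<close> is induced by the vector field \<open>x\<^sub>b \<partial>\<^sub>a\<close>;
  for \<open>a, b \<noteq> 0\<close> these span the Lie algebra of \<open>GL\<^sub>3\<close>, and \<open>R a 0\<close> is the
  infinitesimal translation of the coordinate \<open>a\<close>. The \<open>R 0 b\<close> do not preserve the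
  moment variety, but are the adjoints of the translations.\<close>

datatype dir = A0 | A1 | A2 | A3

fun ex :: "dir \<Rightarrow> mindex \<Rightarrow> nat" where
  "ex A0 I = 3 - mdegree I"
| "ex A1 I = lkp I 1"
| "ex A2 I = lkp I 2"
| "ex A3 I = lkp I 3"

definition un :: "dir \<Rightarrow> dir \<Rightarrow> int" where
  "un a b = (if a = b then 1 else 0)"

definition exi :: "mindex \<Rightarrow> dir \<Rightarrow> int" where
  "exi I a = int (ex a I)"

definition idx :: "(dir \<Rightarrow> int) \<Rightarrow> mindex" where
  "idx e = sgl 1 (nat (e A1)) + sgl 2 (nat (e A2)) + sgl 3 (nat (e A3))"

definition valid :: "(dir \<Rightarrow> int) \<Rightarrow> bool" where
  "valid e \<longleftrightarrow> 0 \<le> e A0 \<and> 0 \<le> e A1 \<and> 0 \<le> e A2 \<and> 0 \<le> e A3 \<and> e A0 + e A1 + e A2 + e A3 = 3"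

lemma all_dir: "(\<forall>a. P a) \<longleftrightarrow> P A0 \<and> P A1 \<and> P A2 \<and> P A3"
  by (metis dir.exhaust)

lemma dir_eqI: "e A0 = f A0 \<Longrightarrow> e A1 = f A1 \<Longrightarrow> e A2 = f A2 \<Longrightarrow> e A3 = f A3 \<Longrightarrow> e = f"
  by (rule ext) (metis dir.exhaust)

lemma valid_nonneg: "valid e \<Longrightarrow> 0 \<le> e a"
  by (cases a) (auto simp: valid_def)

lemma three_cases: "(x::3) = 1 \<or> x = 2 \<or> x = 3"
  using exhaust_3[of x] .

lemma mdegree_3: "mdegree (I :: mindex) = lkp I 1 + lkp I 2 + lkp I 3"
proof -
  have "mdegree I = (\<Sum>v\<in>UNIV. lkp I v)"
    unfolding mdegree_def by (rule sum.mono_neutral_left) (auto simp: in_keys_iff)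
  then show ?thesis by (simp add: sum_3)
qed

lemma lookup_idx: "lkp (idx e) 1 = nat (e A1)" "lkp (idx e) 2 = nat (e A2)" "lkp (idx e) 3 = nat (e A3)"
  by (auto simp: idx_def lookup_add lookup_single "when_def")

lemma exi_idx [simp]: "valid e \<Longrightarrow> exi (idx e) = e"
  by (rule dir_eqI) (auto simp: exi_def mdegree_3 lookup_idx valid_def)

lemma mindex_eqI: "lkp I 1 = lkp J 1 \<Longrightarrow> lkp I 2 = lkp J 2 \<Longrightarrow> lkp I 3 = lkp J 3 \<Longrightarrow> I = (J :: mindex)"
  by (rule poly_mapping_eqI) (metis three_cases)

lemma idx_exi [simp]: "idx (exi I) = I"
  by (rule mindex_eqI) (auto simp: lookup_idx exi_def)

lemma valid_exi: "I \<in> indices \<Longrightarrow> valid (exi I)"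
  by (auto simp: valid_def exi_def indices_def mdegree_3)

lemma idx_in_indices: "valid e \<Longrightarrow> idx e \<in> indices"
  by (auto simp: indices_def mdegree_3 lookup_idx valid_def)

lemma finite_indices [simp]: "finite indices"
proof -
  have "indices \<subseteq> (\<lambda>(i, j, k). sgl 1 i + sgl 2 j + sgl 3 k) ` ({..3} \<times> {..3} \<times> {..3})"
  proof
    fix I assume "I \<in> indices"
    then have "lkp I 1 \<le> 3" "lkp I 2 \<le> 3" "lkp I 3 \<le> 3" by (auto simp: indices_def mdegree_3)
    moreover have "I = sgl 1 (lkp I 1) + sgl 2 (lkp I 2) + sgl 3 (lkp I 3)"
      by (rule mindex_eqI) (auto simp: lookup_add lookup_single "when_def")
    ultimately show "I \<in> (\<lambda>(i, j, k). sgl 1 i + sgl 2 j + sgl 3 k) ` ({..3} \<times> {..3} \<times> {..3})"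
      by (intro image_eqI[where x="(lkp I 1, lkp I 2, lkp I 3)"]) auto
  qed
  then show ?thesis by (rule finite_subset) auto
qed

definition Vi :: "(dir \<Rightarrow> int) \<Rightarrow> moment_polynomial" where
  "Vi e = Var (idx e)"

definition shf :: "dir \<Rightarrow> dir \<Rightarrow> (dir \<Rightarrow> int) \<Rightarrow> dir \<Rightarrow> int" where
  "shf a b e c = e c - un a c + un b c"

lemma valid_shf: "valid e \<Longrightarrow> e a \<noteq> 0 \<Longrightarrow> valid (shf a b e)"
  by (cases a; cases b) (auto simp: valid_def shf_def un_def)

definition mv :: "dir \<Rightarrow> dir \<Rightarrow> mindex \<Rightarrow> mindex" where
  "mv a b I = idx (shf a b (exi I))"

definition R :: "dir \<Rightarrow> dir \<Rightarrow> moment_polynomial \<Rightarrow> moment_polynomial" where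
  "R a b f = (\<Sum>I\<in>indices. pscale (of_nat (ex a I)) (Var (mv a b I) * pd I f))"

lemma R_add: "R a b (f + g) = R a b f + R a b g"
  by (simp add: R_def pd_add distrib_left pscale_add sum.distrib)

lemma R_pscale: "R a b (pscale c f) = pscale c (R a b f)"
  by (simp add: R_def pd_pscale pscale_sum pscale_pscale pscale_mult_right mult.commute)

lemma R_0 [simp]: "R a b 0 = 0"
  by (simp add: R_def)

lemma R_minus: "R a b (f - g) = R a b f - R a b g"
  using R_add[of a b "f - g" g] by simp

lemma R_uminus: "R a b (- f) = - R a b f"
  using R_minus[of a b 0 f] by simp

lemma R_Const [simp]: "R a b (Const c) = 0"
  by (simp add: R_def)

lemma R_1 [simp]: "R a b 1 = 0"
  using R_Const[of a b 1] by simp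

lemma R_mult: "R a b (f * g) = R a b f * g + f * R a b g"
  by (simp add: R_def pd_mult sum_distrib_left sum_distrib_right distrib_left pscale_add sum.distrib
      pscale_def mult_ac)

lemma R_Var: "R a b (Var I) = (if I \<in> indices then pscale (of_nat (ex a I)) (Var (mv a b I)) else 0)"
proof -
  have "R a b (Var I) = (\<Sum>J\<in>indices. if J = I then pscale (of_nat (ex a J)) (Var (mv a b J)) else 0)"
    unfolding R_def by (rule sum.cong) (auto simp: pd_Var)
  then show ?thesis by (simp add: sum.delta)
qed

lemma R_Vi: "valid e \<Longrightarrow> R a b (Vi e) = pscale (of_int (e a)) (Vi (shf a b e))"
proof -
  assume v: "valid e"
  then have "int (ex a (idx e)) = e a" using exi_idx[OF v] by (metis exi_def)
  then show ?thesis using v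
    by (simp add: Vi_def R_Var idx_in_indices mv_def) (metis of_int_of_nat_eq)
qed

lemma derivation_eq:
  fixes d e :: "moment_polynomial \<Rightarrow> moment_polynomial"
  assumes "\<And>f g. d (f + g) = d f + d g" "\<And>f g. e (f + g) = e f + e g"
    "\<And>f g. d (f * g) = d f * g + f * d g" "\<And>f g. e (f * g) = e f * g + f * e g"
    "\<And>c. d (Const c) = e (Const c)" "\<And>I. d (Var I) = e (Var I)"
  shows "d f = e f"
  by (induct f rule: poly_induct) (simp_all add: assms)

lemma R_commute:
  "R a b (R c d f) - R c d (R a b f) = pscale (of_int (un a d)) (R c b f) - pscale (of_int (un b c)) (R a d f)"
proof (rule derivation_eq[where f = f])
  fix I
  show "R a b (R c d (Var I)) - R c d (R a b (Var I)) =
    pscale (of_int (un a d)) (R c b (Var I)) - pscale (of_int (un b c)) (R a d (Var I))"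
  proof (cases "I \<in> indices")
    case True
    define e where "e = exi I"
    have v: "valid e" and I: "Var I = Vi e" using True by (auto simp: e_def valid_exi Vi_def)
    have RR: "R a b (R c d (Vi e)) = pscale (of_int (e c * (shf c d e a))) (Vi (shf a b (shf c d e)))" for a b c d
    proof (cases "e c = 0")
      case False
      then show ?thesis using v valid_shf[OF v, of c d] by (simp add: R_Vi R_pscale pscale_pscale)
    qed (simp add: v R_Vi)
    have sw: "shf c d (shf a b e) = shf a b (shf c d e)" by (rule ext) (simp add: shf_def)
    have s1: "a = d \<Longrightarrow> shf c b e = shf a b (shf c d e)" by (rule ext) (simp add: shf_def)
    have s2: "b = c \<Longrightarrow> shf a d e = shf a b (shf c d e)" by (rule ext) (simp add: shf_def)
    have c: "e c * (shf c d e a) - e a * (shf a b e c) = un a d * e c - un b c * e a"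
      by (auto simp: shf_def un_def algebra_simps)
    have "R a b (R c d (Vi e)) - R c d (R a b (Vi e)) =
      pscale (of_int (un a d * e c - un b c * e a)) (Vi (shf a b (shf c d e)))"
      unfolding RR sw by (simp only: c[symmetric]) (simp add: pscale_def Const_def single_diff algebra_simps)
    also have "\<dots> = pscale (of_int (un a d)) (R c b (Vi e)) - pscale (of_int (un b c)) (R a d (Vi e))"
      using s1 s2 by (auto simp: R_Vi[OF v] un_def pscale_def Const_def single_diff algebra_simps)
    finally show ?thesis by (simp add: I)
  qed (simp add: R_Var)
qed (simp_all add: R_add R_mult pscale_def algebra_simps)

subsection \<open>The Fischer inner product\<close>

definition wI :: "mindex \<Rightarrow> real" where
  "wI I = fact (ex A0 I) * fact (ex A1 I) * fact (ex A2 I) * fact (ex A3 I)"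

definition Wm :: "mindex monomial \<Rightarrow> real" where
  "Wm m = (\<Prod>v\<in>kys m. fact (lkp m v) * wI v ^ lkp m v)"

definition ip :: "moment_polynomial \<Rightarrow> moment_polynomial \<Rightarrow> complex" where
  "ip f g = (\<Sum>m\<in>kys f. of_real (Wm m) * lkp f m * cnj (lkp g m))"

lemma wI_pos: "0 < wI I" by (simp add: wI_def)

lemma Wm_pos: "0 < Wm m"
  unfolding Wm_def by (intro prod_pos) (auto simp: wI_pos)

lemma Wm_superset: "finite A \<Longrightarrow> kys m \<subseteq> A \<Longrightarrow> Wm m = (\<Prod>v\<in>A. fact (lkp m v) * wI v ^ lkp m v)"
  unfolding Wm_def by (rule prod.mono_neutral_left) (auto simp: in_keys_iff)

lemma Wm_add_single: "Wm (m + sgl v 1) = real (lkp m v + 1) * wI v * Wm m"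
proof -
  define A where "A = kys m - {v}"
  have A: "finite A" "v \<notin> A" by (auto simp: A_def)
  have k: "kys m \<subseteq> insert v A" "kys (m + sgl v 1) \<subseteq> insert v A"
    using keys_add[of m "sgl v (1::nat)"] by (auto simp: A_def)
  have e: "(\<Prod>u\<in>A. fact (lkp (m + sgl v 1) u) * wI u ^ lkp (m + sgl v 1) u) =
      (\<Prod>u\<in>A. fact (lkp m u) * wI u ^ lkp m u :: real)"
    by (rule prod.cong) (use A in \<open>auto simp: lookup_add lookup_single "when_def"\<close>)
  have "Wm (m + sgl v 1) = (\<Prod>u\<in>insert v A. fact (lkp (m + sgl v 1) u) * wI u ^ lkp (m + sgl v 1) u)"
    by (rule Wm_superset) (use A k in auto)
  moreover have "Wm m = (\<Prod>u\<in>insert v A. fact (lkp m u) * wI u ^ lkp m u)"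
    by (rule Wm_superset) (use A k in auto)
  ultimately show ?thesis using A e by (simp add: lookup_add algebra_simps)
qed

lemma ip_superset:
  "finite A \<Longrightarrow> kys f \<subseteq> A \<Longrightarrow> ip f g = (\<Sum>m\<in>A. of_real (Wm m) * lkp f m * cnj (lkp g m))"
  unfolding ip_def by (rule sum.mono_neutral_left) (auto simp: in_keys_iff)

lemma ip_add_left: "ip (f + g) h = ip f h + ip g h"
  by (simp add: ip_superset[of "kys f \<union> kys g"] keys_add lookup_add algebra_simps sum.distrib)

lemma ip_0_left [simp]: "ip 0 g = 0" and ip_0_right [simp]: "ip f 0 = 0"
  by (simp_all add: ip_def)

lemma ip_sum_left: "ip (sum f A) h = (\<Sum>x\<in>A. ip (f x) h)"
  by (induct A rule: infinite_finite_induct) (auto simp: ip_add_left)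

lemma ip_single: "ip (sgl m c) g = of_real (Wm m) * c * cnj (lkp g m)"
  by (simp add: ip_superset[of "{m}"])

lemma ip_cnj: "cnj (ip f g) = ip g f"
  by (simp add: ip_superset[of "kys f \<union> kys g" f] ip_superset[of "kys f \<union> kys g" g] mult_ac)

lemma ip_add_right: "ip h (f + g) = ip h f + ip h g"
  by (metis ip_add_left ip_cnj complex_cnj_add)

lemma ip_sum_right: "ip h (sum f A) = (\<Sum>x\<in>A. ip h (f x))"
  by (induct A rule: infinite_finite_induct) (auto simp: ip_add_right)

lemma ip_pscale_left: "ip (pscale c f) g = c * ip f g"
  by (subst ip_superset[of "kys f"]) (simp_all add: keys_pscale ip_def sum_distrib_left mult_ac)

lemma ip_pscale_right: "ip f (pscale c g) = cnj c * ip f g"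
  by (metis ip_pscale_left ip_cnj complex_cnj_mult)

lemma ip_minus_left: "ip (f - g) h = ip f h - ip g h"
  using ip_add_left[of "f - g" g h] by simp

lemma ip_minus_right: "ip h (f - g) = ip h f - ip h g"
  using ip_add_right[of h "f - g" g] by simp

lemma ip_uminus_left: "ip (- f) h = - ip f h"
  using ip_minus_left[of 0 f h] by simp

definition nrm :: "moment_polynomial \<Rightarrow> real" where
  "nrm f = (\<Sum>m\<in>kys f. Wm m * (cmod (lkp f m))\<^sup>2)"

lemma ip_self: "ip f f = of_real (nrm f)"
  by (simp add: ip_def nrm_def mult.assoc complex_norm_square del: of_real_power)

lemma nrm_nonneg: "0 \<le> nrm f"
  unfolding nrm_def by (intro sum_nonneg) (simp add: Wm_pos less_imp_le)

lemma nrm_eq_0: "nrm f = 0 \<longleftrightarrow> f = 0"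
proof
  assume "nrm f = 0"
  then have "\<forall>m\<in>kys f. Wm m * (cmod (lkp f m))\<^sup>2 = 0"
    unfolding nrm_def by (subst (asm) sum_nonneg_eq_0_iff) (auto simp: Wm_pos less_imp_le)
  then have "\<forall>m\<in>kys f. lkp f m = 0"
    using Wm_pos by (metis mult_eq_0_iff norm_eq_zero order_less_irrefl power_eq_0_iff)
  then show "f = 0" by (metis keys_eq_empty not_in_keys_iff_lookup_eq_zero ex_in_conv)
qed (simp add: nrm_def)

lemma ip_self_eq_0: "ip f f = 0 \<longleftrightarrow> f = 0"
  by (simp add: ip_self nrm_eq_0)

lemma lookup_Var_mult:
  fixes g :: "('v, 'a::comm_ring_1) poly_ring"
  shows "lkp (Var v * g) (m + sgl v 1) = lkp g m"
proof -
  have "Var v * g = (\<Sum>n\<in>kys g. sgl (sgl v 1 + n) (lkp g n))"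
    by (subst poly_sum_single[of g]) (simp add: sum_distrib_left Var_def mult_single)
  then have "lkp (Var v * g) (m + sgl v 1) = (\<Sum>n\<in>kys g. if n = m then lkp g n else 0)"
    by (auto simp: lookup_sum lookup_single "when_def" add.commute intro!: sum.cong)
  then show ?thesis by (auto simp: sum.delta in_keys_iff)
qed

lemma ip_Var_mult: "ip (Var v * f) g = of_real (wI v) * ip f (pd v g)"
proof -
  have *: "ip (Var v * sgl m c) g = of_real (wI v) * ip (sgl m c) (pd v g)" for m c
    using Wm_add_single[of m v]
    by (simp add: Var_def mult_single ip_single lookup_pd add.commute[of "sgl v 1"] algebra_simps)
  show ?thesis
    by (subst (1 2) poly_sum_single[of f]) (simp add: sum_distrib_left ip_sum_left *)
qed

lemma ip_Var_mult_right: "ip f (Var v * g) = of_real (wI v) * ip (pd v f) g"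
  by (metis ip_Var_mult ip_cnj complex_cnj_mult complex_cnj_complex_of_real)

lemma wI_idx: "valid e \<Longrightarrow> wI (idx e) = fact (nat (e A0)) * fact (nat (e A1)) * fact (nat (e A2)) * fact (nat (e A3))"
  using exi_idx[of e] unfolding wI_def exi_def fun_eq_iff by (metis nat_int)

lemma fact_step: "0 < (n::int) \<Longrightarrow> real_of_int n * fact (nat (n - 1)) = fact (nat n)"
proof -
  assume "0 < n"
  then obtain k where "n = int (Suc k)" by (metis zero_less_imp_eq_int gr0_conv_Suc of_nat_0_less_iff)
  then show ?thesis by (simp add: nat_add_distrib)
qed

lemma fact_step': "0 \<le> (n::int) \<Longrightarrow> fact (nat (n + 1)) = (real_of_int n + 1) * fact (nat n)"
  using fact_step[of "n + 1"] by simp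

lemma wI_shf:
  assumes "valid e" "e a \<noteq> 0"
  shows "real_of_int (e a) * wI (idx (shf a b e)) = real_of_int (shf a b e b) * wI (idx e)"
proof (cases "a = b")
  case True
  then have "shf a b e = e" by (auto simp: shf_def)
  then show ?thesis using True by simp
next
  case False
  have p: "0 < e a" using assms valid_nonneg[of e a] by simp
  have q: "0 \<le> e b" using assms valid_nonneg by simp
  have w: "wI (idx (shf a b e)) = fact (nat (shf a b e A0)) * fact (nat (shf a b e A1)) *
     fact (nat (shf a b e A2)) * fact (nat (shf a b e A3))"
    by (rule wI_idx) (rule valid_shf[OF assms])
  show ?thesis unfolding w wI_idx[OF assms(1)]
    using False fact_step[OF p, symmetric] fact_step'[OF q]
    by (cases a; cases b) (simp_all add: shf_def un_def algebra_simps)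
qed

lemma exi_mv: "I \<in> indices \<Longrightarrow> exi I a \<noteq> 0 \<Longrightarrow> exi (mv a b I) = shf a b (exi I) \<and> mv a b I \<in> indices"
  using valid_shf[OF valid_exi] by (auto simp: mv_def idx_in_indices)

lemma ex_iff_exi: "ex a I \<noteq> 0 \<longleftrightarrow> exi I a \<noteq> 0" by (simp add: exi_def)

lemma mv_mv:
  assumes "I \<in> indices" "ex a I \<noteq> 0"
  shows "mv b a (mv a b I) = I"
proof -
  have "shf b a (shf a b (exi I)) = exi I" by (rule ext) (simp add: shf_def)
  moreover have "mv b a (mv a b I) = idx (shf b a (exi (mv a b I)))" by (rule mv_def)
  moreover have "exi I a \<noteq> 0" using assms(2) by (simp add: exi_def)
  ultimately show ?thesis using exi_mv[OF assms(1), of a b] by simp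
qed

lemma ex_mv:
  assumes "I \<in> indices" "ex a I \<noteq> 0"
  shows "mv a b I \<in> indices \<and> ex b (mv a b I) \<noteq> 0"
proof -
  have "exi I a \<noteq> 0" using assms(2) by (simp add: exi_def)
  then have e: "exi (mv a b I) = shf a b (exi I)" "mv a b I \<in> indices"
    using exi_mv[OF assms(1), of a b] by auto
  have "0 < shf a b (exi I) b"
    using assms valid_nonneg[OF valid_exi[OF assms(1)], of b] by (auto simp: shf_def un_def exi_def)
  then show ?thesis using e by (metis ex_iff_exi order_less_irrefl)
qed

lemma bij_shf: "bij_betw (mv a b) {I \<in> indices. ex a I \<noteq> 0} {J \<in> indices. ex b J \<noteq> 0}"
  by (rule bij_betw_byWitness[where f' = "mv b a"]) (use mv_mv ex_mv in auto)

lemma wI_mv: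
  assumes "I \<in> indices" "ex a I \<noteq> 0"
  shows "real (ex a I) * wI (mv a b I) = real (ex b (mv a b I)) * wI I"
proof -
  have v: "valid (exi I)" and n: "exi I a \<noteq> 0" using assms by (auto simp: valid_exi exi_def)
  have "exi (mv a b I) b = shf a b (exi I) b" by (simp add: mv_def valid_shf[OF v n])
  then have "int (ex b (mv a b I)) = shf a b (exi I) b" by (simp add: exi_def)
  then have "real (ex b (mv a b I)) = real_of_int (shf a b (exi I) b)" by (metis of_int_of_nat_eq)
  moreover have "real (ex a I) = real_of_int (exi I a)" by (simp add: exi_def)
  ultimately show ?thesis using wI_shf[OF v n, of b] by (simp add: mv_def)
qed

lemma ip_R: "ip (R a b f) g = ip f (R b a g)"
proof -
  let ?S = "{I \<in> indices. ex a I \<noteq> 0}" and ?T = "{J \<in> indices. ex b J \<noteq> 0}"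
  have "ip (R a b f) g = (\<Sum>I\<in>indices. of_nat (ex a I) * of_real (wI (mv a b I)) * ip (pd I f) (pd (mv a b I) g))"
    by (simp add: R_def ip_sum_left ip_pscale_left ip_Var_mult mult.assoc)
  also have "\<dots> = (\<Sum>I\<in>?S. of_nat (ex a I) * of_real (wI (mv a b I)) * ip (pd I f) (pd (mv a b I) g))"
    by (rule sum.mono_neutral_right) auto
  also have "\<dots> = (\<Sum>I\<in>?S. of_nat (ex b (mv a b I)) * of_real (wI (mv b a (mv a b I))) * ip (pd (mv b a (mv a b I)) f) (pd (mv a b I) g))"
  proof (rule sum.cong[OF refl])
    fix I assume I: "I \<in> ?S"
    then have "mv b a (mv a b I) = I" using mv_mv by simp
    moreover have "(of_nat (ex a I) * of_real (wI (mv a b I)) :: complex) = of_nat (ex b (mv a b I)) * of_real (wI I)"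
      using wI_mv[of I a b] I by (metis (mono_tags, lifting) mem_Collect_eq of_real_mult of_real_of_nat_eq)
    ultimately show "of_nat (ex a I) * of_real (wI (mv a b I)) * ip (pd I f) (pd (mv a b I) g) =
       of_nat (ex b (mv a b I)) * of_real (wI (mv b a (mv a b I))) * ip (pd (mv b a (mv a b I)) f) (pd (mv a b I) g)"
      by simp
  qed
  also have "\<dots> = (\<Sum>J\<in>?T. of_nat (ex b J) * of_real (wI (mv b a J)) * ip (pd (mv b a J) f) (pd J g))"
    by (rule sum.reindex_bij_betw[OF bij_shf])
  also have "\<dots> = (\<Sum>J\<in>indices. of_nat (ex b J) * of_real (wI (mv b a J)) * ip (pd (mv b a J) f) (pd J g))"
    by (rule sum.mono_neutral_left) auto
  also have "\<dots> = ip f (R b a g)"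
    by (simp add: R_def ip_sum_right ip_pscale_right ip_Var_mult_right mult.assoc)
  finally show ?thesis .
qed

subsection \<open>Weight spaces\<close>

definition wt :: "mindex monomial \<Rightarrow> dir \<Rightarrow> int" where
  "wt m a = (\<Sum>I\<in>kys m. int (lkp m I) * exi I a)"

lemma wt_superset: "finite A \<Longrightarrow> kys m \<subseteq> A \<Longrightarrow> wt m a = (\<Sum>I\<in>A. int (lkp m I) * exi I a)"
  unfolding wt_def by (rule sum.mono_neutral_left) (auto simp: in_keys_iff)

lemma wt_add: "wt (m + n) a = wt m a + wt n a"
  by (simp add: wt_superset[of "kys m \<union> kys n"] keys_add lookup_add algebra_simps sum.distrib)

lemma wt_single [simp]: "wt (sgl I n) a = int n * exi I a"
  by (simp add: wt_superset[of "{I}"])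

lemma wt_0 [simp]: "wt 0 a = 0" by (simp add: wt_def)

lemma mdegree_superset: "finite A \<Longrightarrow> kys m \<subseteq> A \<Longrightarrow> mdegree m = (\<Sum>I\<in>A. lkp m I)"
  unfolding mdegree_def by (rule sum.mono_neutral_left) (auto simp: in_keys_iff)

lemma mdegree_add: "mdegree (m + n) = mdegree m + mdegree n"
  by (simp add: mdegree_superset[of "kys m \<union> kys n"] keys_add lookup_add sum.distrib)

lemma mdegree_single [simp]: "mdegree (sgl I n) = n"
  by (simp add: mdegree_superset[of "{I}"])

lemma mdegree_0 [simp]: "mdegree 0 = 0" by (simp add: mdegree_def)

lemma exi_sum: "I \<in> indices \<Longrightarrow> exi I A0 + exi I A1 + exi I A2 + exi I A3 = 3"
  using valid_exi[of I] by (simp add: valid_def)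

lemma wt_sum: "kys m \<subseteq> indices \<Longrightarrow> wt m A0 + wt m A1 + wt m A2 + wt m A3 = 3 * int (mdegree m)"
proof -
  assume k: "kys m \<subseteq> indices"
  have "wt m A0 + wt m A1 + wt m A2 + wt m A3 = (\<Sum>I\<in>kys m. int (lkp m I) * (exi I A0 + exi I A1 + exi I A2 + exi I A3))"
    by (simp add: wt_def algebra_simps sum.distrib)
  also have "\<dots> = (\<Sum>I\<in>kys m. int (lkp m I) * 3)"
    by (rule sum.cong) (use k exi_sum in auto)
  finally show ?thesis by (simp add: mdegree_def sum_distrib_left mult.commute)
qed

lemma wt_nonneg: "0 \<le> wt m a"
  unfolding wt_def exi_def by (intro sum_nonneg) auto

definition wsp :: "int \<Rightarrow> int \<Rightarrow> int \<Rightarrow> moment_polynomial set" where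
  "wsp i j k = {f \<in> forms 5. \<forall>m\<in>kys f. wt m A1 = i \<and> wt m A2 = j \<and> wt m A3 = k}"

lemma subspace_keys: "pvs.subspace {f :: moment_polynomial. \<forall>m\<in>kys f. P m}"
  unfolding pvs.subspace_def
  using keys_add keys_pscale by (fastforce dest: subsetD)

lemma subspace_forms: "pvs.subspace (forms d)"
  unfolding forms_def by (rule subspace_keys)

lemma subspace_wsp: "pvs.subspace (wsp i j k)"
  unfolding wsp_def forms_def
  using subspace_keys[of "\<lambda>m. (kys m \<subseteq> indices \<and> mdegree m = 5) \<and> wt m A1 = i \<and> wt m A2 = j \<and> wt m A3 = k"]
  by (rule back_subst[of pvs.subspace]) auto

lemma wsp_forms: "f \<in> wsp i j k \<Longrightarrow> f \<in> forms 5" by (simp add: wsp_def)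

lemma wsp_A0: "f \<in> wsp i j k \<Longrightarrow> m \<in> kys f \<Longrightarrow> wt m A0 = 15 - i - j - k"
  using wt_sum[of m] by (auto simp: wsp_def forms_def)

lemma R_keys:
  assumes "m' \<in> kys (R a b f)"
  shows "\<exists>n. \<exists>I\<in>indices. n + sgl I 1 \<in> kys f \<and> exi I a \<noteq> 0 \<and> m' = n + sgl (mv a b I) 1"
proof -
  have "lkp (R a b f) m' \<noteq> 0" using assms by (simp add: in_keys_iff)
  then obtain I where I: "I \<in> indices" "of_nat (ex a I) * lkp (Var (mv a b I) * pd I f) m' \<noteq> 0"
    unfolding R_def lookup_sum lookup_pscale by (meson sum.not_neutral_contains_not_neutral)
  then have "m' \<in> kys (Var (mv a b I) * pd I f)" by (simp add: in_keys_iff)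
  then obtain n where n: "m' = sgl (mv a b I) 1 + n" "n \<in> kys (pd I f)"
    using keys_mult[of "Var (mv a b I)" "pd I f"] by (auto simp: Var_def)
  then have "n + sgl I 1 \<in> kys f" by (auto simp: in_keys_iff lookup_pd)
  then show ?thesis using I n by (auto simp: exi_def add.commute)
qed

lemma R_key_props:
  assumes "m' \<in> kys (R a b f)"
  shows "\<exists>m\<in>kys f. mdegree m' = mdegree m \<and> (kys m \<subseteq> indices \<longrightarrow> kys m' \<subseteq> indices) \<and> (\<forall>c. wt m' c = wt m c - un a c + un b c)"
proof -
  obtain n I where n: "I \<in> indices" "n + sgl I 1 \<in> kys f" "exi I a \<noteq> 0" "m' = n + sgl (mv a b I) 1"
    using R_keys[OF assms] by blast
  have e: "exi (mv a b I) = shf a b (exi I)" "mv a b I \<in> indices" using exi_mv[OF n(1,3)] by auto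
  have "kys n \<subseteq> kys (n + sgl I 1)" by (auto simp: in_keys_iff lookup_add)
  then have "kys (n + sgl I 1) \<subseteq> indices \<longrightarrow> kys m' \<subseteq> indices"
    using n(4) e(2) keys_add[of n "sgl (mv a b I) (1::nat)"] by auto
  then show ?thesis using n e
    by (intro bexI[of _ "n + sgl I 1"]) (auto simp: mdegree_add wt_add shf_def)
qed

lemma R_forms: "f \<in> forms d \<Longrightarrow> R a b f \<in> forms d"
  unfolding forms_def using R_key_props[of _ a b f] by fastforce

lemma R_wsp: "f \<in> wsp i j k \<Longrightarrow>
  R a b f \<in> wsp (i - un a A1 + un b A1) (j - un a A2 + un b A2) (k - un a A3 + un b A3)"
  unfolding wsp_def using R_key_props[of _ a b f] R_forms[of f 5] by fastforce

lemma R_diag: "f \<in> wsp i j k \<Longrightarrow> R a a f =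
  pscale (of_int (case a of A0 \<Rightarrow> 15 - i - j - k | A1 \<Rightarrow> i | A2 \<Rightarrow> j | A3 \<Rightarrow> k)) f"
proof (rule poly_mapping_eqI)
  fix m assume f: "f \<in> wsp i j k"
  have s: "shf a a e = e" for e by (rule ext) (simp add: shf_def)
  have V: "lkp (Var I * pd I f) m = of_nat (lkp m I) * lkp f m" for I
  proof (cases "lkp m I = 0")
    case True
    have "m \<notin> kys (Var I * pd I f)"
    proof
      assume "m \<in> kys (Var I * pd I f)"
      then obtain n where "m = sgl I 1 + n" using keys_mult[of "Var I" "pd I f"] by (auto simp: Var_def)
      then show False using True by (simp add: lookup_add)
    qed
    then show ?thesis using True by (simp add: in_keys_iff)
  next
    case False
    have *: "m - sgl I 1 + sgl I 1 = m" by (rule monom_minus_add[OF False])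
    have "lkp (Var I * pd I f) m = lkp (pd I f) (m - sgl I 1)"
      using lookup_Var_mult[of I "pd I f" "m - sgl I 1"] unfolding * .
    also have "\<dots> = of_nat (lkp (m - sgl I 1) I + 1) * lkp f m" unfolding lookup_pd * ..
    also have "lkp (m - sgl I 1) I + 1 = lkp m I" using False by (simp add: lookup_minus)
    finally show ?thesis .
  qed
  have "lkp (R a a f) m = (\<Sum>I\<in>indices. of_nat (ex a I) * (of_nat (lkp m I) * lkp f m))"
    by (simp add: R_def lookup_sum mv_def s V)
  also have "\<dots> = of_int (wt m a) * lkp f m"
  proof (cases "m \<in> kys f")
    case True
    then have "kys m \<subseteq> indices" using f by (auto simp: wsp_def forms_def)
    then have "wt m a = (\<Sum>I\<in>indices. int (lkp m I) * exi I a)" by (rule wt_superset[OF finite_indices])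
    then show ?thesis by (simp add: exi_def sum_distrib_left mult_ac)
  qed (simp add: in_keys_iff)
  also have "\<dots> = of_int (case a of A0 \<Rightarrow> 15 - i - j - k | A1 \<Rightarrow> i | A2 \<Rightarrow> j | A3 \<Rightarrow> k) * lkp f m"
    using f wsp_A0[OF f, of m] by (cases "m \<in> kys f"; cases a) (auto simp: wsp_def in_keys_iff)
  finally show "lkp (R a a f) m = lkp (pscale (of_int (case a of A0 \<Rightarrow> 15 - i - j - k | A1 \<Rightarrow> i | A2 \<Rightarrow> j | A3 \<Rightarrow> k)) f) m"
    by simp
qed

definition wc :: "int \<Rightarrow> int \<Rightarrow> int \<Rightarrow> dir \<Rightarrow> int" where
  "wc i j k a = (case a of A0 \<Rightarrow> 15 - i - j - k | A1 \<Rightarrow> i | A2 \<Rightarrow> j | A3 \<Rightarrow> k)"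

text \<open>Both sides are \<open>\<langle>f, R\<^sub>b\<^sub>a R\<^sub>a\<^sub>b f\<rangle>\<close>, as \<open>[R\<^sub>b\<^sub>a, R\<^sub>a\<^sub>b]\<close> acts on weight vectors by the difference of weights.\<close>

lemma nrm_R:
  assumes "f \<in> wsp i j k"
  shows "nrm (R a b f) = nrm (R b a f) + real_of_int (wc i j k a - wc i j k b) * nrm f"
proof -
  have "R b a (R a b f) = R a b (R b a f) + R a a f - R b b f"
    using R_commute[of b a a b f] by (simp add: un_def algebra_simps)
  then have "ip f (R b a (R a b f)) = ip f (R a b (R b a f)) + of_int (wc i j k a) * ip f f - of_int (wc i j k b) * ip f f"
    by (simp only: ip_add_right ip_minus_right) (simp add: R_diag[OF assms] ip_pscale_right wc_def)
  then have "complex_of_real (nrm (R a b f)) = of_real (nrm (R b a f) + real_of_int (wc i j k a - wc i j k b) * nrm f)"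
    by (simp add: ip_R[of _ _ f] algebra_simps flip: ip_self)
  then show ?thesis by (simp only: of_real_eq_iff)
qed

lemma R_inj_weight:
  assumes "f \<in> wsp i j k" "R a b f = 0" "wc i j k b < wc i j k a"
  shows "f = 0"
proof -
  have "0 = nrm (R b a f) + real_of_int (wc i j k a - wc i j k b) * nrm f"
    using nrm_R[OF assms(1), of a b] assms(2) by (simp add: nrm_def)
  then have "real_of_int (wc i j k a - wc i j k b) * nrm f \<le> 0"
    using nrm_nonneg[of "R b a f"] by linarith
  moreover have "0 < real_of_int (wc i j k a - wc i j k b)" using assms(3) by simp
  ultimately have "nrm f \<le> 0" by (simp add: mult_le_0_iff)
  then show ?thesis using nrm_nonneg[of f] by (simp add: nrm_eq_0)
qed

lemma wsp_orth:
  assumes "f \<in> wsp i j k" "g \<in> wsp i' j' k'" "(i, j, k) \<noteq> (i', j', k')"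
  shows "ip f g = 0"
  unfolding ip_def using assms
  by (intro sum.neutral) (auto simp: wsp_def in_keys_iff)

section \<open>The group action and its Lie algebra\<close>

subsection \<open>The action as substitution\<close>

lemma finite_mdegree: "finite {J :: mindex. mdegree J \<le> n}"
proof -
  have "{J :: mindex. mdegree J \<le> n} \<subseteq> (\<lambda>(i, j, k). sgl 1 i + sgl 2 j + sgl 3 k) ` ({..n} \<times> {..n} \<times> {..n})"
  proof
    fix I :: mindex assume "I \<in> {J. mdegree J \<le> n}"
    then have "lkp I 1 \<le> n" "lkp I 2 \<le> n" "lkp I 3 \<le> n" by (auto simp: mdegree_3)
    moreover have "I = sgl 1 (lkp I 1) + sgl 2 (lkp I 2) + sgl 3 (lkp I 3)"
      by (rule mindex_eqI) (auto simp: lookup_add lookup_single "when_def")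
    ultimately show "I \<in> (\<lambda>(i, j, k). sgl 1 i + sgl 2 j + sgl 3 k) ` ({..n} \<times> {..n} \<times> {..n})"
      by (intro image_eqI[where x="(lkp I 1, lkp I 2, lkp I 3)"]) auto
  qed
  then show ?thesis by (rule finite_subset) auto
qed

definition Lam :: "(3, real) poly_ring \<Rightarrow> moment_polynomial" where
  "Lam q = (\<Sum>J\<in>kys q. Const (of_real (lkp q J)) * Var J)"

lemma Lam_superset: "finite A \<Longrightarrow> kys q \<subseteq> A \<Longrightarrow> Lam q = (\<Sum>J\<in>A. Const (of_real (lkp q J)) * Var J)"
  unfolding Lam_def by (rule sum.mono_neutral_left) (auto simp: in_keys_iff)

lemma Lam_add: "Lam (p + q) = Lam p + Lam q"
  by (simp add: Lam_superset[of "kys p \<union> kys q"] keys_add lookup_add Const_add distrib_right sum.distrib)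

lemma Lam_0 [simp]: "Lam 0 = 0" by (simp add: Lam_def)

lemma Lam_sum: "Lam (sum f A) = (\<Sum>x\<in>A. Lam (f x))"
  by (induct A rule: infinite_finite_induct) (auto simp: Lam_add)

lemma Lam_single [simp]: "Lam (sgl J c) = Const (of_real c) * Var J"
  by (simp add: Lam_superset[of "{J}"])

lemma Lam_Const_mult: "Lam (Const c * q) = Const (of_real c) * Lam q"
  by (subst (1 2) poly_sum_single[of q])
     (simp add: sum_distrib_left Lam_sum Const_mult_single Const_mult mult.assoc)

lemma affine_prod: "(\<Prod>l\<in>UNIV. affine_form A b l ^ lkp I l) = meval (affine_form A b) I"
  by (rule meval_superset[symmetric]) auto

lemma degree_le_mult:
  assumes "\<forall>J\<in>kys (p :: ('v,'a::comm_ring_1) poly_ring). mdegree J \<le> n" "\<forall>J\<in>kys q. mdegree J \<le> k"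
  shows "\<forall>J\<in>kys (p * q). mdegree J \<le> n + k"
  using keys_mult[of p q] assms by (force simp: mdegree_add intro: add_mono)

lemma degree_le_power:
  assumes "\<forall>J\<in>kys (p :: ('v,'a::comm_ring_1) poly_ring). mdegree J \<le> 1"
  shows "\<forall>J\<in>kys (p ^ n). mdegree J \<le> n"
proof (induct n)
  case (Suc n)
  show ?case using degree_le_mult[OF assms Suc] by simp
qed (auto simp: keys_one)

lemma degree_affine_form: "\<forall>J\<in>kys (affine_form A b l). mdegree J \<le> 1"
proof -
  have "kys (affine_form A b l) \<subseteq> (\<Union>k. kys (Const (A $ l $ k) * Var k)) \<union> kys (Const (b $ l) :: (3, real) poly_ring)"
    unfolding affine_form_def by (rule order_trans[OF keys_add]) (auto intro: keys_sum[THEN subsetD])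
  moreover have "mdegree J \<le> 1" if "J \<in> kys (Const c * Var k :: (3, real) poly_ring)" for c k J
    using that by (auto simp: Var_def Const_mult_single split: if_splits)
  moreover have "mdegree J \<le> 1" if "J \<in> kys (Const c :: (3, real) poly_ring)" for c J
    using that by (auto simp: Const_def split: if_splits)
  ultimately show ?thesis by blast
qed

lemma degree_meval_affine: "\<forall>J\<in>kys (meval (affine_form A b) I). mdegree J \<le> mdegree I"
proof -
  have "\<forall>J\<in>kys (\<Prod>l\<in>S. affine_form A b l ^ lkp I l). mdegree J \<le> (\<Sum>l\<in>S. lkp I l)" if "finite S" for S
    using that
  proof (induct S rule: finite_induct)
    case (insert l S)
    then show ?case using degree_le_mult[OF degree_le_power[OF degree_affine_form] insert(3)] by simp
  qed (auto simp: keys_one)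
  then show ?thesis by (simp add: meval_def mdegree_def)
qed

lemma act_Lam: "act A b = peval Const (\<lambda>I. Lam (meval (affine_form A b) I))"
proof -
  have "(\<Sum>J | mdegree J \<le> mdegree I. Const (of_real (nu A b I J)) * Var J) = Lam (meval (affine_form A b) I)" for I
    by (subst Lam_superset[OF finite_mdegree[of "mdegree I"]])
       (use degree_meval_affine[of A b I] in \<open>auto simp: nu_def affine_prod\<close>)
  then show ?thesis by (simp add: act_def)
qed

lemma act_Var: "act A b (Var I) = Lam (meval (affine_form A b) I)"
  by (simp add: act_Lam)

lemma act_add: "act A b (f + g) = act A b f + act A b g"
  and act_mult: "act A b (f * g) = act A b f * act A b g"
  and act_Const [simp]: "act A b (Const c) = Const c"
  and act_0 [simp]: "act A b 0 = 0"
  and act_1 [simp]: "act A b 1 = 1"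
  and act_pscale: "act A b (pscale c f) = pscale c (act A b f)"
  and act_sum: "act A b (sum F S) = (\<Sum>x\<in>S. act A b (F x))"
  by (simp_all add: act_Lam peval_add peval_mult peval_pscale peval_sum pscale_def)

abbreviation subst_form :: "real^3^3 \<Rightarrow> real^3 \<Rightarrow> (3, real) poly_ring \<Rightarrow> (3, real) poly_ring" where
  "subst_form A b \<equiv> peval Const (affine_form A b)"

lemma act_Lam_subst: "act A b (Lam q) = Lam (subst_form A b q)"
  by (subst (1 2) poly_sum_single[of q])
     (simp add: act_sum Lam_sum act_mult act_Var peval_sum peval_single Lam_Const_mult)

lemma peval_meval_comp:
  assumes "coeff_hom h" shows "peval h s (meval t m) = meval (\<lambda>v. peval h s (t v)) m"
  by (simp add: meval_def peval_prod[OF assms] peval_power[OF assms])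

lemma subst_affine_form:
  "subst_form A b (affine_form A' b' l) = affine_form (A' ** A) (A' *v b + b') l"
  by (simp add: affine_form_def peval_add peval_sum peval_mult matrix_matrix_mult_def matrix_vector_mult_def
      sum_3 Const_add Const_mult algebra_simps)

lemma act_act: "act A b (act A' b' f) = act (A' ** A) (A' *v b + b') f"
proof (induct f rule: poly_induct)
  case (Var I)
  show ?case by (simp add: act_Var act_Lam_subst peval_meval_comp subst_affine_form)
qed (simp_all add: act_add act_mult)

lemma meval_Var: "meval Var m = sgl m (1 :: 'a::comm_ring_1)"
proof (induct m rule: update_induct)
  case (update m v b)
  have "Poly_Mapping.update v b m = sgl v b + m"
    using update(1) by (intro poly_mapping_eqI)
      (auto simp: lookup_update lookup_add lookup_single "when_def" in_keys_iff)
  then show ?case using update by (simp add: single_monom_insert meval_add)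
qed simp

lemma act_id: "act (mat 1) 0 f = f"
proof (induct f rule: poly_induct)
  case (Var I)
  have "affine_form (mat 1) 0 = Var"
  proof
    fix l show "affine_form (mat 1) 0 l = Var l"
      using three_cases[of l] by (auto simp: affine_form_def mat_def sum_3)
  qed
  then show ?case by (simp add: act_Var meval_Var)
qed (simp_all add: act_add act_mult)

lemma forms_mult:
  assumes "f \<in> forms d" "g \<in> forms e"
  shows "f * g \<in> forms (d + e)"
  unfolding forms_def mem_Collect_eq
proof
  fix m assume "m \<in> kys (f * g)"
  then obtain x y where xy: "m = x + y" "x \<in> kys f" "y \<in> kys g" using keys_mult[of f g] by blast
  then have "kys x \<subseteq> indices" "kys y \<subseteq> indices" "mdegree x = d" "mdegree y = e"
    using assms by (auto simp: forms_def)
  then show "kys m \<subseteq> indices \<and> mdegree m = d + e"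
    using xy(1) keys_add[of x y] by (simp add: mdegree_add) blast
qed

lemma forms_1: "1 \<in> forms 0" by (auto simp: forms_def keys_one)

lemma forms_power: "f \<in> forms 1 \<Longrightarrow> f ^ n \<in> forms n"
proof (induct n)
  case (Suc n) then show ?case using forms_mult[of f 1 "f ^ n" n] by simp
qed (simp add: forms_1)

lemma forms_prod: "finite S \<Longrightarrow> (\<And>v. v \<in> S \<Longrightarrow> F v \<in> forms (d v)) \<Longrightarrow> prod F S \<in> forms (sum d S)"
  by (induct S rule: finite_induct) (auto simp: forms_1 forms_mult)

lemma forms_scale: "f \<in> forms d \<Longrightarrow> Const c * f \<in> forms d"
  using pvs.subspace_scale[OF subspace_forms, of f d c] by (simp add: pscale_def)

lemma Lam_forms: "(\<And>J. J \<in> kys q \<Longrightarrow> J \<in> indices) \<Longrightarrow> Lam q \<in> forms 1"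
  unfolding Lam_def
  by (intro pvs.subspace_sum[OF subspace_forms] forms_scale) (auto simp: forms_def Var_def)

lemma act_forms: "f \<in> forms d \<Longrightarrow> act A b f \<in> forms d"
proof -
  assume f: "f \<in> forms d"
  have "act A b f = (\<Sum>m\<in>kys f. Const (lkp f m) * meval (\<lambda>I. Lam (meval (affine_form A b) I)) m)"
    by (simp add: act_Lam peval_meval)
  also have "\<dots> \<in> forms d"
  proof (intro pvs.subspace_sum[OF subspace_forms] forms_scale)
    fix m assume m: "m \<in> kys f"
    have "Lam (meval (affine_form A b) I) \<in> forms 1" if "I \<in> kys m" for I
    proof (rule Lam_forms)
      fix J assume J: "J \<in> kys (meval (affine_form A b) I)"
      have "I \<in> indices" using that m f by (auto simp: forms_def)
      then have "mdegree I \<le> 3" by (simp add: indices_def)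
      then show "J \<in> indices" using J degree_meval_affine[of A b I] by (auto simp: indices_def)
    qed
    then have "meval (\<lambda>I. Lam (meval (affine_form A b) I)) m \<in> forms (\<Sum>I\<in>kys m. lkp m I)"
      unfolding meval_def by (intro forms_prod forms_power) auto
    then show "meval (\<lambda>I. Lam (meval (affine_form A b) I)) m \<in> forms d"
      using m f by (auto simp: forms_def mdegree_def)
  qed
  finally show ?thesis .
qed

subsection \<open>One-parameter subgroups\<close>

fun dn :: "dir \<Rightarrow> 3" where "dn A0 = 1" | "dn A1 = 1" | "dn A2 = 2" | "dn A3 = 3"

definition TA :: "dir \<Rightarrow> dir \<Rightarrow> real \<Rightarrow> real^3^3" where
  "TA a b t = (\<chi> i j. (if i = j then 1 else 0) + (if i = dn a \<and> b \<noteq> A0 \<and> j = dn b then t else 0))"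

definition Tb :: "dir \<Rightarrow> dir \<Rightarrow> real \<Rightarrow> real^3" where
  "Tb a b t = (\<chi> i. if i = dn a \<and> b = A0 then t else 0)"

definition T :: "dir \<Rightarrow> dir \<Rightarrow> real \<Rightarrow> moment_polynomial \<Rightarrow> moment_polynomial" where
  "T a b t = act (TA a b t) (Tb a b t)"

definition xv :: "dir \<Rightarrow> (3, real) poly_ring" where
  "xv a = (if a = A0 then 1 else Var (dn a))"

lemma affine_form_T: "affine_form (TA a b t) (Tb a b t) l =
  (if l = dn a then Var l + Const t * xv b else Var l)"
  using three_cases[of l]
  by (cases b) (auto simp: affine_form_def TA_def Tb_def xv_def sum_3 Const_add distrib_right)

lemma T_add: "a \<noteq> A0 \<Longrightarrow> a \<noteq> b \<Longrightarrow> T a b s (T a b t f) = T a b (s + t) f"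
proof -
  assume "a \<noteq> A0" "a \<noteq> b"
  then have n: "b \<noteq> A0 \<Longrightarrow> dn a \<noteq> dn b" by (cases a; cases b) auto
  have "affine_form (TA a b t ** TA a b s) (TA a b t *v Tb a b s + Tb a b t) l =
     affine_form (TA a b (s + t)) (Tb a b (s + t)) l" for l
    unfolding subst_affine_form[symmetric] affine_form_T
    using n by (auto simp: peval_add peval_mult affine_form_T xv_def Const_add algebra_simps)
  then have "affine_form (TA a b t ** TA a b s) (TA a b t *v Tb a b s + Tb a b t) = affine_form (TA a b (s + t)) (Tb a b (s + t))"
    by blast
  then show ?thesis unfolding T_def act_act by (simp only: act_Lam)
qed

lemma coeff_linear_power:
  fixes c :: "'a::comm_ring_1"
  shows "coeff ([:c, 1:] ^ k) 0 = c ^ k" "coeff ([:c, 1:] ^ k) 1 = of_nat k * c ^ (k - 1)"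
proof -
  show 0: "coeff ([:c, 1:] ^ k) 0 = c ^ k" for k
    by (induct k) (auto simp: coeff_pCons)
  show "coeff ([:c, 1:] ^ k) 1 = of_nat k * c ^ (k - 1)"
  proof (induct k)
    case (Suc k)
    have "coeff ([:c, 1:] ^ Suc k) 1 = c * coeff ([:c, 1:] ^ k) 1 + c ^ k"
      by (simp add: coeff_pCons 0)
    then show ?case using Suc by (cases k) (auto simp: algebra_simps)
  qed simp
qed

lemma Lam_pow_poly:
  fixes q r :: "(3, real) poly_ring"
  shows "\<exists>P. (\<forall>t. Lam (r * (q + Const t * y) ^ n) = poly P (Const (of_real t))) \<and>
    coeff P 0 = Lam (r * q ^ n) \<and> coeff P 1 = Const (of_nat n) * Lam (r * q ^ (n - 1) * y)"
proof -
  define c where "c k = Const (of_nat (n choose k)) * Lam (r * q ^ (n - k) * y ^ k)" for k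
  define P where "P = (\<Sum>k\<le>n. monom (c k) k)"
  have "Lam (r * (q + Const t * y) ^ n) = poly P (Const (of_real t))" for t
  proof -
    have "r * (q + Const t * y) ^ n = (\<Sum>k\<le>n. Const (of_nat (n choose k) * t ^ k) * (r * q ^ (n - k) * y ^ k))"
      by (subst add.commute, subst binomial_ring)
         (simp add: sum_distrib_left Const_mult Const_power power_mult_distrib mult_ac, simp add: Const_def mult_ac)
    then have "Lam (r * (q + Const t * y) ^ n) = (\<Sum>k\<le>n. Const (of_real (of_nat (n choose k) * t ^ k)) * Lam (r * q ^ (n - k) * y ^ k))"
      by (simp add: Lam_sum Lam_Const_mult)
    also have "\<dots> = poly P (Const (of_real t))"
      by (simp add: P_def c_def poly_sum poly_monom Const_mult Const_power mult_ac)
    finally show ?thesis .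
  qed
  moreover have "coeff P k = (if k \<le> n then c k else 0)" for k
    by (simp add: P_def coeff_sum sum.delta)
  moreover have "c 0 = Lam (r * q ^ n)" by (simp add: c_def)
  moreover have "(if 1 \<le> n then c 1 else 0) = Const (of_nat n) * Lam (r * q ^ (n - 1) * y)"
    by (cases n) (simp_all add: c_def)
  ultimately show ?thesis by (intro exI[of _ P]) (simp only: le0 if_True simp_thms)
qed

lemma T_Var_poly:
  assumes "a \<noteq> A0" "a \<noteq> b" "I \<in> indices"
  shows "\<exists>P. (\<forall>t. T a b t (Var I) = poly P (Const (of_real t))) \<and> coeff P 0 = Var I \<and> coeff P 1 = R a b (Var I)"
proof -
  define I' where "I' = I - sgl (dn a) (lkp I (dn a))"
  have I: "I = sgl (dn a) (lkp I (dn a)) + I'" and I'0: "lkp I' (dn a) = 0"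
    by (auto simp: I'_def intro!: poly_mapping_eqI simp: lookup_add lookup_minus lookup_single "when_def")
  define r :: "(3, real) poly_ring" where "r = sgl I' 1"
  define n where "n = lkp I (dn a)"
  have rr: "meval (affine_form (TA a b t) (Tb a b t)) I' = r" for t
  proof -
    have "meval (affine_form (TA a b t) (Tb a b t)) I' = meval Var I'"
      unfolding meval_def by (rule prod.cong) (use I'0 in \<open>auto simp: affine_form_T in_keys_iff\<close>)
    then show ?thesis by (simp add: meval_Var r_def)
  qed
  have m: "meval (affine_form (TA a b t) (Tb a b t)) I = r * (Var (dn a) + Const t * xv b) ^ n" for t
    by (subst I, simp only: meval_add rr) (simp add: affine_form_T n_def mult.commute)
  obtain P where P: "\<And>t. Lam (r * (Var (dn a) + Const t * xv b) ^ n) = poly P (Const (of_real t))"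
    "coeff P 0 = Lam (r * Var (dn a) ^ n)" "coeff P 1 = Const (of_nat n) * Lam (r * Var (dn a) ^ (n - 1) * xv b)"
    using Lam_pow_poly[of r "Var (dn a)" "xv b" n] by blast
  have q0: "r * Var (dn a) ^ n = sgl I 1"
  proof -
    have "sgl I (1::real) = sgl (sgl (dn a) n + I') 1" using I by (simp add: n_def)
    then show ?thesis by (simp add: single_monom_insert r_def mult.commute)
  qed
  have "Const (of_nat n) * Lam (r * Var (dn a) ^ (n - 1) * xv b) = R a b (Var I)"
  proof (cases "n = 0")
    case True
    have "ex a I = n" using assms(1) by (cases a) (auto simp: n_def)
    then show ?thesis using True by (simp add: R_Var)
  next
    case False
    have en: "ex a I = n" using assms(1) by (cases a) (auto simp: n_def)
    have "r * Var (dn a) ^ (n - 1) * xv b = sgl (mv a b I) 1"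
    proof -
      have "r * Var (dn a) ^ (n - 1) = sgl (sgl (dn a) (n - 1) + I') 1"
        by (simp add: single_monom_insert r_def mult.commute)
      moreover have "sgl v (1::real) * xv b = sgl ((if b = A0 then 0 else sgl (dn b) 1) + v) 1" for v
        by (auto simp: xv_def Var_def mult_single add.commute)
      ultimately have "r * Var (dn a) ^ (n - 1) * xv b = sgl ((if b = A0 then 0 else sgl (dn b) 1) + (sgl (dn a) (n - 1) + I')) 1"
        by simp
      also have "(if b = A0 then 0 else sgl (dn b) 1) + (sgl (dn a) (n - 1) + I') = mv a b I"
      proof -
        have nI: "lkp I' l = (if l = dn a then 0 else lkp I l)" for l
          by (auto simp: I'_def lookup_minus lookup_single "when_def")
        show ?thesis using False assms(1,2) en
          by (intro mindex_eqI; cases a; cases b)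
             (auto simp: mv_def lookup_idx lookup_add lookup_single "when_def" nI shf_def un_def exi_def)
      qed
      finally show ?thesis .
    qed
    then show ?thesis using assms(3) en by (simp add: R_Var pscale_def)
  qed
  then show ?thesis using P q0 m
    by (intro exI[of _ P]) (simp add: T_def act_Var)
qed

lemma T_poly:
  assumes "a \<noteq> A0" "a \<noteq> b" "f \<in> forms d"
  shows "\<exists>P. (\<forall>t. T a b t f = poly P (Const (of_real t))) \<and> coeff P 0 = f \<and> coeff P 1 = R a b f"
proof -
  let ?Q = "\<lambda>f. \<exists>P. (\<forall>t. T a b t f = poly P (Const (of_real t))) \<and> coeff P 0 = f \<and> coeff P 1 = R a b f"
  have Tm: "T a b t (f * g) = T a b t f * T a b t g" "T a b t (f + g) = T a b t f + T a b t g"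
    "T a b t 1 = 1" "T a b t 0 = 0" "T a b t (Const c) = Const c" for t f g c by (simp_all add: T_def act_mult act_add)
  have mult: "?Q (f * g)" if f: "?Q f" and g: "?Q g" for f g
  proof -
    obtain P Q where P: "\<forall>t. T a b t f = poly P (Const (of_real t))" "coeff P 0 = f" "coeff P 1 = R a b f"
      and Q: "\<forall>t. T a b t g = poly Q (Const (of_real t))" "coeff Q 0 = g" "coeff Q 1 = R a b g"
      using f g by blast
    have "coeff (P * Q) 1 = R a b (f * g)" using P Q by (simp add: coeff_mult R_mult)
    then show ?thesis using P Q by (intro exI[of _ "P * Q"]) (simp add: Tm coeff_mult)
  qed
  have add: "?Q (f + g)" if f: "?Q f" and g: "?Q g" for f g
  proof -
    obtain P Q where P: "\<forall>t. T a b t f = poly P (Const (of_real t))" "coeff P 0 = f" "coeff P 1 = R a b f"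
      and Q: "\<forall>t. T a b t g = poly Q (Const (of_real t))" "coeff Q 0 = g" "coeff Q 1 = R a b g"
      using f g by blast
    then show ?thesis by (intro exI[of _ "P + Q"]) (simp add: Tm R_add)
  qed
  have C: "?Q (Const c)" for c by (intro exI[of _ "[:Const c:]"]) (simp add: Tm)
  have pow: "?Q (Var I ^ n)" if "I \<in> indices" for I n
  proof (induct n)
    case 0 then show ?case using C[of 1] by simp
  next
    case (Suc n) show ?case unfolding power_Suc by (rule mult[OF T_Var_poly[OF assms(1,2) that] Suc])
  qed
  have prod: "?Q (\<Prod>I\<in>S. Var I ^ e I)" if "finite S" "S \<subseteq> indices" for S e
    using that
  proof (induct S rule: finite_induct)
    case empty then show ?case using C[of 1] by simp
  next
    case (insert I S)
    then show ?case unfolding prod.insert[OF insert(1,2)] by (intro mult pow) auto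
  qed
  have mono: "?Q (sgl m c)" if "kys m \<subseteq> indices" for m c
  proof -
    have "sgl m c = Const c * (\<Prod>I\<in>kys m. Var I ^ lkp m I)"
      unfolding meval_def[symmetric] meval_Var by (simp add: Const_mult_single)
    moreover have "?Q (\<Prod>I\<in>kys m. Var I ^ lkp m I)" by (rule prod) (use that in auto)
    ultimately show ?thesis using mult[OF C] by simp
  qed
  have "?Q (\<Sum>m\<in>S. sgl m (lkp f m))" if "finite S" "S \<subseteq> kys f" for S
    using that
  proof (induct S rule: finite_induct)
    case empty
    then show ?case using C[of 0] by simp
  next
    case (insert m S)
    then have "kys m \<subseteq> indices" using assms(3) by (auto simp: forms_def)
    then have "?Q (sgl m (lkp f m))" by (rule mono)
    moreover have "?Q (\<Sum>m\<in>S. sgl m (lkp f m))" using insert by simp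
    ultimately show ?case unfolding sum.insert[OF insert(1,2)] by (rule add)
  qed
  from this[OF finite_keys order_refl] show ?thesis by (simp only: poly_sum_single[symmetric])
qed

lemma poly_real_zero:
  fixes P :: "moment_polynomial poly"
  assumes "\<And>t::real. poly P (Const (of_real t)) = 0"
  shows "P = 0"
proof (rule poly_eqI)
  fix k
  have "lkp (coeff P k) m = 0" for m
  proof (cases "k \<le> degree P")
    case True
    have z: "(\<Sum>k\<le>degree P. lkp (coeff P k) m * complex_of_real t ^ k) = 0" for t
    proof -
      have "0 = lkp (\<Sum>k\<le>degree P. pscale (complex_of_real t ^ k) (coeff P k)) m"
        using assms[of t] by (simp add: poly_altdef pscale_def Const_power mult.commute)
      then show ?thesis by (simp add: lookup_sum mult.commute)
    qed
    have i: "infinite (range complex_of_real)"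
      by (metis finite_imageD infinite_UNIV_char_0 inj_of_real)
    show ?thesis
      by (rule poly_coeffs_zero[OF i _ True]) (use z in auto)
  qed (simp add: coeff_eq_0)
  then show "coeff P k = coeff 0 k" by (intro poly_mapping_eqI) simp
qed

text \<open>Differentiating the group law shows that the coefficients of \<open>T a b t f\<close> are \<open>R\<^sup>k f / k!\<close>.\<close>

lemma T_coeff_rec:
  assumes ab: "a \<noteq> A0" "a \<noteq> b" and P: "\<And>t. T a b t f = poly P (Const (of_real t))"
    and F: "\<And>k. coeff P k \<in> forms d"
  shows "R a b (coeff P k) = pscale (of_nat (Suc k)) (coeff P (Suc k))"
proof -
  obtain Q where Q: "\<And>k t. T a b t (coeff P k) = poly (Q k) (Const (of_real t))"
    "\<And>k. coeff (Q k) 0 = coeff P k" "\<And>k. coeff (Q k) 1 = R a b (coeff P k)"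
    using T_poly[OF ab F] by metis
  let ?c = "\<lambda>t. Const (complex_of_real t) :: moment_polynomial"
  have e: "poly (\<Sum>k\<le>degree P. smult (?c t ^ k) (Q k)) (?c s) =
      poly (\<Sum>k\<le>degree P. smult (coeff P k) ([:?c t, 1:] ^ k)) (?c s)" for s t
  proof -
    have "T a b s (T a b t f) = (\<Sum>k\<le>degree P. ?c t ^ k * T a b s (coeff P k))"
      unfolding P poly_altdef by (simp add: T_def act_sum act_mult mult.commute flip: Const_power)
    moreover have "T a b s (T a b t f) = poly P (?c t + ?c s)"
      unfolding T_add[OF ab] by (simp add: P Const_add add.commute)
    moreover have "poly P (?c t + ?c s) = (\<Sum>k\<le>degree P. coeff P k * (?c t + ?c s) ^ k)"
      by (rule poly_altdef)
    ultimately show ?thesis by (simp add: poly_sum poly_power Q(1))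
  qed
  have e2: "(\<Sum>k\<le>degree P. ?c t ^ k * R a b (coeff P k)) = (\<Sum>k\<le>degree P. coeff P k * (of_nat k * ?c t ^ (k - 1)))" for t
  proof -
    have "(\<Sum>k\<le>degree P. smult (?c t ^ k) (Q k)) - (\<Sum>k\<le>degree P. smult (coeff P k) ([:?c t, 1:] ^ k)) = 0"
      by (rule poly_real_zero) (use e[of t] in simp)
    then have "coeff (\<Sum>k\<le>degree P. smult (?c t ^ k) (Q k)) 1 = coeff (\<Sum>k\<le>degree P. smult (coeff P k) ([:?c t, 1:] ^ k)) 1"
      by simp
    then show ?thesis using Q(3) by (simp add: coeff_sum coeff_linear_power(2)[unfolded One_nat_def])
  qed
  define S where "S = (\<Sum>k\<le>degree P. monom (R a b (coeff P k)) k)"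
  define D where "D = (\<Sum>k\<le>degree P. monom (of_nat k * coeff P k) (k - 1))"
  have "S - D = 0"
    by (rule poly_real_zero) (use e2 in \<open>simp add: S_def D_def poly_sum poly_monom mult_ac\<close>)
  then have "coeff S k = coeff D k" by simp
  moreover have "coeff S k = R a b (coeff P k)"
    by (cases "k \<le> degree P") (auto simp: S_def coeff_sum sum.delta coeff_eq_0)
  moreover have "coeff D k = of_nat (Suc k) * coeff P (Suc k)"
  proof -
    have "coeff D k = (\<Sum>k'\<le>degree P. if k' = Suc k then of_nat k' * coeff P k' else 0)"
      unfolding D_def coeff_sum by (rule sum.cong) auto
    then show ?thesis by (auto simp: sum.delta coeff_eq_0)
  qed
  ultimately show ?thesis by (simp add: pscale_def Const_def del: of_nat_Suc)
qed

lemma coeffs_in_subspace: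
  fixes c :: "nat \<Rightarrow> moment_polynomial"
  assumes W: "pvs.subspace W"
  shows "(\<And>t::real. 0 < t \<Longrightarrow> (\<Sum>k\<le>n. pscale (of_real t ^ k) (c k)) \<in> W) \<Longrightarrow> k \<le> n \<Longrightarrow> c k \<in> W"
proof (induct n arbitrary: c k)
  case 0
  then show ?case using 0(1)[of 1] by simp
next
  case (Suc n)
  let ?c = "\<lambda>k. pscale (2 ^ k - 2 ^ Suc n) (c k)"
  have "(\<Sum>k\<le>n. pscale (of_real t ^ k) (?c k)) \<in> W" if "0 < t" for t :: real
  proof -
    have "(\<Sum>k\<le>Suc n. pscale (of_real (2 * t) ^ k) (c k)) - pscale (2 ^ Suc n) (\<Sum>k\<le>Suc n. pscale (of_real t ^ k) (c k)) \<in> W"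
      using Suc(2)[of "2 * t"] Suc(2)[of t] that pvs.subspace_diff[OF W] pvs.subspace_scale[OF W] by simp
    moreover have "(\<Sum>k\<le>Suc n. pscale (of_real (2 * t) ^ k) (c k)) - pscale (2 ^ Suc n) (\<Sum>k\<le>Suc n. pscale (of_real t ^ k) (c k)) =
      (\<Sum>k\<le>n. pscale (of_real t ^ k) (?c k))"
    proof (rule poly_mapping_eqI)
      fix m
      have "(\<Sum>k\<le>n. of_real (2 * t) ^ k * lkp (c k) m) - 2 ^ Suc n * (\<Sum>k\<le>n. of_real t ^ k * lkp (c k) m) =
        (\<Sum>k\<le>n. of_real t ^ k * ((2 ^ k - 2 ^ Suc n) * lkp (c k) m))"
        unfolding sum_distrib_left sum_subtractf[symmetric]
        by (rule sum.cong) (simp_all add: power_mult_distrib algebra_simps)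
      then show "lkp ((\<Sum>k\<le>Suc n. pscale (of_real (2 * t) ^ k) (c k)) - pscale (2 ^ Suc n) (\<Sum>k\<le>Suc n. pscale (of_real t ^ k) (c k))) m =
        lkp (\<Sum>k\<le>n. pscale (of_real t ^ k) (?c k)) m"
        by (simp add: lookup_minus lookup_sum lookup_add power_mult_distrib algebra_simps)
    qed
    ultimately show ?thesis by simp
  qed
  then have 1: "?c k \<in> W" if "k \<le> n" for k using Suc(1)[of ?c] that by blast
  have 2: "c k \<in> W" if "k \<le> n" for k
  proof -
    have "(2::real) ^ k \<noteq> 2 ^ Suc n" using that power_inject_exp[of "2::real" k "Suc n"] by simp
    then have "complex_of_real (2 ^ k) \<noteq> complex_of_real (2 ^ Suc n)" by (simp only: of_real_eq_iff not_False_eq_True)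
    then have "(2::complex) ^ k \<noteq> 2 ^ Suc n" by simp
    then have "c k = pscale (inverse (2 ^ k - 2 ^ Suc n)) (?c k)" by (simp add: pscale_pscale)
    then show ?thesis using pvs.subspace_scale[OF W 1[OF that]] by metis
  qed
  have "c (Suc n) = (\<Sum>k\<le>Suc n. pscale (of_real 1 ^ k) (c k)) - (\<Sum>k\<le>n. c k)" by simp
  also have "\<dots> \<in> W"
  proof (rule pvs.subspace_diff[OF W])
    show "(\<Sum>k\<le>Suc n. pscale (of_real 1 ^ k) (c k)) \<in> W" by (rule Suc(2)) simp
    show "sum c {..n} \<in> W" using 2 by (intro pvs.subspace_sum[OF W]) auto
  qed
  finally have 3: "c (Suc n) \<in> W" .
  show ?case
  proof (cases "k = Suc n")
    case True then show ?thesis using 3 by simp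
  next
    case False
    then show ?thesis using Suc(3) by (intro 2) simp
  qed
qed

lemma poly_as_pscale: "poly P (Const z) = (\<Sum>k\<le>degree P. pscale (z ^ k) (coeff P k))"
  by (simp add: poly_altdef pscale_def Const_power mult.commute)

lemma R_in_group_stable:
  assumes ab: "a \<noteq> A0" "a \<noteq> b" and W: "pvs.subspace W" "W \<subseteq> forms d"
    and st: "\<And>t f. f \<in> W \<Longrightarrow> T a b t f \<in> W" and f: "f \<in> W"
  shows "R a b f \<in> W"
proof -
  obtain P where P: "\<And>t. T a b t f = poly P (Const (of_real t))" "coeff P 1 = R a b f"
    using T_poly[OF ab, of f d] W(2) f by auto
  show ?thesis
  proof (cases "1 \<le> degree P")
    case True
    have "(\<Sum>k\<le>degree P. pscale (of_real t ^ k) (coeff P k)) \<in> W" for t :: real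
      unfolding poly_as_pscale[symmetric] P(1)[symmetric] by (rule st[OF f])
    then have "coeff P 1 \<in> W" by (rule coeffs_in_subspace[OF W(1) _ True])
    then show ?thesis using P by simp
  next
    case False
    then have "R a b f = 0" using P(2) by (simp add: coeff_eq_0)
    then show ?thesis using pvs.subspace_0[OF W(1)] by simp
  qed
qed

lemma T_in_Lie_stable:
  assumes ab: "a \<noteq> A0" "a \<noteq> b" and W: "pvs.subspace W" "W \<subseteq> forms d"
    and st: "\<And>f. f \<in> W \<Longrightarrow> R a b f \<in> W" and f: "f \<in> W"
  shows "T a b t f \<in> W"
proof -
  obtain P where P: "\<And>t. T a b t f = poly P (Const (of_real t))" "coeff P 0 = f"
    using T_poly[OF ab, of f d] W(2) f by auto
  have F: "coeff P k \<in> forms d" for k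
  proof (cases "k \<le> degree P")
    case True
    have "(\<Sum>k\<le>degree P. pscale (of_real t ^ k) (coeff P k)) \<in> forms d" for t :: real
      unfolding poly_as_pscale[symmetric] P(1)[symmetric] T_def using act_forms W(2) f by blast
    then show ?thesis by (rule coeffs_in_subspace[OF subspace_forms _ True])
  qed (simp add: coeff_eq_0 pvs.subspace_0[OF subspace_forms])
  have "coeff P k \<in> W" for k
  proof (induct k)
    case 0 then show ?case using P f by simp
  next
    case (Suc k)
    have "coeff P (Suc k) = pscale (inverse (of_nat (Suc k))) (R a b (coeff P k))"
      by (subst T_coeff_rec[OF ab P(1) F]) (simp add: pscale_pscale del: of_nat_Suc)
    then show ?case using pvs.subspace_scale[OF W(1) st[OF Suc]] by simp
  qed
  then show ?thesis unfolding P(1) poly_as_pscale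
    by (intro pvs.subspace_sum[OF W(1)] pvs.subspace_scale[OF W(1)])
qed

subsection \<open>The torus and weight components\<close>

lemma Const_prod: "Const (prod f A) = (\<Prod>x\<in>A. Const (f x :: 'a::comm_ring_1))"
  by (induct A rule: infinite_finite_induct) (auto simp: Const_mult)

lemma meval_scale: "meval (\<lambda>v. Const (h v) * Var v) m = sgl m (meval h m :: 'a::comm_ring_1)"
proof -
  have "meval (\<lambda>v. Const (h v) * Var v) m = Const (meval h m) * meval Var m"
    unfolding meval_def by (simp add: power_mult_distrib prod.distrib Const_power Const_prod)
  then show ?thesis by (simp add: meval_Var Const_mult_single)
qed

lemma affine_form_diag: "affine_form (diag_mat t) 0 = (\<lambda>l. Const (t $ l) * Var l)"
proof
  fix l show "affine_form (diag_mat t) 0 l = Const (t $ l) * Var l"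
    using three_cases[of l] by (auto simp: affine_form_def diag_mat_def sum_3)
qed

definition tau :: "real^3 \<Rightarrow> mindex \<Rightarrow> complex" where
  "tau t I = of_real (meval (($) t) I)"

lemma act_diag_single: "act (diag_mat t) 0 (sgl m c) = sgl m (c * meval (tau t) m)"
  by (simp add: act_Lam peval_single affine_form_diag meval_scale tau_def[symmetric] Const_mult_single)

lemma meval_3: "meval s (I :: mindex) = s 1 ^ lkp I 1 * s 2 ^ lkp I 2 * s 3 ^ lkp I 3"
proof -
  have "meval s I = (\<Prod>l\<in>UNIV. s l ^ lkp I l)" by (rule meval_superset) auto
  also have "\<dots> = (\<Prod>l\<in>{1, 2, 3}. s l ^ lkp I l)" by (simp only: UNIV_3)
  also have "\<dots> = s 1 ^ lkp I 1 * s 2 ^ lkp I 2 * s 3 ^ lkp I 3" by (simp add: mult.assoc)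
  finally show ?thesis .
qed

lemma nat_wt: "nat (wt m a) = (\<Sum>I\<in>kys m. lkp m I * ex a I)"
proof -
  have "wt m a = int (\<Sum>I\<in>kys m. lkp m I * ex a I)" by (simp add: wt_def exi_def)
  then show ?thesis by (simp only: nat_int)
qed

lemma prod_power_power: "(\<Prod>I\<in>S. (x ^ e I) ^ n I) = (x :: real) ^ (\<Sum>I\<in>S. n I * e I)"
proof -
  have "(\<Prod>I\<in>S. (x ^ e I) ^ n I) = (\<Prod>I\<in>S. x ^ (n I * e I))"
    by (rule prod.cong) (simp_all only: power_mult[symmetric] mult.commute)
  then show ?thesis by (simp only: power_sum)
qed

lemma meval_tau: "meval (tau t) m = of_real (t $ 1 ^ nat (wt m A1) * t $ 2 ^ nat (wt m A2) * t $ 3 ^ nat (wt m A3))"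
proof -
  have "meval (tau t) m = of_real (\<Prod>I\<in>kys m. (t $ 1 ^ ex A1 I * t $ 2 ^ ex A2 I * t $ 3 ^ ex A3 I) ^ lkp m I)"
    unfolding meval_def[of "tau t"] tau_def meval_3 by simp
  then show ?thesis
    unfolding nat_wt prod_power_power[symmetric] power_mult_distrib prod.distrib .
qed

lemma act_diag: "act (diag_mat t) 0 f = (\<Sum>m\<in>kys f. sgl m (lkp f m * of_real (t $ 1 ^ nat (wt m A1) * t $ 2 ^ nat (wt m A2) * t $ 3 ^ nat (wt m A3))))"
  by (subst poly_sum_single[of f]) (simp add: act_sum act_diag_single meval_tau)

lemma act_diag_wsp:
  assumes "f \<in> wsp i j k"
  shows "act (diag_mat t) 0 f = pscale (of_real (t $ 1 ^ nat i * t $ 2 ^ nat j * t $ 3 ^ nat k)) f"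
proof -
  have "act (diag_mat t) 0 f = (\<Sum>m\<in>kys f. pscale (of_real (t $ 1 ^ nat i * t $ 2 ^ nat j * t $ 3 ^ nat k)) (sgl m (lkp f m)))"
    unfolding act_diag using assms by (intro sum.cong) (auto simp: wsp_def pscale_single mult.commute)
  then show ?thesis by (simp add: pscale_sum[symmetric] poly_sum_single[symmetric])
qed

definition cmp :: "int \<Rightarrow> int \<Rightarrow> int \<Rightarrow> moment_polynomial \<Rightarrow> moment_polynomial" where
  "cmp i j k f = (\<Sum>m\<in>{m\<in>kys f. wt m A1 = i \<and> wt m A2 = j \<and> wt m A3 = k}. sgl m (lkp f m))"

lemma lookup_cmp: "lkp (cmp i j k f) m = (if wt m A1 = i \<and> wt m A2 = j \<and> wt m A3 = k then lkp f m else 0)"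
  by (auto simp: cmp_def lookup_sum lookup_single "when_def" in_keys_iff sum.delta)

lemma cmp_wsp: "f \<in> forms 5 \<Longrightarrow> cmp i j k f \<in> wsp i j k"
  by (auto simp: wsp_def forms_def in_keys_iff lookup_cmp split: if_splits)

lemma cmp_id: "f \<in> wsp i j k \<Longrightarrow> cmp i j k f = f"
  by (rule poly_mapping_eqI) (auto simp: lookup_cmp wsp_def in_keys_iff)

lemma cmp_other: "f \<in> wsp i j k \<Longrightarrow> (i, j, k) \<noteq> (i', j', k') \<Longrightarrow> cmp i' j' k' f = 0"
  by (rule poly_mapping_eqI) (auto simp: lookup_cmp wsp_def in_keys_iff)

lemma cmp_add: "cmp i j k (f + g) = cmp i j k f + cmp i j k g"
  by (rule poly_mapping_eqI) (auto simp: lookup_cmp lookup_add)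

lemma cmp_pscale: "cmp i j k (pscale c f) = pscale c (cmp i j k f)"
  by (rule poly_mapping_eqI) (auto simp: lookup_cmp)

lemma cmp_0 [simp]: "cmp i j k 0 = 0"
  by (rule poly_mapping_eqI) (auto simp: lookup_cmp)

definition wts :: "(int \<times> int \<times> int) set" where
  "wts = {0..15} \<times> {0..15} \<times> {0..15}"

lemma finite_wts [simp]: "finite wts" by (simp add: wts_def)

lemma wt_bounds: "f \<in> forms 5 \<Longrightarrow> m \<in> kys f \<Longrightarrow> wt m a \<in> {0..15}"
  using wt_sum[of m] wt_nonneg[of m A0] wt_nonneg[of m A1] wt_nonneg[of m A2] wt_nonneg[of m A3]
  by (cases a) (auto simp: forms_def)

lemma cmp_sum_wts: "f \<in> forms 5 \<Longrightarrow> f = (\<Sum>(i, j, k)\<in>wts. cmp i j k f)"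
proof (rule poly_mapping_eqI)
  fix m assume f: "f \<in> forms 5"
  have "lkp (\<Sum>(i, j, k)\<in>wts. cmp i j k f) m =
    (\<Sum>x\<in>wts. if x = (wt m A1, wt m A2, wt m A3) then lkp f m else 0)"
    unfolding lookup_sum by (rule sum.cong) (auto simp: lookup_cmp split: if_splits)
  also have "\<dots> = lkp f m"
    using wt_bounds[OF f, of m A1] wt_bounds[OF f, of m A2] wt_bounds[OF f, of m A3]
    by (cases "m \<in> kys f") (auto simp: sum.delta in_keys_iff wts_def)
  finally show "lkp f m = lkp (\<Sum>(i, j, k)\<in>wts. cmp i j k f) m" by simp
qed

lemma base16:
  fixes a b c i j k :: int
  assumes "a + 16 * b + 256 * c = i + 16 * j + 256 * k" "0 \<le> a" "a \<le> 15" "0 \<le> b" "b \<le> 15"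
    "0 \<le> i" "i \<le> 15" "0 \<le> j" "j \<le> 15"
  shows "a = i \<and> b = j \<and> c = k"
proof -
  define u where "u = (j - b) + 16 * (k - c)"
  have au: "a - i = 16 * u" using assms(1) by (simp add: u_def algebra_simps)
  have "16 * u < 16" "- 16 < 16 * u" using au assms(2,3,6,7) by linarith+
  then have u0: "u = 0" by linarith
  have bj: "b - j = 16 * (k - c)" using u0 by (simp add: u_def)
  define v where "v = k - c"
  have "16 * v < 16" "- 16 < 16 * v" using bj assms(4,5,8,9) unfolding v_def[symmetric] by linarith+
  then have "v = 0" by linarith
  then show ?thesis using au u0 bj by (simp add: v_def)
qed

text \<open>The one-parameter group \<open>diag(s, s\<^sup>1\<^sup>6, s\<^sup>2\<^sup>5\<^sup>6)\<close> separates the weights of quintic forms.\<close>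

lemma cmp_in_group_stable:
  assumes W: "pvs.subspace W" "W \<subseteq> forms 5" and st: "\<And>t. \<forall>i. t $ i \<noteq> 0 \<Longrightarrow> act (diag_mat t) 0 ` W \<subseteq> W" and f: "f \<in> W"
  shows "cmp i j k f \<in> W"
proof (cases "i \<in> {0..15} \<and> j \<in> {0..15} \<and> k \<in> {0..15}")
  case True
  have ff: "f \<in> forms 5" using W f by auto
  define N where "N m = nat (wt m A1 + 16 * wt m A2 + 256 * wt m A3)" for m
  define c where "c n = (\<Sum>m\<in>{m\<in>kys f. N m = n}. sgl m (lkp f m))" for n
  have Nb: "N m \<le> 4095" if "m \<in> kys f" for m
    using wt_bounds[OF ff that, of A1] wt_bounds[OF ff that, of A2] wt_bounds[OF ff that, of A3] by (auto simp: N_def)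
  have "(\<Sum>n\<le>4095. pscale (of_real s ^ n) (c n)) \<in> W" if s: "0 < s" for s :: real
  proof -
    define t :: "real^3" where "t = (\<chi> l. if l = 1 then s else if l = 2 then s ^ 16 else s ^ 256)"
    have "act (diag_mat t) 0 f = (\<Sum>m\<in>kys f. sgl m (lkp f m * of_real s ^ N m))"
      unfolding act_diag
    proof (rule sum.cong[OF refl])
      fix m assume m: "m \<in> kys f"
      have "s ^ nat (wt m A1) * (s ^ 16) ^ nat (wt m A2) * (s ^ 256) ^ nat (wt m A3) = s ^ N m"
      proof -
        have "N m = nat (wt m A1) + 16 * nat (wt m A2) + 256 * nat (wt m A3)"
          using wt_nonneg[of m A1] wt_nonneg[of m A2] wt_nonneg[of m A3] by (simp add: N_def)
        then show ?thesis by (simp only: power_mult power_add)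
      qed
      then show "sgl m (lkp f m * of_real (t $ 1 ^ nat (wt m A1) * t $ 2 ^ nat (wt m A2) * t $ 3 ^ nat (wt m A3))) = sgl m (lkp f m * of_real s ^ N m)"
        by (simp add: t_def flip: of_real_power of_real_mult)
    qed
    also have "\<dots> = (\<Sum>n\<le>4095. \<Sum>m\<in>{m\<in>kys f. N m = n}. sgl m (lkp f m * of_real s ^ N m))"
    proof (rule sum.group[symmetric])
      show "N ` kys f \<subseteq> {..4095}" using Nb by (intro image_subsetI) (simp only: atMost_iff)
    qed (rule finite_keys, rule finite_atMost)
    also have "\<dots> = (\<Sum>n\<le>4095. pscale (of_real s ^ n) (c n))"
      unfolding c_def pscale_sum pscale_single
      by (intro sum.cong refl) (auto simp: mult.commute)
    finally have "act (diag_mat t) 0 f = (\<Sum>n\<le>4095. pscale (of_real s ^ n) (c n))" .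
    moreover have "\<forall>i. t $ i \<noteq> 0" using s by (simp add: t_def)
    ultimately show ?thesis using st[of t] f by auto
  qed
  then have c: "c n \<in> W" if "n \<le> 4095" for n by (rule coeffs_in_subspace[OF W(1) _ that])
  have "cmp i j k f = c (nat (i + 16 * j + 256 * k))"
    unfolding cmp_def c_def
  proof (rule sum.cong[OF _ refl], rule Collect_cong, rule conj_cong[OF refl])
    fix m assume m: "m \<in> kys f"
    show "(wt m A1 = i \<and> wt m A2 = j \<and> wt m A3 = k) = (N m = nat (i + 16 * j + 256 * k))"
    proof
      assume "N m = nat (i + 16 * j + 256 * k)"
      then have "wt m A1 + 16 * wt m A2 + 256 * wt m A3 = i + 16 * j + 256 * k"
        using wt_nonneg[of m] True by (auto simp: N_def eq_nat_nat_iff)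
      then show "wt m A1 = i \<and> wt m A2 = j \<and> wt m A3 = k"
        using wt_bounds[OF ff m, of A1] wt_bounds[OF ff m, of A2] wt_bounds[OF ff m, of A3] True
        by (intro base16) auto
    qed (simp add: N_def)
  qed
  then show ?thesis using c True by auto
next
  case False
  have "f \<in> forms 5" using W f by auto
  then have "cmp i j k f = 0" using False wt_bounds[of f]
    by (intro poly_mapping_eqI) (auto simp: lookup_cmp in_keys_iff)
  then show ?thesis using pvs.subspace_0[OF W(1)] by simp
qed

subsection \<open>Submodules and Lie-stable graded subspaces\<close>

definition gstab :: "moment_polynomial set \<Rightarrow> bool" where
  "gstab W \<longleftrightarrow> pvs.subspace W \<and> W \<subseteq> forms 5 \<and> (\<forall>f\<in>W. \<forall>i j k. cmp i j k f \<in> W) \<and>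
     (\<forall>f\<in>W. \<forall>a b. a \<noteq> A0 \<longrightarrow> b \<noteq> A0 \<longrightarrow> a \<noteq> b \<longrightarrow> R a b f \<in> W)"

definition astab :: "moment_polynomial set \<Rightarrow> bool" where
  "astab W \<longleftrightarrow> gstab W \<and> (\<forall>f\<in>W. \<forall>a. a \<noteq> A0 \<longrightarrow> R a A0 f \<in> W)"

lemma TA_gl: "b \<noteq> A0 \<Longrightarrow> Tb a b t = 0" by (simp add: Tb_def vec_eq_iff)
lemma TA_tr: "TA a A0 t = mat 1" by (simp add: TA_def mat_def vec_eq_iff)

lemma dn_inj: "a \<noteq> A0 \<Longrightarrow> b \<noteq> A0 \<Longrightarrow> dn a = dn b \<longleftrightarrow> a = b"
  by (cases a; cases b) auto

lemma dn_surj: "\<exists>a. a \<noteq> A0 \<and> dn a = m"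
  by (metis dir.distinct(1,3,5) dn.simps(2-4) three_cases)

lemma TA_invertible:
  assumes "a \<noteq> A0" "b \<noteq> A0" "a \<noteq> b"
  shows "invertible (TA a b t)"
proof -
  have n: "dn a \<noteq> dn b" using dn_inj[OF assms(1,2)] assms(3) by simp
  have "(TA a b s ** TA a b t) $ i $ j = TA a b (s + t) $ i $ j" for s t i j
    using n assms three_cases[of i] three_cases[of j] three_cases[of "dn a"] three_cases[of "dn b"]
    unfolding TA_def matrix_matrix_mult_def
    by (elim disjE) (simp_all add: sum_3)
  then have "TA a b s ** TA a b t = TA a b (s + t)" for s t by (simp add: vec_eq_iff)
  moreover have "TA a b 0 = mat 1" by (simp add: TA_def mat_def vec_eq_iff)
  ultimately show ?thesis unfolding invertible_def by (intro exI[of _ "TA a b (- t)"]) simp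
qed

lemma diag_invertible: "\<forall>i. t $ i \<noteq> 0 \<Longrightarrow> invertible (diag_mat t)"
proof -
  assume t: "\<forall>i. t $ i \<noteq> 0"
  have "diag_mat u ** diag_mat v = mat 1" if "\<forall>i. u $ i * v $ i = 1" for u v
  proof -
    have "(diag_mat u ** diag_mat v) $ i $ j = mat 1 $ i $ j" for i j
      using that three_cases[of i] three_cases[of j]
      unfolding diag_mat_def mat_def matrix_matrix_mult_def
      by (elim disjE) (simp_all add: sum_3)
    then show ?thesis by (simp add: vec_eq_iff)
  qed
  from this[of t "\<chi> i. inverse (t $ i)"] this[of "\<chi> i. inverse (t $ i)" t] show ?thesis
    using t unfolding invertible_def by (intro exI[of _ "diag_mat (\<chi> i. inverse (t $ i))"]) simp
qed

lemma gl_submodule_gstab: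
  assumes "gl_submodule W" "W \<subseteq> forms 5"
  shows "gstab W"
proof -
  have W: "pvs.subspace W" and st: "\<And>A. invertible A \<Longrightarrow> act A 0 ` W \<subseteq> W"
    using assms(1) by (auto simp: gl_submodule_def)
  have "cmp i j k f \<in> W" if "f \<in> W" for f i j k
    by (rule cmp_in_group_stable[OF W assms(2) _ that]) (use st diag_invertible in blast)
  moreover have "R a b f \<in> W" if "f \<in> W" "a \<noteq> A0" "b \<noteq> A0" "a \<noteq> b" for f a b
    by (rule R_in_group_stable[OF that(2,4) W assms(2) _ that(1)])
       (use st[OF TA_invertible[OF that(2-4)]] in \<open>auto simp: T_def TA_gl[OF that(3)]\<close>)
  ultimately show ?thesis using W assms(2) by (auto simp: gstab_def)
qed

lemma gstab_gl_submodule: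
  assumes "gstab W"
  shows "gl_submodule W"
proof -
  have W: "pvs.subspace W" "W \<subseteq> forms 5" using assms by (auto simp: gstab_def)
  define P where "P A \<longleftrightarrow> invertible A \<longrightarrow> act A 0 ` W \<subseteq> W" for A :: "real^3^3"
  have dg: "P (diag_mat t)" for t
    unfolding P_def
  proof (intro impI image_subsetI)
    fix f assume f: "f \<in> W"
    have "act (diag_mat t) 0 f = (\<Sum>(i, j, k)\<in>wts. act (diag_mat t) 0 (cmp i j k f))"
      using cmp_sum_wts[of f] f W(2) by (subst cmp_sum_wts[of f]) (auto simp: act_sum case_prod_unfold)
    also have "\<dots> \<in> W"
    proof (intro pvs.subspace_sum[OF W(1)], clarify)
      fix i j k
      have "f \<in> forms 5" using f W(2) by auto
      then have "act (diag_mat t) 0 (cmp i j k f) = pscale (of_real (t $ 1 ^ nat i * t $ 2 ^ nat j * t $ 3 ^ nat k)) (cmp i j k f)"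
        by (rule act_diag_wsp[OF cmp_wsp])
      then show "act (diag_mat t) 0 (cmp i j k f) \<in> W"
        using assms f by (simp only:) (rule pvs.subspace_scale[OF W(1)], simp add: gstab_def)
    qed
    finally show "act (diag_mat t) 0 f \<in> W" .
  qed
  have tr: "P (TA a b t)" if "a \<noteq> A0" "b \<noteq> A0" "a \<noteq> b" for a b t
    unfolding P_def
    using T_in_Lie_stable[OF that(1,3) W] assms that by (auto simp: gstab_def T_def TA_gl)
  have mult: "P (A ** B)" if "P A" "P B" for A B
    unfolding P_def
  proof
    assume "invertible (A ** B)"
    then have "invertible A" "invertible B" by (simp_all add: invertible_det_nz det_mul)
    then have "act A 0 ` W \<subseteq> W" "act B 0 ` W \<subseteq> W" using that by (auto simp: P_def)
    moreover have "act (A ** B) 0 f = act B 0 (act A 0 f)" for f by (simp add: act_act)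
    ultimately show "act (A ** B) 0 ` W \<subseteq> W" by auto
  qed
  have tm: "P (\<chi> i j. if i = m \<and> j = n then c else of_bool (i = j))" if mn: "m \<noteq> n" for m n c
  proof -
    obtain a b where ab: "a \<noteq> A0" "b \<noteq> A0" "dn a = m" "dn b = n" using dn_surj by metis
    then have "(\<chi> i j. if i = m \<and> j = n then c else of_bool (i = j)) = TA a b c"
      using mn by (auto simp: TA_def vec_eq_iff)
    then show ?thesis using tr[of a b c] ab mn by auto
  qed
  have "P A" for A
  proof (rule induct_matrix_elementary[where P = P])
    show "P (A ** B)" if "P A" "P B" for A B using that by (rule mult)
  next
    fix A :: "real^3^3" and i assume "row i A = 0"
    then have "det A = 0" by (rule det_zero_row(1))
    then show "P A" by (simp add: P_def invertible_det_nz)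
  next
    fix A :: "real^3^3" assume "\<And>i j. i \<noteq> j \<Longrightarrow> A $ i $ j = 0"
    then have "A = diag_mat (\<chi> i. A $ i $ i)" by (auto simp: diag_mat_def vec_eq_iff)
    then show "P A" using dg by metis
  next
    fix m n :: 3 assume mn: "m \<noteq> n"
    define E where "E m n c = (\<chi> i j. if i = m \<and> j = n then c else of_bool (i = j) :: real^3^3)" for m n :: 3 and c
    define D where "D = diag_mat (\<chi> i. if i = m then - 1 else 1)"
    have "(\<chi> i j. mat 1 $ i $ Transposition.transpose m n j) = E m n 1 ** E n m (- 1) ** E m n 1 ** D"
    proof -
      have "(\<chi> i j. mat 1 $ i $ Transposition.transpose m n j) $ i $ j = (E m n 1 ** E n m (- 1) ** E m n 1 ** D) $ i $ j" for i j
        using mn three_cases[of m] three_cases[of n] three_cases[of i] three_cases[of j]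
        unfolding E_def D_def diag_mat_def mat_def matrix_matrix_mult_def Transposition.transpose_def
        by (elim disjE) (simp_all add: sum_3)
      then show ?thesis by (simp add: vec_eq_iff)
    qed
    moreover have "P (E m n 1 ** E n m (- 1) ** E m n 1 ** D)"
      unfolding E_def D_def using mn by (intro mult dg tm) auto
    ultimately show "P (\<chi> i j. mat 1 $ i $ Transposition.transpose m n j)" by simp
  next
    show "P (\<chi> i j. if i = m \<and> j = n then c else of_bool (i = j))" if "m \<noteq> n" for m n c
      using that by (rule tm)
  qed
  then show ?thesis using W by (auto simp: gl_submodule_def P_def)
qed

lemma aff_submodule_astab:
  assumes "aff_submodule W" "W \<subseteq> forms 5"
  shows "astab W"
proof -
  have W: "pvs.subspace W" and st: "\<And>A b. invertible A \<Longrightarrow> act A b ` W \<subseteq> W"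
    using assms(1) by (auto simp: aff_submodule_def)
  have "gl_submodule W" using W st by (auto simp: gl_submodule_def)
  moreover have "R a A0 f \<in> W" if "f \<in> W" "a \<noteq> A0" for f a
    by (rule R_in_group_stable[OF that(2,2) W assms(2) _ that(1)])
       (use st[of "mat 1"] in \<open>auto simp: T_def TA_tr invertible_def intro!: exI[of _ "mat 1"]\<close>)
  ultimately show ?thesis using gl_submodule_gstab[OF _ assms(2)] by (auto simp: astab_def)
qed

lemma astab_aff_submodule:
  assumes "astab W"
  shows "aff_submodule W"
proof -
  have W: "pvs.subspace W" "W \<subseteq> forms 5" using assms by (auto simp: gstab_def astab_def)
  have gl: "gl_submodule W" using assms gstab_gl_submodule by (auto simp: astab_def)
  have tr: "act (mat 1) (Tb a A0 t) f \<in> W" if "f \<in> W" "a \<noteq> A0" for f a t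
    using T_in_Lie_stable[OF that(2,2) W _ that(1)] assms that(2) by (auto simp: T_def TA_tr astab_def)
  have "act A b f \<in> W" if A: "invertible A" and f: "f \<in> W" for A b f
  proof -
    have "b = Tb A1 A0 (b $ 1) + Tb A2 A0 (b $ 2) + Tb A3 A0 (b $ 3)"
      by (simp add: Tb_def vec_eq_iff forall_3)
    then have "act (mat 1) b f = act (mat 1) (Tb A1 A0 (b $ 1)) (act (mat 1) (Tb A2 A0 (b $ 2)) (act (mat 1) (Tb A3 A0 (b $ 3)) f))"
      by (simp add: act_act add_ac)
    then have "act (mat 1) b f \<in> W" using tr f by simp
    moreover have "act A b f = act A 0 (act (mat 1) b f)" by (simp add: act_act)
    ultimately show ?thesis using gl A by (auto simp: gl_submodule_def)
  qed
  then show ?thesis using W by (auto simp: aff_submodule_def)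
qed

section \<open>Moments of tetrahedra\<close>

subsection \<open>Integration over the standard simplex\<close>

definition bary :: "real^3 \<Rightarrow> 4 \<Rightarrow> real" where
  "bary u k = (if k = 1 then u $ 1 else if k = 2 then u $ 2 else if k = 3 then u $ 3 else 1 - u $ 1 - u $ 2 - u $ 3)"

definition simplex3 :: "(real^3) set" where
  "simplex3 = {u. \<forall>k. 0 \<le> bary u k}"

lemma sum_bary: "(\<Sum>k\<in>UNIV. bary u k) = 1"
  by (simp add: sum_4 bary_def)

lemma std_simplex_eq: "simplex3 = convex hull (insert 0 (range (\<lambda>i::3. axis i (1::real))))"
proof -
  have B: "(Basis :: (real^3) set) = range (\<lambda>i. axis i 1)" by (auto simp: Basis_vec_def)
  have i: "inj (\<lambda>i::3. axis i (1::real))" by (auto simp: inj_def axis_eq_axis)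
  have "convex hull (insert 0 (range (\<lambda>i::3. axis i (1::real)))) = {x. (\<forall>i. 0 \<le> x $ i) \<and> (\<Sum>i\<in>UNIV. x $ i) \<le> 1}"
    using std_simplex[where 'a="real^3"] unfolding B by (simp add: sum.reindex[OF i] cart_eq_inner_axis[symmetric])
  moreover have "simplex3 = {x. (\<forall>i. 0 \<le> x $ i) \<and> (\<Sum>i\<in>UNIV. x $ i) \<le> 1}"
    by (rule set_eqI) (auto simp: simplex3_def bary_def forall_3 forall_4 sum_3)
  ultimately show ?thesis by (rule trans[OF _ sym, rotated])
qed

lemma compact_simplex3: "compact simplex3"
  unfolding std_simplex_eq by (rule finite_imp_compact_convex_hull) auto

lemma measure_simplex3: "0 < measure lborel simplex3"
proof -
  have "(Basis :: (real^3) set) = range (\<lambda>i. axis i 1)" by (auto simp: Basis_vec_def)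
  then show ?thesis using content_std_simplex[where 'a="real^3"] by (simp add: std_simplex_eq)
qed

lemma set_integrable_compact:
  fixes f :: "'a::euclidean_space \<Rightarrow> 'b::euclidean_space"
  assumes "compact K" "continuous_on UNIV f"
  shows "set_integrable lborel K f"
  using borel_integrable_compact[OF assms(1) continuous_on_subset[OF assms(2) subset_UNIV]]
  by (simp add: set_integrable_def)

lemma abs_integrable_compact:
  fixes f :: "'a::euclidean_space \<Rightarrow> 'b::euclidean_space"
  assumes "compact K" "continuous_on UNIV f"
  shows "f absolutely_integrable_on K"
proof -
  have "integrable lborel (\<lambda>x. indicator K x *\<^sub>R f x)"
    using set_integrable_compact[OF assms] by (simp add: set_integrable_def)
  then show ?thesis
    unfolding set_integrable_def by (subst integrable_completion) (auto dest: borel_measurable_integrable)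
qed

lemma integrable_compact:
  fixes f :: "'a::euclidean_space \<Rightarrow> 'b::euclidean_space"
  assumes "compact K" "continuous_on UNIV f"
  shows "f integrable_on K"
  using set_borel_integral_eq_integral(1)[OF set_integrable_compact[OF assms]] .

lemma integral_affine_image:
  fixes L :: "real^3 \<Rightarrow> real^3" and f :: "real^3 \<Rightarrow> real"
  assumes L: "linear L" "inj L" and K: "compact K" and f: "continuous_on UNIV f"
  shows "integral ((\<lambda>u. L u + b) ` K) f = \<bar>det (matrix L)\<bar> * integral K (\<lambda>u. f (L u + b))"
proof -
  let ?g = "\<lambda>u. L u + b" and ?F = "\<lambda>x. vec (f x) :: real^1"
  have c: "continuous_on UNIV ?g"
    by (intro continuous_intros linear_continuous_on) (simp add: L linear_conv_bounded_linear[symmetric])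
  have F: "continuous_on UNIV ?F" unfolding vec_def by (intro continuous_intros f)
  have cK: "compact (?g ` K)" using c K continuous_on_subset by (blast intro: compact_continuous_image)
  have d: "(?g has_derivative L) (at x within K)" for x
    using L(1) by (auto intro!: derivative_eq_intros linear_imp_has_derivative)
  have i: "inj_on ?g K" using L(2) by (auto simp: inj_on_def inj_def)
  have "integral K (\<lambda>x. \<bar>det (matrix L)\<bar> *\<^sub>R ?F (?g x)) = integral (?g ` K) ?F"
    using has_absolute_integral_change_of_variables_compact[OF K d i, of ?F "integral (?g ` K) ?F"]
      abs_integrable_compact[OF cK F] by blast
  moreover have "integral (?g ` K) ?F $ 1 = integral (?g ` K) f"
    using integral_component_eq_cart[OF integrable_compact[OF cK F], of 1] by simp
  moreover have "integral K (\<lambda>x. \<bar>det (matrix L)\<bar> *\<^sub>R ?F (?g x)) $ 1 = \<bar>det (matrix L)\<bar> * integral K (\<lambda>u. f (?g u))"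
  proof -
    have "continuous_on UNIV (\<lambda>x. ?F (?g x))"
      by (rule continuous_on_compose2[OF F c]) auto
    then have "integral K (\<lambda>x. ?F (?g x)) $ 1 = integral K (\<lambda>u. f (?g u))"
      using integral_component_eq_cart[OF integrable_compact[OF K], of "\<lambda>x. ?F (?g x)" 1] by simp
    then show ?thesis by (simp only: integral_cmul) simp
  qed
  ultimately show ?thesis by simp
qed

lemma lborel_indicator_integral:
  fixes g :: "real^3 \<Rightarrow> real"
  assumes "compact K" "continuous_on UNIV g"
  shows "(LINT x|lborel. indicator K x *\<^sub>R g x) = integral K g"
  using set_borel_integral_eq_integral(2)[OF set_integrable_compact[OF assms]] by (simp add: set_lebesgue_integral_def)

lemma measure_integral: "compact K \<Longrightarrow> measure lborel K = integral K (\<lambda>_ :: real^3. 1)"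
  using lborel_indicator_integral[of K "\<lambda>_. 1"] by (simp add: borel_compact)

lemma uniform_integral:
  fixes f :: "real^3 \<Rightarrow> real"
  assumes K: "compact K" "0 < integral K (\<lambda>_. 1 :: real)" and f: "continuous_on UNIV f"
  shows "(\<integral>w. f w \<partial>uniform_measure lborel K) = integral K f / integral K (\<lambda>_. 1)"
proof -
  have m: "K \<in> sets borel" by (simp add: K borel_compact)
  have e: "emeasure lborel K = ennreal (measure lborel K)"
    using emeasure_compact_finite[OF K(1)] by (simp add: emeasure_eq_ennreal_measure)
  have D: "(indicator K x / emeasure lborel K :: ennreal) = ennreal (indicator K x / measure lborel K)" for x
    using K(2) by (auto simp: e measure_integral[OF K(1)] indicator_def divide_ennreal simp flip: ennreal_1)
  have "(\<integral>w. f w \<partial>uniform_measure lborel K) = (LINT x|lborel. (indicator K x / measure lborel K) *\<^sub>R f x)"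
    unfolding uniform_measure_def D
    by (rule integral_density) (use f m in \<open>auto intro: borel_measurable_continuous_onI\<close>)
  also have "\<dots> = (LINT x|lborel. indicator K x *\<^sub>R f x) / measure lborel K"
    by (simp flip: integral_divide_zero)
  finally show ?thesis by (simp only: lborel_indicator_integral[OF K(1) f] measure_integral[OF K(1)])
qed

lemma continuous_bary [continuous_intros]: "continuous_on S (\<lambda>u. bary u k)"
  unfolding bary_def by (cases "k = 1"; cases "k = 2"; cases "k = 3"; simp; intro continuous_intros)

definition em :: "3 \<Rightarrow> 4" where
  "em l = (if l = 1 then 1 else if l = 2 then 2 else 3)"

definition perm_map :: "(4 \<Rightarrow> 4) \<Rightarrow> real^3 \<Rightarrow> real^3" where
  "perm_map p u = (\<chi> l. bary u (p (em l)))"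

lemma bary_perm_map:
  assumes "bij p" shows "bary (perm_map p u) k = bary u (p k)"
proof -
  have "(\<Sum>k\<in>UNIV. bary u (p k)) = 1"
    using sum.reindex_bij_betw[OF assms, of "bary u"] sum_bary[of u] by simp
  then have "bary u (p 4) = 1 - bary u (p 1) - bary u (p 2) - bary u (p 3)" by (simp add: sum_4)
  then show ?thesis using exhaust_4[of k]
    by (elim disjE) (simp_all add: perm_map_def bary_def[of "\<chi> l. _ l"] em_def)
qed

lemma bary_inj: "(\<And>k. bary u k = bary v k) \<Longrightarrow> u = v"
  using bary_def[of u 1] bary_def[of u 2] bary_def[of u 3] bary_def[of v 1] bary_def[of v 2] bary_def[of v 3]
  by (simp add: vec_eq_iff forall_3)

definition bary0 :: "real^3 \<Rightarrow> 4 \<Rightarrow> real" where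
  "bary0 u k = (if k = 1 then u $ 1 else if k = 2 then u $ 2 else if k = 3 then u $ 3 else - u $ 1 - u $ 2 - u $ 3)"

lemma linear_bary0: "linear (\<lambda>u. \<chi> l. bary0 u (p (em l)))"
  by (rule linearI) (auto simp: bary0_def vec_eq_iff algebra_simps)

lemma bary_bary0: "bary u k = bary0 u k + bary 0 k"
  by (simp add: bary_def bary0_def)

lemma perm_map_affine: "perm_map p u = (\<chi> l. bary0 u (p (em l))) + perm_map p 0"
  by (simp add: perm_map_def vec_eq_iff bary_bary0[of u])

lemma perm_map_inv: "bij p \<Longrightarrow> perm_map (inv p) (perm_map p u) = u"
  by (rule bary_inj) (simp add: bary_perm_map bij_imp_bij_inv bij_is_surj surj_f_inv_f)

lemma perm_map_image: "bij p \<Longrightarrow> perm_map p ` simplex3 = simplex3"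
proof -
  have sub: "perm_map p ` simplex3 \<subseteq> simplex3" if "bij p" for p
    using that by (auto simp: simplex3_def bary_perm_map)
  moreover assume p: "bij p"
  moreover have "u \<in> perm_map p ` simplex3" if "u \<in> simplex3" for u
  proof -
    have "perm_map p (perm_map (inv p) u) = u" using perm_map_inv[OF bij_imp_bij_inv[OF p], of u] p by (simp add: inv_inv_eq)
    moreover have "perm_map (inv p) u \<in> simplex3" using sub[OF bij_imp_bij_inv[OF p]] that by auto
    ultimately show ?thesis by (metis image_eqI)
  qed
  ultimately show ?thesis using sub[OF p] by blast
qed

abbreviation J3 :: "(real^3 \<Rightarrow> real) \<Rightarrow> real" where "J3 \<equiv> integral simplex3"

lemma J3_pos: "0 < J3 (\<lambda>_. 1)"
  using measure_simplex3 by (simp add: measure_integral[OF compact_simplex3])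

lemma perm_map_inj: "bij p \<Longrightarrow> inj (\<lambda>u. (\<chi> l. bary0 u (p (em l))) :: real^3)"
proof -
  assume p: "bij p"
  have "u = v" if "(\<chi> l. bary0 u (p (em l))) = ((\<chi> l. bary0 v (p (em l))) :: real^3)" for u v
  proof -
    have "perm_map p u = perm_map p v" unfolding perm_map_affine[of p u] perm_map_affine[of p v] that ..
    then show ?thesis using perm_map_inv[OF p] by metis
  qed
  then show ?thesis by (auto simp: inj_def)
qed

lemma J3_perm:
  assumes p: "bij p" and f: "continuous_on UNIV f"
  shows "J3 (\<lambda>u. f (perm_map p u)) = J3 f"
proof -
  let ?d = "\<bar>det (matrix (\<lambda>u. (\<chi> l. bary0 u (p (em l))) :: real^3))\<bar>"
  have *: "J3 g = ?d * J3 (\<lambda>u. g (perm_map p u))" if "continuous_on UNIV g" for g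
    using integral_affine_image[OF linear_bary0 perm_map_inj[OF p] compact_simplex3 that, of "perm_map p 0"]
    unfolding perm_map_affine[of p, symmetric] perm_map_image[OF p] .
  have "?d = 1" using *[of "\<lambda>_. 1"] J3_pos by simp
  then show ?thesis using *[OF f] by simp
qed

text \<open>The map \<open>half\<close> sends the simplex onto the half of it where \<open>u\<^sub>2 \<le> u\<^sub>1\<close>.\<close>

definition half :: "real^3 \<Rightarrow> real^3" where
  "half u = (\<chi> l. if l = 1 then u $ 1 + u $ 2 / 2 else if l = 2 then u $ 2 / 2 else u $ 3)"

definition sw12 :: "4 \<Rightarrow> 4" where
  "sw12 k = (if k = 1 then 2 else if k = 2 then 1 else k)"

lemma bij_sw12: "bij sw12"
  by (rule involuntory_imp_bij) (auto simp: sw12_def)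

lemma half_image: "half ` simplex3 = {u \<in> simplex3. u $ 2 \<le> u $ 1}"
proof (rule set_eqI, rule iffI)
  fix u assume "u \<in> half ` simplex3"
  then show "u \<in> {u \<in> simplex3. u $ 2 \<le> u $ 1}"
    by (auto simp: half_def simplex3_def bary_def forall_4)
next
  fix u :: "real^3" assume u: "u \<in> {u \<in> simplex3. u $ 2 \<le> u $ 1}"
  define v :: "real^3" where "v = (\<chi> l. if l = 1 then u $ 1 - u $ 2 else if l = 2 then 2 * u $ 2 else u $ 3)"
  have "half v = u" by (simp add: half_def v_def vec_eq_iff forall_3)
  moreover have "v \<in> simplex3" using u by (auto simp: v_def simplex3_def bary_def forall_4)
  ultimately show "u \<in> half ` simplex3" by blast
qed

lemma J3_half:
  assumes f: "continuous_on UNIV f"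
  shows "J3 f = (J3 (\<lambda>u. f (half u)) + J3 (\<lambda>u. f (perm_map sw12 (half u)))) / 2"
proof -
  let ?A = "{u \<in> simplex3. u $ 2 \<le> u $ 1}" and ?B = "{u \<in> simplex3. u $ 1 \<le> u $ 2}"
  let ?L = "\<lambda>u. (\<chi> l. bary0 u (sw12 (em l))) :: real^3" and ?d = "\<bar>det (matrix half)\<bar>"
  have lin: "linear half" by (rule linearI) (auto simp: half_def vec_eq_iff algebra_simps add_divide_distrib)
  have inj: "inj half" by (auto simp: inj_def half_def vec_eq_iff forall_3)
  have sw: "perm_map sw12 u = ?L u" for u
    by (simp add: perm_map_def sw12_def em_def bary_def bary0_def vec_eq_iff forall_3)
  have BA: "?B = perm_map sw12 ` ?A"
  proof (rule set_eqI, rule iffI)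
    fix u assume u: "u \<in> ?B"
    have "perm_map sw12 (perm_map sw12 u) = u"
      by (rule bary_inj) (auto simp: bary_perm_map[OF bij_sw12] sw12_def)
    moreover have "perm_map sw12 u \<in> ?A"
      using u perm_map_image[OF bij_sw12] by (auto simp: sw sw12_def em_def bary0_def)
    ultimately show "u \<in> perm_map sw12 ` ?A" by (intro image_eqI[of _ _ "perm_map sw12 u"]) simp_all
  next
    fix u assume "u \<in> perm_map sw12 ` ?A"
    then show "u \<in> ?B"
      using perm_map_image[OF bij_sw12] by (auto simp: sw sw12_def em_def bary0_def)
  qed
  have cA: "compact ?A" unfolding half_image[symmetric]
    by (intro compact_continuous_image compact_simplex3 linear_continuous_on) (use lin linear_conv_bounded_linear in auto)
  have cp: "continuous_on UNIV (perm_map sw12)"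
    unfolding perm_map_def by (intro continuous_intros)
  have cB: "compact ?B" unfolding BA by (rule compact_continuous_image[OF continuous_on_subset[OF cp] cA]) auto
  have neg: "negligible (?A \<inter> ?B)"
  proof (rule negligible_subset)
    show "negligible {x :: real^3. (axis 1 1 - axis 2 1) \<bullet> x = 0}"
      by (rule negligible_hyperplane) (simp add: axis_eq_axis)
    show "?A \<inter> ?B \<subseteq> {x :: real^3. (axis 1 1 - axis 2 1) \<bullet> x = 0}"
      by (auto simp: inner_diff_left inner_axis' )
  qed
  have d1: "\<bar>det (matrix ?L)\<bar> = 1"
  proof -
    have "J3 (\<lambda>_. 1) = \<bar>det (matrix ?L)\<bar> * J3 (\<lambda>_. 1)"
      using integral_affine_image[OF linear_bary0 perm_map_inj[OF bij_sw12] compact_simplex3, of "\<lambda>_. 1" 0]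
      unfolding sw[symmetric] add_0_right perm_map_image[OF bij_sw12] by simp
    then show ?thesis using J3_pos by simp
  qed
  have *: "J3 g = ?d * (J3 (\<lambda>u. g (half u)) + J3 (\<lambda>u. g (perm_map sw12 (half u))))" if g: "continuous_on UNIV g" for g
  proof -
    have A: "integral ?A h = ?d * J3 (\<lambda>u. h (half u))" if "continuous_on UNIV h" for h
      using integral_affine_image[OF lin inj compact_simplex3 that, of 0] by (simp add: half_image)
    have B: "integral ?B g = integral ?A (\<lambda>u. g (perm_map sw12 u))"
      using integral_affine_image[OF linear_bary0 perm_map_inj[OF bij_sw12] cA g, of 0] d1
      unfolding sw[symmetric] add_0_right BA by simp
    have U: "?A \<union> ?B = simplex3" by auto
    have "J3 g = integral ?A g + integral ?B g"
      by (rule integral_unique[OF has_integral_Un[OF integrable_integral[OF integrable_compact[OF cA g]]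
          integrable_integral[OF integrable_compact[OF cB g]] neg, unfolded U]])
    then show ?thesis unfolding B
      using A[OF g] A[OF continuous_on_compose2[OF g cp]] by (simp add: distrib_left)
  qed
  have "?d = 1 / 2" using *[of "\<lambda>_. 1"] J3_pos by simp
  then show ?thesis using *[OF f] by simp
qed

definition bm :: "4 \<Rightarrow> 4 \<Rightarrow> 4 \<Rightarrow> real" where
  "bm i j k = J3 (\<lambda>u. bary u i * bary u j * bary u k)"

lemma bm_perm: "bij p \<Longrightarrow> bm (p i) (p j) (p k) = bm i j k"
  unfolding bm_def
  by (subst J3_perm[symmetric, of p "\<lambda>u. bary u i * bary u j * bary u k"])
     (auto simp: bary_perm_map intro!: continuous_intros)

lemma bm_comm: "bm i j k = bm j i k" "bm i j k = bm i k j"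
  by (simp_all add: bm_def mult_ac)

lemma fresh_4: "card (S :: 4 set) < 4 \<Longrightarrow> \<exists>d. d \<notin> S"
proof (rule ccontr)
  assume c: "card S < 4" and "\<not> (\<exists>d. d \<notin> S)"
  then have "S = UNIV" by auto
  then show False using c by simp
qed

lemma perm_exists:
  fixes a b c :: 4
  assumes "a \<noteq> b" "a \<noteq> c" "b \<noteq> c"
  shows "\<exists>p :: 4 \<Rightarrow> 4. bij p \<and> p 1 = a \<and> p 2 = b \<and> p 3 = c"
proof -
  obtain d where d: "d \<notin> {a, b, c}" using fresh_4[of "{a, b, c}"] card_length[of "[a, b, c]"] by auto
  define p :: "4 \<Rightarrow> 4" where "p k = (if k = 1 then a else if k = 2 then b else if k = 3 then c else d)" for k
  have "p 1 = a" "p 2 = b" "p 3 = c" "p 4 = d" by (simp_all add: p_def)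
  then have "inj p" unfolding inj_def forall_4 using assms d by auto
  then have "bij p" by (simp add: bij_def finite_UNIV_inj_surj)
  then show ?thesis by (intro exI[of _ p]) (simp add: p_def)
qed

definition lf :: "(4 \<Rightarrow> real) \<Rightarrow> real^3 \<Rightarrow> real" where
  "lf a u = (\<Sum>k\<in>UNIV. a k * bary u k)"

lemma J3_lf: "J3 (\<lambda>u. lf a u * lf b u * lf c u) = (\<Sum>i\<in>UNIV. \<Sum>j\<in>UNIV. \<Sum>k\<in>UNIV. a i * b j * c k * bm i j k)"
proof -
  let ?F = "\<lambda>i j k u. a i * b j * c k * (bary u i * bary u j * bary u k)"
  have S: "J3 (\<lambda>u. \<Sum>i\<in>UNIV. F i u) = (\<Sum>i\<in>UNIV. J3 (F i))" if "\<And>i. continuous_on UNIV (F i)" for F :: "4 \<Rightarrow> real^3 \<Rightarrow> real"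
    by (rule integral_sum) (auto intro!: integrable_compact compact_simplex3 that)
  have e: "lf a u * lf b u * lf c u = (\<Sum>i\<in>UNIV. \<Sum>j\<in>UNIV. \<Sum>k\<in>UNIV. ?F i j k u)" for u
  proof -
    have "lf a u * (lf b u * lf c u) = (\<Sum>i\<in>UNIV. a i * bary u i * (\<Sum>j\<in>UNIV. \<Sum>k\<in>UNIV. b j * bary u j * (c k * bary u k)))"
    proof -
      have "lf b u * lf c u = (\<Sum>j\<in>UNIV. \<Sum>k\<in>UNIV. b j * bary u j * (c k * bary u k))"
        by (simp only: lf_def sum_product)
      then show ?thesis by (simp only: lf_def[of a] sum_distrib_right)
    qed
    then show ?thesis by (simp add: sum_distrib_left mult_ac)
  qed
  have "J3 (\<lambda>u. \<Sum>i\<in>UNIV. \<Sum>j\<in>UNIV. \<Sum>k\<in>UNIV. ?F i j k u) = (\<Sum>i\<in>UNIV. J3 (\<lambda>u. \<Sum>j\<in>UNIV. \<Sum>k\<in>UNIV. ?F i j k u))"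
    by (intro S continuous_intros)
  also have "\<dots> = (\<Sum>i\<in>UNIV. \<Sum>j\<in>UNIV. J3 (\<lambda>u. \<Sum>k\<in>UNIV. ?F i j k u))"
    by (intro sum.cong refl S continuous_intros)
  also have "\<dots> = (\<Sum>i\<in>UNIV. \<Sum>j\<in>UNIV. \<Sum>k\<in>UNIV. J3 (?F i j k))"
    by (intro sum.cong refl S continuous_intros)
  finally show ?thesis unfolding e bm_def by (simp only: integral_mult_right)
qed

lemma lf_1: "lf (\<lambda>_. 1) u = 1" by (simp add: lf_def sum_bary)

lemma lf_bary: "lf (\<lambda>k. of_bool (k = i)) u = bary u i"
  by (simp add: lf_def sum.delta if_distrib[of "\<lambda>x. x * _"] cong: if_cong)

lemma bm_values:
  "bm i j k = J3 (\<lambda>_. 1) / 120 * (1 + of_bool (i = j) + of_bool (j = k) + of_bool (i = k) + 2 * of_bool (i = j \<and> j = k))"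
proof -
  define P where "P = bm 1 1 1"
  define Q where "Q = bm 1 1 2"
  define T where "T = bm 1 2 3"
  have p3: "bm a b c = T" if "a \<noteq> b" "a \<noteq> c" "b \<noteq> c" for a b c
    using perm_exists[OF that] bm_perm unfolding T_def by blast
  have p2: "bm a a b = Q" if ab: "a \<noteq> b" for a b
  proof -
    obtain c where "c \<notin> {a, b}" using fresh_4[of "{a, b}"] card_length[of "[a, b]"] by auto
    then obtain p :: "4 \<Rightarrow> 4" where "bij p" "p 1 = a" "p 2 = b" using perm_exists[of a b c] ab by auto
    then show ?thesis using bm_perm[of p 1 1 2] unfolding Q_def by simp
  qed
  have p1: "bm a a a = P" for a
  proof -
    obtain b where b: "b \<notin> {a}" using fresh_4[of "{a}"] by auto
    obtain c where "c \<notin> {a, b}" using fresh_4[of "{a, b}"] card_length[of "[a, b]"] by auto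
    then obtain p :: "4 \<Rightarrow> 4" where "bij p" "p 1 = a" using perm_exists[of a b c] b by auto
    then show ?thesis using bm_perm[of p 1 1 1] unfolding P_def by simp
  qed
  have PQT: "bm i j k = (if i = j then if j = k then P else Q else if j = k \<or> i = k then Q else T)" for i j k
  proof -
    consider "i = j" "j = k" | "i = j" "j \<noteq> k" | "i \<noteq> j" "j = k" | "i \<noteq> j" "i = k" | "i \<noteq> j" "j \<noteq> k" "i \<noteq> k" by blast
    then show ?thesis
    proof cases
      case 3 then show ?thesis using p2[of k i] bm_comm(1)[of i k k] bm_comm(2)[of k i k] by simp
    next
      case 4 then show ?thesis using p2[of k j] bm_comm(2)[of k j k] by simp
    qed (use p1 p2 p3 in auto)
  qed
  have b: "bary (half u) 1 = lf (\<lambda>k. if k = 1 then 1 else if k = 2 then 1 / 2 else 0) u"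
    "bary (half u) 2 = lf (\<lambda>k. if k = 2 then 1 / 2 else 0) u"
    "bary (half u) 3 = lf (\<lambda>k. if k = 3 then 1 else 0) u" for u
    by (simp_all add: lf_def sum_4 half_def bary_def)
  have c3: "continuous_on UNIV (\<lambda>u. bary u 1 * bary u 2 * bary u 3)"
    and c2: "continuous_on UNIV (\<lambda>u. bary u 1 * bary u 2)" by (intro continuous_intros)+
  have sb: "bary (perm_map sw12 u) 1 = bary u 2" "bary (perm_map sw12 u) 2 = bary u 1" "bary (perm_map sw12 u) 3 = bary u 3" for u
    by (simp_all add: bary_perm_map[OF bij_sw12] sw12_def)
  have "T = J3 (\<lambda>u. bary (half u) 1 * bary (half u) 2 * bary (half u) 3)"
    using J3_half[OF c3] by (simp add: sb T_def bm_def mult_ac)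
  then have e1: "T = Q / 2"
    unfolding b J3_lf by (simp add: sum_4 PQT)
  have "J3 (\<lambda>u. bary u 1 * bary u 2) = J3 (\<lambda>u. bary (half u) 1 * bary (half u) 2)"
    using J3_half[OF c2] by (simp add: sb mult.commute)
  then have "J3 (\<lambda>u. lf (\<lambda>k. of_bool (k = 1)) u * lf (\<lambda>k. of_bool (k = 2)) u * lf (\<lambda>_. 1) u) =
     J3 (\<lambda>u. lf (\<lambda>k. if k = 1 then 1 else if k = 2 then 1 / 2 else 0) u * lf (\<lambda>k. if k = 2 then 1 / 2 else 0) u * lf (\<lambda>_. 1) u)"
    by (simp only: b lf_bary lf_1 mult_1_right)
  then have e2: "P = 3 * Q" unfolding J3_lf using e1 by (simp add: sum_4 PQT)
  have "J3 (\<lambda>_. 1) = J3 (\<lambda>u. lf (\<lambda>_. 1) u * lf (\<lambda>_. 1) u * lf (\<lambda>_. 1) u)" by (simp only: lf_1 mult_1_right)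
  then have "J3 (\<lambda>_. 1) = 60 * Q" unfolding J3_lf using e1 e2 by (simp add: sum_4 PQT)
  then show ?thesis using e1 e2 by (simp add: PQT)
qed

definition mo :: "(4 \<Rightarrow> real) \<Rightarrow> 4 \<Rightarrow> real" where
  "mo a k = (\<Sum>j\<in>UNIV - {k}. a j) / 3"

text \<open>A cubature rule of degree three: the vertices with weight \<open>1/40\<close> and the barycentres of the facets
  with weight \<open>9/40\<close>.\<close>

lemma cubature:
  "J3 (\<lambda>u. lf a u * lf b u * lf c u) = J3 (\<lambda>_. 1) *
     (1 / 40 * (\<Sum>k\<in>UNIV. a k * b k * c k) + 9 / 40 * (\<Sum>k\<in>UNIV. mo a k * mo b k * mo c k))"
proof -
  define A B C where "A = a 1 + a 2 + a 3 + a 4" and "B = b 1 + b 2 + b 3 + b 4" and "C = c 1 + c 2 + c 3 + c 4"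
  let ?s = "\<lambda>f. f 1 + f 2 + f 3 + f (4::4) :: real"
  have mo: "mo a k = (A - a k) / 3" "mo b k = (B - b k) / 3" "mo c k = (C - c k) / 3" for k
    by (simp_all add: mo_def sum_diff1 sum_4 A_def B_def C_def)
  have "(\<Sum>i\<in>UNIV. \<Sum>j\<in>UNIV. \<Sum>k\<in>UNIV. a i * b j * c k *
       (1 + of_bool (i = j) + of_bool (j = k) + of_bool (i = k) + 2 * of_bool (i = j \<and> j = k))) =
     A * B * C + C * ?s (\<lambda>k. a k * b k) + A * ?s (\<lambda>k. b k * c k) + B * ?s (\<lambda>k. a k * c k) + 2 * ?s (\<lambda>k. a k * b k * c k)"
    unfolding A_def B_def C_def by (simp add: sum_4 algebra_simps)
  also have "\<dots> = 3 * ?s (\<lambda>k. a k * b k * c k) + ?s (\<lambda>k. (A - a k) * (B - b k) * (C - c k))"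
  proof -
    have e: "a 4 = A - a 1 - a 2 - a 3" "b 4 = B - b 1 - b 2 - b 3" "c 4 = C - c 1 - c 2 - c 3"
      by (simp_all add: A_def B_def C_def)
    show ?thesis unfolding e by (simp add: algebra_simps)
  qed
  finally have *: "(\<Sum>i\<in>UNIV. \<Sum>j\<in>UNIV. \<Sum>k\<in>UNIV. a i * b j * c k *
       (1 + of_bool (i = j) + of_bool (j = k) + of_bool (i = k) + 2 * of_bool (i = j \<and> j = k))) =
     3 * ?s (\<lambda>k. a k * b k * c k) + ?s (\<lambda>k. (A - a k) * (B - b k) * (C - c k))" .
  have J: "J3 (\<lambda>u. lf a u * lf b u * lf c u) = J3 (\<lambda>_. 1) / 120 * (\<Sum>i\<in>UNIV. \<Sum>j\<in>UNIV. \<Sum>k\<in>UNIV. a i * b j * c k *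
       (1 + of_bool (i = j) + of_bool (j = k) + of_bool (i = k) + 2 * of_bool (i = j \<and> j = k)))"
    unfolding J3_lf bm_values sum_distrib_left by (intro sum.cong refl) simp
  show ?thesis unfolding J * unfolding mo sum_4 by (simp add: field_simps)
qed

subsection \<open>Nondegenerate tetrahedra\<close>

lemma nondegenerate_iff:
  "nondegenerate X \<longleftrightarrow> (\<forall>u. (\<Sum>k\<in>UNIV. u k) = 0 \<and> (\<Sum>k\<in>UNIV. u k *\<^sub>R X $ k) = 0 \<longrightarrow> (\<forall>k. u k = 0))"
proof
  assume X: "nondegenerate X"
  then have inj: "inj (($) X)" and na: "\<not> affine_dependent (range (($) X))" by (auto simp: nondegenerate_def)
  show "\<forall>u. (\<Sum>k\<in>UNIV. u k) = 0 \<and> (\<Sum>k\<in>UNIV. u k *\<^sub>R X $ k) = 0 \<longrightarrow> (\<forall>k. u k = 0)"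
  proof (intro allI impI)
    fix u k assume u: "(\<Sum>k\<in>UNIV. u k) = 0 \<and> (\<Sum>k\<in>UNIV. u k *\<^sub>R X $ k) = 0"
    define U where "U v = u (inv (($) X) v)" for v
    have i: "inv (($) X) (X $ k) = k" for k using inj by simp
    have "sum U (range (($) X)) = 0" "sum (\<lambda>v. U v *\<^sub>R v) (range (($) X)) = 0"
      using u by (simp_all add: sum.reindex[OF inj] U_def i)
    then have "\<forall>v\<in>range (($) X). U v = 0"
      using na affine_dependent_explicit_finite[of "range (($) X)"] by auto
    then have "U (X $ k) = 0" by blast
    then show "u k = 0" by (simp only: U_def i)
  qed
next
  assume *: "\<forall>u. (\<Sum>k\<in>UNIV. u k) = 0 \<and> (\<Sum>k\<in>UNIV. u k *\<^sub>R X $ k) = 0 \<longrightarrow> (\<forall>k. u k = 0)"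
  have inj: "inj (($) X)"
  proof (rule injI, rule ccontr)
    fix i j assume ij: "X $ i = X $ j" "i \<noteq> j"
    define u :: "4 \<Rightarrow> real" where "u k = of_bool (k = i) - of_bool (k = j)" for k
    have "(\<Sum>k\<in>UNIV. u k) = 0" by (simp add: u_def sum_subtractf)
    moreover have "(\<Sum>k\<in>UNIV. u k *\<^sub>R X $ k) = 0"
    proof -
      have "(\<Sum>k\<in>UNIV. u k *\<^sub>R X $ k) = (\<Sum>k\<in>UNIV. (if k = i then X $ k else 0)) - (\<Sum>k\<in>UNIV. (if k = j then X $ k else 0))"
        unfolding sum_subtractf[symmetric] by (rule sum.cong) (auto simp: u_def)
      then show ?thesis using ij by simp
    qed
    ultimately have "u i = 0" using * by blast
    then show False using ij by (simp add: u_def)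
  qed
  moreover have "\<not> affine_dependent (range (($) X))"
  proof
    assume "affine_dependent (range (($) X))"
    then obtain U where U: "sum U (range (($) X)) = 0" "\<exists>v\<in>range (($) X). U v \<noteq> 0" "sum (\<lambda>v. U v *\<^sub>R v) (range (($) X)) = 0"
      using affine_dependent_explicit_finite[of "range (($) X)"] by auto
    then have "(\<Sum>k\<in>UNIV. U (X $ k)) = 0 \<and> (\<Sum>k\<in>UNIV. U (X $ k) *\<^sub>R X $ k) = 0"
      by (simp add: sum.reindex[OF inj])
    then have "U (X $ k) = 0" for k using spec[OF *, of "\<lambda>k. U (X $ k)"] by blast
    then show False using U(2) by auto
  qed
  ultimately show "nondegenerate X" by (simp add: nondegenerate_def)
qed

definition Lin :: "real^3^4 \<Rightarrow> real^3 \<Rightarrow> real^3" where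
  "Lin X u = (\<Sum>l\<in>UNIV. u $ l *\<^sub>R (X $ em l - X $ 4))"

lemma linear_Lin: "linear (Lin X)"
  by (rule linearI) (simp_all add: Lin_def sum_3 algebra_simps)

lemma Lin_bary0: "Lin X u = (\<Sum>k\<in>UNIV. bary0 u k *\<^sub>R X $ k)"
  by (simp add: Lin_def sum_3 sum_4 em_def bary0_def algebra_simps)

lemma sum_bary0: "(\<Sum>k\<in>UNIV. bary0 u k) = 0"
  by (simp add: sum_4 bary0_def)

lemma nondegenerate_inj: "nondegenerate X \<longleftrightarrow> inj (Lin X)"
proof
  assume X: "nondegenerate X"
  have "u = 0" if "Lin X u = 0" for u
  proof -
    have "bary0 u k = 0" for k
      using X that sum_bary0[of u] unfolding nondegenerate_iff Lin_bary0 by blast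
    from this[of 1] this[of 2] this[of 3] show ?thesis by (simp add: bary0_def vec_eq_iff forall_3)
  qed
  then show "inj (Lin X)" using linear_injective_0[OF linear_Lin] by blast
next
  assume inj: "inj (Lin X)"
  show "nondegenerate X" unfolding nondegenerate_iff
  proof (intro allI impI)
    fix u k assume u: "(\<Sum>k\<in>UNIV. u k) = 0 \<and> (\<Sum>k\<in>UNIV. u k *\<^sub>R X $ k) = 0"
    define w :: "real^3" where "w = (\<chi> l. u (em l))"
    have b: "bary0 w k = u k" for k
      using u exhaust_4[of k] by (auto simp: bary0_def w_def em_def sum_4)
    then have "Lin X w = 0" using u by (simp add: Lin_bary0)
    then have "w = 0" using inj linear_injective_0[OF linear_Lin] by blast
    then show "u k = 0" using b[of k] by (simp add: bary0_def split: if_splits)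
  qed
qed

lemma matrix_Lin_mult: "matrix (Lin X) *v u = Lin X u"
  by (rule matrix_works) (simp only: linear_matrix_vector_mul_eq linear_Lin)

lemma nondegenerate_det: "nondegenerate X \<longleftrightarrow> det (matrix (Lin X)) \<noteq> 0"
  using nondegenerate_inj det_nz_iff_inj[OF linear_Lin] by blast

lemma tetrahedron_image: "tetrahedron X = (\<lambda>u. Lin X u + X $ 4) ` simplex3"
proof -
  have l: "Lin X (axis l 1) = X $ em l - X $ 4" for l
    using three_cases[of l] by (elim disjE) (simp_all add: Lin_def sum_3 axis_def)
  have "(\<lambda>x. X $ 4 + x) ` Lin X ` insert 0 (range (\<lambda>i. axis i 1)) = insert (X $ 4) (range (\<lambda>i. X $ em i))"
    by (simp only: image_insert image_image l linear_0[OF linear_Lin]) simp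
  also have "range (\<lambda>i. X $ em i) = {X $ em 1, X $ em 2, X $ em 3}" by (simp only: UNIV_3 image_insert image_empty)
  also have "insert (X $ 4) \<dots> = {X $ 4, X $ 1, X $ 2, X $ 3}" by (simp add: em_def)
  also have "\<dots> = range (($) X)" by (simp add: UNIV_4 insert_commute)
  finally have "range (($) X) = (\<lambda>x. X $ 4 + x) ` Lin X ` insert 0 (range (\<lambda>i. axis i 1))" by (rule sym)
  then have "tetrahedron X = (\<lambda>x. X $ 4 + x) ` Lin X ` simplex3"
    by (simp only: tetrahedron_def std_simplex_eq convex_hull_translation convex_hull_linear_image[OF linear_Lin])
  then show ?thesis by (simp add: image_image add.commute)
qed

definition dl :: "mindex \<Rightarrow> dir list" where
  "dl I = replicate (lkp I 1) A1 @ replicate (lkp I 2) A2 @ replicate (lkp I 3) A3 @ replicate (3 - mdegree I) A0"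

definition sd :: "(3 \<Rightarrow> 'r::comm_semiring_1) \<Rightarrow> dir \<Rightarrow> 'r" where
  "sd s a = (case a of A0 \<Rightarrow> 1 | A1 \<Rightarrow> s 1 | A2 \<Rightarrow> s 2 | A3 \<Rightarrow> s 3)"

lemma sd_simps [simp]: "sd s A0 = 1" "sd s A1 = s 1" "sd s A2 = s 2" "sd s A3 = s 3"
  by (simp_all add: sd_def)

lemma meval_dl: "meval s I = prod_list (map (sd s) (dl I))"
proof -
  have "meval s I = (\<Prod>l\<in>UNIV. s l ^ lkp I l)" by (rule meval_superset) auto
  also have "\<dots> = (\<Prod>l\<in>{1, 2, 3}. s l ^ lkp I l)" by (simp only: UNIV_3)
  finally show ?thesis by (simp add: dl_def mult.assoc)
qed

lemma dl_triple: "mdegree I \<le> 3 \<Longrightarrow> \<exists>a b c. dl I = [a, b, c]"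
proof -
  assume "mdegree I \<le> 3"
  then have "length (dl I) = 3" by (simp add: dl_def mdegree_3)
  then show ?thesis by (auto simp: numeral_3_eq_3 length_Suc_conv)
qed

definition cub :: "(real \<Rightarrow> 'r::comm_ring_1) \<Rightarrow> (4 \<Rightarrow> 3 \<Rightarrow> 'r) \<Rightarrow> mindex \<Rightarrow> 'r" where
  "cub h x I = h (1 / 40) * (\<Sum>k\<in>UNIV. meval (x k) I) +
     h (9 / 40) * (\<Sum>k\<in>UNIV. meval (\<lambda>l. h (1 / 3) * (\<Sum>j\<in>UNIV - {k}. x j l)) I)"

lemma moment_cub:
  assumes X: "nondegenerate X" and I: "mdegree I \<le> 3"
  shows "moment X I = cub id (\<lambda>k l. X $ k $ l) I"
proof -
  obtain a b c where abc: "dl I = [a, b, c]" using dl_triple[OF I] by blast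
  let ?f = "\<lambda>w :: real^3. sd (($) w) a * sd (($) w) b * sd (($) w) c"
  let ?x = "\<lambda>d k. sd (($) (X $ k)) d"
  have inj: "inj (Lin X)" and d: "det (matrix (Lin X)) \<noteq> 0"
    using X by (simp_all add: nondegenerate_inj[symmetric] nondegenerate_det[symmetric])
  have f: "(\<Prod>l\<in>UNIV. w $ l ^ lkp I l) = ?f w" for w
  proof -
    have "(\<Prod>l\<in>UNIV. w $ l ^ lkp I l) = meval (($) w) I" by (rule meval_superset[symmetric]) auto
    then show ?thesis by (simp add: meval_dl abc mult.assoc)
  qed
  have cs: "continuous_on UNIV (\<lambda>w :: real^3. sd (($) w) d)" for d
    by (cases d) (auto intro: continuous_intros)
  have c: "continuous_on UNIV ?f" by (intro continuous_intros cs)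
  let ?T = "\<lambda>u. Lin X u + X $ 4"
  have "continuous_on UNIV ?T"
    by (intro continuous_intros linear_continuous_on) (simp add: linear_Lin linear_conv_bounded_linear[symmetric])
  then have K: "compact (tetrahedron X)" unfolding tetrahedron_image
    by (intro compact_continuous_image compact_simplex3) (auto intro: continuous_on_subset)
  have J: "integral (tetrahedron X) g = \<bar>det (matrix (Lin X))\<bar> * J3 (\<lambda>u. g (?T u))" if "continuous_on UNIV g" for g
    unfolding tetrahedron_image by (rule integral_affine_image[OF linear_Lin inj compact_simplex3 that])
  have s: "sd (($) (?T u)) d = lf (?x d) u" for u d
  proof -
    have "?T u = (\<Sum>k\<in>UNIV. bary u k *\<^sub>R X $ k)"
      by (simp add: Lin_def sum_3 sum_4 em_def bary_def algebra_simps)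
    then show ?thesis by (cases d) (simp_all add: lf_def sum_bary mult.commute)
  qed
  have m: "mo (?x d) k = sd (\<lambda>l. 1 / 3 * (\<Sum>j\<in>UNIV - {k}. X $ j $ l)) d" for d k
    by (cases d) (simp_all add: mo_def)
  have "moment X I = integral (tetrahedron X) ?f / integral (tetrahedron X) (\<lambda>_. 1)"
    unfolding moment_def f by (rule uniform_integral[OF K _ c]) (use J[of "\<lambda>_. 1"] J3_pos d in simp)
  also have "\<dots> = J3 (\<lambda>u. lf (?x a) u * lf (?x b) u * lf (?x c) u) / J3 (\<lambda>_. 1)"
    using d by (simp add: J[OF c] J[of "\<lambda>_. 1"] s)
  also have "\<dots> = 1 / 40 * (\<Sum>k\<in>UNIV. ?x a k * ?x b k * ?x c k) + 9 / 40 * (\<Sum>k\<in>UNIV. mo (?x a) k * mo (?x b) k * mo (?x c) k)"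
    unfolding cubature using J3_pos by simp
  also have "\<dots> = cub id (\<lambda>k l. X $ k $ l) I"
    by (simp add: cub_def meval_dl abc m mult.assoc)
  finally show ?thesis .
qed

lemma peval_cub:
  assumes "coeff_hom h"
  shows "peval h s (cub Const x I) = cub h (\<lambda>k l. peval h s (x k l)) I"
  by (simp add: cub_def peval_add[OF assms] peval_mult[OF assms] peval_sum[OF assms] peval_Const[OF assms] peval_meval_comp[OF assms])

subsection \<open>Zariski density of the nondegenerate tetrahedra\<close>

lemma poly_infinite_zero:
  fixes P :: "'a::{real_algebra_1,idom} poly"
  assumes "\<And>t. t \<in> S \<Longrightarrow> poly P (of_real t) = 0" "infinite S"
  shows "P = 0"
proof (rule ccontr)
  assume "P \<noteq> 0"
  then have "finite {x. poly P x = 0}" by (rule poly_roots_finite)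
  moreover have "of_real ` S \<subseteq> {x. poly P x = 0}" using assms(1) by auto
  ultimately have "finite (of_real ` S :: 'a set)" by (rule finite_subset[rotated])
  then show False using assms(2) by (simp add: finite_image_iff inj_on_def)
qed

lemma peval_real_zero:
  fixes f :: "('v, 'a::{real_algebra_1,idom}) poly_ring"
  assumes "finite A" "\<forall>m\<in>kys f. kys m \<subseteq> A" "\<And>x :: 'v \<Rightarrow> real. peval id (\<lambda>v. of_real (x v)) f = 0"
  shows "f = 0"
  using assms
proof (induct A arbitrary: f rule: finite_induct)
  case empty
  then have k: "kys f \<subseteq> {0}" by auto
  have "peval id (\<lambda>v. of_real 0) f = lkp f 0"
    using peval_superset[of id "{0}" f "\<lambda>v. of_real 0"] k by simp
  then have "lkp f 0 = peval id (\<lambda>v. of_real 0) f" by (rule sym)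
  also have "\<dots> = 0" by (rule empty(2))
  finally have "lkp f 0 = 0" .
  then show ?case using k by (metis in_keys_iff keys_eq_empty subset_singletonD insertI1)
next
  case (insert v A)
  define fn where "fn n = (\<Sum>m\<in>{m\<in>kys f. lkp m v = n}. sgl (m - sgl v n) (lkp f m))" for n
  have dec: "m = sgl v (lkp m v) + (m - sgl v (lkp m v))" for m :: "'v monomial"
    by (rule poly_mapping_eqI) (auto simp: lookup_add lookup_minus lookup_single "when_def")
  have km: "v \<notin> kys (m - sgl v (lkp m v))" for m :: "'v monomial"
    by (simp add: in_keys_iff lookup_minus)
  have "fn n = 0" for n
  proof (rule insert(3))
    show "\<forall>m\<in>kys (fn n). kys m \<subseteq> A"
    proof
      fix m' assume "m' \<in> kys (fn n)"
      then obtain m where m: "m \<in> kys f" "lkp m v = n" "m' = m - sgl v n"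
        unfolding fn_def using keys_sum by (fastforce split: if_splits)
      then have "kys m' \<subseteq> kys m" by (auto simp: in_keys_iff lookup_minus)
      then show "kys m' \<subseteq> A" using insert(4) m km[of m] by auto
    qed
    fix x :: "'v \<Rightarrow> real"
    let ?h = "\<lambda>m. lkp f m * meval (\<lambda>v. of_real (x v)) (m - sgl v (lkp m v))"
    define P where "P = (\<Sum>m\<in>kys f. monom (?h m) (lkp m v))"
    have "poly P (of_real t) = 0" for t
    proof -
      have "lkp f m * meval (\<lambda>w. of_real ((x(v := t)) w)) m = ?h m * of_real t ^ lkp m v" for m
      proof -
        have "meval (\<lambda>w. of_real ((x(v := t)) w)) (m - sgl v (lkp m v)) = (meval (\<lambda>v. of_real (x v)) (m - sgl v (lkp m v)) :: 'a)"
          unfolding meval_def by (rule prod.cong) (use km[of m] in auto)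
        then show ?thesis by (subst dec, subst meval_add) (simp add: mult_ac)
      qed
      then have "poly P (of_real t) = (\<Sum>m\<in>kys f. lkp f m * meval (\<lambda>w. of_real ((x(v := t)) w)) m)"
        unfolding P_def poly_sum poly_monom by (intro sum.cong refl) (rule sym)
      also have "\<dots> = peval id (\<lambda>w. of_real ((x(v := t)) w)) f" by (simp only: peval_meval id_apply)
      also have "\<dots> = 0" by (rule insert(5))
      finally show ?thesis .
    qed
    then have "P = 0" using poly_infinite_zero[of UNIV P] by (simp add: infinite_UNIV_char_0)
    then have "0 = coeff P n" by simp
    also have "\<dots> = (\<Sum>m\<in>kys f. if lkp m v = n then ?h m else 0)" by (simp add: P_def coeff_sum)
    also have "\<dots> = (\<Sum>m\<in>{m\<in>kys f. lkp m v = n}. ?h m)" by (rule sum.inter_filter[symmetric]) simp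
    also have "\<dots> = peval id (\<lambda>v. of_real (x v)) (fn n)"
      by (simp add: fn_def peval_sum peval_single)
    finally show "peval id (\<lambda>v. of_real (x v)) (fn n) = 0" by simp
  qed
  have "lkp f m0 = 0" for m0
  proof (cases "m0 \<in> kys f")
    case True
    let ?n = "lkp m0 v"
    have "lkp (fn ?n) (m0 - sgl v ?n) = (\<Sum>m\<in>{m\<in>kys f. lkp m v = ?n}. if m = m0 then lkp f m else 0)"
      unfolding fn_def lookup_sum
    proof (rule sum.cong[OF refl])
      fix m assume m: "m \<in> {m\<in>kys f. lkp m v = ?n}"
      have "m - sgl v ?n = m0 - sgl v ?n \<longleftrightarrow> m = m0"
        using dec[of m] dec[of m0] m by auto
      then show "lkp (sgl (m - sgl v ?n) (lkp f m)) (m0 - sgl v ?n) = (if m = m0 then lkp f m else 0)"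
        by (simp add: lookup_single "when_def")
    qed
    then show ?thesis using True \<open>fn ?n = 0\<close> by (simp add: sum.delta)
  qed (simp add: in_keys_iff)
  then show ?case by (intro poly_mapping_eqI) simp
qed

lemma matrix_Lin: "matrix (Lin X) $ i $ j = X $ em j $ i - X $ 4 $ i"
  using three_cases[of j] by (elim disjE) (simp_all add: matrix_def Lin_def sum_3 axis_def)

lemma poly_nondegenerate_zero:
  fixes f :: "(4 \<times> 3, 'a::{real_algebra_1,idom}) poly_ring"
  assumes "\<And>X. nondegenerate X \<Longrightarrow> peval id (\<lambda>(k, l). of_real (X $ k $ l)) f = 0"
  shows "f = 0"
proof (rule peval_real_zero[of UNIV])
  fix x :: "4 \<times> 3 \<Rightarrow> real"
  define X :: "real^3^4" where "X = (\<chi> k l. x (k, l))"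
  define Y :: "real^3^4" where "Y = (\<chi> k l. of_bool (k = em l))"
  define Z where "Z t = X + t *\<^sub>R (Y - X)" for t
  define P where "P = peval (\<lambda>c. [:c:]) (\<lambda>(k, l). [:of_real (X $ k $ l), of_real (Y $ k $ l - X $ k $ l) :: 'a:]) f"
  define M :: "(real poly)^3^3" where
    "M = (\<chi> i j. [:matrix (Lin X) $ i $ j, matrix (Lin Y) $ i $ j - matrix (Lin X) $ i $ j:])"
  have hom: "coeff_hom (\<lambda>c :: 'a. [:c:])" by (simp add: coeff_hom_def pCons_one)
  have hp: "coeff_hom (\<lambda>p :: 'a poly. poly p t)" for t by (simp add: coeff_hom_def)
  have P: "poly P (of_real t) = peval id (\<lambda>(k, l). of_real (Z t $ k $ l)) f" for t
    unfolding P_def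
  proof (induct f rule: poly_induct)
    case (Var v)
    then show ?case by (cases v) (simp add: peval_Var[OF hom] Z_def algebra_simps)
  qed (simp_all add: peval_Const[OF hom] peval_add[OF hom] peval_mult[OF hom] peval_add peval_mult)
  have MM: "poly (M $ i $ j) t = matrix (Lin (Z t)) $ i $ j" for i j t
    by (simp add: M_def matrix_Lin Z_def algebra_simps)
  have D: "poly (det M) t = det (matrix (Lin (Z t)))" for t
    by (simp add: det_3 MM)
  have "Lin Y = id"
    by (rule ext) (simp add: Lin_def Y_def sum_3 em_def vec_eq_iff forall_3)
  then have "poly (det M) 1 \<noteq> 0" by (simp add: D Z_def matrix_id)
  then have "det M \<noteq> 0" by auto
  then have fin: "finite {t. poly (det M) t = 0}" by (rule poly_roots_finite)
  have "P = 0"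
  proof (rule poly_infinite_zero)
    show "infinite (UNIV - {t. poly (det M) t = 0})"
      using fin by (simp add: Diff_infinite_finite infinite_UNIV_char_0)
    fix t assume "t \<in> UNIV - {t. poly (det M) t = 0}"
    then have "nondegenerate (Z t)" by (simp add: D nondegenerate_det)
    then show "poly P (of_real t) = 0" using assms by (simp add: P)
  qed
  moreover have "(\<lambda>(k, l). of_real (Z 0 $ k $ l)) = (\<lambda>v. of_real (x v) :: 'a)"
    by (auto simp: Z_def X_def)
  ultimately show "peval id (\<lambda>v. of_real (x v)) f = 0" using P[of 0] by simp
qed auto

lemma moment_poly_cub:
  assumes "I \<in> indices"
  shows "moment_poly I = cub Const (\<lambda>k l. Var (k, l)) I"
  unfolding moment_poly_def
proof (rule the_equality)
  let ?c = "cub Const (\<lambda>k l. Var (k, l)) I :: (4 \<times> 3, real) poly_ring"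
  have c: "peval id (\<lambda>(k, l). X $ k $ l) ?c = moment X I" if "nondegenerate X" for X
    using moment_cub[OF that, of I] assms by (simp add: peval_cub indices_def)
  then show "\<forall>X. nondegenerate X \<longrightarrow> peval id (\<lambda>(k, l). X $ k $ l) ?c = moment X I" by blast
  fix f :: "(4 \<times> 3, real) poly_ring"
  assume f: "\<forall>X. nondegenerate X \<longrightarrow> peval id (\<lambda>(k, l). X $ k $ l) f = moment X I"
  have pm: "peval id s (f - ?c) = peval id s f - peval id s ?c" for s
    using peval_add[of id s "f - ?c" ?c] by simp
  have "f - ?c = 0"
    by (rule poly_nondegenerate_zero) (use f c in \<open>simp add: pm\<close>)
  then show "f = ?c" by simp
qed

section \<open>The space of vanishing quintics\<close>

definition pt :: "complex^3^4 \<Rightarrow> mindex \<Rightarrow> complex" where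
  "pt X = cub of_real (\<lambda>k l. X $ k $ l)"

lemma moment_map_pt: "I \<in> indices \<Longrightarrow> moment_map X I = pt X I"
  by (simp add: moment_map_def moment_poly_cub peval_cub pt_def)

lemma peval_indices_cong: "f \<in> forms d \<Longrightarrow> (\<And>I. I \<in> indices \<Longrightarrow> s I = t I) \<Longrightarrow> peval h s f = peval h t f"
  by (rule peval_cong) (auto simp: forms_def)

lemma V_iff: "f \<in> vanishing_quintics \<longleftrightarrow> f \<in> forms 5 \<and> (\<forall>X. peval id (pt X) f = 0)"
proof -
  have e: "peval id (moment_map X) f = peval id (pt X) f" if "f \<in> forms 5" for X
    by (rule peval_indices_cong[OF that moment_map_pt])
  have "moment_map X \<in> moment_variety" for X
  proof -
    have "moment_map X 0 = 1"
      by (simp add: moment_map_pt indices_def pt_def cub_def flip: of_real_add)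
    moreover have "0 \<in> indices" by (simp add: indices_def)
    ultimately show ?thesis unfolding moment_variety_def by (intro CollectI conjI bexI[of _ 0]) auto
  qed
  then show ?thesis unfolding vanishing_quintics_def moment_variety_def using e by fastforce
qed

definition xact :: "real^3^3 \<Rightarrow> real^3 \<Rightarrow> complex^3^4 \<Rightarrow> complex^3^4" where
  "xact A b X = (\<chi> k l. (\<Sum>j\<in>UNIV. of_real (A $ l $ j) * X $ k $ j) + of_real (b $ l))"

lemma peval_Lam: "peval id (pt X) (Lam q) = of_real (1 / 40) * (\<Sum>k\<in>UNIV. peval of_real (($) (X $ k)) q) +
   of_real (9 / 40) * (\<Sum>k\<in>UNIV. peval of_real (\<lambda>l. of_real (1 / 3) * (\<Sum>j\<in>UNIV - {k}. X $ j $ l)) q)"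
proof -
  have g: "(\<Sum>J\<in>S. L J * (a * P J + b * Q J)) = a * (\<Sum>J\<in>S. L J * P J) + b * (\<Sum>J\<in>S. L J * Q J)"
    for S :: "mindex set" and a b :: complex and L P Q
    by (simp add: distrib_left sum.distrib sum_distrib_left mult_ac)
  have sw: "(\<Sum>J\<in>S. L J * (\<Sum>k\<in>UNIV. M k J)) = (\<Sum>k\<in>UNIV. \<Sum>J\<in>S. L J * (M k J :: complex))"
    for S :: "mindex set" and L and M :: "4 \<Rightarrow> mindex \<Rightarrow> complex"
    by (simp only: sum_distrib_left) (rule sum.swap)
  have "peval id (pt X) (Lam q) = (\<Sum>J\<in>kys q. of_real (lkp q J) * pt X J)"
    by (simp add: Lam_def peval_sum peval_mult)
  then show ?thesis unfolding peval_meval by (simp only: pt_def cub_def g sw)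
qed

lemma pt_act: "peval id (pt X) (act A b f) = peval id (pt (xact A b X)) f"
proof (induct f rule: poly_induct)
  case (Var I)
  have a: "peval of_real s (affine_form A b l) = (\<Sum>j\<in>UNIV. of_real (A $ l $ j) * s j) + of_real (b $ l)" for s :: "3 \<Rightarrow> complex" and l
    by (simp add: affine_form_def peval_add peval_sum peval_mult)
  have c: "of_real (1 / 3) * (\<Sum>j\<in>UNIV - {k}. xact A b X $ j $ l) =
    (\<Sum>i\<in>UNIV. of_real (A $ l $ i) * (of_real (1 / 3) * (\<Sum>j\<in>UNIV - {k}. X $ j $ i))) + of_real (b $ l)" for k l
  proof -
    have "(\<Sum>j\<in>UNIV - {k}. xact A b X $ j $ l) = (\<Sum>i\<in>UNIV. of_real (A $ l $ i) * (\<Sum>j\<in>UNIV - {k}. X $ j $ i)) + 3 * of_real (b $ l)"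
      by (simp add: xact_def sum.distrib sum_distrib_left) (rule sum.swap)
    then show ?thesis by (simp add: distrib_left sum_distrib_left mult_ac)
  qed
  have xk: "($) (xact A b X $ k) = (\<lambda>l. (\<Sum>j\<in>UNIV. of_real (A $ l $ j) * X $ k $ j) + of_real (b $ l))" for k
    by (rule ext) (simp add: xact_def)
  show ?case
    unfolding act_Var peval_Lam peval_meval_comp[OF coeff_hom_of_real] a peval_Var[OF coeff_hom_id(1)]
    unfolding pt_def cub_def c by (simp only: xk)
qed (simp_all add: act_add act_mult peval_add peval_mult)

lemma V_forms: "vanishing_quintics \<subseteq> forms 5"
  by (auto simp: V_iff)

lemma V_aff_submodule: "aff_submodule vanishing_quintics"
proof -
  have "pvs.subspace vanishing_quintics"
    using subspace_forms[of 5] unfolding pvs.subspace_def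
    by (auto simp: V_iff peval_add peval_pscale)
  then show ?thesis by (auto simp: aff_submodule_def V_iff act_forms pt_act)
qed

lemma V_astab: "astab vanishing_quintics"
  by (rule aff_submodule_astab[OF V_aff_submodule V_forms])

definition X0 :: "complex^3^4" where
  "X0 = (\<chi> k l. if k = 4 \<or> k = em l then 1 else - 1)"

text \<open>The functional \<open>\<langle>_, ell\<^sup>5\<rangle>\<close> is evaluation at the moments of the regular tetrahedron \<open>X0\<close>.\<close>

definition lc :: "mindex \<Rightarrow> real" where
  "lc I = (if lkp I 1 = 0 \<and> lkp I 2 = 0 \<and> lkp I 3 = 0 then 5
    else if lkp I 1 = 1 \<and> lkp I 2 = 1 \<and> lkp I 3 = 1 then 2
    else if lkp I 1 + lkp I 2 + lkp I 3 = 2 \<and> (lkp I 1 = 2 \<or> lkp I 2 = 2 \<or> lkp I 3 = 2) then 3 else 0)"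

definition ell :: moment_polynomial where
  "ell = (\<Sum>I\<in>indices. pscale (of_real (lc I)) (Var I))"

definition p0 :: "mindex \<Rightarrow> complex" where
  "p0 I = of_real (wI I * lc I)"

lemma p0_pt: "I \<in> indices \<Longrightarrow> p0 I = 30 * pt X0 I"
proof -
  assume "I \<in> indices"
  then have d: "lkp I 1 + lkp I 2 + lkp I 3 \<le> 3" by (simp add: indices_def mdegree_3)
  have U: "UNIV - {1::4} = {2, 3, 4}" "UNIV - {2::4} = {1, 3, 4}" "UNIV - {3::4} = {1, 2, 4}" "UNIV - {4::4} = {1, 2, 3}"
    by (simp_all add: set_eq_iff forall_4)
  have e: "pt X0 I = of_real (1 / 40) * (\<Sum>k\<in>UNIV. meval (($) (X0 $ k)) I) + of_real (9 / 40) * (\<Sum>k\<in>UNIV. meval (\<lambda>l. - (1 / 3) * X0 $ k $ l) I)"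
  proof -
    have "of_real (1 / 3) * (\<Sum>j\<in>UNIV - {k}. X0 $ j $ l) = - (1 / 3) * X0 $ k $ l" for k l
      using exhaust_4[of k] three_cases[of l] by (elim disjE) (simp_all add: U X0_def em_def)
    then show ?thesis by (simp add: pt_def cub_def)
  qed
  have m3: "meval s I = s 1 ^ lkp I 1 * s 2 ^ lkp I 2 * s 3 ^ lkp I 3" for s :: "3 \<Rightarrow> complex"
    by (rule meval_3)
  have c: "lkp I 1 \<in> {0,1,2,3} \<and> lkp I 2 \<in> {0,1,2,3} \<and> lkp I 3 \<in> {0,1,2,3}" using d by auto
  show ?thesis
    unfolding e m3 using d c
    by (elim insertE conjE) (simp_all add: p0_def wI_def lc_def mdegree_3 X0_def em_def sum_4 fact_numeral power2_eq_square)
qed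

lemma of_nat_Const: "of_nat n = Const (of_nat n)"
  by (induct n) (simp_all add: Const_add)

lemma pd_power: "pd v (f ^ Suc n) = of_nat (Suc n) * f ^ n * pd v f"
proof (induct n)
  case (Suc n)
  have "pd v (f ^ Suc (Suc n)) = pd v f * f ^ Suc n + f * pd v (f ^ Suc n)" unfolding power_Suc[of f "Suc n"] by (rule pd_mult)
  then show ?case unfolding Suc by (simp add: algebra_simps)
qed simp

lemma pd_ell: "I \<in> indices \<Longrightarrow> pd I ell = Const (of_real (lc I))"
proof -
  assume "I \<in> indices"
  have "pd I ell = (\<Sum>J\<in>indices. if J = I then pscale (of_real (lc J)) 1 else 0)"
    unfolding ell_def pd_sum by (rule sum.cong) (auto simp: pd_pscale pd_Var)
  then show ?thesis using \<open>I \<in> indices\<close> by (simp add: pscale_def)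
qed

lemma ip_ell_monom: "kys m \<subseteq> indices \<Longrightarrow> mdegree m = n \<Longrightarrow> ip (sgl m 1) (ell ^ n) = fact n * meval p0 m"
proof (induct n arbitrary: m)
  case 0
  then have "m = 0" by (intro poly_mapping_eqI) (auto simp: mdegree_def in_keys_iff)
  then show ?case by (simp add: ip_superset[of "{0}"] lookup_one Wm_def)
next
  case (Suc n)
  then have "kys m \<noteq> {}" by (auto simp: mdegree_def)
  then obtain v where v: "v \<in> kys m" by blast
  define m' where "m' = m - sgl v 1"
  have m: "m = sgl v 1 + m'" using monom_minus_add[of m v] v by (simp add: m'_def in_keys_iff add.commute)
  have "kys m' \<subseteq> kys m" by (auto simp: m'_def in_keys_iff lookup_minus)
  then have m': "kys m' \<subseteq> indices" "mdegree m' = n" "v \<in> indices"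
    using Suc(2,3) v arg_cong[OF m, of mdegree] by (auto simp: mdegree_add)
  have p: "pd v (ell ^ Suc n) = pscale (of_nat (Suc n) * of_real (lc v)) (ell ^ n)"
    by (simp only: pd_power pd_ell[OF m'(3)] of_nat_Const pscale_def Const_mult mult_ac)
  have "ip (sgl m 1) (ell ^ Suc n) = ip (Var v * sgl m' 1) (ell ^ Suc n)"
    by (simp add: m Var_def mult_single)
  also have "\<dots> = of_real (wI v) * (of_nat (Suc n) * of_real (lc v) * ip (sgl m' 1) (ell ^ n))"
    unfolding ip_Var_mult p ip_pscale_right by simp
  also have "\<dots> = fact (Suc n) * meval p0 m"
    by (simp add: Suc(1)[OF m'(1,2)] m meval_add p0_def[of v] mult_ac)
  finally show ?case .
qed

lemma ip_ell: "f \<in> forms d \<Longrightarrow> ip f (ell ^ d) = fact d * peval id p0 f"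
proof -
  assume f: "f \<in> forms d"
  have "ip f (ell ^ d) = (\<Sum>m\<in>kys f. lkp f m * ip (sgl m 1) (ell ^ d))"
    by (simp add: ip_def ip_single mult_ac)
  also have "\<dots> = (\<Sum>m\<in>kys f. lkp f m * (fact d * meval p0 m))"
    by (rule sum.cong) (use f in \<open>auto simp: forms_def ip_ell_monom\<close>)
  finally show ?thesis by (simp add: peval_meval sum_distrib_left mult_ac)
qed

lemma peval_p0: "f \<in> forms d \<Longrightarrow> peval id p0 f = 30 ^ d * peval id (pt X0) f"
proof -
  assume f: "f \<in> forms d"
  have "peval id p0 f = peval id (\<lambda>I. 30 * pt X0 I) f" by (rule peval_indices_cong[OF f p0_pt])
  also have "\<dots> = (\<Sum>m\<in>kys f. lkp f m * (30 ^ d * meval (pt X0) m))"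
    unfolding peval_meval
    by (rule sum.cong) (use f in \<open>auto simp: forms_def meval_def power_mult_distrib prod.distrib mdegree_def simp flip: power_sum\<close>)
  finally show ?thesis by (simp add: peval_meval sum_distrib_left mult_ac)
qed

lemma V_ip_ell: "f \<in> vanishing_quintics \<Longrightarrow> ip f (ell ^ 5) = 0"
  using ip_ell[of f 5] peval_p0[of f 5] by (simp add: V_iff)

lemma astab_in_V:
  assumes W: "astab W" and z: "\<And>f. f \<in> W \<Longrightarrow> ip f (ell ^ 5) = 0"
  shows "W \<subseteq> vanishing_quintics"
proof
  fix f assume f: "f \<in> W"
  have Wf: "W \<subseteq> forms 5" using W by (auto simp: astab_def gstab_def)
  define G where "G = peval Const (cub (\<lambda>c. Const (of_real c)) (\<lambda>k l. Var (k, l) :: (4 \<times> 3, complex) poly_ring)) f"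
  have G: "peval id (\<lambda>(k, l). X $ k $ l) G = peval id (pt X) f" for X
  proof -
    have "peval id (\<lambda>(k, l). X $ k $ l) G = peval id (\<lambda>I. peval id (\<lambda>(k, l). X $ k $ l) (cub (\<lambda>c. Const (of_real c)) (\<lambda>k l. Var (k, l)) I)) f"
      unfolding G_def by (rule peval_peval) auto
    moreover have "peval id (\<lambda>(k, l). X $ k $ l) (cub (\<lambda>c. Const (of_real c)) (\<lambda>k l. Var (k, l)) I) = pt X I" for I
      by (simp add: cub_def pt_def peval_add peval_mult peval_sum peval_meval_comp)
    ultimately show ?thesis by (simp only:)
  qed
  define Y :: "real^3^4" where "Y = (\<chi> k l. if k = 4 \<or> k = em l then 1 else - 1)"
  have YX: "of_real (Y $ k $ l) = X0 $ k $ l" for k l by (simp add: Y_def X0_def)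
  have Y: "inj (Lin Y)"
  proof -
    have c: "Y $ em l $ m - Y $ 4 $ m = (if l = m then 0 else - 2)" for l m
      using three_cases[of l] three_cases[of m] by (elim disjE) (simp_all add: Y_def em_def)
    have "Lin Y u $ m = (\<Sum>l\<in>UNIV. u $ l * (if l = m then 0 else - 2))" for u m
      by (simp only: Lin_def sum_component vector_scaleR_component vector_minus_component c real_scaleR_def)
    then have L: "Lin Y u $ 1 = - 2 * (u $ 2 + u $ 3)" "Lin Y u $ 2 = - 2 * (u $ 1 + u $ 3)" "Lin Y u $ 3 = - 2 * (u $ 1 + u $ 2)" for u
      by (simp_all add: sum_3)
    have "Lin Y u = 0 \<Longrightarrow> u = 0" for u
    proof -
      assume "Lin Y u = 0"
      then have "u $ 2 + u $ 3 = 0" "u $ 1 + u $ 3 = 0" "u $ 1 + u $ 2 = 0" using L[of u] by simp_all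
      then have "u $ 1 = 0" "u $ 2 = 0" "u $ 3 = 0" by linarith+
      then show "u = 0" by (simp add: vec_eq_iff forall_3)
    qed
    then show ?thesis using linear_injective_0[OF linear_Lin] by blast
  qed
  have "G = 0"
  proof (rule poly_nondegenerate_zero)
    fix X :: "real^3^4" assume X: "nondegenerate X"
    have "invertible (matrix (Lin Y))" using Y det_nz_iff_inj[OF linear_Lin] by (simp add: invertible_det_nz)
    then obtain M where M: "matrix (Lin Y) ** M = mat 1" "M ** matrix (Lin Y) = mat 1" by (auto simp: invertible_def)
    define A where "A = matrix (Lin X) ** M"
    define b where "b = X $ 4 - A *v Y $ 4"
    have iX: "invertible (matrix (Lin X))" using X by (simp add: invertible_det_nz nondegenerate_det)
    have "invertible A" unfolding A_def
      by (rule invertible_mult[OF iX]) (use M in \<open>auto simp: invertible_def\<close>)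
    have Al: "A *v Lin Y u = Lin X u" for u
    proof -
      have "A *v Lin Y u = (A ** matrix (Lin Y)) *v u"
        by (simp add: matrix_Lin_mult flip: matrix_vector_mul_assoc)
      also have "A ** matrix (Lin Y) = matrix (Lin X)"
        unfolding A_def by (simp add: M flip: matrix_mul_assoc)
      finally show ?thesis by (simp add: matrix_Lin_mult)
    qed
    have "A *v Y $ k + b = X $ k" for k
    proof -
      have l: "Lin Z (axis l 1) = Z $ em l - Z $ 4" for l and Z :: "real^3^4"
        using three_cases[of l] by (elim disjE) (simp_all add: Lin_def sum_3 axis_def)
      have "A *v (Y $ em l - Y $ 4) = X $ em l - X $ 4" for l
        using Al[of "axis l 1"] by (simp add: l)
      from this[of 1] this[of 2] this[of 3] show ?thesis
        using exhaust_4[of k] by (auto simp: b_def em_def matrix_vector_mult_diff_distrib algebra_simps)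
    qed
    then have Xk: "X $ k $ l = (\<Sum>j\<in>UNIV. A $ l $ j * Y $ k $ j) + b $ l" for k l
      by (metis (no_types, lifting) matrix_vector_mult_def sum.cong vec_lambda_beta vector_add_component)
    have "of_real (X $ k $ l) = xact A b X0 $ k $ l" for k l
      by (simp add: xact_def Xk YX)
    then have "peval id (\<lambda>(k, l). of_real (X $ k $ l)) G = peval id (pt (xact A b X0)) f"
      by (simp only: G)
    also have "\<dots> = peval id (pt X0) (act A b f)" by (simp add: pt_act)
    also have "act A b f \<in> W"
      using astab_aff_submodule[OF W] \<open>invertible A\<close> f by (auto simp: aff_submodule_def)
    then have "peval id (pt X0) (act A b f) = 0"
      using z[of "act A b f"] ip_ell[of "act A b f" 5] peval_p0[of "act A b f" 5] Wf by auto
    finally show "peval id (\<lambda>(k, l). of_real (X $ k $ l)) G = 0" .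
  qed
  then have "peval id (pt X) f = 0" for X using G[of X] by simp
  then show "f \<in> vanishing_quintics" using f Wf by (auto simp: V_iff)
qed

section \<open>Verified linear algebra on weight spaces\<close>

text \<open>A monomial is an ascending list of moment indices, and a linear functional on a weight space is an
  integer combination of monomials via the Fischer product. All functions on these data branch by pattern
  matching in auxiliary functions only, never by \<open>if\<close> or \<open>case\<close>, whose congruence rules would make
  the rewriting engine traverse the large arguments again and again.\<close>

subsection \<open>Combinations of monomials\<close>

datatype e4 = E0 | E1 | E2 | E3
datatype ix = Ix e4 e4 e4
datatype ord3 = Lt3 | Eq3 | Gt3

fun cmp4 :: "e4 \<Rightarrow> e4 \<Rightarrow> ord3" where
 "cmp4 E0 E0 = Eq3" | "cmp4 E0 E1 = Lt3" | "cmp4 E0 E2 = Lt3" | "cmp4 E0 E3 = Lt3"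
|"cmp4 E1 E0 = Gt3" | "cmp4 E1 E1 = Eq3" | "cmp4 E1 E2 = Lt3" | "cmp4 E1 E3 = Lt3"
|"cmp4 E2 E0 = Gt3" | "cmp4 E2 E1 = Gt3" | "cmp4 E2 E2 = Eq3" | "cmp4 E2 E3 = Lt3"
|"cmp4 E3 E0 = Gt3" | "cmp4 E3 E1 = Gt3" | "cmp4 E3 E2 = Gt3" | "cmp4 E3 E3 = Eq3"

fun orc :: "ord3 \<Rightarrow> e4 \<Rightarrow> e4 \<Rightarrow> ord3" where
  "orc Eq3 x y = cmp4 x y" | "orc Lt3 x y = Lt3" | "orc Gt3 x y = Gt3"

fun cmpix :: "ix \<Rightarrow> ix \<Rightarrow> ord3" where
  "cmpix (Ix a b c) (Ix a' b' c') = orc (orc (cmp4 a a') b b') c c'"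

fun cmpm :: "ix list \<Rightarrow> ix list \<Rightarrow> ord3" and cmpm1 :: "ord3 \<Rightarrow> ix list \<Rightarrow> ix list \<Rightarrow> ord3" where
  "cmpm [] [] = Eq3" | "cmpm [] (y#ys) = Lt3" | "cmpm (x#xs) [] = Gt3"
| "cmpm (x#xs) (y#ys) = cmpm1 (cmpix x y) xs ys"
| "cmpm1 Eq3 xs ys = cmpm xs ys" | "cmpm1 Lt3 xs ys = Lt3" | "cmpm1 Gt3 xs ys = Gt3"

lemma cmp4_Eq3: "cmp4 x y = Eq3 \<longleftrightarrow> x = y" by (cases x; cases y) auto
lemma orc_Eq3: "orc c x y = Eq3 \<longleftrightarrow> c = Eq3 \<and> x = y" by (cases c) (auto simp: cmp4_Eq3)
lemma cmpix_Eq3: "cmpix x y = Eq3 \<longleftrightarrow> x = y" by (cases x; cases y) (auto simp: orc_Eq3 cmp4_Eq3)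
lemma cmpm_Eq3: "cmpm xs ys = Eq3 \<Longrightarrow> xs = ys" and "cmpm1 c xs' ys' = Eq3 \<Longrightarrow> c = Eq3 \<and> xs' = ys'"
  by (induct xs ys and c xs' ys' rule: cmpm_cmpm1.induct) (auto simp: cmpix_Eq3)

fun insix :: "ix \<Rightarrow> ix list \<Rightarrow> ix list" and insix1 :: "ord3 \<Rightarrow> ix \<Rightarrow> ix \<Rightarrow> ix list \<Rightarrow> ix list" where
  "insix x [] = [x]"
| "insix x (y#ys) = insix1 (cmpix x y) x y ys"
| "insix1 Gt3 x y ys = y # insix x ys" | "insix1 Eq3 x y ys = x # y # ys" | "insix1 Lt3 x y ys = x # y # ys"

lemma mset_insix: "mset (insix x ys) = add_mset x (mset ys)" and "mset (insix1 c x y ys) = add_mset x (add_mset y (mset ys))"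
  by (induct rule: insix_insix1.induct) auto

type_synonym trm = "ix list \<times> int"

definition ks :: "trm list \<Rightarrow> ix list set" where "ks p = fst ` set p"

lemma ks_simps [simp]: "ks [] = {}" "ks ((m,c)#p) = insert m (ks p)" by (simp_all add: ks_def)

fun cons0 :: "bool \<Rightarrow> 'a \<Rightarrow> 'a list \<Rightarrow> 'a list" where
  "cons0 True x l = l" | "cons0 False x l = x # l"

lemma cons0_if: "cons0 b x l = (if b then l else x # l)" by (cases b) auto

function comb :: "int \<Rightarrow> trm list \<Rightarrow> int \<Rightarrow> trm list \<Rightarrow> trm list"
  and comb1 :: "ord3 \<Rightarrow> int \<Rightarrow> ix list \<Rightarrow> int \<Rightarrow> trm list \<Rightarrow> int \<Rightarrow> ix list \<Rightarrow> int \<Rightarrow> trm list \<Rightarrow> trm list" where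
  "comb a [] b [] = []"
| "comb a [] b ((m,c)#q) = (m,b*c) # comb a [] b q"
| "comb a ((m,c)#p) b [] = (m,a*c) # comb a p b []"
| "comb a ((m,c)#p) b ((m',c')#q) = comb1 (cmpm m m') a m c p b m' c' q"
| "comb1 Gt3 a m c p b m' c' q = (m,a*c) # comb a p b ((m',c')#q)"
| "comb1 Lt3 a m c p b m' c' q = (m',b*c') # comb a ((m,c)#p) b q"
| "comb1 Eq3 a m c p b m' c' q = cons0 (a*c + b*c' = 0) (m,a*c+b*c') (comb a p b q)"
  by pat_completeness auto
termination by (relation "Wellfounded.measure (\<lambda>x. case x of Inl (a,p,b,q) \<Rightarrow> 2 * (length p + length q) | Inr (c,a,m,d,p,b,m',c',q) \<Rightarrow> 2 * (length p + length q) + 3)") auto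

fun val :: "(ix list \<Rightarrow> complex) \<Rightarrow> trm list \<Rightarrow> complex" where
  "val \<phi> [] = 0" | "val \<phi> ((m,c)#p) = of_int c * \<phi> m + val \<phi> p"

lemma val_comb: "val \<phi> (comb a p b q) = of_int a * val \<phi> p + of_int b * val \<phi> q"
  and "(d = Eq3 \<longrightarrow> m = m') \<longrightarrow> val \<phi> (comb1 d a m c p b m' c' q) =
    of_int a * (of_int c * \<phi> m + val \<phi> p) + of_int b * (of_int c' * \<phi> m' + val \<phi> q)"
proof (induct a p b q and d a m c p b m' c' q rule: comb_comb1.induct)
  case (4 a m c p b m' c' q)
  then show ?case using cmpm_Eq3 by auto
next
  case (7 a m c p b m' c' q)
  have "of_int a * (of_int c * \<phi> m + val \<phi> p) + of_int b * (of_int c' * \<phi> m + val \<phi> q) =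
    of_int (a * c + b * c') * \<phi> m + (of_int a * val \<phi> p + of_int b * val \<phi> q)"
    by (simp add: algebra_simps)
  then show ?case using 7 by (auto simp: cons0_if simp del: of_int_add of_int_mult)
qed (auto simp: algebra_simps)

lemma keys_comb: "ks (comb a p b q) \<subseteq> ks p \<union> ks q"
  and "ks (comb1 d a m c p b m' c' q) \<subseteq> {m, m'} \<union> ks p \<union> ks q"
  by (induct a p b q and d a m c p b m' c' q rule: comb_comb1.induct) (auto simp: cons0_if split: if_splits)

definition "padd p q = comb 1 p 1 q"

lemma val_padd: "val \<phi> (padd p q) = val \<phi> p + val \<phi> q" by (simp add: padd_def val_comb)
lemma keys_padd: "ks (padd p q) \<subseteq> ks p \<union> ks q" unfolding padd_def by (rule keys_comb)

fun pairs :: "trm list list \<Rightarrow> trm list list" where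
  "pairs [] = []" | "pairs [p] = [p]" | "pairs (p#q#r) = padd p q # pairs r"
fun mrg :: "e4 list \<Rightarrow> trm list list \<Rightarrow> trm list" where
  "mrg u [] = []" | "mrg u [p] = p"
| "mrg [] (p#q#r) = padd p (mrg [] (q#r))" | "mrg (x#u) (p#q#r) = mrg u (pairs (p#q#r))"

lemma val_mrg: "val \<phi> (mrg u ps) = sum_list (map (val \<phi>) ps)"
proof -
  have p: "sum_list (map (val \<phi>) (pairs ps)) = sum_list (map (val \<phi>) ps)" for ps
    by (induct ps rule: pairs.induct) (auto simp: val_padd)
  show ?thesis by (induct u ps rule: mrg.induct) (simp_all add: val_padd p del: pairs.simps)
qed

lemma keys_mrg: "ks (mrg u ps) \<subseteq> (\<Union>p\<in>set ps. ks p)"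
proof -
  have p: "(\<Union>p\<in>set (pairs ps). ks p) \<subseteq> (\<Union>p\<in>set ps. ks p)" for ps
  proof (induct ps rule: pairs.induct)
    case (3 p q r)
    then show ?case using keys_padd[of p q] by auto
  qed auto
  show ?thesis
  proof (induct u ps rule: mrg.induct)
    case (3 p q r) then show ?case using keys_padd[of p "mrg [] (q # r)"] by auto
  next
    case (4 x u p q r) show ?case unfolding mrg.simps by (rule order_trans[OF 4 p])
  qed auto
qed

fun scal :: "int \<Rightarrow> trm list \<Rightarrow> trm list" where
 "scal a [] = []" | "scal a ((m,c)#p) = (m,a*c) # scal a p"

lemma val_scal: "val \<phi> (scal a p) = of_int a * val \<phi> p"
  by (induct a p rule: scal.induct) (auto simp: algebra_simps)
lemma keys_scal: "ks (scal a p) = ks p"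
  by (induct a p rule: scal.induct) auto

subsection \<open>Lie operators\<close>

fun dec :: "e4 \<Rightarrow> (int \<times> e4) option" where
 "dec E0 = None" | "dec E1 = Some (1,E0)" | "dec E2 = Some (2,E1)" | "dec E3 = Some (3,E2)"
fun inc :: "e4 \<Rightarrow> e4" where "inc E0 = E1" | "inc E1 = E2" | "inc E2 = E3" | "inc E3 = E3"
fun sub4 :: "e4 \<Rightarrow> e4 \<Rightarrow> e4" where
 "sub4 E0 x = E0" | "sub4 E1 E0 = E1" | "sub4 E1 E1 = E0" | "sub4 E1 E2 = E0" | "sub4 E1 E3 = E0"
|"sub4 E2 E0 = E2" | "sub4 E2 E1 = E1" | "sub4 E2 E2 = E0" | "sub4 E2 E3 = E0"
|"sub4 E3 E0 = E3" | "sub4 E3 E1 = E2" | "sub4 E3 E2 = E1" | "sub4 E3 E3 = E0"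
fun up :: "dir \<Rightarrow> ix \<Rightarrow> ix" where
 "up A0 v = v" | "up A1 (Ix i j k) = Ix (inc i) j k" | "up A2 (Ix i j k) = Ix i (inc j) k" | "up A3 (Ix i j k) = Ix i j (inc k)"
fun sto :: "dir \<Rightarrow> (int \<times> e4) option \<Rightarrow> dir \<Rightarrow> ix \<Rightarrow> (int \<times> ix) option" where
 "sto a None b x = None"
|"sto A0 (Some (c,i)) b x = Some (c, up b x)"
|"sto A1 (Some (c,i')) b (Ix i j k) = Some (c, up b (Ix i' j k))"
|"sto A2 (Some (c,i')) b (Ix i j k) = Some (c, up b (Ix i i' k))"
|"sto A3 (Some (c,i')) b (Ix i j k) = Some (c, up b (Ix i j i'))"
fun sel :: "dir \<Rightarrow> ix \<Rightarrow> e4" where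
 "sel A0 (Ix i j k) = sub4 (sub4 (sub4 E3 i) j) k" | "sel A1 (Ix i j k) = i" | "sel A2 (Ix i j k) = j" | "sel A3 (Ix i j k) = k"
definition "stp a b x = sto a (dec (sel a x)) b x"

fun vale :: "e4 \<Rightarrow> int" where "vale E0 = 0" | "vale E1 = 1" | "vale E2 = 2" | "vale E3 = 3"

fun dg :: "dir \<Rightarrow> ix \<Rightarrow> int" where
  "dg A0 (Ix i j k) = 3 - vale i - vale j - vale k" | "dg A1 (Ix i j k) = vale i" | "dg A2 (Ix i j k) = vale j" | "dg A3 (Ix i j k) = vale k"

definition ixm :: "ix \<Rightarrow> mindex" where "ixm x = idx (\<lambda>a. dg a x)"
definition vix :: "ix set" where "vix = {x. 0 \<le> dg A0 x}"

lemma vale_nonneg: "0 \<le> vale i" by (cases i) auto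

lemma vix_valid: "x \<in> vix \<Longrightarrow> valid (\<lambda>a. dg a x)"
  by (cases x) (auto simp: vix_def valid_def vale_nonneg)

lemma ixm_indices: "x \<in> vix \<Longrightarrow> ixm x \<in> indices"
  by (simp add: ixm_def idx_in_indices vix_valid)

lemma exi_ixm: "x \<in> vix \<Longrightarrow> exi (ixm x) a = dg a x"
  by (simp add: ixm_def vix_valid)

lemma Var_ixm: "Var (ixm x) = Vi (\<lambda>a. dg a x)" by (simp add: Vi_def ixm_def)

lemma stp_None: "x \<in> vix \<Longrightarrow> stp a b x = None \<Longrightarrow> dg a x = 0"
proof -
  obtain i j k where x: "x = Ix i j k" using ix.exhaust by blast
  show "x \<in> vix \<Longrightarrow> stp a b x = None \<Longrightarrow> dg a x = 0"
    unfolding x by (cases i; cases j; cases k; simp add: vix_def; cases a; simp add: stp_def)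
qed

lemma stp_Some: "x \<in> vix \<Longrightarrow> stp a b x = Some (c, y) \<Longrightarrow> c = dg a x \<and> y \<in> vix \<and> (\<forall>d. dg d y = shf a b (\<lambda>a. dg a x) d)"
proof -
  obtain i j k where x: "x = Ix i j k" using ix.exhaust by blast
  have "case stp a b (Ix i j k) of None \<Rightarrow> True | Some (c, y) \<Rightarrow>
      c = dg a (Ix i j k) \<and> y \<in> vix \<and> (\<forall>d. dg d y = shf a b (\<lambda>a. dg a (Ix i j k)) d)" if "Ix i j k \<in> vix"
    using that by (cases i; cases j; cases k; simp add: vix_def; cases a; cases b; simp add: stp_def vix_def all_dir shf_def un_def)
  then show "x \<in> vix \<Longrightarrow> stp a b x = Some (c, y) \<Longrightarrow> c = dg a x \<and> y \<in> vix \<and> (\<forall>d. dg d y = shf a b (\<lambda>a. dg a x) d)"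
    by (simp add: x)
qed

definition mon :: "ix list \<Rightarrow> moment_polynomial" where
  "mon l = prod_list (map (\<lambda>x. Var (ixm x)) l)"

lemma mon_simps [simp]: "mon [] = 1" "mon (x # l) = Var (ixm x) * mon l" "mon (k @ l) = mon k * mon l"
  by (simp_all add: mon_def)

lemma mon_mset: "mset k = mset l \<Longrightarrow> mon k = mon l"
  unfolding mon_def by (metis mset_map prod_mset_prod_list)

lemma mon_insix: "mon (insix x l) = Var (ixm x) * mon l"
  using mon_mset[of "insix x l" "x # l"] by (simp add: mset_insix)

definition ph :: "moment_polynomial \<Rightarrow> ix list \<Rightarrow> complex" where
  "ph f m = ip f (mon m)"

fun revap :: "'a list \<Rightarrow> 'a list \<Rightarrow> 'a list" where "revap [] ys = ys" | "revap (x#xs) ys = revap xs (x#ys)"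

lemma revap_rev: "revap xs ys = rev xs @ ys" by (induct xs ys rule: revap.induct) auto

fun Rac :: "(int \<times> ix) option \<Rightarrow> ix list \<Rightarrow> ix list \<Rightarrow> trm list \<Rightarrow> trm list" where
  "Rac None pre vs acc = acc"
| "Rac (Some (c,v)) pre vs acc = padd [(insix v (revap pre vs), c)] acc"
fun Rmono :: "dir \<Rightarrow> dir \<Rightarrow> ix list \<Rightarrow> ix list \<Rightarrow> trm list \<Rightarrow> trm list" where
 "Rmono a b pre [] acc = acc"
|"Rmono a b pre (v#vs) acc = Rmono a b (v#pre) vs (Rac (stp a b v) pre vs acc)"

lemma mon_rev: "mon (rev l) = mon l" by (rule mon_mset) simp

lemma R_Var_ixm:
  assumes "v \<in> vix"
  shows "R a b (Var (ixm v)) = (case stp a b v of None \<Rightarrow> 0 | Some (c, y) \<Rightarrow> pscale (of_int c) (Var (ixm y)))"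
proof (cases "stp a b v")
  case None
  then show ?thesis using stp_None[OF assms None] by (simp add: Var_ixm R_Vi[OF vix_valid[OF assms]])
next
  case (Some cy)
  then obtain c y where cy: "stp a b v = Some (c, y)" by (cases cy) auto
  have "shf a b (\<lambda>a. dg a v) = (\<lambda>d. dg d y)" using stp_Some[OF assms cy] by auto
  then show ?thesis using stp_Some[OF assms cy] cy by (simp add: Var_ixm R_Vi[OF vix_valid[OF assms]])
qed

lemma val_Rmono: "set vs \<subseteq> vix \<Longrightarrow> val (ph f) (Rmono a b pre vs acc) = ip f (mon pre * R a b (mon vs)) + val (ph f) acc"
proof (induct vs arbitrary: pre acc)
  case (Cons v vs)
  have "val (ph f) (Rac (stp a b v) pre vs acc) = ip f (mon pre * (R a b (Var (ixm v)) * mon vs)) + val (ph f) acc"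
    using R_Var_ixm[of v a b] Cons(2)
    by (cases "stp a b v") (auto simp: val_padd ph_def mon_insix revap_rev mon_rev ip_pscale_right pscale_mult_left pscale_mult_right mult_ac)
  then show ?case using Cons by (simp add: R_mult distrib_left ip_add_right mult_ac)
qed simp

lemma keys_Rmono: "set pre \<subseteq> vix \<Longrightarrow> set vs \<subseteq> vix \<Longrightarrow> (\<forall>m\<in>ks acc. set m \<subseteq> vix) \<Longrightarrow>
   \<forall>m\<in>ks (Rmono a b pre vs acc). set m \<subseteq> vix"
proof (induct vs arbitrary: pre acc)
  case (Cons v vs)
  have "\<forall>m\<in>ks (Rac (stp a b v) pre vs acc). set m \<subseteq> vix"
  proof (cases "stp a b v")
    case (Some cy)
    then obtain c y where cy: "stp a b v = Some (c, y)" by (cases cy) auto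
    have "y \<in> vix" using stp_Some[OF _ cy] Cons(3) by auto
    moreover have "set (insix y (revap pre vs)) = insert y (set pre \<union> set vs)"
      using mset_insix[of y "revap pre vs"] by (metis revap_rev set_append set_mset_add_mset_insert set_mset_mset set_rev)
    ultimately have "set (insix y (revap pre vs)) \<subseteq> vix" using Cons(2,3) by auto
    then show ?thesis using keys_padd[of "[(insix y (revap pre vs), c)]" acc] Cons(4) cy by auto
  qed (use Cons(4) in simp)
  then show ?case unfolding Rmono.simps using Cons(2,3) by (intro Cons(1)) auto
qed simp

fun Rpls :: "dir \<Rightarrow> dir \<Rightarrow> trm list \<Rightarrow> trm list list" where
 "Rpls a b [] = []" | "Rpls a b ((m,c)#p) = scal c (Rmono a b [] m []) # Rpls a b p"
definition "Rpl a b p = mrg [E0,E0,E0,E0,E0,E0,E0,E0,E0,E0,E0,E0] (Rpls a b p)"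

lemma val_Rpl: "(\<forall>m\<in>ks p. set m \<subseteq> vix) \<Longrightarrow> val (ph f) (Rpl a b p) = val (ph (R b a f)) p"
  unfolding Rpl_def val_mrg
  by (induct a b p rule: Rpls.induct) (auto simp: val_scal val_Rmono ph_def ip_R)

lemma keys_Rpl: "(\<forall>m\<in>ks p. set m \<subseteq> vix) \<Longrightarrow> \<forall>m\<in>ks (Rpl a b p). set m \<subseteq> vix"
proof -
  assume p: "\<forall>m\<in>ks p. set m \<subseteq> vix"
  have "\<forall>q\<in>set (Rpls a b p). \<forall>m\<in>ks q. set m \<subseteq> vix"
    using p
  proof (induct a b p rule: Rpls.induct)
    case (2 a b m c p)
    have "\<forall>m'\<in>ks (scal c (Rmono a b [] m [])). set m' \<subseteq> vix"
      unfolding keys_scal by (rule keys_Rmono) (use 2(2) in auto)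
    moreover have "\<forall>q\<in>set (Rpls a b p). \<forall>m\<in>ks q. set m \<subseteq> vix" by (rule 2(1)) (use 2(2) in auto)
    ultimately show ?case unfolding Rpls.simps list.set by blast
  qed simp
  then show ?thesis using keys_mrg unfolding Rpl_def by blast
qed

subsection \<open>Tries and elimination\<close>

datatype trie = Em | Lv int "trm list" | Nt trie trie trie trie

fun flat :: "ix list \<Rightarrow> e4 list" where "flat [] = []" | "flat (Ix a b c # xs) = a # b # c # flat xs"

lemma flat_inj: "flat xs = flat ys \<Longrightarrow> xs = ys"
proof (induct xs arbitrary: ys rule: flat.induct)
  case 1
  then show ?case by (cases ys rule: flat.cases) auto
next
  case (2 a b c xs)
  then show ?case by (cases ys rule: flat.cases) auto
qed

fun lk :: "e4 list \<Rightarrow> trie \<Rightarrow> (int \<times> trm list) option" where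
  "lk [] (Lv c q) = Some (c, q)" | "lk [] Em = None" | "lk [] (Nt t0 t1 t2 t3) = None"
| "lk (d#ds) Em = None" | "lk (d#ds) (Lv c q) = None"
| "lk (E0#ds) (Nt t0 t1 t2 t3) = lk ds t0" | "lk (E1#ds) (Nt t0 t1 t2 t3) = lk ds t1"
| "lk (E2#ds) (Nt t0 t1 t2 t3) = lk ds t2" | "lk (E3#ds) (Nt t0 t1 t2 t3) = lk ds t3"

fun ins :: "e4 list \<Rightarrow> int \<Rightarrow> trm list \<Rightarrow> trie \<Rightarrow> trie" where
  "ins [] c q t = Lv c q"
| "ins (d#ds) c q (Lv c' q') = Lv c' q'"
| "ins (E0#ds) c q Em = Nt (ins ds c q Em) Em Em Em" | "ins (E1#ds) c q Em = Nt Em (ins ds c q Em) Em Em"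
| "ins (E2#ds) c q Em = Nt Em Em (ins ds c q Em) Em" | "ins (E3#ds) c q Em = Nt Em Em Em (ins ds c q Em)"
| "ins (E0#ds) c q (Nt t0 t1 t2 t3) = Nt (ins ds c q t0) t1 t2 t3"
| "ins (E1#ds) c q (Nt t0 t1 t2 t3) = Nt t0 (ins ds c q t1) t2 t3"
| "ins (E2#ds) c q (Nt t0 t1 t2 t3) = Nt t0 t1 (ins ds c q t2) t3"
| "ins (E3#ds) c q (Nt t0 t1 t2 t3) = Nt t0 t1 t2 (ins ds c q t3)"

lemma lk_Em [simp]: "lk ds Em = None" by (cases ds) auto

lemma lk_Nt: "lk ds' (Nt t0 t1 t2 t3) = Some r \<Longrightarrow> \<exists>d ds. ds' = d # ds \<and>
    lk ds (case d of E0 \<Rightarrow> t0 | E1 \<Rightarrow> t1 | E2 \<Rightarrow> t2 | E3 \<Rightarrow> t3) = Some r"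
  by (cases "(ds', Nt t0 t1 t2 t3)" rule: lk.cases) auto

lemma lk_ins: "lk ds' (ins ds c q t) = Some r \<Longrightarrow> ds' = ds \<and> r = (c, q) \<or> lk ds' t = Some r"
proof (induct ds c q t arbitrary: ds' rule: ins.induct)
  case (1 c q t)
  then show ?case by (cases ds') auto
next
  case (2 d ds c q c' q')
  then show ?case by (cases ds') auto
qed (simp only: ins.simps, drule lk_Nt, elim exE conjE, rename_tac d ds'', case_tac d; simp)+

definition trie_ok :: "(ix list \<Rightarrow> complex) \<Rightarrow> trie \<Rightarrow> bool" where
  "trie_ok \<phi> t \<longleftrightarrow> (\<forall>m c q. lk (flat m) t = Some (c, q) \<longrightarrow> of_int c * \<phi> m + val \<phi> q = 0)"

definition zero_ok :: "(ix list \<Rightarrow> complex) \<Rightarrow> trie \<Rightarrow> bool" where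
  "zero_ok \<phi> t \<longleftrightarrow> (\<forall>m c q. lk (flat m) t = Some (c, q) \<longrightarrow> \<phi> m = 0 \<and> q = [])"

lemma zero_trie_ok: "zero_ok \<phi> t \<Longrightarrow> trie_ok \<phi> t"
  unfolding zero_ok_def trie_ok_def by (metis add.right_neutral mult_zero_right val.simps(1))
lemma zero_ok_Em: "zero_ok \<phi> Em" by (simp add: zero_ok_def)

fun some0 :: "num option \<Rightarrow> num option" where "some0 None = None" | "some0 (Some m) = Some (num.Bit0 m)"
fun some1 :: "num option \<Rightarrow> num option" where "some1 None = None" | "some1 (Some m) = Some (num.Bit1 m)"

text \<open>Exact division of binary numerals by three, from the low-order end.\<close>

lemma nat_of_num_BitM: "nat_of_num (Num.BitM m) < 4 * nat_of_num m"
  by (induct m) (auto simp: nat_of_num_pos)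

function third :: "num \<Rightarrow> num option" where
  "third num.One = None" | "third (num.Bit0 m) = some0 (third m)"
| "third (num.Bit1 num.One) = Some num.One"
| "third (num.Bit1 (num.Bit0 m)) = some1 (third (Num.BitM m))"
| "third (num.Bit1 (num.Bit1 m)) = some1 (third (num.Bit0 m))"
  by pat_completeness auto
termination by (relation "Wellfounded.measure nat_of_num") (auto simp: nat_of_num_pos intro: less_le_trans[OF nat_of_num_BitM])

lemma nat_of_num_BitM_eq: "Suc (nat_of_num (Num.BitM m)) = nat_of_num m + nat_of_num m"
  by (induct m) (auto simp: nat_of_num_pos)

lemma third_sound: "third n = Some m \<Longrightarrow> nat_of_num n = 3 * nat_of_num m"
proof (induct n arbitrary: m rule: third.induct)
  case (2 n)
  then show ?case by (cases "third n") auto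
next
  case (4 n)
  then show ?case using nat_of_num_BitM_eq[of n] by (cases "third (Num.BitM n)") auto
next
  case (5 n)
  then show ?case by (cases "third (num.Bit0 n)") auto
qed auto

fun rd3 :: "e4 list \<Rightarrow> num option \<Rightarrow> num option \<Rightarrow> num \<Rightarrow> num \<Rightarrow> num \<times> num" where
  "rd3 (x#u) (Some a) (Some b) c d = rd3 u (third a) (third b) a b"
| "rd3 u p q c d = (c,d)"
fun rd2 :: "num \<Rightarrow> num \<Rightarrow> num \<times> num" where
  "rd2 (num.Bit0 a) (num.Bit0 b) = rd2 a b" | "rd2 a b = rd3 [E0,E0,E0,E0] (third a) (third b) a b"

lemma rd3_sound: "(\<forall>a. p = Some a \<longrightarrow> nat_of_num c = 3 * nat_of_num a) \<Longrightarrow> (\<forall>a. q = Some a \<longrightarrow> nat_of_num d = 3 * nat_of_num a) \<Longrightarrow>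
    rd3 u p q c d = (c', d') \<Longrightarrow> nat_of_num c' * nat_of_num d = nat_of_num d' * nat_of_num c"
proof (induct u p q c d rule: rd3.induct)
  case (1 x u a b c d)
  have "nat_of_num c' * nat_of_num b = nat_of_num d' * nat_of_num a"
    by (rule 1(1)) (use third_sound 1(4) in auto)
  then show ?case using 1(2,3) by simp
qed auto

lemma rd3_third: "rd3 u (third c) (third d) c d = (c', d') \<Longrightarrow> nat_of_num c' * nat_of_num d = nat_of_num d' * nat_of_num c"
  using rd3_sound[of "third c" c "third d" d u c' d'] third_sound by blast

lemma rd2_sound: "rd2 c d = (c', d') \<Longrightarrow> nat_of_num c' * nat_of_num d = nat_of_num d' * nat_of_num c"
proof (induct c d rule: rd2.induct)
  case (1 a b)
  then show ?case by (simp add: algebra_simps)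
qed (simp_all only: rd2.simps rd3_third)

fun combn :: "bool \<Rightarrow> num \<times> num \<Rightarrow> trm list \<Rightarrow> trm list \<Rightarrow> trm list" where
  "combn True (c,d) r q = comb (Int.Pos d) r (Int.Neg c) q" | "combn False (c,d) r q = comb (Int.Pos d) r (Int.Pos c) q"

definition num_abs :: "int \<Rightarrow> num" where "num_abs k = num_of_nat (nat \<bar>k\<bar>)"

definition combg :: "int \<Rightarrow> int \<Rightarrow> trm list \<Rightarrow> trm list \<Rightarrow> trm list" where
  "combg c d r q = (if c = 0 then comb d r 0 q else if d = 0 then []
     else combn ((0 < c) = (0 < d)) (rd2 (num_abs c) (num_abs d)) r q)"

lemma num_abs [simp]: "num_abs (Int.Pos x) = x" "num_abs (Int.Neg x) = x"
  by (simp_all add: num_abs_def Int.Pos_def Int.Neg_def nat_of_num_numeral[symmetric] nat_of_num_inverse)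

lemma combg_code [code]:
  "combg 0 d r q = comb d r 0 q" "combg (Int.Pos x) 0 r q = []" "combg (Int.Neg x) 0 r q = []"
  "combg (Int.Pos x) (Int.Pos y) r q = combn True (rd2 x y) r q"
  "combg (Int.Neg x) (Int.Neg y) r q = combn True (rd2 x y) r q"
  "combg (Int.Pos x) (Int.Neg y) r q = combn False (rd2 x y) r q"
  "combg (Int.Neg x) (Int.Pos y) r q = combn False (rd2 x y) r q"
  unfolding combg_def num_abs by (simp_all add: Int.Pos_def Int.Neg_def)

lemma val_combg:
  assumes "of_int c * z + val \<phi> r = 0" "of_int d * z + val \<phi> q = 0"
  shows "val \<phi> (combg c d r q) = 0"
proof (cases "c = 0 \<or> d = 0")
  case True
  then show ?thesis using assms by (auto simp: combg_def val_comb)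
next
  case False
  obtain c' d' where cd: "rd2 (num_abs c) (num_abs d) = (c', d')" by fastforce
  have n: "int (nat_of_num (num_abs k)) = \<bar>k\<bar>" if "k \<noteq> 0" for k
    using that by (simp add: num_abs_def num_of_nat_inverse)
  have "int (nat_of_num c') * \<bar>d\<bar> = int (nat_of_num d') * \<bar>c\<bar>"
    using rd2_sound[OF cd] False by (simp flip: n of_nat_mult)
  then have e: "numeral c' * \<bar>d\<bar> = numeral d' * \<bar>c\<bar>" by (simp add: nat_of_num_numeral)
  have v: "val \<phi> r = - (of_int c * z)" "val \<phi> q = - (of_int d * z)"
    using assms by (simp_all add: add_eq_0_iff)
  show ?thesis
  proof (cases "(0 < c) = (0 < d)")
    case True
    then have "numeral c' * d = numeral d' * c" using e False by (auto simp: abs_if split: if_splits)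
    then have "of_int (numeral c' * d) * z = of_int (numeral d' * c) * z" by simp
    then show ?thesis using False True by (simp add: combg_def cd val_comb v Int.Pos_def Int.Neg_def mult.assoc)
  next
    case neq: False
    then have "numeral c' * d = - (numeral d' * c)" using e False by (auto simp: abs_if split: if_splits)
    then have "of_int (numeral c' * d) * z = of_int (- (numeral d' * c)) * z" by simp
    then show ?thesis using False neq by (simp add: combg_def cd val_comb v Int.Pos_def Int.Neg_def mult.assoc)
  qed
qed

function red :: "ix list list \<Rightarrow> trie \<Rightarrow> trm list \<Rightarrow> trm list"
  and red1 :: "(int \<times> trm list) option \<Rightarrow> ix list list \<Rightarrow> trie \<Rightarrow> ix list \<Rightarrow> int \<Rightarrow> trm list \<Rightarrow> trm list" where
 "red u t [] = []" | "red [] t (x#r) = x#r"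
|"red (x#u) t ((m,c)#r) = red1 (lk (flat m) t) u t m c r"
|"red1 None u t m c r = (m,c)#r" | "red1 (Some (d,q)) u t m c r = red u t (combg c d r q)"
  by pat_completeness auto
termination by (relation "Wellfounded.measure (\<lambda>x. case x of Inl (u,t,p) \<Rightarrow> 2 * length u  | Inr (c,u,r) \<Rightarrow> 2 * length u + 1)") auto

lemma val_red: "trie_ok \<phi> t \<Longrightarrow> val \<phi> r = 0 \<Longrightarrow> val \<phi> (red u t r) = 0"
  and "trie_ok \<phi> t \<Longrightarrow> (\<forall>d q. z = Some (d, q) \<longrightarrow> of_int d * \<phi> m + val \<phi> q = 0) \<Longrightarrow> of_int c * \<phi> m + val \<phi> r = 0 \<Longrightarrow>
    val \<phi> (red1 z u t m c r) = 0"
proof (induct u t r and z u t m c r rule: red_red1.induct)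
  case (3 x u t m c r)
  then show ?case by (auto simp: trie_ok_def)
next
  case (5 d q u t m c r)
  then show ?case using val_combg[of c "\<phi> m" \<phi> r d q] by auto
qed auto

fun addr :: "trie \<Rightarrow> trm list \<Rightarrow> trie" where "addr t [] = t" | "addr t ((m,c)#q) = ins (flat m) c q t"
fun elim :: "ix list list \<Rightarrow> trm list list \<Rightarrow> trie \<Rightarrow> trie" where
  "elim u [] t = t" | "elim u (r#rs) t = elim u rs (addr t (red u t r))"

lemma trie_ok_addr: "trie_ok \<phi> t \<Longrightarrow> val \<phi> r = 0 \<Longrightarrow> trie_ok \<phi> (addr t r)"
  by (cases "(t, r)" rule: addr.cases) (auto simp: trie_ok_def dest!: lk_ins flat_inj)

lemma trie_ok_elim: "trie_ok \<phi> t \<Longrightarrow> (\<forall>r\<in>set rs. val \<phi> r = 0) \<Longrightarrow> trie_ok \<phi> (elim u rs t)"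
  by (induct rs arbitrary: t) (auto intro: trie_ok_addr val_red)

fun len_ne :: "e4 list \<Rightarrow> trm list \<Rightarrow> bool" where
  "len_ne [] [] = False" | "len_ne (u#us) (x#xs) = len_ne us xs" | "len_ne [] (x#xs) = True" | "len_ne (u#us) [] = True"
fun lensel :: "e4 list \<Rightarrow> trm list list \<Rightarrow> trm list list \<Rightarrow> trm list list" where
  "lensel n [] acc = acc" | "lensel n (r#rs) acc = lensel n rs (cons0 (len_ne n r) r acc)"
definition "lsort rs = lensel [E0] rs (lensel [E0,E0] rs (lensel [E0,E0,E0] rs (lensel [E0,E0,E0,E0] rs (lensel [E0,E0,E0,E0,E0] rs []))))"

lemma set_lensel: "set (lensel n rs acc) \<subseteq> set rs \<union> set acc"
proof (induct rs arbitrary: acc)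
  case (Cons r rs)
  show ?case using Cons[of "cons0 (len_ne n r) r acc"] by (auto simp: cons0_if split: if_splits)
qed simp

lemma set_lsort: "set (lsort rs) \<subseteq> set rs"
proof -
  have "set (lensel n rs acc) \<subseteq> set rs" if "set acc \<subseteq> set rs" for n acc
    using set_lensel[of n rs acc] that by blast
  then show ?thesis unfolding lsort_def by (simp only: set_empty2 empty_subsetI list.set)
qed


fun zlk :: "(int \<times> trm list) option \<Rightarrow> bool" where "zlk None = False" | "zlk (Some x) = True"
fun dropz :: "trie \<Rightarrow> trm list \<Rightarrow> trm list" where
  "dropz t [] = []" | "dropz t ((m,c)#r) = cons0 (zlk (lk (flat m) t)) (m,c) (dropz t r)"
fun zi :: "bool \<Rightarrow> ix list \<Rightarrow> trie \<Rightarrow> trie" where "zi True m t = t" | "zi False m t = ins (flat m) 1 [] t"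

fun zpass :: "trie \<Rightarrow> trm list list \<Rightarrow> trm list list \<Rightarrow> trie \<times> trm list list" and zp1 where
  "zpass t acc [] = (t, acc)" | "zpass t acc (r#rs) = zp1 (dropz t r) t acc rs"
| "zp1 [] t acc rs = zpass t acc rs" | "zp1 [(m,c)] t acc rs = zpass (zi (c = 0) m t) acc rs" | "zp1 (x#y#z) t acc rs = zpass t ((x#y#z)#acc) rs"
fun zps :: "e4 list \<Rightarrow> trie \<times> trm list list \<Rightarrow> trie \<times> trm list list" where
  "zps [] (t,rs) = (t,rs)" | "zps (x#u) (t,rs) = zps u (zpass t [] rs)"

lemma val_dropz: "zero_ok \<phi> t \<Longrightarrow> val \<phi> (dropz t r) = val \<phi> r"
proof (induct t r rule: dropz.induct)
  case (2 t m c r)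
  then show ?case by (cases "lk (flat m) t") (auto simp: zero_ok_def)
qed simp

lemma zero_ok_zi: "zero_ok \<phi> t \<Longrightarrow> (\<not> b \<Longrightarrow> \<phi> m = 0) \<Longrightarrow> zero_ok \<phi> (zi b m t)"
  by (cases b) (auto simp: zero_ok_def dest!: lk_ins flat_inj)

lemma zpass_ok:
  "zero_ok \<phi> t \<Longrightarrow> \<forall>r\<in>set acc \<union> set rs. val \<phi> r = 0 \<Longrightarrow> zpass t acc rs = (t', rs') \<Longrightarrow> zero_ok \<phi> t' \<and> (\<forall>r\<in>set rs'. val \<phi> r = 0)"
  "zero_ok \<phi> t \<Longrightarrow> val \<phi> r = 0 \<Longrightarrow> \<forall>r\<in>set acc \<union> set rs. val \<phi> r = 0 \<Longrightarrow> zp1 r t acc rs = (t', rs') \<Longrightarrow> zero_ok \<phi> t' \<and> (\<forall>r\<in>set rs'. val \<phi> r = 0)"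
  by (induct t acc rs and r t acc rs rule: zpass_zp1.induct) (auto simp: val_dropz intro!: zero_ok_zi)

lemma zps_ok:
  "zero_ok \<phi> t \<Longrightarrow> \<forall>r\<in>set rs. val \<phi> r = 0 \<Longrightarrow> zps u (t, rs) = (t', rs') \<Longrightarrow> zero_ok \<phi> t' \<and> (\<forall>r\<in>set rs'. val \<phi> r = 0)"
proof (induct u arbitrary: t rs)
  case (Cons x u)
  obtain t1 rs1 where 1: "zpass t [] rs = (t1, rs1)" by fastforce
  have "zero_ok \<phi> t1 \<and> (\<forall>r\<in>set rs1. val \<phi> r = 0)" using zpass_ok(1)[OF Cons(2) _ 1] Cons(3) by simp
  then show ?case using Cons(1)[of t1 rs1] Cons(4) by (simp add: 1)
qed simp

fun chk :: "ix list list \<Rightarrow> trie \<Rightarrow> trie \<Rightarrow> bool"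
  and chk1 :: "(int \<times> trm list) option \<Rightarrow> ix list \<Rightarrow> ix list list \<Rightarrow> trie \<Rightarrow> trie \<Rightarrow> bool"
  and chk2 :: "bool \<Rightarrow> trm list \<Rightarrow> ix list \<Rightarrow> ix list list \<Rightarrow> trie \<Rightarrow> trie \<Rightarrow> bool" where
  "chk [] t z = True" | "chk (m#ms) t z = chk1 (lk (flat m) t) m ms t z"
| "chk1 None m ms t z = False" | "chk1 (Some (c,q)) m ms t z = chk2 (c = 0) (dropz z q) m ms t z"
| "chk2 True q m ms t z = False" | "chk2 False (x#q) m ms t z = False" | "chk2 False [] m ms t z = chk ms t (zi False m z)"

lemma chk_sound:
  "trie_ok \<phi> t \<Longrightarrow> zero_ok \<phi> z \<Longrightarrow> chk ms t z \<Longrightarrow> \<forall>m\<in>set ms. \<phi> m = 0"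
  "trie_ok \<phi> t \<Longrightarrow> zero_ok \<phi> z \<Longrightarrow> (\<forall>c q. x = Some (c, q) \<longrightarrow> of_int c * \<phi> m + val \<phi> q = 0) \<Longrightarrow> chk1 x m ms t z \<Longrightarrow> \<forall>m\<in>set (m # ms). \<phi> m = 0"
  "trie_ok \<phi> t \<Longrightarrow> zero_ok \<phi> z \<Longrightarrow> (\<not> b \<longrightarrow> q = [] \<longrightarrow> \<phi> m = 0) \<Longrightarrow> chk2 b q m ms t z \<Longrightarrow> \<forall>m\<in>set (m # ms). \<phi> m = 0"
proof (induct ms t z and x m ms t z and b q m ms t z rule: chk_chk1_chk2.induct)
  case (2 m ms t z)
  then show ?case by (auto simp: trie_ok_def)
next
  case (4 c q m ms t z)
  then show ?case using val_dropz[of \<phi> z q] by fastforce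
next
  case (7 m ms t z)
  then show ?case using zero_ok_zi[of \<phi> z False m] by auto
qed auto

subsection \<open>Enumeration of the monomials of a weight\<close>

definition allix :: "ix list" where
  "allix = [Ix E0 E0 E0,Ix E0 E0 E1,Ix E0 E0 E2,Ix E0 E0 E3,Ix E0 E1 E0,Ix E0 E1 E1,Ix E0 E1 E2,Ix E0 E2 E0,Ix E0 E2 E1,Ix E0 E3 E0,
   Ix E1 E0 E0,Ix E1 E0 E1,Ix E1 E0 E2,Ix E1 E1 E0,Ix E1 E1 E1,Ix E1 E2 E0,Ix E2 E0 E0,Ix E2 E0 E1,Ix E2 E1 E0,Ix E3 E0 E0]"

lemma set_allix: "set allix = vix"
proof -
  have "Ix a b c \<in> set allix \<longleftrightarrow> Ix a b c \<in> vix" for a b c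
    by (cases a; cases b; cases c) (simp_all add: allix_def vix_def)
  then show ?thesis by (metis ix.exhaust set_eqI)
qed

function gen :: "ix list \<Rightarrow> e4 list \<Rightarrow> int \<Rightarrow> int \<Rightarrow> int \<Rightarrow> int \<Rightarrow> ix list \<Rightarrow> ix list list \<Rightarrow> ix list list"
  and gen1 :: "bool \<Rightarrow> e4 \<Rightarrow> e4 \<Rightarrow> e4 \<Rightarrow> ix list \<Rightarrow> e4 \<Rightarrow> e4 list \<Rightarrow> int \<Rightarrow> int \<Rightarrow> int \<Rightarrow> int \<Rightarrow> ix list \<Rightarrow> ix list list \<Rightarrow> ix list list" where
 "gen vs [] n i j k pre acc = cons0 (\<not> (i = 0 \<and> j = 0 \<and> k = 0)) (revap pre []) acc"
|"gen [] (u#us) n i j k pre acc = acc"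
|"gen (Ix a b c # vs) (u#us) n i j k pre acc = gen1 (i < 0 \<or> j < 0 \<or> k < 0 \<or> n < i+j+k) a b c vs u us n i j k pre acc"
|"gen1 True a b c vs u us n i j k pre acc = acc"
|"gen1 False a b c vs u us n i j k pre acc = gen (Ix a b c # vs) us (n-3) (i - vale a) (j - vale b) (k - vale c) (Ix a b c # pre) (gen vs (u#us) n i j k pre acc)"
  by pat_completeness auto
termination by (relation "Wellfounded.measure (\<lambda>x. case x of Inl (vs,us,_) \<Rightarrow> 2*length vs + 2*length us | Inr (t,a,b,c,vs,u,us,_) \<Rightarrow> 2*length vs + 2*length us + 3)") auto

definition "gn i j k = gen allix [E0,E0,E0,E0,E0] 15 i j k [] []"

definition wl :: "dir \<Rightarrow> ix multiset \<Rightarrow> int" where "wl a M = (\<Sum>x\<in>#M. dg a x)"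

lemma wl_simps [simp]: "wl a {#} = 0" "wl a (add_mset x M) = dg a x + wl a M"
  by (simp_all add: wl_def)

lemma set_gen:
  "set pre \<subseteq> vix \<Longrightarrow> set vs \<subseteq> vix \<Longrightarrow> \<forall>l\<in>set acc. set l \<subseteq> vix \<Longrightarrow> \<forall>l\<in>set (gen vs us n i j k pre acc). set l \<subseteq> vix"
  "set pre \<subseteq> vix \<Longrightarrow> set (Ix a b c # vs) \<subseteq> vix \<Longrightarrow> \<forall>l\<in>set acc. set l \<subseteq> vix \<Longrightarrow> \<forall>l\<in>set (gen1 t a b c vs u us n i j k pre acc). set l \<subseteq> vix"
  by (induct vs us n i j k pre acc and t a b c vs u us n i j k pre acc rule: gen_gen1.induct) (auto simp: cons0_if revap_rev)

lemma gen_acc: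
  "set acc \<subseteq> set (gen vs us n i j k pre acc)"
  "set acc \<subseteq> set (gen1 t a b c vs u us n i j k pre acc)"
  by (induct vs us n i j k pre acc and t a b c vs u us n i j k pre acc rule: gen_gen1.induct) (auto simp: cons0_if)

lemma wl_bounds: "set_mset M \<subseteq> vix \<Longrightarrow> 0 \<le> wl A1 M \<and> 0 \<le> wl A2 M \<and> 0 \<le> wl A3 M \<and> wl A1 M + wl A2 M + wl A3 M \<le> 3 * int (size M)"
proof (induct M)
  case (add x M)
  then show ?case by (cases x) (auto simp: vix_def vale_nonneg add_nonneg_nonneg; use vale_nonneg in fastforce)
qed simp

lemma gen_complete:
  "set vs \<subseteq> vix \<Longrightarrow> n = 3 * int (length us) \<Longrightarrow> set_mset M \<subseteq> set vs \<Longrightarrow> size M = length us \<Longrightarrow> wl A1 M = i \<Longrightarrow> wl A2 M = j \<Longrightarrow> wl A3 M = k \<Longrightarrow>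
     \<exists>l\<in>set (gen vs us n i j k pre acc). mset l = M + mset pre"
  "set (Ix a b c # vs) \<subseteq> vix \<Longrightarrow> n = 3 * int (Suc (length us)) \<Longrightarrow> set_mset M \<subseteq> set (Ix a b c # vs) \<Longrightarrow> size M = Suc (length us) \<Longrightarrow> wl A1 M = i \<Longrightarrow> wl A2 M = j \<Longrightarrow> wl A3 M = k \<Longrightarrow>
     \<not> t \<Longrightarrow> \<exists>l\<in>set (gen1 t a b c vs u us n i j k pre acc). mset l = M + mset pre"
proof (induct vs us n i j k pre acc and t a b c vs u us n i j k pre acc arbitrary: M and M rule: gen_gen1.induct)
  case (3 a b c vs u us n i j k pre acc)
  have "set_mset M \<subseteq> vix" using 3 by auto
  then have "\<not> (i < 0 \<or> j < 0 \<or> k < 0 \<or> n < i + j + k)" using wl_bounds[of M] 3 by auto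
  then show ?case using 3(1)[of M] 3(2-) by simp
next
  case (5 a b c vs u us n i j k pre acc)
  let ?v = "Ix a b c"
  show ?case
  proof (cases "?v \<in># M")
    case True
    then obtain M' where M: "M = add_mset ?v M'" by (metis insert_DiffM)
    have "\<exists>l\<in>set (gen (?v # vs) us (n - 3) (i - vale a) (j - vale b) (k - vale c) (?v # pre) (gen vs (u # us) n i j k pre acc)). mset l = M' + mset (?v # pre)"
      by (rule 5(2)) (use 5(3-) M in auto)
    then show ?thesis by (auto simp: M)
  next
    case False
    have "\<exists>l\<in>set (gen vs (u # us) n i j k pre acc). mset l = M + mset pre"
      by (rule 5(1)) (use 5(3-) False in auto)
    then show ?thesis using gen_acc(1) by fastforce
  qed
qed (auto simp: cons0_if revap_rev)

lemma ixm_surj: "I \<in> indices \<Longrightarrow> \<exists>x\<in>vix. ixm x = I"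
proof -
  assume I: "I \<in> indices"
  define e :: "nat \<Rightarrow> e4" where "e n = (if n = 0 then E0 else if n = 1 then E1 else if n = 2 then E2 else E3)" for n
  have d: "lkp I 1 + lkp I 2 + lkp I 3 \<le> 3" using I by (simp add: indices_def mdegree_3)
  then have v: "vale (e (lkp I l)) = int (lkp I l)" for l
    using three_cases[of l] by (auto simp: e_def)
  let ?x = "Ix (e (lkp I 1)) (e (lkp I 2)) (e (lkp I 3))"
  have "?x \<in> vix" using d by (simp add: vix_def v)
  moreover have "ixm ?x = I" by (rule mindex_eqI) (simp_all add: ixm_def lookup_idx v)
  ultimately show ?thesis by blast
qed

definition mm :: "ix list \<Rightarrow> mindex monomial" where
  "mm l = sum_list (map (\<lambda>x. sgl (ixm x) 1) l)"

lemma mm_simps [simp]: "mm [] = 0" "mm (x # l) = sgl (ixm x) 1 + mm l" by (simp_all add: mm_def)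

lemma mon_mm: "mon l = sgl (mm l) 1"
  by (induct l) (auto simp: Var_def mult_single)

lemma wt_mm: "set l \<subseteq> vix \<Longrightarrow> wt (mm l) a = wl a (mset l)"
  by (induct l) (auto simp: wt_add exi_ixm)

lemma monom_list: "kys m \<subseteq> indices \<Longrightarrow> \<exists>l. set l \<subseteq> vix \<and> length l = mdegree m \<and> mm l = m"
proof (induct "mdegree m" arbitrary: m)
  case 0
  then have "m = 0" by (intro poly_mapping_eqI) (auto simp: mdegree_def in_keys_iff)
  then show ?case by (intro exI[of _ "[]"]) simp
next
  case (Suc n)
  then have "kys m \<noteq> {}" by (auto simp: mdegree_def)
  then obtain v where v: "v \<in> kys m" by blast
  define m' where "m' = m - sgl v 1"
  have m: "m = sgl v 1 + m'" using monom_minus_add[of m v] v by (simp add: m'_def in_keys_iff add.commute)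
  have d: "mdegree m' = n" using Suc(2) arg_cong[OF m, of mdegree] by (simp add: mdegree_add)
  have "kys m' \<subseteq> kys m" by (auto simp: m'_def in_keys_iff lookup_minus)
  then obtain l where l: "set l \<subseteq> vix" "length l = n" "mm l = m'" using Suc(1)[OF d[symmetric]] Suc(3) d by auto
  obtain x where "x \<in> vix" "ixm x = v" using ixm_surj v Suc(3) by blast
  then show ?case using l d m Suc(2) by (intro exI[of _ "x # l"]) simp
qed

lemma wsp_zero:
  assumes f: "f \<in> wsp i j k" and z: "\<forall>m\<in>set (gn i j k). ph f m = 0"
  shows "f = 0"
proof -
  have "lkp f m = 0" for m
  proof (rule ccontr)
    assume "lkp f m \<noteq> 0"
    then have m: "m \<in> kys f" by (simp add: in_keys_iff)
    then have k: "kys m \<subseteq> indices" "mdegree m = 5" using f by (auto simp: wsp_def forms_def)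
    obtain l where l: "set l \<subseteq> vix" "length l = 5" "mm l = m" using monom_list[OF k(1)] k(2) by auto
    have "wl A1 (mset l) = i" "wl A2 (mset l) = j" "wl A3 (mset l) = k"
      using f m wt_mm[OF l(1)] l(3) by (auto simp: wsp_def)
    then obtain l' where "l' \<in> set (gn i j k)" "mset l' = mset l"
      using gen_complete(1)[of allix 15 "[E0,E0,E0,E0,E0]" "mset l" i j k "[]" "[]"] l by (auto simp: gn_def set_allix)
    then have "ph f l = 0" using z mon_mset[of l' l] by (auto simp: ph_def)
    then have "ip (sgl m 1) f = 0" unfolding ph_def mon_mm l(3) using ip_cnj[of f "sgl m 1"] by simp
    then show False using \<open>lkp f m \<noteq> 0\<close> Wm_pos[of m] by (simp add: ip_single)
  qed
  then show ?thesis by (intro poly_mapping_eqI) simp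
qed

subsection \<open>Equations for vectors of a given weight\<close>

fun rw :: "dir \<Rightarrow> dir \<Rightarrow> ix list list \<Rightarrow> trm list list \<Rightarrow> trm list list" where
  "rw a b [] acc = acc" | "rw a b (m#ms) acc = rw a b ms (Rmono a b [] m [] # acc)"

fun eqs :: "(dir \<times> dir) list \<Rightarrow> int \<Rightarrow> int \<Rightarrow> int \<Rightarrow> trm list list \<Rightarrow> trm list list" where
  "eqs [] i j k acc = acc"
| "eqs ((a,b)#cs) i j k acc = eqs cs i j k (rw b a (gn (i - un a A1 + un b A1) (j - un a A2 + un b A2) (k - un a A3 + un b A3)) acc)"

lemma rw_ok: "R a b f = 0 \<Longrightarrow> \<forall>m\<in>set ms. set m \<subseteq> vix \<Longrightarrow> \<forall>r\<in>set acc. val (ph f) r = 0 \<Longrightarrow> \<forall>r\<in>set (rw b a ms acc). val (ph f) r = 0"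
proof (induct ms arbitrary: acc)
  case (Cons m ms)
  have "val (ph f) (Rmono b a [] m []) = 0"
    using Cons(2,3) ip_R[of a b f "mon m"] by (simp add: val_Rmono)
  then show ?case unfolding rw.simps using Cons(3,4) by (intro Cons(1)[OF Cons(2)]) auto
qed simp

lemma gn_vix: "\<forall>m\<in>set (gn i j k). set m \<subseteq> vix"
  unfolding gn_def by (rule set_gen(1)) (auto simp: set_allix)

lemma eqs_ok: "\<forall>(a,b)\<in>set cs. R a b f = 0 \<Longrightarrow> \<forall>r\<in>set acc. val (ph f) r = 0 \<Longrightarrow> \<forall>r\<in>set (eqs cs i j k acc). val (ph f) r = 0"
proof (induct cs i j k acc rule: eqs.induct)
  case (2 a b cs i j k acc)
  show ?case unfolding eqs.simps
  proof (rule 2(1))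
    show "\<forall>(a, b)\<in>set cs. R a b f = 0" using 2(2) by auto
    have "R a b f = 0" using 2(2) by auto
    then show "\<forall>r\<in>set (rw b a (gn (i - un a A1 + un b A1) (j - un a A2 + un b A2) (k - un a A3 + un b A3)) acc). val (ph f) r = 0"
      by (rule rw_ok[OF _ gn_vix 2(3)])
  qed
qed simp

fun mulx :: "ix \<Rightarrow> int \<Rightarrow> trm list \<Rightarrow> trm list" where
  "mulx v a [] = []" | "mulx v a ((m,c)#p) = (insix v m, a*c) # mulx v a p"

fun mulell :: "trm list \<Rightarrow> trm list" where
  "mulell p = padd (mulx (Ix E0 E0 E0) 5 p) (padd (mulx (Ix E2 E0 E0) 3 p) (padd (mulx (Ix E0 E2 E0) 3 p)
     (padd (mulx (Ix E0 E0 E2) 3 p) (mulx (Ix E1 E1 E1) 2 p))))"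

definition "L5 = mulell (mulell (mulell (mulell (mulell [([],1)]))))"

fun sumd :: "dir \<Rightarrow> ix list \<Rightarrow> int" where "sumd a [] = 0" | "sumd a (x#xs) = dg a x + sumd a xs"

fun filt :: "int \<Rightarrow> int \<Rightarrow> int \<Rightarrow> trm list \<Rightarrow> trm list" where
  "filt i j k [] = []"
| "filt i j k ((m,c)#p) = cons0 (\<not> (sumd A1 m = i \<and> sumd A2 m = j \<and> sumd A3 m = k)) (m,c) (filt i j k p)"

fun wrow :: "(dir \<times> dir) list \<Rightarrow> int \<Rightarrow> int \<Rightarrow> int \<Rightarrow> trm list" where
  "wrow [] i j k = filt i j k L5"
| "wrow ((a,b)#ws) i j k = Rpl b a (wrow ws (i - un a A1 + un b A1) (j - un a A2 + un b A2) (k - un a A3 + un b A3))"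

fun wrows :: "(dir \<times> dir) list list \<Rightarrow> int \<Rightarrow> int \<Rightarrow> int \<Rightarrow> trm list list" where
  "wrows [] i j k = []" | "wrows (w#ws) i j k = wrow w i j k # wrows ws i j k"

lemma ell_eq: "ell = pscale 5 (Var (ixm (Ix E0 E0 E0))) + pscale 3 (Var (ixm (Ix E2 E0 E0))) + pscale 3 (Var (ixm (Ix E0 E2 E0))) +
   pscale 3 (Var (ixm (Ix E0 E0 E2))) + pscale 2 (Var (ixm (Ix E1 E1 E1)))"
proof -
  let ?S = "{ixm (Ix E0 E0 E0), ixm (Ix E2 E0 E0), ixm (Ix E0 E2 E0), ixm (Ix E0 E0 E2), ixm (Ix E1 E1 E1)}"
  have l: "lkp (ixm (Ix a b c)) 1 = nat (vale a)" "lkp (ixm (Ix a b c)) 2 = nat (vale b)" "lkp (ixm (Ix a b c)) 3 = nat (vale c)" for a b c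
    by (simp_all add: ixm_def lookup_idx)
  have ne: "ixm (Ix a b c) = ixm (Ix a' b' c') \<longleftrightarrow> a = a' \<and> b = b' \<and> c = c'" for a b c a' b' c'
  proof
    assume e: "ixm (Ix a b c) = ixm (Ix a' b' c')"
    from arg_cong[OF e, of "\<lambda>I. lkp I 1"] arg_cong[OF e, of "\<lambda>I. lkp I 2"] arg_cong[OF e, of "\<lambda>I. lkp I 3"]
    have "nat (vale a) = nat (vale a')" "nat (vale b) = nat (vale b')" "nat (vale c) = nat (vale c')" by (simp_all only: l)
    moreover have "nat (vale x) = nat (vale y) \<Longrightarrow> x = y" for x y by (cases x; cases y) auto
    ultimately show "a = a' \<and> b = b' \<and> c = c'" by blast
  qed simp
  have S: "?S \<subseteq> indices" by (auto simp: ixm_indices vix_def)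
  have "ell = (\<Sum>I\<in>?S. pscale (of_real (lc I)) (Var I))"
    unfolding ell_def
  proof (rule sum.mono_neutral_right[OF finite_indices S], rule ballI)
    fix I assume I: "I \<in> indices - ?S"
    then obtain a b c where abc: "I = ixm (Ix a b c)" using ixm_surj by (metis Diff_iff ix.exhaust)
    have "lc I = 0" using I unfolding abc
      by (cases a; cases b; cases c; simp add: lc_def l ne)
    then show "pscale (of_real (lc I)) (Var I) = 0" by simp
  qed
  also have "\<dots> = pscale 5 (Var (ixm (Ix E0 E0 E0))) + pscale 3 (Var (ixm (Ix E2 E0 E0))) + pscale 3 (Var (ixm (Ix E0 E2 E0))) +
   pscale 3 (Var (ixm (Ix E0 E0 E2))) + pscale 2 (Var (ixm (Ix E1 E1 E1)))"
    by (simp add: ne lc_def l)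
  finally show ?thesis .
qed

lemma val_mulx: "val (ph f) (mulx v a p) = of_int a * of_real (wI (ixm v)) * val (ph (pd (ixm v) f)) p"
proof (induct v a p rule: mulx.induct)
  case (2 v a m c p)
  have "ph f (insix v m) = of_real (wI (ixm v)) * ph (pd (ixm v) f) m"
    by (simp add: ph_def mon_insix ip_Var_mult_right)
  then show ?case using 2 by (simp add: algebra_simps)
qed simp

lemma val_mulell:
  assumes "\<And>f. val (ph f) p = ip f g"
  shows "val (ph f) (mulell p) = ip f (ell * g)"
  by (simp add: val_padd val_mulx assms ell_eq distrib_right ip_add_right pscale_mult_left ip_pscale_right ip_Var_mult_right)

lemma val_L5: "val (ph f) L5 = ip f (ell ^ 5)"
proof -
  have "val (ph f) [([], 1)] = ip f 1" for f by (simp add: ph_def)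
  from val_mulell[OF val_mulell[OF val_mulell[OF val_mulell[OF val_mulell[OF this]]]]]
  show ?thesis by (simp add: L5_def numeral_eq_Suc mult.assoc del: mulell.simps)
qed

lemma keys_mulx: "v \<in> vix \<Longrightarrow> \<forall>m\<in>ks p. set m \<subseteq> vix \<Longrightarrow> \<forall>m\<in>ks (mulx v a p). set m \<subseteq> vix"
proof (induct v a p rule: mulx.induct)
  case (2 v a m c p)
  have "set (insix v m) = insert v (set m)" using mset_insix[of v m] by (metis set_mset_add_mset_insert set_mset_mset)
  then show ?case using 2 by auto
qed simp

lemma keys_mulell:
  assumes "\<forall>m\<in>ks p. set m \<subseteq> vix"
  shows "\<forall>m\<in>ks (mulell p). set m \<subseteq> vix"
proof -
  have p: "\<forall>m\<in>ks (padd p q). set m \<subseteq> vix" if "\<forall>m\<in>ks p. set m \<subseteq> vix" "\<forall>m\<in>ks q. set m \<subseteq> vix" for p q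
    using that keys_padd[of p q] by blast
  show ?thesis unfolding mulell.simps
    by (intro p keys_mulx assms) (simp_all add: vix_def)
qed

lemma keys_filt: "ks (filt i j k p) \<subseteq> ks p"
  by (induct i j k p rule: filt.induct) (auto simp: cons0_if)

lemma keys_wrow: "\<forall>m\<in>ks (wrow ws i j k). set m \<subseteq> vix"
proof (induct ws i j k rule: wrow.induct)
  case (1 i j k)
  have "\<forall>m\<in>ks L5. set m \<subseteq> vix" unfolding L5_def by (intro keys_mulell) simp
  then show ?case using keys_filt[of i j k L5] by (simp del: image_subset_iff) blast
next
  case (2 a b ws i j k)
  then show ?case using keys_Rpl by simp
qed

lemma sumd_wl: "sumd a m = wl a (mset m)" by (induct m) auto

lemma val_filt: "f \<in> wsp i j k \<Longrightarrow> \<forall>m\<in>ks p. set m \<subseteq> vix \<Longrightarrow> val (ph f) (filt i j k p) = val (ph f) p"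
proof (induct i j k p rule: filt.induct)
  case (2 i j k m c p)
  have "ph f m = 0" if "\<not> (sumd A1 m = i \<and> sumd A2 m = j \<and> sumd A3 m = k)"
  proof -
    have "mm m \<notin> kys f" using that 2(2,3) wt_mm[of m] by (auto simp: wsp_def sumd_wl)
    then have "ip (sgl (mm m) 1) f = 0" by (simp add: ip_single in_keys_iff)
    then show ?thesis unfolding ph_def mon_mm using ip_cnj[of "sgl (mm m) 1" f] by simp
  qed
  then show ?case using 2 by (auto simp: cons0_if)
qed simp

lemma V_R: "f \<in> vanishing_quintics \<Longrightarrow> a \<noteq> A0 \<Longrightarrow> a \<noteq> b \<Longrightarrow> R a b f \<in> vanishing_quintics"
  using V_astab by (cases "b = A0") (auto simp: astab_def gstab_def)

lemma val_wrow: "f \<in> vanishing_quintics \<Longrightarrow> f \<in> wsp i j k \<Longrightarrow> \<forall>(a,b)\<in>set ws. a \<noteq> A0 \<and> a \<noteq> b \<Longrightarrow> val (ph f) (wrow ws i j k) = 0"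
proof (induct ws i j k arbitrary: f rule: wrow.induct)
  case (1 i j k)
  have "\<forall>m\<in>ks L5. set m \<subseteq> vix" unfolding L5_def by (intro keys_mulell) simp
  then show ?case using 1 val_filt[of f i j k L5] V_ip_ell[of f] by (simp add: val_L5)
next
  case (2 a b ws i j k)
  have "val (ph f) (wrow ((a, b) # ws) i j k) = val (ph (R a b f)) (wrow ws (i - un a A1 + un b A1) (j - un a A2 + un b A2) (k - un a A3 + un b A3))"
    using val_Rpl keys_wrow by simp
  also have "\<dots> = 0" by (rule 2(1)) (use 2(2-) V_R R_wsp in auto)
  finally show ?case .
qed

fun cat :: "'a list \<Rightarrow> 'a list \<Rightarrow> 'a list" where "cat [] ys = ys" | "cat (x#xs) ys = x # cat xs ys"
lemma cat_append: "cat xs ys = xs @ ys" by (induct xs ys rule: cat.induct) auto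

fun fin :: "ix list list \<Rightarrow> trm list list \<Rightarrow> trie \<times> trm list list \<Rightarrow> trie" where
  "fin g ws (t,rs) = elim g (cat (lsort rs) ws) t"

fun sgls :: "ix list list \<Rightarrow> trm list list \<Rightarrow> trm list list" where
  "sgls [] acc = acc" | "sgls (m#ms) acc = [(m,1)] # sgls ms acc"

fun solve :: "ix list list \<Rightarrow> ix list list \<Rightarrow> (dir \<times> dir) list \<Rightarrow> (dir \<times> dir) list list \<Rightarrow> int \<Rightarrow> int \<Rightarrow> int \<Rightarrow> bool" where
  "solve g ms cs ws i j k = chk g (fin g (wrows ws i j k) (zps [E0,E0,E0] (Em, sgls ms (eqs cs i j k [])))) Em"

definition "claim ms cs ws i j k = solve (gn i j k) ms cs ws i j k"

lemma wrows_ok: "f \<in> vanishing_quintics \<Longrightarrow> f \<in> wsp i j k \<Longrightarrow> \<forall>w\<in>set ws. \<forall>(a,b)\<in>set w. a \<noteq> A0 \<and> a \<noteq> b \<Longrightarrow> \<forall>r\<in>set (wrows ws i j k). val (ph f) r = 0"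
  by (induct ws) (auto simp: val_wrow)

theorem claim_sound:
  assumes c: "claim ms cs ws i j k" and f: "f \<in> wsp i j k" "ws \<noteq> [] \<Longrightarrow> f \<in> vanishing_quintics"
    and cs: "\<forall>(a,b)\<in>set cs. R a b f = 0" and ws: "\<forall>w\<in>set ws. \<forall>(a,b)\<in>set w. a \<noteq> A0 \<and> a \<noteq> b"
    and ms: "\<forall>m\<in>set ms. ph f m = 0"
  shows "f = 0"
proof -
  let ?g = "gn i j k"
  have s: "\<forall>r\<in>set (sgls ms acc). val (ph f) r = 0" if "\<forall>r\<in>set acc. val (ph f) r = 0" for acc
    using ms that by (induct ms acc rule: sgls.induct) auto
  have r: "\<forall>r\<in>set (sgls ms (eqs cs i j k [])). val (ph f) r = 0"
    by (rule s) (use eqs_ok[OF cs, of "[]"] in auto)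
  obtain t rs where z: "zps [E0,E0,E0] (Em, sgls ms (eqs cs i j k [])) = (t, rs)" by fastforce
  have t: "zero_ok (ph f) t" "\<forall>r\<in>set rs. val (ph f) r = 0" using zps_ok[OF zero_ok_Em r z] by auto
  have w: "\<forall>r\<in>set (wrows ws i j k). val (ph f) r = 0"
    using wrows_ok[OF _ f(1) ws] f(2) by (cases ws) auto
  have "trie_ok (ph f) (fin ?g (wrows ws i j k) (t, rs))"
    unfolding fin.simps
    by (rule trie_ok_elim) (use zero_trie_ok[OF t(1)] t(2) w set_lsort[of rs] in \<open>auto simp: cat_append\<close>)
  then have "\<forall>m\<in>set ?g. ph f m = 0"
    using chk_sound(1)[OF _ zero_ok_Em] c unfolding claim_def solve.simps z by blast
  then show ?thesis by (rule wsp_zero[OF f(1)])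
qed

subsection \<open>Computations\<close>

text \<open>Each entry of the tables consists of a weight and of operator words \<open>w\<close>; the equations used are
  \<open>R\<^sub>3\<^sub>0 f = R\<^sub>1\<^sub>2 f = R\<^sub>2\<^sub>3 f = 0\<close> and, for every listed \<open>w\<close>, the vanishing of \<open>w f\<close> at the regular
  tetrahedron.\<close>

fun check_entry :: "int \<times> int \<times> int \<times> (dir \<times> dir) list list \<Rightarrow> bool" where
  "check_entry (i, j, k, ws) = claim [] [(A3,A0),(A1,A2),(A2,A3)] ws i j k"

definition "table1 = [(0,0,0,[[]]),
  (0,0,1,[]),
  (0,0,2,[[]]),
  (0,1,1,[]),
  (0,0,3,[[(A3,A1),(A3,A2)]]),
  (0,1,2,[]),
  (1,1,1,[]),
  (0,0,4,[[]]),
  (0,1,3,[]),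
  (0,2,2,[[]]),
  (1,1,2,[]),
  (0,0,5,[[(A3,A1),(A3,A2)]]),
  (0,1,4,[[(A3,A1)]]),
  (0,2,3,[[(A2,A1)]]),
  (1,1,3,[]),
  (1,2,2,[]),
  (0,0,6,[[]]),
  (0,1,5,[]),
  (0,2,4,[[],[(A3,A1),(A3,A1)]]),
  (0,3,3,[]),
  (1,1,4,[]),
  (1,2,3,[]),
  (2,2,2,[[]]),
  (0,0,7,[]),
  (0,1,6,[[(A3,A1)]]),
  (0,2,5,[[(A2,A1)]]),
  (0,3,4,[[(A3,A1)]]),
  (1,1,5,[]),
  (1,2,4,[[(A3,A2)]]),
  (1,3,3,[])]"

lemma table1: "list_all check_entry table1" by code_simp

definition "table2 = [(0,1,7,[]),
  (2,2,4,[[]]),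
  (1,4,4,[[(A2,A1),(A3,A1)]]),
  (2,3,5,[])]"

lemma table2: "list_all check_entry table2" by code_simp

definition "table3 = [(0,2,6,[[]]),
  (2,3,3,[]),
  (2,2,5,[[(A3,A1),(A3,A2)]]),
  (2,4,4,[[]])]"

lemma table3: "list_all check_entry table3" by code_simp

definition "table4 = [(0,3,5,[]),
  (0,3,6,[[(A3,A1)]]),
  (2,3,4,[]),
  (3,3,4,[])]"

lemma table4: "list_all check_entry table4" by code_simp

definition "table5 = [(0,4,4,[[]]),
  (0,4,5,[]),
  (3,3,3,[]),
  (3,4,4,[])]"

lemma table5: "list_all check_entry table5" by code_simp

definition "table6 = [(1,1,6,[]),
  (1,2,6,[]),
  (0,5,5,[])]"

lemma table6: "list_all check_entry table6" by code_simp

definition "table7 = [(1,2,5,[[(A3,A1)]]),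
  (1,3,5,[]),
  (1,4,5,[])]"

lemma table7: "list_all check_entry table7" by code_simp

definition "mon134 = [Ix E0 E0 E0,Ix E0 E0 E0,Ix E0 E0 E2,Ix E0 E1 E2,Ix E1 E2 E0]"

lemma claim134: "claim [mon134] [(A3,A0),(A1,A2),(A2,A3)] [] 1 3 4" by code_simp

definition "mon223 = [Ix E0 E0 E0,Ix E0 E0 E0,Ix E0 E0 E2,Ix E0 E2 E0,Ix E2 E0 E1]"

lemma claim223: "claim [mon223] [(A3,A0),(A1,A2),(A2,A3)] [] 2 2 3" by code_simp

lemma claim135: "claim [] [(A2,A0),(A1,A2),(A2,A3)] [[]] 1 3 5" by code_simp

lemma claim226: "claim [] [(A2,A0),(A1,A2),(A2,A3)] [[],[(A3,A1),(A3,A1)],[(A3,A0),(A3,A0)],[(A3,A1),(A3,A2),(A3,A0)]] 2 2 6" by code_simp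

section \<open>Highest weight vectors among the vanishing quintics\<close>

subsection \<open>Commutation with powers\<close>

abbreviation V :: "moment_polynomial set" where "V \<equiv> vanishing_quintics"
abbreviation D1 :: "moment_polynomial \<Rightarrow> moment_polynomial" where "D1 \<equiv> R A1 A0"
abbreviation D2 :: "moment_polynomial \<Rightarrow> moment_polynomial" where "D2 \<equiv> R A2 A0"
abbreviation D3 :: "moment_polynomial \<Rightarrow> moment_polynomial" where "D3 \<equiv> R A3 A0"

definition hw :: "moment_polynomial \<Rightarrow> bool" where
  "hw f \<longleftrightarrow> R A1 A2 f = 0 \<and> R A2 A3 f = 0"

lemma pscale_m1: "pscale (- 1) f = - f"
  by (rule poly_mapping_eqI) simp

lemma R_comm: "a \<noteq> d \<Longrightarrow> b \<noteq> c \<Longrightarrow> R a b (R c d f) = R c d (R a b f)"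
  using R_commute[of a b c d f] by (simp add: un_def)

lemma R_comm_pow: "a \<noteq> d \<Longrightarrow> b \<noteq> c \<Longrightarrow> R a b ((R c d ^^ n) f) = (R c d ^^ n) (R a b f)"
proof (induct n)
  case (Suc n)
  then show ?case using R_comm[of a d b c "(R c d ^^ n) f"] by simp
qed simp

lemma R_bracket_D: "a \<noteq> A0 \<Longrightarrow> a \<noteq> b \<Longrightarrow> R a b (R b A0 f) = R b A0 (R a b f) - R a A0 f"
  using R_commute[of a b b A0 f] by (simp add: un_def algebra_simps)

lemma pow_0 [simp]: "(R a b ^^ n) 0 = 0" by (induct n) auto
lemma pow_add: "(R a b ^^ n) (f + g) = (R a b ^^ n) f + (R a b ^^ n) g" by (induct n) (auto simp: R_add)
lemma pow_pscale: "(R a b ^^ n) (pscale c f) = pscale c ((R a b ^^ n) f)" by (induct n) (auto simp: R_pscale)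
lemma pow_uminus: "(R a b ^^ n) (- f) = - (R a b ^^ n) f" by (induct n) (auto simp: R_uminus)
lemma pow_minus: "(R a b ^^ n) (f - g) = (R a b ^^ n) f - (R a b ^^ n) g" by (induct n) (auto simp: R_minus)
lemma pow_shift: "R a b ((R a b ^^ n) f) = (R a b ^^ n) (R a b f)" by (induct n) auto

lemma R_pow_D:
  assumes "a \<noteq> A0" "a \<noteq> b" "b \<noteq> A0"
  shows "R a b ((R b A0 ^^ n) f) = (R b A0 ^^ n) (R a b f) - pscale (of_nat n) ((R b A0 ^^ (n - 1)) (R a A0 f))"
proof (induct n)
  case (Suc n)
  have "R a b ((R b A0 ^^ Suc n) f) = R b A0 (R a b ((R b A0 ^^ n) f)) - R a A0 ((R b A0 ^^ n) f)"
    using R_bracket_D[OF assms(1,2)] by simp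
  also have "R a A0 ((R b A0 ^^ n) f) = (R b A0 ^^ n) (R a A0 f)"
    by (rule R_comm_pow) (use assms in auto)
  also have "R b A0 (R a b ((R b A0 ^^ n) f)) = (R b A0 ^^ Suc n) (R a b f) - pscale (of_nat n) ((R b A0 ^^ n) (R a A0 f))"
    unfolding Suc by (cases n) (simp_all add: R_minus R_pscale)
  finally show ?case by (simp add: pscale_left_add algebra_simps)
qed simp

lemma wc_shift: "wc (i - un a A1 + un b A1) (j - un a A2 + un b A2) (k - un a A3 + un b A3) c = wc i j k c - un a c + un b c"
  by (cases a; cases b; cases c) (simp_all add: wc_def un_def)

lemma R_pow_wsp: "f \<in> wsp i j k \<Longrightarrow>
  (R a b ^^ n) f \<in> wsp (i - int n * un a A1 + int n * un b A1) (j - int n * un a A2 + int n * un b A2) (k - int n * un a A3 + int n * un b A3)"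
proof (induct n)
  case (Suc n)
  have "R a b ((R a b ^^ n) f) \<in> wsp (i - int n * un a A1 + int n * un b A1 - un a A1 + un b A1)
     (j - int n * un a A2 + int n * un b A2 - un a A2 + un b A2) (k - int n * un a A3 + int n * un b A3 - un a A3 + un b A3)"
    by (rule R_wsp[OF Suc(1)[OF Suc(2)]])
  then show ?case by (simp add: algebra_simps)
qed simp

lemma wsp_cast: "f \<in> wsp i j k \<Longrightarrow> i = i' \<Longrightarrow> j = j' \<Longrightarrow> k = k' \<Longrightarrow> f \<in> wsp i' j' k'" by simp

lemma R_wsp': "f \<in> wsp i j k \<Longrightarrow> i' = i - un a A1 + un b A1 \<Longrightarrow> j' = j - un a A2 + un b A2 \<Longrightarrow> k' = k - un a A3 + un b A3 \<Longrightarrow> R a b f \<in> wsp i' j' k'"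
  using R_wsp by simp

lemma D_pow_wsp:
  "f \<in> wsp i j k \<Longrightarrow> (D1 ^^ n) f \<in> wsp (i - int n) j k"
  "f \<in> wsp i j k \<Longrightarrow> (D2 ^^ n) f \<in> wsp i (j - int n) k"
  "f \<in> wsp i j k \<Longrightarrow> (D3 ^^ n) f \<in> wsp i j (k - int n)"
  using R_pow_wsp[of f i j k, where a = A1 and b = A0 and n = n] R_pow_wsp[of f i j k, where a = A2 and b = A0 and n = n]
    R_pow_wsp[of f i j k, where a = A3 and b = A0 and n = n]
  by (simp_all add: un_def)

lemma R_pow_V: "f \<in> V \<Longrightarrow> a \<noteq> A0 \<Longrightarrow> a \<noteq> b \<Longrightarrow> (R a b ^^ n) f \<in> V"
  by (induct n) (auto intro: V_R)

lemma V_subspace: "pvs.subspace V" using V_aff_submodule by (simp add: aff_submodule_def)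

lemma wsp_nonneg: "f \<in> wsp i j k \<Longrightarrow> f \<noteq> 0 \<Longrightarrow> 0 \<le> i \<and> 0 \<le> j \<and> 0 \<le> k \<and> 0 \<le> 15 - i - j - k"
proof -
  assume f: "f \<in> wsp i j k" "f \<noteq> 0"
  then obtain m where m: "m \<in> kys f" by (metis ex_in_conv keys_eq_empty)
  then show ?thesis using f wsp_A0[OF f(1) m] wt_nonneg[of m A0] wt_nonneg[of m A1] wt_nonneg[of m A2] wt_nonneg[of m A3]
    by (auto simp: wsp_def)
qed

lemma D_max:
  assumes "f \<in> wsp i j k" "f \<noteq> 0" "a \<noteq> A0"
  shows "\<exists>n. (R a A0 ^^ n) f \<noteq> 0 \<and> R a A0 ((R a A0 ^^ n) f) = 0"
proof -
  have "\<exists>n. (R a A0 ^^ n) f = 0"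
  proof (rule ccontr)
    assume "\<not> (\<exists>n. (R a A0 ^^ n) f = 0)"
    then have "(R a A0 ^^ 16) f \<noteq> 0" by blast
    from wsp_nonneg[OF R_pow_wsp[OF assms(1), where n = 16 and a = a and b = A0] this] wsp_nonneg[OF assms(1,2)]
    show False using assms(3) by (cases a) (auto simp: un_def)
  qed
  then obtain n where n: "(R a A0 ^^ n) f = 0" "\<forall>m<n. (R a A0 ^^ m) f \<noteq> 0"
    using exists_least_iff[of "\<lambda>n. (R a A0 ^^ n) f = 0"] by blast
  then obtain m where "n = Suc m" using assms(2) by (cases n) auto
  then show ?thesis using n by auto
qed

lemma hw_D1_pow: "hw f \<Longrightarrow> hw ((D1 ^^ n) f)"
  by (simp add: hw_def R_comm_pow)

lemma hw_D2_pow: "hw f \<Longrightarrow> D1 f = 0 \<Longrightarrow> hw ((D2 ^^ n) f) \<and> D1 ((D2 ^^ n) f) = 0"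
  by (simp add: hw_def R_comm_pow R_pow_D)

lemma hw_D3_pow: "hw f \<Longrightarrow> D1 f = 0 \<Longrightarrow> D2 f = 0 \<Longrightarrow> hw ((D3 ^^ n) f) \<and> D1 ((D3 ^^ n) f) = 0 \<and> D2 ((D3 ^^ n) f) = 0"
  by (simp add: hw_def R_comm_pow R_pow_D)

subsection \<open>Translation invariant highest weight vectors\<close>

definition "tables = table1 @ table2 @ table3 @ table4 @ table5 @ table6 @ table7"

lemma tables_checked: "\<forall>t\<in>set tables. check_entry t"
  using table1 table2 table3 table4 table5 table6 table7 by (auto simp: tables_def list_all_iff)

fun covers :: "(int \<times> int \<times> int \<times> 'a) list \<Rightarrow> int \<Rightarrow> int \<Rightarrow> int \<Rightarrow> bool" where
  "covers [] i j k = False" | "covers ((i',j',k',_)#t) i j k = ((i = i' \<and> j = j' \<and> k = k') \<or> covers t i j k)"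

lemma covers_ex: "covers t i j k \<Longrightarrow> \<exists>ws. (i, j, k, ws) \<in> set t"
  by (induct t i j k rule: covers.induct) auto

lemma tables_cover:
  "list_all (\<lambda>i. list_all (\<lambda>j. list_all (\<lambda>k. i \<le> j \<and> j \<le> k \<and> i + j + 2 * k \<le> 15 \<longrightarrow>
     covers tables i j k \<or> (i = 1 \<and> j = 3 \<and> k = 4) \<or> (i = 2 \<and> j = 2 \<and> k = 3)) [0,1,2,3,4,5,6,7]) [0,1,2,3,4,5]) [0,1,2,3]"
  by code_simp

fun good_words :: "(dir \<times> dir) list list \<Rightarrow> bool" where
  "good_words ws = list_all (list_all (\<lambda>(a, b). a \<noteq> A0 \<and> a \<noteq> b)) ws"

lemma tables_good: "list_all (\<lambda>(i, j, k, ws). good_words ws) tables"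
  by code_simp

lemma good_words_iff: "good_words ws \<longleftrightarrow> (\<forall>w\<in>set ws. \<forall>(a,b)\<in>set w. a \<noteq> A0 \<and> a \<noteq> b)"
  by (simp add: list_all_iff)

lemma hw_dominant:
  assumes "f \<in> wsp i j k" "hw f" "f \<noteq> 0"
  shows "0 \<le> i" "i \<le> j" "j \<le> k"
  using wsp_nonneg[OF assms(1,3)] R_inj_weight[OF assms(1), of A1 A2] R_inj_weight[OF assms(1), of A2 A3] assms(2,3)
  by (auto simp: hw_def wc_def not_less[symmetric])

lemma T_inv_hw:
  assumes f: "f \<in> V" "f \<in> wsp i j k" "hw f" "D3 f = 0" "f \<noteq> 0"
  shows "(i, j, k) = (1, 3, 4) \<or> (i, j, k) = (2, 2, 3)"
proof (rule ccontr)
  assume neg: "\<not> ((i, j, k) = (1, 3, 4) \<or> (i, j, k) = (2, 2, 3))"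
  note d = hw_dominant[OF f(2,3,5)]
  have e: "k \<le> 15 - i - j - k"
    using R_inj_weight[OF f(2), of A3 A0] f(4,5) by (auto simp: wc_def not_less[symmetric])
  have "i \<in> set [0,1,2,3]" "j \<in> set [0,1,2,3,4,5]" "k \<in> set [0,1,2,3,4,5,6,7]"
    using d e by (simp, linarith)+
  then have "i \<le> j \<and> j \<le> k \<and> i + j + 2 * k \<le> 15 \<longrightarrow>
     covers tables i j k \<or> (i = 1 \<and> j = 3 \<and> k = 4) \<or> (i = 2 \<and> j = 2 \<and> k = 3)"
    using tables_cover unfolding list_all_iff by blast
  moreover have "i + j + 2 * k \<le> 15" using e by simp
  ultimately have "covers tables i j k" using d neg by blast
  then obtain ws where ws: "(i, j, k, ws) \<in> set tables" using covers_ex by blast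
  then have c: "claim [] [(A3,A0),(A1,A2),(A2,A3)] ws i j k" using tables_checked by fastforce
  have g: "\<forall>w\<in>set ws. \<forall>(a,b)\<in>set w. a \<noteq> A0 \<and> a \<noteq> b"
    using ws tables_good unfolding good_words_iff[symmetric] by (auto simp only: list_all_iff)
  have "f = 0" by (rule claim_sound[OF c f(2) f(1) _ g]) (use f in \<open>auto simp: hw_def\<close>)
  then show False using f(5) by simp
qed

lemma T_inv_unique:
  assumes f: "f \<in> wsp i j k" "hw f" "D3 f = 0" and g: "g \<in> wsp i j k" "hw g" "D3 g = 0" "g \<noteq> 0"
    and ijk: "(i, j, k) = (1, 3, 4) \<or> (i, j, k) = (2, 2, 3)"
  shows "\<exists>t. f = pscale t g"
proof -
  obtain m where m: "claim [m] [(A3,A0),(A1,A2),(A2,A3)] [] i j k"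
    using ijk claim134 claim223 by auto
  have z: "h = 0" if "h \<in> wsp i j k" "hw h" "D3 h = 0" "ph h m = 0" for h
    by (rule claim_sound[OF m that(1)]) (use that in \<open>auto simp: hw_def\<close>)
  have gm: "ph g m \<noteq> 0" using z[OF g(1-3)] g(4) by blast
  define t where "t = ph f m / ph g m"
  have "f - pscale t g = 0"
  proof (rule z)
    show "f - pscale t g \<in> wsp i j k"
      using f g pvs.subspace_diff[OF subspace_wsp] pvs.subspace_scale[OF subspace_wsp] by blast
    show "ph (f - pscale t g) m = 0" using gm by (simp add: ph_def ip_minus_left ip_pscale_left t_def)
    show "hw (f - pscale t g)" unfolding hw_def R_minus R_pscale using f(2) g(2) by (simp add: hw_def)
    show "D3 (f - pscale t g) = 0" unfolding R_minus R_pscale f(3) g(3) by simp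
  qed
  then show ?thesis by (intro exI[of _ t]) simp
qed

lemma claim_D2:
  assumes "claim [] [(A2,A0),(A1,A2),(A2,A3)] ws i j k" "good_words ws"
    "f \<in> V" "f \<in> wsp i j k" "hw f" "D2 f = 0"
  shows "f = 0"
  by (rule claim_sound[OF assms(1,4,3) _ assms(2)[unfolded good_words_iff]]) (use assms(5,6) in \<open>auto simp: hw_def\<close>)

lemma no_hw_135: "f \<in> V \<Longrightarrow> f \<in> wsp 1 3 5 \<Longrightarrow> hw f \<Longrightarrow> D2 f = 0 \<Longrightarrow> f = 0"
  by (rule claim_D2[OF claim135]) simp_all

lemma no_hw_226: "f \<in> V \<Longrightarrow> f \<in> wsp 2 2 6 \<Longrightarrow> hw f \<Longrightarrow> D2 f = 0 \<Longrightarrow> f = 0"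
  by (rule claim_D2[OF claim226]) simp_all

subsection \<open>Existence of highest weight vectors\<close>

lemma exists_hw:
  assumes "gstab W" "f \<in> W" "f \<in> wsp i j k" "f \<noteq> 0"
  shows "\<exists>g i' j' k'. g \<in> W \<and> g \<in> wsp i' j' k' \<and> g \<noteq> 0 \<and> hw g \<and> i' \<le> i \<and> i' + j' + k' = i + j + k"
  using assms(2-)
proof (induct "nat (2 * i + j)" arbitrary: f i j k rule: less_induct)
  case less
  note nn = wsp_nonneg[OF less(3,4)]
  have W: "R a b h \<in> W" if "h \<in> W" "a \<noteq> A0" "b \<noteq> A0" "a \<noteq> b" for a b h
    using assms(1) that by (auto simp: gstab_def)
  consider "hw f" | "R A1 A2 f \<noteq> 0" | "R A2 A3 f \<noteq> 0" by (auto simp: hw_def)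
  then show ?case
  proof cases
    case 1
    then show ?thesis using less by blast
  next
    case 2
    have w: "R A1 A2 f \<in> wsp (i - 1) (j + 1) k" by (rule R_wsp'[OF less(3)]) (simp_all add: un_def)
    have "nat (2 * (i - 1) + (j + 1)) < nat (2 * i + j)" using nn wsp_nonneg[OF w 2] by auto
    from less(1)[OF this W[OF less(2)] w 2] obtain g i' j' k' where
      "g \<in> W \<and> g \<in> wsp i' j' k' \<and> g \<noteq> 0 \<and> hw g \<and> i' \<le> i - 1 \<and> i' + j' + k' = i - 1 + (j + 1) + k" by auto
    then show ?thesis
      by (rule_tac exI[of _ g], rule_tac exI[of _ i'], rule_tac exI[of _ j'], rule_tac exI[of _ k']) simp
  next
    case 3
    have w: "R A2 A3 f \<in> wsp i (j - 1) (k + 1)" by (rule R_wsp'[OF less(3)]) (simp_all add: un_def)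
    have "nat (2 * i + (j - 1)) < nat (2 * i + j)" using nn wsp_nonneg[OF w 3] by auto
    from less(1)[OF this W[OF less(2)] w 3] obtain g i' j' k' where
      "g \<in> W \<and> g \<in> wsp i' j' k' \<and> g \<noteq> 0 \<and> hw g \<and> i' \<le> i \<and> i' + j' + k' = i + (j - 1) + (k + 1)" by auto
    then show ?thesis
      by (rule_tac exI[of _ g], rule_tac exI[of _ i'], rule_tac exI[of _ j'], rule_tac exI[of _ k']) simp
  qed
qed

lemma exists_T_inv_hw:
  assumes "astab W" "f \<in> W" "f \<in> wsp i j k" "f \<noteq> 0"
  shows "\<exists>g i' j' k'. g \<in> W \<and> g \<in> wsp i' j' k' \<and> g \<noteq> 0 \<and> hw g \<and> D3 g = 0 \<and> i' \<le> i \<and> i' + j' + k' \<le> i + j + k"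
  using assms(2-)
proof (induct "nat (i + j + k)" arbitrary: f i j k rule: less_induct)
  case less
  have W: "gstab W" "\<And>h. h \<in> W \<Longrightarrow> D3 h \<in> W" using assms(1) by (auto simp: astab_def)
  obtain g i' j' k' where g: "g \<in> W" "g \<in> wsp i' j' k'" "g \<noteq> 0" "hw g" "i' \<le> i" "i' + j' + k' = i + j + k"
    using exists_hw[OF W(1) less(2-4)] by blast
  show ?case
  proof (cases "D3 g = 0")
    case True
    then show ?thesis using g
      by (rule_tac exI[of _ g], rule_tac exI[of _ i'], rule_tac exI[of _ j'], rule_tac exI[of _ k']) simp
  next
    case False
    have w: "D3 g \<in> wsp i' j' (k' - 1)" by (rule R_wsp'[OF g(2)]) (simp_all add: un_def)
    have "nat (i' + j' + (k' - 1)) < nat (i + j + k)" using g(6) wsp_nonneg[OF w False] by auto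
    from less(1)[OF this W(2)[OF g(1)] w False] obtain h i2 j2 k2 where
      "h \<in> W \<and> h \<in> wsp i2 j2 k2 \<and> h \<noteq> 0 \<and> hw h \<and> D3 h = 0 \<and> i2 \<le> i' \<and> i2 + j2 + k2 \<le> i' + j' + (k' - 1)" by auto
    then show ?thesis using g(5,6)
      by (rule_tac exI[of _ h], rule_tac exI[of _ i2], rule_tac exI[of _ j2], rule_tac exI[of _ k2]) simp
  qed
qed

lemma V_zero:
  assumes f: "f \<in> V" "f \<in> wsp i j k" and s: "i + j + k \<le> 6 \<or> i + j + k \<le> 7 \<and> i \<le> 1 \<or> i \<le> 0"
  shows "f = 0"
proof (rule ccontr)
  assume "f \<noteq> 0"
  from exists_T_inv_hw[OF V_astab f this] obtain g i' j' k' where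
    g: "g \<in> V" "g \<in> wsp i' j' k'" "g \<noteq> 0" "hw g" "D3 g = 0" "i' \<le> i" "i' + j' + k' \<le> i + j + k" by blast
  show False using T_inv_hw[OF g(1,2,4,5,3)] g(6,7) s by auto
qed

lemma gap2:
  assumes f: "f \<in> wsp i j k" and ab: "a \<noteq> b" and z: "R a b (R a b f) = 0" and g: "wc i j k a = wc i j k b + 2"
  shows "f = 0"
proof -
  let ?g = "R a b f"
  have "nrm (R a b ?g) = nrm (R b a ?g) + real_of_int (wc i j k a - un a a + un b a - (wc i j k b - un a b + un b b)) * nrm ?g"
    using nrm_R[OF R_wsp[OF f, of a b], of a b] by (simp add: wc_shift)
  then have "nrm (R b a ?g) = 0" using z g ab by (simp add: un_def nrm_def)
  then have "R b a ?g = 0" by (simp add: nrm_eq_0)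
  then have "ip ?g ?g = 0" by (simp add: ip_R[of a b f])
  then have "?g = 0" by (simp add: ip_self_eq_0)
  then show ?thesis by (rule R_inj_weight[OF f]) (use g in simp)
qed

lemma V_313: "f \<in> V \<Longrightarrow> f \<in> wsp 3 1 3 \<Longrightarrow> f = 0"
proof -
  assume f: "f \<in> V" "f \<in> wsp 3 1 3"
  have "R A1 A2 (R A1 A2 f) \<in> wsp 1 3 3"
    by (rule R_wsp'[OF R_wsp'[OF f(2), of 2 A1 A2 2 3]]) (simp_all add: un_def)
  then have "R A1 A2 (R A1 A2 f) = 0" using V_R f(1) by (intro V_zero[of _ 1 3 3]) auto
  then show ?thesis by (rule gap2[OF f(2), rotated]) (simp_all add: wc_def)
qed

lemma V_331: "f \<in> V \<Longrightarrow> f \<in> wsp 3 3 1 \<Longrightarrow> f = 0"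
proof -
  assume f: "f \<in> V" "f \<in> wsp 3 3 1"
  have "R A2 A3 (R A2 A3 f) \<in> wsp 3 1 3"
    by (rule R_wsp'[OF R_wsp'[OF f(2), of 3 A2 A3 2 2]]) (simp_all add: un_def)
  then have "R A2 A3 (R A2 A3 f) = 0" using V_R f(1) by (intro V_313) auto
  then show ?thesis by (rule gap2[OF f(2), rotated]) (simp_all add: wc_def)
qed

lemma V_241: "f \<in> V \<Longrightarrow> f \<in> wsp 2 4 1 \<Longrightarrow> f = 0"
proof -
  assume f: "f \<in> V" "f \<in> wsp 2 4 1"
  have "R A2 A1 f \<in> wsp 3 3 1" by (rule R_wsp'[OF f(2)]) (simp_all add: un_def)
  then have "R A2 A1 f = 0" using V_R f(1) by (intro V_331) auto
  then show ?thesis by (rule R_inj_weight[OF f(2)]) (simp_all add: wc_def)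
qed

subsection \<open>The possible highest weights\<close>

definition F3 :: "nat \<Rightarrow> nat \<Rightarrow> nat \<Rightarrow> moment_polynomial \<Rightarrow> moment_polynomial" where
  "F3 a b c f = (D3 ^^ a) ((D2 ^^ b) ((D1 ^^ c) f))"

lemma F3_V: "f \<in> V \<Longrightarrow> F3 a b c f \<in> V"
  by (simp add: F3_def R_pow_V)

lemma F3_wsp: "f \<in> wsp i j k \<Longrightarrow> F3 a b c f \<in> wsp (i - int c) (j - int b) (k - int a)"
  unfolding F3_def by (intro D_pow_wsp)

lemma F3_minus: "F3 a b c (f - g) = F3 a b c f - F3 a b c g"
  and F3_pscale: "F3 a b c (pscale t f) = pscale t (F3 a b c f)"
  by (simp_all add: F3_def pow_minus pow_pscale)

definition leads :: "nat \<Rightarrow> nat \<Rightarrow> nat \<Rightarrow> moment_polynomial \<Rightarrow> bool" where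
  "leads a b c f \<longleftrightarrow> F3 a b c f \<noteq> 0 \<and> hw (F3 a b c f) \<and> D3 (F3 a b c f) = 0"

lemma no_444:
  assumes f: "f \<in> wsp 4 4 4" "hw f" "D1 ((D1 ^^ 3) f) = 0"
  shows "D2 ((D1 ^^ 3) f) = 0"
proof -
  define g where "g = D1 f"
  have b: "D1 (R A2 A1 x) = R A2 A1 (D1 x) + D2 x" for x
    using R_bracket_D[of A2 A1 x] by simp
  have c: "D1 (D2 x) = D2 (D1 x)" for x by (rule R_comm) auto
  have "nrm (R A1 A2 f) = nrm (R A2 A1 f)" using nrm_R[OF f(1), of A1 A2] by (simp add: wc_def)
  then have "R A2 A1 f = 0" using f(2) by (simp add: hw_def nrm_eq_0[symmetric] nrm_def)
  then have "R A2 A1 g + D2 f = 0" using b[of f] by (simp add: g_def)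
  then have "D1 (R A2 A1 g + D2 f) = 0" by simp
  then have "R A2 A1 (D1 g) + D2 g + D2 g = 0" by (simp add: R_add b c g_def)
  moreover have two: "x + x = pscale 2 x" for x :: moment_polynomial
    by (rule poly_mapping_eqI) (simp only: lookup_add lookup_pscale mult_2)
  ultimately have "R A2 A1 (D1 g) + pscale 2 (D2 g) = 0" by (simp only: add.assoc)
  then have "D1 (D1 (R A2 A1 (D1 g) + pscale 2 (D2 g))) = 0" by simp
  then have "R A2 A1 (D1 (D1 (D1 g))) + D2 (D1 (D1 g)) + D2 (D1 (D1 g)) + pscale 2 (D2 (D1 (D1 g))) = 0"
    by (simp only: R_add R_pscale b c)
  moreover have "D1 (D1 (D1 g)) = 0" using f(3) by (simp add: g_def eval_nat_numeral)
  moreover have "x + x + pscale 2 x = pscale 4 x" for x :: moment_polynomial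
    by (rule poly_mapping_eqI) (simp only: lookup_add lookup_pscale, simp)
  ultimately have "pscale 4 (D2 (D1 (D1 g))) = 0" by (simp only: R_0 add_0_left)
  then have "D2 (D1 (D1 g)) = 0"
    using pscale_pscale[of "1 / 4" 4 "D2 (D1 (D1 g))"] by simp
  then show ?thesis by (simp add: g_def eval_nat_numeral)
qed

lemma hw_chain:
  assumes f: "f \<in> V" "f \<in> wsp i j k" "hw f" "f \<noteq> 0"
  shows "(\<exists>b c. b \<le> 1 \<and> c \<le> 2 \<and> i = 1 + int c \<and> j = 3 + int b \<and> k = 4 \<and> leads 0 b c f) \<or>
    (\<exists>a b. a \<le> 2 \<and> b \<le> 1 \<and> i = 2 \<and> j = 2 + int b \<and> k = 3 + int a \<and> D1 f = 0 \<and> leads a b 0 f)"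
proof -
  obtain c where c: "(D1 ^^ c) f \<noteq> 0" "D1 ((D1 ^^ c) f) = 0" using D_max[OF f(2,4), of A1] by auto
  let ?g = "(D1 ^^ c) f"
  have g: "?g \<in> V" "?g \<in> wsp (i - int c) j k" "hw ?g" using f by (auto simp: R_pow_V D_pow_wsp hw_D1_pow)
  obtain b where b: "(D2 ^^ b) ?g \<noteq> 0" "D2 ((D2 ^^ b) ?g) = 0" using D_max[OF g(2) c(1), of A2] by auto
  let ?h = "(D2 ^^ b) ?g"
  have h: "?h \<in> V" "?h \<in> wsp (i - int c) (j - int b) k" "hw ?h" "D1 ?h = 0"
    using g c hw_D2_pow[OF g(3) c(2), of b] by (auto simp: R_pow_V D_pow_wsp)
  obtain a where a: "(D3 ^^ a) ?h \<noteq> 0" "D3 ((D3 ^^ a) ?h) = 0" using D_max[OF h(2) b(1), of A3] by auto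
  let ?u = "(D3 ^^ a) ?h"
  have u: "?u \<in> V" "?u \<in> wsp (i - int c) (j - int b) (k - int a)" "hw ?u"
    using h hw_D3_pow[OF h(3,4) b(2), of a] by (auto simp: R_pow_V D_pow_wsp)
  have L: "leads a b c f" using a u by (simp add: leads_def F3_def)
  have dom: "i \<le> j" "j \<le> k" using hw_dominant[OF f(2,3,4)] by auto
  have domg: "j \<le> k" using hw_dominant[OF g(2,3) c(1)] by auto
  have sub: "(D3 ^^ n) ?h \<noteq> 0" if "n \<le> a" for n
  proof
    assume "(D3 ^^ n) ?h = 0"
    then have "(D3 ^^ (a - n)) ((D3 ^^ n) ?h) = 0" by simp
    moreover have "(D3 ^^ (a - n + n)) ?h = (D3 ^^ (a - n)) ((D3 ^^ n) ?h)" by (simp only: funpow_add o_apply)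
    ultimately show False using a(1) that by simp
  qed
  have subw: "(D3 ^^ n) ?h \<in> V" "(D3 ^^ n) ?h \<in> wsp (i - int c) (j - int b) (k - int n)" "hw ((D3 ^^ n) ?h)" "D2 ((D3 ^^ n) ?h) = 0" for n
    using h hw_D3_pow[OF h(3,4) b(2), of n] by (auto simp: R_pow_V D_pow_wsp)
  from T_inv_hw[OF u(1,2,3) a(2,1)] show ?thesis
  proof
    assume w: "(i - int c, j - int b, k - int a) = (1, 3, 4)"
    have a0: "a = 0"
    proof (rule ccontr)
      assume "a \<noteq> 0"
      then have "(D3 ^^ (a - 1)) ?h \<in> wsp 1 3 5"
        by (intro wsp_cast[OF subw(2)]) (use w in auto)
      then have "(D3 ^^ (a - 1)) ?h = 0" by (rule no_hw_135[OF subw(1) _ subw(3,4)])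
      then show False using sub[of "a - 1"] by simp
    qed
    have b1: "b \<le> 1" using w a0 dom by auto
    have "c \<le> 2"
    proof (rule ccontr)
      assume "\<not> c \<le> 2"
      then have "c = 3" "b = 1" using w dom a0 b1 by auto
      then have "f \<in> wsp 4 4 4" by (intro wsp_cast[OF f(2)]) (use w a0 in auto)
      from no_444[OF this f(3)] c(2) b(1) \<open>c = 3\<close> \<open>b = 1\<close> show False by simp
    qed
    then show ?thesis using w a0 b1 L by auto
  next
    assume w: "(i - int c, j - int b, k - int a) = (2, 2, 3)"
    have a2: "a \<le> 2"
    proof (rule ccontr)
      assume "\<not> a \<le> 2"
      then have "(D3 ^^ (a - 3)) ?h \<in> wsp 2 2 6"
        by (intro wsp_cast[OF subw(2)]) (use w in auto)
      then have "(D3 ^^ (a - 3)) ?h = 0" by (rule no_hw_226[OF subw(1) _ subw(3,4)])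
      then show False using sub[of "a - 3"] by simp
    qed
    have b1: "b \<le> 1"
    proof (rule ccontr)
      assume b2: "\<not> b \<le> 1"
      have st: "R A2 A3 ((D3 ^^ Suc n) ((D2 ^^ m) ?g)) = - pscale (of_nat (Suc n)) ((D3 ^^ n) ((D2 ^^ Suc m) ?g))" for n m
      proof -
        have "R A2 A3 ((D2 ^^ m) ?g) = 0" using hw_D2_pow[OF g(3) c(2), of m] by (simp add: hw_def)
        then show ?thesis using R_pow_D[of A2 A3 "Suc n" "(D2 ^^ m) ?g"] by simp
      qed
      let ?u2 = "(D3 ^^ Suc (Suc a)) ((D2 ^^ (b - 2)) ?g)"
      have "?u2 \<in> wsp (i - int c) (j - int (b - 2)) (k - int (Suc (Suc a)))" by (intro D_pow_wsp f)
      then have "?u2 \<in> wsp 2 4 1" by (rule wsp_cast) (use w b2 in auto)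
      moreover have "?u2 \<in> V" by (intro R_pow_V f(1)) simp_all
      ultimately have "?u2 = 0" using V_241 by blast
      then have "pscale (of_nat (Suc (Suc a))) ((D3 ^^ Suc a) ((D2 ^^ Suc (b - 2)) ?g)) = 0"
        using st[of "Suc a" "b - 2"] by simp
      then have "(D3 ^^ Suc a) ((D2 ^^ Suc (b - 2)) ?g) = 0"
        by (metis of_nat_neq_0 pvs.scale_eq_0_iff)
      then have "pscale (of_nat (Suc a)) ((D3 ^^ a) ((D2 ^^ Suc (Suc (b - 2))) ?g)) = 0"
        using st[of a "Suc (b - 2)"] by simp
      then have "(D3 ^^ a) ((D2 ^^ Suc (Suc (b - 2))) ?g) = 0"
        by (metis of_nat_neq_0 pvs.scale_eq_0_iff)
      moreover have "Suc (Suc (b - 2)) = b" using b2 by simp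
      ultimately show False using a(1) by simp
    qed
    have c0: "c = 0"
    proof (rule ccontr)
      assume c1: "c \<noteq> 0"
      let ?p = "(D1 ^^ (c - 1)) f"
      have p: "?p \<in> V" "?p \<in> wsp (i - int (c - 1)) j k" "hw ?p"
        using f by (simp_all add: R_pow_V D_pow_wsp hw_D1_pow)
      have "D1 ?p = (D1 ^^ Suc (c - 1)) f" by simp
      moreover have "Suc (c - 1) = c" using c1 by simp
      ultimately have p4: "D1 ?p = ?g" by (simp only:)
      have "(D3 ^^ a) ((D2 ^^ Suc b) ?p) \<in> wsp (i - int (c - 1)) (j - int (Suc b)) (k - int a)" by (intro D_pow_wsp f)
      then have "(D3 ^^ a) ((D2 ^^ Suc b) ?p) \<in> wsp 3 1 3" by (rule wsp_cast) (use w c1 in auto)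
      moreover have "(D3 ^^ a) ((D2 ^^ Suc b) ?p) \<in> V" by (intro R_pow_V f(1)) simp_all
      ultimately have "(D3 ^^ a) ((D2 ^^ Suc b) ?p) = 0" using V_313 by blast
      then have e: "0 = (D3 ^^ a) (R A1 A2 ((D2 ^^ Suc b) ?p))" by (metis R_0 R_comm_pow dir.distinct(1) dir.distinct(11))
      have r: "R A1 A2 ((D2 ^^ Suc b) ?p) = - pscale (of_nat (Suc b)) ?h"
      proof -
        have z: "R A1 A2 ?p = 0" using p(3) unfolding hw_def by blast
        have "R A1 A2 ((D2 ^^ Suc b) ?p) = (D2 ^^ Suc b) (R A1 A2 ?p) - pscale (of_nat (Suc b)) ((D2 ^^ (Suc b - 1)) (D1 ?p))"
          by (rule R_pow_D) simp_all
        then show ?thesis by (simp only: p4 z pow_0 diff_0 diff_Suc_1)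
      qed
      have "(D3 ^^ a) (- pscale (of_nat (Suc b)) ?h) = 0" by (rule e[unfolded r, symmetric])
      then have "pscale (of_nat (Suc b)) ?u = 0" by (simp add: pow_uminus pow_pscale)
      then show False using a(1) by (metis of_nat_neq_0 pvs.scale_eq_0_iff)
    qed
    show ?thesis using w a2 b1 c0 L c by auto
  qed
qed

lemma hw_weights:
  assumes "f \<in> V" "f \<in> wsp i j k" "hw f" "f \<noteq> 0"
  shows "(i, j, k) \<in> {(3,3,4), (3,4,4), (2,4,4), (2,3,4), (1,4,4), (1,3,4), (2,2,3), (2,3,3), (2,2,4), (2,2,5), (2,3,5)}"
proof -
  consider (1) b c :: nat where "b \<le> 1" "c \<le> 2" "i = 1 + int c" "j = 3 + int b" "k = 4"
    | (2) a b :: nat where "a \<le> 2" "b \<le> 1" "i = 2" "j = 2 + int b" "k = 3 + int a"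
    using hw_chain[OF assms] by blast
  then show ?thesis
  proof cases
    case (1 b c)
    have "b = 0 \<or> b = 1" "c = 0 \<or> c = 1 \<or> c = 2" using 1 by auto
    then show ?thesis unfolding 1(3-5) by (elim disjE) simp_all
  next
    case (2 a b)
    have "b = 0 \<or> b = 1" "a = 0 \<or> a = 1 \<or> a = 2" using 2 by auto
    then show ?thesis unfolding 2(3-5) by (elim disjE) simp_all
  qed
qed

lemma proportional:
  assumes H: "\<forall>f\<in>H. \<forall>g\<in>H. \<forall>t. f - pscale t g \<in> H"
    and L: "\<forall>f\<in>H. f \<noteq> 0 \<longrightarrow> F3 a b c f \<noteq> 0"
    and N: "\<forall>f\<in>H. \<forall>g\<in>H. F3 a b c g \<noteq> 0 \<longrightarrow> (\<exists>t. F3 a b c f = pscale t (F3 a b c g))"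
    and v: "v \<in> H" "v \<noteq> 0" and f: "f \<in> H"
  shows "\<exists>t. f = pscale t v"
proof -
  have "F3 a b c v \<noteq> 0" using L v by blast
  then obtain t where t: "F3 a b c f = pscale t (F3 a b c v)" using N f v(1) by blast
  then have "F3 a b c (f - pscale t v) = 0" by (simp add: F3_minus F3_pscale)
  moreover have "f - pscale t v \<in> H" using H f v(1) by blast
  ultimately have "f - pscale t v = 0" using L by blast
  then show ?thesis by (intro exI[of _ t]) simp
qed

definition Hsp :: "int \<Rightarrow> int \<Rightarrow> int \<Rightarrow> moment_polynomial set" where
  "Hsp i j k = {f \<in> V. f \<in> wsp i j k \<and> hw f}"

lemma Hsp_comb: "f \<in> Hsp i j k \<Longrightarrow> g \<in> Hsp i j k \<Longrightarrow> f - pscale t g \<in> Hsp i j k"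
  unfolding Hsp_def
  using pvs.subspace_diff[OF subspace_wsp] pvs.subspace_scale[OF subspace_wsp]
    pvs.subspace_diff[OF V_subspace] pvs.subspace_scale[OF V_subspace]
  by (auto simp: hw_def R_minus R_pscale)

lemma leads_proportional:
  assumes f: "f \<in> Hsp i j k" "g \<in> Hsp i j k" and z: "f = 0 \<or> leads a b c f" "leads a b c g"
  shows "\<exists>t. F3 a b c f = pscale t (F3 a b c g)"
proof (cases "f = 0")
  case True
  then have "F3 a b c f = pscale 0 (F3 a b c g)" by (simp add: F3_def)
  then show ?thesis by blast
next
  case False
  then have L: "leads a b c f" using z by simp
  have w: "F3 a b c f \<in> wsp (i - int c) (j - int b) (k - int a)" "F3 a b c g \<in> wsp (i - int c) (j - int b) (k - int a)"
    using f F3_wsp by (auto simp: Hsp_def)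
  have "F3 a b c g \<in> V" using f F3_V by (auto simp: Hsp_def)
  from T_inv_hw[OF this w(2)] z(2)
  show ?thesis using T_inv_unique[OF w(1) _ _ w(2)] L by (auto simp: leads_def)
qed

lemma hw_mult:
  assumes v: "v \<in> Hsp i j k" "v \<noteq> 0" and f: "f \<in> Hsp i j k" and n: "(i, j, k) \<noteq> (2, 3, 4)"
  shows "\<exists>t. f = pscale t v"
proof -
  have C: "(\<exists>b c. b \<le> 1 \<and> c \<le> 2 \<and> i = 1 + int c \<and> j = 3 + int b \<and> k = 4 \<and> leads 0 b c f) \<or>
    (\<exists>a b. a \<le> 2 \<and> b \<le> 1 \<and> i = 2 \<and> j = 2 + int b \<and> k = 3 + int a \<and> D1 f = 0 \<and> leads a b 0 f)" if "f \<in> Hsp i j k" "f \<noteq> 0" for f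
    using hw_chain[of f i j k] that by (auto simp: Hsp_def)
  obtain a b c where abc: "\<And>f. f \<in> Hsp i j k \<Longrightarrow> f \<noteq> 0 \<Longrightarrow> leads a b c f"
  proof -
    from C[OF v] show ?thesis
    proof (elim disjE exE conjE)
      fix b c assume h: "b \<le> 1" "c \<le> 2" "i = 1 + int c" "j = 3 + int b" "k = 4" "leads 0 b c v"
      have "leads 0 b c f" if "f \<in> Hsp i j k" "f \<noteq> 0" for f
        using C[OF that] h n by (elim disjE exE conjE) auto
      then show thesis by (rule that)
    next
      fix a b assume h: "a \<le> 2" "b \<le> 1" "i = 2" "j = 2 + int b" "k = 3 + int a" "leads a b 0 v"
      have "leads a b 0 f" if "f \<in> Hsp i j k" "f \<noteq> 0" for f
        using C[OF that] h n by (elim disjE exE conjE) auto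
      then show thesis by (rule that)
    qed
  qed
  have H: "\<forall>f\<in>Hsp i j k. \<forall>g\<in>Hsp i j k. \<forall>t. f - pscale t g \<in> Hsp i j k"
    by (intro ballI allI) (rule Hsp_comb)
  have L: "\<forall>f\<in>Hsp i j k. f \<noteq> 0 \<longrightarrow> F3 a b c f \<noteq> 0"
    by (intro ballI impI) (drule (1) abc, simp add: leads_def)
  have N: "\<forall>f\<in>Hsp i j k. \<forall>g\<in>Hsp i j k. F3 a b c g \<noteq> 0 \<longrightarrow> (\<exists>t. F3 a b c f = pscale t (F3 a b c g))"
  proof (intro ballI impI)
    fix f g assume h: "f \<in> Hsp i j k" "g \<in> Hsp i j k" "F3 a b c g \<noteq> 0"
    have "g \<noteq> 0" using h(3) by (auto simp: F3_def)
    have "leads a b c g" by (rule abc[OF h(2) \<open>g \<noteq> 0\<close>])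
    have z: "f = 0 \<or> leads a b c f" by (cases "f = 0") (simp_all add: abc[OF h(1)])
    show "\<exists>t. F3 a b c f = pscale t (F3 a b c g)" by (rule leads_proportional[OF h(1,2) z \<open>leads a b c g\<close>])
  qed
  show ?thesis by (rule proportional[OF H L N v f])
qed

lemma hw_mult_234:
  assumes v: "v \<in> Hsp 2 3 4" "D1 v \<noteq> 0" and y: "y \<in> Hsp 2 3 4" "D1 y = 0" "y \<noteq> 0" and f: "f \<in> Hsp 2 3 4"
  shows "\<exists>s t. f = pscale s v + pscale t y"
proof -
  have A: "leads 0 0 1 f" if "f \<in> Hsp 2 3 4" "D1 f \<noteq> 0" for f
  proof -
    have "f \<noteq> 0" using that(2) by auto
    then have "(\<exists>b c. b \<le> 1 \<and> c \<le> 2 \<and> 2 = 1 + int c \<and> 3 = 3 + int b \<and> 4 = (4::int) \<and> leads 0 b c f)"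
      using hw_chain[of f 2 3 4] that by (simp add: Hsp_def)
    then obtain b c where "2 = 1 + int c" "3 = 3 + int b" "leads 0 b c f" by blast
    moreover then have "c = 1" "b = 0" by linarith+
    ultimately show ?thesis by simp
  qed
  have B: "leads 1 1 0 f" if "f \<in> Hsp 2 3 4" "D1 f = 0" "f \<noteq> 0" for f
  proof -
    have n: "\<not> leads 0 b 1 f" for b using that(2) by (auto simp: leads_def F3_def)
    from hw_chain[of f 2 3 4] that consider
      (1) b c where "2 = 1 + int c" "leads 0 b c f" | (2) a b where "3 = 2 + int b" "4 = 3 + int a" "leads a b 0 f"
      unfolding Hsp_def by blast
    then show ?thesis
    proof cases
      case (1 b c)
      have "c = 1" using 1(1) by linarith
      then show ?thesis using n[of b] 1(2) by simp
    next
      case (2 a b)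
      have "a = 1" "b = 1" using 2(1,2) by linarith+
      then show ?thesis using 2(3) by simp
    qed
  qed
  have F: "F3 0 0 1 f = D1 f" for f by (simp add: F3_def)
  obtain s where s: "D1 f = pscale s (D1 v)"
  proof (cases "D1 f = 0")
    case True
    then have "D1 f = pscale 0 (D1 v)" by simp
    then show ?thesis by (rule that)
  next
    case False
    then obtain s where "F3 0 0 1 f = pscale s (F3 0 0 1 v)"
      using leads_proportional[OF f v(1), of 0 0 1] A[OF f] A[OF v] by blast
    then show ?thesis by (intro that) (simp only: F)
  qed
  define H where "H = {f \<in> Hsp 2 3 4. D1 f = 0}"
  have H: "\<forall>f\<in>H. \<forall>g\<in>H. \<forall>t. f - pscale t g \<in> H"
    unfolding H_def using Hsp_comb by (auto simp: R_minus R_pscale)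
  have L: "\<forall>f\<in>H. f \<noteq> 0 \<longrightarrow> F3 1 1 0 f \<noteq> 0"
  proof (intro ballI impI)
    fix f assume h: "f \<in> H" "f \<noteq> 0"
    have hh: "f \<in> Hsp 2 3 4" "D1 f = 0" using h(1) by (auto simp: H_def)
    show "F3 1 1 0 f \<noteq> 0" using B[OF hh h(2)] unfolding leads_def by (rule conjunct1)
  qed
  have N: "\<forall>f\<in>H. \<forall>g\<in>H. F3 1 1 0 g \<noteq> 0 \<longrightarrow> (\<exists>t. F3 1 1 0 f = pscale t (F3 1 1 0 g))"
  proof (intro ballI impI)
    fix f g assume h: "f \<in> H" "g \<in> H" "F3 1 1 0 g \<noteq> 0"
    have "g \<noteq> 0" using h(3) by (auto simp: F3_def)
    have hh: "f \<in> Hsp 2 3 4" "D1 f = 0" "g \<in> Hsp 2 3 4" "D1 g = 0" using h(1,2) by (auto simp: H_def)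
    have "leads 1 1 0 g" by (rule B[OF hh(3,4) \<open>g \<noteq> 0\<close>])
    have z: "f = 0 \<or> leads 1 1 0 f" by (cases "f = 0") (simp_all add: B[OF hh(1,2), unfolded One_nat_def])
    show "\<exists>t. F3 1 1 0 f = pscale t (F3 1 1 0 g)" by (rule leads_proportional[OF hh(1,3) z \<open>leads 1 1 0 g\<close>])
  qed
  have yH: "y \<in> H" using y by (simp add: H_def)
  have fH: "f - pscale s v \<in> H" using Hsp_comb[OF f v(1)] s by (simp add: H_def R_minus R_pscale)
  obtain t where "f - pscale s v = pscale t y" using proportional[OF H L N yH y(3) fH] by blast
  then have "f = pscale s v + pscale t y" by (simp add: algebra_simps)
  then show ?thesis by blast
qed

abbreviation spn :: "moment_polynomial set \<Rightarrow> moment_polynomial set" where "spn \<equiv> pvs.span"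

subsection \<open>Dimensions of direct sums\<close>

definition has_dim :: "moment_polynomial set \<Rightarrow> nat \<Rightarrow> bool" where
  "has_dim U n \<longleftrightarrow> (\<exists>B. finite B \<and> \<not> pvs.dependent B \<and> card B = n \<and> spn B = U)"

lemma has_dim_dim: "has_dim U n \<Longrightarrow> pvs.dim U = n"
  unfolding has_dim_def using pvs.dim_eq_card by (metis pvs.span_span)

lemma has_dim_0: "has_dim {0} 0"
  unfolding has_dim_def by (rule exI[of _ "{}"]) (simp add: pvs.independent_empty)

lemma has_dim_0_iff: "has_dim U 0 \<Longrightarrow> U = {0}"
  unfolding has_dim_def by auto

lemma has_dim_1: "x \<noteq> 0 \<Longrightarrow> has_dim (spn {x}) 1"
  unfolding has_dim_def by (rule exI[of _ "{x}"]) (simp add: pvs.dependent_single)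

lemma has_dim_2:
  assumes "\<And>s t. pscale s x + pscale t y = 0 \<Longrightarrow> s = 0 \<and> t = 0"
  shows "has_dim (spn {x, y}) 2"
proof -
  have y: "y \<noteq> 0" using assms[of 0 1] by auto
  have n: "x \<notin> spn {y}"
  proof
    assume "x \<in> spn {y}"
    then obtain c where "x = pscale c y" by (auto simp: pvs.span_singleton)
    then have "pscale 1 x + pscale (- c) y = 0" by simp
    then show False using assms[of 1 "- c"] by simp
  qed
  have "y \<in> spn {y}" by (rule pvs.span_base) simp
  then have "x \<noteq> y" using n by blast
  moreover have "\<not> pvs.dependent {x, y}" by (rule pvs.independent_insertI[OF n]) (simp add: pvs.dependent_single y)
  ultimately show ?thesis unfolding has_dim_def by (intro exI[of _ "{x, y}"]) simp
qed

definition ssum :: "moment_polynomial set \<Rightarrow> moment_polynomial set \<Rightarrow> moment_polynomial set" where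
  "ssum U W = {x + y | x y. x \<in> U \<and> y \<in> W}"

lemma subspace_ssum: "pvs.subspace U \<Longrightarrow> pvs.subspace W \<Longrightarrow> pvs.subspace (ssum U W)"
  unfolding ssum_def by (rule pvs.subspace_sums)

lemma ssum_left: "pvs.subspace W \<Longrightarrow> x \<in> U \<Longrightarrow> x \<in> ssum U W"
proof -
  assume "pvs.subspace W" "x \<in> U"
  then have "x + 0 \<in> ssum U W" unfolding ssum_def using pvs.subspace_0 by blast
  then show ?thesis by simp
qed

lemma ssum_right: "pvs.subspace U \<Longrightarrow> x \<in> W \<Longrightarrow> x \<in> ssum U W"
proof -
  assume "pvs.subspace U" "x \<in> W"
  then have "0 + x \<in> ssum U W" unfolding ssum_def using pvs.subspace_0 by blast
  then show ?thesis by simp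
qed

lemma ssum_assoc: "ssum (ssum U W) X = ssum U (ssum W X)"
  unfolding ssum_def by (auto simp: add.assoc) (metis add.assoc)+

lemma ssum_left_commute: "ssum U (ssum W X) = ssum W (ssum U X)"
  unfolding ssum_def by (auto) (metis add.left_commute)+

lemma ssum_0 [simp]: "ssum {0} W = W" "ssum W {0} = W"
  by (auto simp: ssum_def)

lemma has_dim_ssum:
  assumes "has_dim U m" "has_dim W n" and z: "U \<inter> W = {0}"
  shows "has_dim (ssum U W) (m + n)"
proof -
  obtain B where B: "finite B" "\<not> pvs.dependent B" "card B = m" "spn B = U" using assms(1) by (auto simp: has_dim_def)
  obtain C where C: "finite C" "\<not> pvs.dependent C" "card C = n" "spn C = W" using assms(2) by (auto simp: has_dim_def)
  have d: "B \<inter> C = {}"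
  proof (rule ccontr)
    assume "B \<inter> C \<noteq> {}"
    then obtain x where x: "x \<in> B" "x \<in> C" by blast
    have "x \<in> U" "x \<in> W" using pvs.span_base[OF x(1)] pvs.span_base[OF x(2)] B(4) C(4) by simp_all
    then have "x = 0" using z by blast
    then show False using x B(2) pvs.dependent_zero by blast
  qed
  have i: "\<not> pvs.dependent (B \<union> D)" if "finite D" "D \<subseteq> C" for D
    using that
  proof (induct D rule: finite_induct)
    case empty
    then show ?case using B by simp
  next
    case (insert x D)
    have xW: "x \<in> W" "spn D \<subseteq> W" using insert(4) pvs.span_base[of x C] pvs.span_mono[of D C] C(4) by auto
    have "x \<notin> spn D"
    proof -
      have "\<not> pvs.dependent (insert x D)" using pvs.independent_mono[OF C(2) insert(4)] .
      then show ?thesis using insert(2) by (simp add: pvs.independent_insert)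
    qed
    have "x \<notin> spn (B \<union> D)"
    proof
      assume "x \<in> spn (B \<union> D)"
      then obtain u w where uw: "x = u + w" "u \<in> U" "w \<in> spn D" using B(4) by (auto simp: pvs.span_Un)
      have "w \<in> W" using uw(3) xW(2) by blast
      have sW: "pvs.subspace W" using pvs.subspace_span[of C] C(4) by simp
      have "x - w \<in> W" by (rule pvs.subspace_diff[OF sW xW(1) \<open>w \<in> W\<close>])
      moreover have "x - w = u" using uw(1) by simp
      ultimately have "u \<in> U \<inter> W" using uw(2) by simp
      then have "u = 0" using z by blast
      then show False using uw(1,3) \<open>x \<notin> spn D\<close> by simp
    qed
    moreover have "\<not> pvs.dependent (B \<union> D)" using insert(3,4) by blast
    ultimately have "\<not> pvs.dependent (insert x (B \<union> D))" by (rule pvs.independent_insertI)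
    then show ?case by simp
  qed
  have "spn (B \<union> C) = ssum U W" by (simp add: pvs.span_Un B(4) C(4) ssum_def)
  moreover have "card (B \<union> C) = m + n" using card_Un_disjoint[OF B(1) C(1) d] B(3) C(3) by simp
  ultimately show ?thesis unfolding has_dim_def using i[OF C(1)] B(1) C(1) by (intro exI[of _ "B \<union> C"]) simp
qed

fun lsum :: "moment_polynomial set list \<Rightarrow> moment_polynomial set" where
  "lsum [] = {0}" | "lsum (U # Us) = ssum U (lsum Us)"

fun indep :: "moment_polynomial set list \<Rightarrow> bool" where
  "indep [] = True" | "indep (U # Us) = (U \<inter> lsum Us = {0} \<and> indep Us)"

lemma subspace_lsum: "\<forall>U\<in>set Us. pvs.subspace U \<Longrightarrow> pvs.subspace (lsum Us)"
  by (induct Us) (simp_all add: subspace_ssum pvs.subspace_single_0)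

lemma lsum_member: "\<forall>U\<in>set Us. pvs.subspace U \<Longrightarrow> W \<in> set Us \<Longrightarrow> x \<in> W \<Longrightarrow> x \<in> lsum Us"
  by (induct Us) (auto intro: ssum_left ssum_right subspace_lsum)

lemma lsum_subset: "pvs.subspace W \<Longrightarrow> \<forall>U\<in>set Us. U \<subseteq> W \<Longrightarrow> lsum Us \<subseteq> W"
proof (induct Us)
  case Nil
  then show ?case by (simp add: pvs.subspace_0)
next
  case (Cons U Us)
  then have "U \<subseteq> W" "lsum Us \<subseteq> W" by simp_all
  then show ?case using pvs.subspace_add[OF Cons(2)] by (auto simp: ssum_def)
qed

lemma lsum_append: "lsum (Us @ Ws) = ssum (lsum Us) (lsum Ws)"
  by (induct Us) (simp_all add: ssum_assoc)

lemma has_dim_lsum: "list_all2 has_dim Us ns \<Longrightarrow> indep Us \<Longrightarrow> has_dim (lsum Us) (sum_list ns)"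
  by (induct rule: list_all2_induct) (simp_all add: has_dim_0 has_dim_ssum)

lemma lsum_eq: "lsum Us = {\<Sum>i<length Us. u i | u. \<forall>i<length Us. u i \<in> Us ! i}"
proof (induct Us)
  case (Cons U Us)
  show ?case
  proof (intro equalityI subsetI)
    fix x assume "x \<in> lsum (U # Us)"
    then obtain a b where x: "x = a + b" "a \<in> U" "b \<in> lsum Us" by (auto simp: ssum_def)
    then obtain u where u: "b = (\<Sum>i<length Us. u i)" "\<forall>i<length Us. u i \<in> Us ! i" using Cons by auto
    have "x = (\<Sum>i<length (U # Us). case_nat a u i)"
      by (simp add: x(1) u(1) sum.lessThan_Suc_shift del: sum.lessThan_Suc)
    moreover have "\<forall>i<length (U # Us). case_nat a u i \<in> (U # Us) ! i"
      using u(2) x(2) by (auto simp: nth_Cons split: nat.split)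
    ultimately show "x \<in> {\<Sum>i<length (U # Us). u i | u. \<forall>i<length (U # Us). u i \<in> (U # Us) ! i}" by blast
  next
    fix x assume "x \<in> {\<Sum>i<length (U # Us). u i | u. \<forall>i<length (U # Us). u i \<in> (U # Us) ! i}"
    then obtain u where u: "x = (\<Sum>i<length (U # Us). u i)" "\<forall>i<length (U # Us). u i \<in> (U # Us) ! i" by blast
    have "x = u 0 + (\<Sum>i<length Us. u (Suc i))" by (simp add: u(1) sum.lessThan_Suc_shift del: sum.lessThan_Suc)
    moreover have "u 0 \<in> U" using u(2) by force
    moreover have "(\<Sum>i<length Us. u (Suc i)) \<in> lsum Us" unfolding Cons using u(2) by force
    ultimately show "x \<in> lsum (U # Us)" by (auto simp: ssum_def)
  qed
qed simp

lemma indep_unique: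
  assumes "\<forall>U\<in>set Us. pvs.subspace U" "indep Us" "\<forall>i<length Us. u i \<in> Us ! i" "(\<Sum>i<length Us. u i) = 0"
  shows "\<forall>i<length Us. u i = 0"
  using assms
proof (induct Us arbitrary: u)
  case (Cons U Us)
  have s: "u 0 + (\<Sum>i<length Us. u (Suc i)) = 0" using Cons(5) by (simp add: sum.lessThan_Suc_shift del: sum.lessThan_Suc)
  have l: "(\<Sum>i<length Us. u (Suc i)) \<in> lsum Us" unfolding lsum_eq using Cons(4) by force
  have sub: "pvs.subspace (lsum Us)" using Cons(2) by (intro subspace_lsum) simp
  have "u 0 = - (\<Sum>i<length Us. u (Suc i))" using s by (simp add: eq_neg_iff_add_eq_0)
  then have "u 0 \<in> lsum Us" using pvs.subspace_neg[OF sub l] by simp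
  moreover have "u 0 \<in> U" using Cons(4) by force
  ultimately have u0: "u 0 = 0" using Cons(3) by auto
  have "\<forall>i<length Us. u (Suc i) = 0" by (rule Cons(1)) (use Cons(2-4) s u0 in auto)
  then show ?case using u0 by (auto simp: less_Suc_eq_0_disj)
qed simp

lemma direct_sum_lsum: "\<forall>U\<in>set Us. pvs.subspace U \<Longrightarrow> indep Us \<Longrightarrow> direct_sum (lsum Us) Us"
  unfolding direct_sum_def using lsum_eq indep_unique by blast

lemma indep_append:
  assumes "\<forall>U\<in>set (Us @ Ws). pvs.subspace U" "indep (Us @ Ws)"
  shows "indep Us \<and> indep Ws \<and> lsum Us \<inter> lsum Ws = {0}"
  using assms
proof (induct Us)
  case Nil
  have "0 \<in> lsum Ws" using subspace_lsum[of Ws] Nil by (auto simp: pvs.subspace_0)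
  then show ?case using Nil by auto
next
  case (Cons U Us)
  have ih: "indep Us" "indep Ws" "lsum Us \<inter> lsum Ws = {0}" using Cons by auto
  have sU: "pvs.subspace U" and sUs: "pvs.subspace (lsum Us)" and sW: "pvs.subspace (lsum Ws)"
    using Cons(2) by (auto intro!: subspace_lsum)
  have z: "U \<inter> ssum (lsum Us) (lsum Ws) = {0}" using Cons(3) by (simp add: lsum_append)
  have zU: "0 \<in> U" "0 \<in> lsum Us" "0 \<in> lsum Ws" using sU sUs sW pvs.subspace_0 by blast+
  have "U \<inter> lsum Us = {0}" using z zU ssum_left[OF sW] by blast
  moreover have "ssum U (lsum Us) \<inter> lsum Ws = {0}"
  proof (intro equalityI subsetI)
    fix x assume "x \<in> ssum U (lsum Us) \<inter> lsum Ws"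
    then obtain u a where x: "x = u + a" "u \<in> U" "a \<in> lsum Us" "x \<in> lsum Ws" by (auto simp: ssum_def)
    have "u = - a + x" using x(1) by simp
    then have "u \<in> ssum (lsum Us) (lsum Ws)" using pvs.subspace_neg[OF sUs x(3)] x(4) unfolding ssum_def by blast
    then have "u = 0" using z x(2) by blast
    then have "x \<in> lsum Us \<inter> lsum Ws" using x by simp
    then show "x \<in> {0}" using ih(3) by simp
  next
    fix x :: moment_polynomial assume "x \<in> {0}"
    then show "x \<in> ssum U (lsum Us) \<inter> lsum Ws" using zU ssum_left[OF sUs zU(1)] by simp
  qed
  ultimately show ?case using ih by simp
qed

subsection \<open>Orthogonal projections\<close>

definition perp :: "moment_polynomial set \<Rightarrow> moment_polynomial set \<Rightarrow> bool" where
  "perp U W \<longleftrightarrow> (\<forall>x\<in>U. \<forall>y\<in>W. ip x y = 0)"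

lemma perp_lsum: "\<forall>W\<in>set Ws. perp U W \<Longrightarrow> perp U (lsum Ws)"
  by (induct Ws) (auto simp: perp_def ssum_def ip_add_right)

lemma perp_int: "pvs.subspace U \<Longrightarrow> pvs.subspace W \<Longrightarrow> perp U W \<Longrightarrow> U \<inter> W = {0}"
proof (intro equalityI subsetI)
  fix x assume "perp U W" "x \<in> U \<inter> W"
  then have "ip x x = 0" by (simp add: perp_def)
  then show "x \<in> {0}" by (simp add: ip_self_eq_0)
qed (simp add: pvs.subspace_0)

lemma ip_span: "(\<And>b. b \<in> B \<Longrightarrow> ip b f = 0) \<Longrightarrow> y \<in> spn B \<Longrightarrow> ip y f = 0"
proof -
  assume h: "\<And>b. b \<in> B \<Longrightarrow> ip b f = 0" "y \<in> spn B"
  have "pvs.subspace {y. ip y f = 0}" by (auto simp: pvs.subspace_def ip_add_left ip_pscale_left)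
  then have "spn B \<subseteq> {y. ip y f = 0}" by (rule pvs.span_minimal[rotated]) (use h(1) in blast)
  then show ?thesis using h(2) by blast
qed

lemma ip_eq_0_sym: "ip f g = 0 \<longleftrightarrow> ip g f = 0"
  by (metis complex_cnj_zero_iff ip_cnj)

lemma orthogonal_projection:
  assumes "finite B"
  shows "\<exists>s\<in>spn B. \<forall>b\<in>spn B. ip b (f - s) = 0"
  using assms
proof (induct B arbitrary: f rule: finite_induct)
  case empty
  then show ?case by simp
next
  case (insert b B)
  obtain s where s: "s \<in> spn B" "\<forall>x\<in>spn B. ip x (f - s) = 0" using insert(3) by blast
  obtain r where r: "r \<in> spn B" "\<forall>x\<in>spn B. ip x (b - r) = 0" using insert(3) by blast
  let ?c = "b - r"
  define t where "t = ip (f - s) ?c / ip ?c ?c"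
  let ?s = "s + pscale t ?c"
  have sub: "spn B \<subseteq> spn (insert b B)" by (rule pvs.span_mono) blast
  have bB: "b \<in> spn (insert b B)" by (rule pvs.span_base) blast
  have c: "?c \<in> spn (insert b B)" by (rule pvs.span_diff[OF bB]) (use r(1) sub in blast)
  have "?s \<in> spn (insert b B)" using s(1) sub c by (intro pvs.span_add pvs.span_scale) auto
  moreover have "ip x (f - ?s) = 0" if "x \<in> spn (insert b B)" for x
  proof (rule ip_span[OF _ that])
    have e: "ip x (f - ?s) = 0" if "x \<in> spn B" for x
      using that s(2) r(2) by (simp add: ip_minus_right ip_add_right ip_pscale_right)
    have ce: "ip ?c (f - ?s) = 0"
    proof (cases "?c = 0")
      case False
      then have "ip ?c ?c \<noteq> 0" by (simp add: ip_self_eq_0)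
      then have "ip (f - ?s) ?c = 0"
        by (simp add: t_def ip_minus_left ip_add_left ip_pscale_left)
      then show ?thesis by (simp add: ip_eq_0_sym)
    qed simp
    fix y assume "y \<in> insert b B"
    then consider "y \<in> B" | "y = b" by blast
    then show "ip y (f - ?s) = 0"
    proof cases
      case 1
      then show ?thesis using e pvs.span_base by blast
    next
      case 2
      have "ip b (f - ?s) = ip ?c (f - ?s) + ip r (f - ?s)" by (simp add: ip_minus_left)
      then show ?thesis using 2 ce e[OF r(1)] by simp
    qed
  qed
  ultimately show ?case by blast
qed

section \<open>Two explicit quintics\<close>

subsection \<open>Polynomials from lists of terms\<close>

fun pv :: "trm list \<Rightarrow> moment_polynomial" where
  "pv [] = 0" | "pv ((m,c)#p) = pscale (of_int c) (mon m) + pv p"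

definition good :: "trm list \<Rightarrow> bool" where "good p \<longleftrightarrow> (\<forall>m\<in>ks p. set m \<subseteq> vix)"

lemma ip_pv: "ip f (pv p) = val (ph f) p"
  by (induct p rule: pv.induct) (simp_all add: ip_add_right ip_pscale_right ph_def)

lemma ip_eqI: "(\<And>f. ip f g = ip f h) \<Longrightarrow> g = h"
  using ip_self_eq_0[of "g - h"] by (simp add: ip_minus_right)

lemma R_pv: "good p \<Longrightarrow> R a b (pv p) = pv (Rpl a b p)"
  by (rule ip_eqI) (simp add: ip_pv val_Rpl good_def ip_R[symmetric])

lemma good_Rpl: "good p \<Longrightarrow> good (Rpl a b p)"
  using keys_Rpl by (simp add: good_def)

fun app :: "(dir \<times> dir) list \<Rightarrow> trm list \<Rightarrow> trm list" where
  "app [] p = p" | "app ((a,b)#ws) p = Rpl a b (app ws p)"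

fun word :: "(dir \<times> dir) list \<Rightarrow> moment_polynomial \<Rightarrow> moment_polynomial" where
  "word [] f = f" | "word ((a,b)#ws) f = R a b (word ws f)"

lemma good_app: "good p \<Longrightarrow> good (app ws p)"
  by (induct ws p rule: app.induct) (auto intro: good_Rpl)

lemma word_pv: "good p \<Longrightarrow> word ws (pv p) = pv (app ws p)"
  by (induct ws p rule: app.induct) (simp_all add: R_pv good_app)

fun nil :: "trm list \<Rightarrow> bool" where "nil [] = True" | "nil (x#xs) = False"

lemma word_nil: "good p \<Longrightarrow> nil (app ws p) \<Longrightarrow> word ws (pv p) = 0"
  by (cases "app ws p") (auto simp: word_pv)

fun inw :: "int \<Rightarrow> int \<Rightarrow> int \<Rightarrow> trm list \<Rightarrow> bool" where
  "inw i j k [] = True"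
| "inw i j k ((m,c)#p) = (length m = 5 \<and> list_all (\<lambda>x. 0 \<le> dg A0 x) m \<and> sumd A1 m = i \<and> sumd A2 m = j \<and> sumd A3 m = k \<and> inw i j k p)"

lemma inw_good: "inw i j k p \<Longrightarrow> good p"
  by (induct i j k p rule: inw.induct) (auto simp: good_def vix_def list_all_iff)

lemma mdegree_mm: "mdegree (mm l) = length l"
  by (induct l) (auto simp: mdegree_add)

lemma keys_mm: "set l \<subseteq> vix \<Longrightarrow> kys (mm l) \<subseteq> indices"
proof (induct l)
  case (Cons x l)
  then show ?case using keys_add[of "sgl (ixm x) 1" "mm l"] ixm_indices[of x] by auto
qed simp

lemma mon_wsp: "set m \<subseteq> vix \<Longrightarrow> length m = 5 \<Longrightarrow> mon m \<in> wsp (sumd A1 m) (sumd A2 m) (sumd A3 m)"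
  by (simp add: mon_mm wsp_def forms_def keys_mm mdegree_mm wt_mm sumd_wl)

lemma pv_wsp: "inw i j k p \<Longrightarrow> pv p \<in> wsp i j k"
proof (induct i j k p rule: inw.induct)
  case (1 i j k)
  then show ?case using pvs.subspace_0[OF subspace_wsp] by simp
next
  case (2 i j k m c p)
  then have "set m \<subseteq> vix" by (auto simp: vix_def list_all_iff)
  then have "mon m \<in> wsp i j k" using mon_wsp[of m] 2(2) by simp
  then show ?case using 2 pvs.subspace_add[OF subspace_wsp] pvs.subspace_scale[OF subspace_wsp] by simp
qed

fun tv :: "(ix \<times> int) list \<Rightarrow> ix \<Rightarrow> int" where
  "tv [] y = 0" | "tv ((x,c)#l) y = (if x = y then c else tv l y)"
fun evm :: "(ix \<times> int) list \<Rightarrow> ix list \<Rightarrow> int" where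
  "evm l [] = 1" | "evm l (x#xs) = tv l x * evm l xs"
fun evq :: "(ix \<times> int) list \<Rightarrow> trm list \<Rightarrow> int" where
  "evq l [] = 0" | "evq l ((m,c)#p) = c * evm l m + evq l p"

lemma peval_pv:
  assumes s: "\<And>x. x \<in> vix \<Longrightarrow> s (ixm x) = a * of_int (tv l x)" and p: "good p" "\<And>m. m \<in> ks p \<Longrightarrow> length m = d"
  shows "peval id s (pv p) = a ^ d * of_int (evq l p)"
proof -
  have m: "peval id s (mon m) = a ^ length m * of_int (evm l m)" if "set m \<subseteq> vix" for m
    using that by (induct m) (simp_all add: peval_mult s mult_ac)
  show ?thesis using p
    by (induct p rule: pv.induct) (simp_all add: peval_add peval_pscale m good_def algebra_simps)
qed

lemma ixm_inj: "inj ixm"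
proof (rule injI)
  fix x y assume e: "ixm x = ixm y"
  have v: "nat (vale u) = nat (vale w) \<Longrightarrow> u = w" for u w by (cases u; cases w) auto
  obtain a b c a' b' c' where xy: "x = Ix a b c" "y = Ix a' b' c'" by (metis ix.exhaust)
  show "x = y"
    using arg_cong[OF e, of "\<lambda>I. lkp I 1"] arg_cong[OF e, of "\<lambda>I. lkp I 2"] arg_cong[OF e, of "\<lambda>I. lkp I 3"]
    by (auto simp: xy ixm_def lookup_idx dest!: v)
qed

lemma pv_nonzero: "good p \<Longrightarrow> (\<And>m. m \<in> ks p \<Longrightarrow> length m = d) \<Longrightarrow> evq l p \<noteq> 0 \<Longrightarrow> pv p \<noteq> 0"
  using peval_pv[of "\<lambda>I. of_int (tv l (inv ixm I))" 1 l p d] ixm_inj by auto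

definition "tetra_point = [(Ix E0 E0 E0, 15), (Ix E2 E0 E0, 3), (Ix E0 E2 E0, 3), (Ix E0 E0 E2, 3), (Ix E1 E1 E1, 1)]"

lemma p0_ixm: "x \<in> vix \<Longrightarrow> p0 (ixm x) = 2 * of_int (tv tetra_point x)"
proof -
  assume x: "x \<in> vix"
  obtain a b c where abc: "x = Ix a b c" using ix.exhaust by blast
  have w: "wI (ixm x) = fact (nat (dg A0 x)) * fact (nat (dg A1 x)) * fact (nat (dg A2 x)) * fact (nat (dg A3 x))"
    unfolding ixm_def by (rule wI_idx[OF vix_valid[OF x]])
  have l: "lkp (ixm (Ix a b c)) 1 = nat (vale a)" "lkp (ixm (Ix a b c)) 2 = nat (vale b)" "lkp (ixm (Ix a b c)) 3 = nat (vale c)"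
    by (simp_all add: ixm_def lookup_idx)
  show ?thesis using x unfolding p0_def w unfolding abc lc_def l
    by (cases a; cases b; cases c; simp add: vix_def tetra_point_def fact_numeral)
qed

lemma Rpl_length:
  assumes "\<And>m. m \<in> ks p \<Longrightarrow> length m = d" "m \<in> ks (Rpl a b p)"
  shows "length m = d"
proof -
  have ins: "length (insix v m) = Suc (length m)" for v m
    using arg_cong[OF mset_insix(1)[of v m], of size] by simp
  have M: "m' \<in> ks (Rmono a b pre vs acc) \<Longrightarrow> m' \<in> ks acc \<or> length m' = length pre + length vs" for m' pre vs acc
  proof (induct vs arbitrary: pre acc)
    case (Cons v vs)
    have "m'' \<in> ks (Rac (stp a b v) pre vs acc) \<Longrightarrow> m'' \<in> ks acc \<or> length m'' = Suc (length pre + length vs)" for m''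
    proof (cases "stp a b v")
      case (Some cy)
      then obtain c y where cy: "stp a b v = Some (c, y)" by (cases cy) auto
      assume "m'' \<in> ks (Rac (stp a b v) pre vs acc)"
      then show ?thesis using keys_padd[of "[(insix y (revap pre vs), c)]" acc] by (auto simp: cy ins revap_rev)
    qed simp
    then show ?case using Cons(1)[of "v # pre" "Rac (stp a b v) pre vs acc"] Cons(2) by fastforce
  qed simp
  have "\<forall>q\<in>set (Rpls a b p). \<forall>m\<in>ks q. length m = d"
    using assms(1)
  proof (induct p)
    case (Cons mc p)
    obtain m c where mc: "mc = (m, c)" by (cases mc) auto
    have l: "length m = d" using Cons(2)[of m] by (simp add: mc)
    have ih: "\<forall>q\<in>set (Rpls a b p). \<forall>m\<in>ks q. length m = d" by (rule Cons(1)) (rule Cons(2), simp add: mc)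
    have "\<forall>m'\<in>ks (Rmono a b [] m []). length m' = d" using M[of _ "[]" m "[]"] l by auto
    then show ?case using ih by (auto simp: mc keys_scal)
  qed simp
  then show ?thesis using assms(2) keys_mrg unfolding Rpl_def by blast
qed

lemma app_length: "(\<And>m. m \<in> ks p \<Longrightarrow> length m = d) \<Longrightarrow> m \<in> ks (app ws p) \<Longrightarrow> length m = d"
  by (induct ws p arbitrary: m rule: app.induct) (auto intro: Rpl_length)

lemma inw_length: "inw i j k p \<Longrightarrow> m \<in> ks p \<Longrightarrow> length m = 5"
  by (induct i j k p rule: inw.induct) auto

lemma word_forms: "f \<in> forms 5 \<Longrightarrow> word ws f \<in> forms 5"
  by (induct ws f rule: word.induct) (auto intro: R_forms)

lemma word_ell:
  assumes p: "inw i j k p" and e: "evq tetra_point (app ws p) = 0"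
  shows "ip (word ws (pv p)) (ell ^ 5) = 0"
proof -
  have g: "good p" by (rule inw_good[OF p])
  have "peval id p0 (pv (app ws p)) = 2 ^ 5 * of_int (evq tetra_point (app ws p))"
    by (rule peval_pv[OF p0_ixm good_app[OF g] app_length[OF inw_length[OF p]]])
  then show ?thesis using ip_ell[OF word_forms[OF wsp_forms[OF pv_wsp[OF p]]], of ws] e by (simp add: word_pv g)
qed

lemma word_nonzero:
  assumes p: "inw i j k p" and e: "evq l (app ws p) \<noteq> 0"
  shows "word ws (pv p) \<noteq> 0"
  unfolding word_pv[OF inw_good[OF p]]
  by (rule pv_nonzero[OF good_app[OF inw_good[OF p]] app_length[OF inw_length[OF p]] e])

subsection \<open>The data\<close>

definition with_ix :: "(ix \<Rightarrow> ix \<Rightarrow> ix \<Rightarrow> ix \<Rightarrow> ix \<Rightarrow> ix \<Rightarrow> ix \<Rightarrow> ix \<Rightarrow> ix \<Rightarrow> ix \<Rightarrow> ix \<Rightarrow> ix \<Rightarrow> ix \<Rightarrow> ix \<Rightarrow> ix \<Rightarrow> ix \<Rightarrow> ix \<Rightarrow> ix \<Rightarrow> ix \<Rightarrow> ix \<Rightarrow> 'a) \<Rightarrow> 'a" where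
  "with_ix F = F (Ix E0 E0 E0) (Ix E0 E0 E1) (Ix E0 E0 E2) (Ix E0 E0 E3) (Ix E0 E1 E0) (Ix E0 E1 E1) (Ix E0 E1 E2) (Ix E0 E2 E0) (Ix E0 E2 E1) (Ix E0 E3 E0) (Ix E1 E0 E0) (Ix E1 E0 E1) (Ix E1 E0 E2) (Ix E1 E1 E0) (Ix E1 E1 E1) (Ix E1 E2 E0) (Ix E2 E0 E0) (Ix E2 E0 E1) (Ix E2 E1 E0) (Ix E3 E0 E0)"

definition n344 :: "trm list" where
  "n344 = with_ix (\<lambda>a b c d e f g h i j k l m n u p q r s t. [
  ([i,i,k,l,l],16),([i,i,k,k,m],24),([h,i,l,l,l],4),([h,i,k,l,m],-40),([h,h,l,l,m],8),([h,h,k,m,m],-12),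
  ([g,j,k,l,l],-16),([g,j,k,k,m],-24),([g,i,k,l,n],-16),([g,i,k,k,u],-24),([g,h,l,l,n],-8),([g,h,k,m,n],24),
  ([g,h,k,l,u],56),([g,g,k,n,n],16),([g,g,k,k,p],24),([g,g,h,k,q],-28),([f,j,l,l,l],-4),([f,j,k,l,m],40),
  ([f,i,l,l,n],4),([f,i,k,m,n],-8),([f,i,k,l,u],-32),([f,h,l,m,n],-16),([f,h,l,l,u],-16),([f,h,k,m,u],48),
  ([f,g,l,n,n],4),([f,g,k,n,u],-32),([f,g,k,l,p],-8),([f,g,i,k,q],28),([f,g,h,l,q],12),([f,g,h,k,r],-36),
  ([f,f,m,n,n],12),([f,f,l,n,u],8),([f,f,l,l,p],12),([f,f,k,u,u],-8),([f,f,k,m,p],-40),([f,f,i,l,q],-8),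
  ([f,f,i,k,r],24),([f,f,h,m,q],-4),([f,f,h,l,r],12),([f,f,g,n,q],-8),([f,f,g,k,s],24),([f,f,f,u,q],8),
  ([f,f,f,n,r],-12),([f,f,f,l,s],-12),([f,f,f,f,t],4),([e,j,l,l,m],-12),([e,j,k,m,m],16),([e,i,l,m,n],52),
  ([e,i,l,l,u],-16),([e,i,k,m,u],-48),([e,h,m,m,n],12),([e,h,l,m,u],-12),([e,g,m,n,n],-40),([e,g,l,n,u],-24),
  ([e,g,l,l,p],28),([e,g,k,u,u],32),([e,g,k,m,p],16),([e,g,i,l,q],-6),([e,g,i,k,r],16),([e,g,h,m,q],16),
  ([e,g,h,l,r],-10),([e,g,g,n,q],12),([e,g,g,k,s],-32),([e,f,m,n,u],-24),([e,f,l,u,u],40),([e,f,l,m,p],-16),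
  ([e,f,i,m,q],-10),([e,f,i,l,r],-8),([e,f,h,m,r],-6),([e,f,g,u,q],-12),([e,f,g,n,r],52),([e,f,g,l,s],-16),
  ([e,f,f,u,r],-16),([e,f,f,m,s],28),([e,f,f,g,t],-12),([e,e,m,u,u],16),([e,e,m,m,p],-16),([e,e,i,m,r],8),
  ([e,e,g,u,r],-24),([e,e,g,m,s],8),([e,e,g,g,t],8),([d,j,k,l,n],16),([d,j,k,k,u],24),([d,i,k,n,n],-16),
  ([d,i,k,k,p],-24),([d,h,l,n,n],4),([d,h,k,n,u],-24),([d,h,k,l,p],-16),([d,h,i,k,q],28),([d,h,h,l,q],-4),
  ([d,h,h,k,r],12),([d,f,n,n,n],-4),([d,f,k,n,p],40),([d,f,j,k,q],-28),([d,f,h,n,q],4),([d,f,h,k,s],-12),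
  ([d,e,n,n,u],40),([d,e,l,n,p],-28),([d,e,k,u,p],-16),([d,e,j,l,q],6),([d,e,j,k,r],-16),([d,e,i,n,q],-12),
  ([d,e,i,k,s],32),([d,e,h,u,q],-16),([d,e,h,n,r],-12),([d,e,h,l,s],22),([d,e,f,p,q],22),([d,e,f,n,s],-28),
  ([d,e,f,h,t],6),([d,e,e,p,r],16),([d,e,e,u,s],-8),([d,e,e,i,t],-8),([c,j,l,l,n],4),([c,j,k,m,n],-16),
  ([c,j,k,l,u],-24),([c,i,l,n,n],-8),([c,i,k,n,u],56),([c,i,k,l,p],24),([c,i,i,k,q],-28),([c,h,m,n,n],-4),
  ([c,h,l,n,u],24),([c,h,l,l,p],-4),([c,h,k,u,u],-40),([c,h,k,m,p],16),([c,h,i,l,q],-4),([c,h,i,k,r],12),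
  ([c,h,h,m,q],4),([c,h,h,l,r],-12),([c,g,n,n,n],4),([c,g,k,n,p],-40),([c,g,j,k,q],28),([c,g,h,n,q],-4),
  ([c,g,h,k,s],12),([c,f,n,n,u],-16),([c,f,l,n,p],-16),([c,f,k,u,p],48),([c,f,j,l,q],4),([c,f,j,k,r],-12),
  ([c,f,i,n,q],12),([c,f,i,k,s],-36),([c,f,h,u,q],-8),([c,f,h,n,r],12),([c,f,h,l,s],12),([c,f,f,p,q],-4),
  ([c,f,f,n,s],12),([c,f,f,h,t],-8),([c,e,n,u,u],-16),([c,e,m,n,p],28),([c,e,l,u,p],-12),([c,e,j,m,q],-6),
  ([c,e,j,l,r],18),([c,e,i,u,q],28),([c,e,i,n,r],-40),([c,e,i,l,s],-6),([c,e,h,u,r],28),([c,e,h,m,s],-22),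
  ([c,e,g,p,q],-22),([c,e,g,n,s],28),([c,e,g,h,t],-6),([c,e,f,p,r],-6),([c,e,f,u,s],-12),([c,e,f,i,t],18),
  ([c,c,n,n,p],8),([c,c,k,p,p],-12),([c,c,j,n,q],-4),([c,c,j,k,s],12),([c,c,h,p,q],4),([c,c,h,n,s],-12),
  ([c,c,h,h,t],4),([c,c,e,p,s],6),([c,c,e,j,t],-6),([b,j,l,m,n],-28),([b,j,l,l,u],40),([b,j,k,m,u],-16),
  ([b,i,m,n,n],28),([b,i,l,n,u],-24),([b,i,l,l,p],-40),([b,i,k,u,u],32),([b,i,k,m,p],16),([b,i,i,l,q],12),
  ([b,i,i,k,r],-32),([b,h,m,n,u],-12),([b,h,l,u,u],-16),([b,h,l,m,p],28),([b,h,i,m,q],-22),([b,h,i,l,r],28),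
  ([b,h,h,m,r],6),([b,g,n,n,u],-16),([b,g,l,n,p],52),([b,g,k,u,p],-48),([b,g,j,l,q],-12),([b,g,j,k,r],32),
  ([b,g,i,n,q],-6),([b,g,i,k,s],16),([b,g,h,u,q],28),([b,g,h,n,r],-6),([b,g,h,l,s],-40),([b,f,n,u,u],40),
  ([b,f,m,n,p],-16),([b,f,l,u,p],-24),([b,f,j,m,q],22),([b,f,j,l,r],-28),([b,f,i,u,q],-12),([b,f,i,n,r],-16),
  ([b,f,i,l,s],52),([b,f,h,u,r],-12),([b,f,h,m,s],-6),([b,f,g,p,q],-10),([b,f,g,n,s],-8),([b,f,g,h,t],18),
  ([b,f,f,p,r],28),([b,f,f,u,s],-16),([b,f,f,i,t],-12),([b,e,u,u,u],-32),([b,e,m,u,p],32),([b,e,j,m,r],-8),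
  ([b,e,i,u,r],32),([b,e,i,m,s],-24),([b,e,g,p,r],-24),([b,e,g,u,s],32),([b,e,g,i,t],-8),([b,d,n,n,p],-12),
  ([b,d,k,p,p],16),([b,d,j,n,q],6),([b,d,j,k,s],-16),([b,d,h,p,q],-6),([b,d,h,n,s],18),([b,d,h,h,t],-6),
  ([b,d,e,p,s],-8),([b,d,e,j,t],8),([b,c,n,u,p],-12),([b,c,l,p,p],12),([b,c,j,u,q],-16),([b,c,j,n,r],22),
  ([b,c,j,l,s],-12),([b,c,i,p,q],16),([b,c,i,n,s],-10),([b,c,h,p,r],-22),([b,c,h,u,s],28),([b,c,h,i,t],-6),
  ([b,c,f,p,s],-6),([b,c,f,j,t],6),([b,b,u,u,p],16),([b,b,m,p,p],-16),([b,b,j,u,r],-8),([b,b,j,m,s],16),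
  ([b,b,i,p,r],8),([b,b,i,u,s],-24),([b,b,i,i,t],8),([b,b,g,p,s],8),([b,b,g,j,t],-8),([a,j,m,m,n],2),
  ([a,j,l,m,u],-2),([a,i,m,n,u],-6),([a,i,l,u,u],4),([a,i,l,m,p],2),([a,i,i,m,q],3),([a,i,i,l,r],-4),
  ([a,h,m,u,u],2),([a,h,m,m,p],-2),([a,h,i,m,r],1),([a,g,n,u,u],4),([a,g,m,n,p],2),([a,g,l,u,p],-6),
  ([a,g,j,m,q],-3),([a,g,j,l,r],4),([a,g,i,u,q],-3),([a,g,i,n,r],2),([a,g,i,l,s],2),([a,g,h,u,r],-3),
  ([a,g,h,m,s],1),([a,g,g,p,q],3),([a,g,g,n,s],-4),([a,g,g,h,t],1),([a,f,u,u,u],-4),([a,f,m,u,p],4),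
  ([a,f,j,m,r],-1),([a,f,i,u,r],4),([a,f,i,m,s],-3),([a,f,g,p,r],-3),([a,f,g,u,s],4),([a,f,g,i,t],-1),
  ([a,d,n,u,p],-2),([a,d,l,p,p],2),([a,d,j,u,q],3),([a,d,j,n,r],-2),([a,d,j,l,s],-2),([a,d,i,p,q],-3),
  ([a,d,i,n,s],4),([a,d,h,p,r],2),([a,d,h,u,s],-1),([a,d,h,i,t],-1),([a,d,f,p,s],-1),([a,d,f,j,t],1),
  ([a,c,u,u,p],2),([a,c,m,p,p],-2),([a,c,j,u,r],-1),([a,c,j,m,s],2),([a,c,i,p,r],1),([a,c,i,u,s],-3),
  ([a,c,i,i,t],1),([a,c,g,p,s],1),([a,c,g,j,t],-1)])"

definition k235 :: "trm list" where
  "k235 = with_ix (\<lambda>a b c d e f g h i j k l m n u p q r s t. [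
  ([f,g,g,k,k],2),([f,f,g,k,l],-540),([f,f,f,k,m],540),([e,g,g,k,l],646),([e,f,g,l,l],540),([e,f,g,k,m],-650),
  ([e,f,f,l,m],-540),([e,e,g,l,m],-646),([e,e,f,m,m],648),([d,f,i,k,k],-2),([d,f,h,k,l],540),
  ([d,f,f,k,n],-540),([d,e,i,k,l],-646),([d,e,h,l,l],-595),([d,e,f,l,n],650),([d,e,f,k,u],650),
  ([d,e,f,f,q],-55),([d,e,e,l,u],646),([d,e,e,f,r],-648),([c,g,i,k,k],-1),([c,g,h,k,l],-540),([c,f,i,k,l],540),
  ([c,f,h,k,m],-540),([c,f,g,k,n],1080),([c,f,f,k,u],-540),([c,e,i,l,l],54),([c,e,i,k,m],648),
  ([c,e,h,l,m],1188),([c,e,g,l,n],-648),([c,e,g,k,u],-646),([c,e,f,m,n],-648),([c,e,f,l,u],-648),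
  ([c,e,f,g,q],108),([c,e,f,f,r],594),([c,e,e,m,u],-648),([c,e,e,g,r],647),([c,d,j,k,k],1),([c,d,e,n,n],-1),
  ([c,d,e,k,p],-2),([c,d,e,h,q],1),([c,d,e,e,s],1),([c,c,i,k,n],-540),([c,c,h,k,u],540),([c,c,e,n,u],648),
  ([c,c,e,i,q],-54),([c,c,e,h,r],-594),([b,g,i,k,l],-34),([b,g,h,l,l],595),([b,g,h,k,m],578),
  ([b,g,g,k,n],-578),([b,f,i,l,l],-576),([b,f,i,k,m],-540),([b,f,h,l,m],-612),([b,f,g,l,n],-578),
  ([b,f,g,k,u],574),([b,f,f,m,n],612),([b,f,f,l,u],1152),([b,f,f,g,q],-17),([b,f,f,f,r],-576),
  ([b,e,i,l,m],612),([b,e,h,m,m],-612),([b,e,g,m,n],646),([b,e,g,l,u],-578),([b,e,g,g,q],-34),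
  ([b,e,f,m,u],-72),([b,e,f,g,r],38),([b,d,j,k,l],34),([b,d,i,k,n],578),([b,d,h,k,u],-578),([b,d,f,n,n],-36),
  ([b,d,f,k,p],-34),([b,d,f,h,q],36),([b,d,e,n,u],-646),([b,d,e,l,p],-34),([b,d,e,i,q],34),([b,d,e,h,r],612),
  ([b,d,e,f,s],34),([b,c,j,l,l],-18),([b,c,j,k,m],-36),([b,c,i,l,n],576),([b,c,h,l,u],-576),([b,c,g,n,n],37),
  ([b,c,g,k,p],36),([b,c,g,h,q],-37),([b,c,f,n,u],-576),([b,c,f,l,p],36),([b,c,f,h,r],576),([b,c,f,f,s],-18),
  ([b,c,e,u,u],648),([b,c,e,m,p],36),([b,c,e,i,r],-648),([b,c,e,g,s],-36),([b,c,c,n,p],-36),([b,c,c,j,q],18),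
  ([b,c,c,h,s],18),([b,b,i,m,n],-612),([b,b,h,m,u],612),([b,b,g,n,u],578),([b,b,g,i,q],17),([b,b,g,h,r],-595),
  ([b,b,f,u,u],-576),([b,b,f,i,r],576),([b,b,d,n,p],34),([b,b,d,j,q],-17),([b,b,d,h,s],-17),([b,b,c,u,p],-36),
  ([b,b,c,j,r],18),([b,b,c,i,s],18),([a,g,i,l,l],-136),([a,g,h,l,m],-272),([a,g,g,l,n],272),([a,f,i,l,m],540),
  ([a,f,h,m,m],270),([a,f,g,m,n],-268),([a,f,g,l,u],-268),([a,f,g,g,q],-2),([a,f,f,m,u],-540),
  ([a,f,f,g,r],404),([a,e,i,m,m],-459),([a,e,g,m,u],918),([a,e,g,g,r],-459),([a,d,j,l,l],136),
  ([a,d,i,l,n],-272),([a,d,h,l,u],272),([a,d,f,n,u],268),([a,d,f,l,p],-272),([a,d,f,i,q],2),([a,d,f,h,r],-270),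
  ([a,d,f,f,s],136),([a,d,e,u,u],-459),([a,d,e,i,r],459),([a,c,j,l,m],-270),([a,c,i,m,n],270),
  ([a,c,h,m,u],-270),([a,c,g,n,u],-272),([a,c,g,l,p],270),([a,c,g,i,q],1),([a,c,g,h,r],271),([a,c,f,u,u],540),
  ([a,c,f,m,p],270),([a,c,f,i,r],-540),([a,c,f,g,s],-270),([a,c,d,n,p],2),([a,c,d,j,q],-1),([a,c,d,h,s],-1),
  ([a,c,c,u,p],-270),([a,c,c,j,r],135),([a,c,c,i,s],135),([a,b,j,m,m],153),([a,b,g,u,u],-153),
  ([a,b,g,m,p],-306),([a,b,g,i,r],153),([a,b,g,g,s],153),([a,b,d,u,p],306),([a,b,d,j,r],-153),
  ([a,b,d,i,s],-153)])"

lemma n_weight: "inw 3 4 4 n344" by code_simp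
lemma k_weight: "inw 2 3 5 k235" by code_simp

lemma n_nil1: "nil (app [(A1,A2)] n344)" by code_simp
lemma n_nil2: "nil (app [(A2,A3)] n344)" by code_simp
lemma n_nil3: "nil (app [(A1,A0),(A1,A0),(A1,A0)] n344)" by code_simp
lemma n_nil4: "nil (app [(A3,A0),(A3,A0),(A3,A0),(A3,A0)] n344)" by code_simp
lemma n_nil5: "nil (app [(A2,A1),(A2,A1),(A3,A2),(A1,A0),(A1,A0)] n344)" by code_simp
lemma n_ev1: "evq tetra_point (app [(A1,A0)] n344) = 0" by code_simp
lemma n_ev2: "evq tetra_point (app [(A3,A0),(A2,A0)] n344) = 0" by code_simp
lemma n_ev3: "evq tetra_point (app [(A3,A2),(A2,A0),(A2,A0)] n344) = 0" by code_simp
lemma n_ev4: "evq tetra_point (app [(A2,A1),(A3,A0),(A1,A0)] n344) = 0" by code_simp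
lemma n_ev5: "evq tetra_point (app [(A2,A1),(A3,A2),(A2,A0),(A1,A0)] n344) = 0" by code_simp
lemma n_ev6: "evq tetra_point (app [(A3,A1),(A2,A0),(A1,A0)] n344) = 0" by code_simp
lemma n_ev7: "evq tetra_point (app [(A2,A1),(A3,A1),(A1,A0),(A1,A0)] n344) = 0" by code_simp
lemma n_ev8: "evq tetra_point (app [(A2,A0),(A2,A0),(A1,A0)] n344) = 0" by code_simp
lemma n_ev9: "evq tetra_point (app [(A2,A1),(A2,A0),(A1,A0),(A1,A0)] n344) = 0" by code_simp
lemma n_nonzero: "evq [(Ix E0 E0 E0, 1), (Ix E0 E0 E2, 1), (Ix E0 E1 E2, 1), (Ix E1 E2 E0, 1)] (app [(A2,A0),(A1,A0),(A1,A0)] n344) \<noteq> 0" by code_simp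

lemma k_nil1: "nil (app [(A1,A2)] k235)" by code_simp
lemma k_nil2: "nil (app [(A2,A3)] k235)" by code_simp
lemma k_nil3: "nil (app [(A1,A0)] k235)" by code_simp
lemma k_nil4: "nil (app [(A3,A0),(A3,A0),(A3,A0),(A3,A0)] k235)" by code_simp
lemma k_ev1: "evq tetra_point (app [(A3,A2)] k235) = 0" by code_simp
lemma k_ev2: "evq tetra_point (app [(A2,A1),(A3,A2),(A3,A0)] k235) = 0" by code_simp
lemma k_ev3: "evq tetra_point (app [(A2,A1),(A3,A2),(A3,A2),(A2,A0)] k235) = 0" by code_simp
lemma k_ev4: "evq tetra_point (app [(A3,A1),(A3,A0)] k235) = 0" by code_simp
lemma k_ev5: "evq tetra_point (app [(A3,A1),(A3,A2),(A2,A0)] k235) = 0" by code_simp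
lemma k_ev6: "evq tetra_point (app [(A3,A0),(A2,A0)] k235) = 0" by code_simp
lemma k_ev7: "evq tetra_point (app [(A3,A2),(A2,A0),(A2,A0)] k235) = 0" by code_simp
lemma k_nonzero: "evq [(Ix E0 E0 E0, 1), (Ix E0 E0 E2, 1), (Ix E0 E2 E0, 1), (Ix E2 E0 E1, 1)] (app [(A3,A0),(A3,A0),(A2,A0)] k235) \<noteq> 0" by code_simp

section \<open>Submodules generated by highest weight vectors\<close>

subsection \<open>Ordered words in the lowering operators\<close>

definition lw :: "nat \<Rightarrow> nat \<Rightarrow> nat \<Rightarrow> moment_polynomial \<Rightarrow> moment_polynomial" where
  "lw a b c f = (R A2 A1 ^^ a) ((R A3 A1 ^^ b) ((R A3 A2 ^^ c) f))"

lemma lw_add: "lw a b c (f + g) = lw a b c f + lw a b c g"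
  and lw_pscale: "lw a b c (pscale t f) = pscale t (lw a b c f)"
  and lw_0 [simp]: "lw a b c 0 = 0"
  by (simp_all add: lw_def pow_add pow_pscale)

lemma span_image:
  assumes add: "\<And>f g. h (f + g) = h f + h g" and sc: "\<And>t f. h (pscale t f) = pscale t (h f)"
    and G: "\<And>f. f \<in> G \<Longrightarrow> h f \<in> spn H"
  shows "f \<in> spn G \<Longrightarrow> h f \<in> spn H"
proof (induct rule: pvs.span_induct_alt)
  case base
  have "h 0 = h (pscale 0 0)" by simp
  also have "\<dots> = 0" by (subst sc) simp
  finally show ?case by (simp add: pvs.span_zero)
next
  case (step c x y)
  then show ?case by (simp add: add sc pvs.span_add pvs.span_scale G)
qed

text \<open>Moving \<open>R a b\<close> through a power of \<open>R c d\<close> when the bracket is \<open>s R e g\<close> and commutes with \<open>R c d\<close>.\<close>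

lemma R_pow_bracket:
  assumes br: "\<And>h. R a b (R c d h) = R c d (R a b h) + pscale s (R e g h)"
    and co: "\<And>h. R e g (R c d h) = R c d (R e g h)"
  shows "R a b ((R c d ^^ n) f) = (R c d ^^ n) (R a b f) + pscale (of_nat n * s) ((R c d ^^ (n - 1)) (R e g f))"
proof (induct n)
  case (Suc n)
  have e: "R e g ((R c d ^^ n) f) = (R c d ^^ n) (R e g f)" for n by (induct n) (simp_all add: co)
  have "R a b ((R c d ^^ Suc n) f) = R c d (R a b ((R c d ^^ n) f)) + pscale s ((R c d ^^ n) (R e g f))"
    by (simp add: br e)
  also have "R c d (R a b ((R c d ^^ n) f)) = (R c d ^^ Suc n) (R a b f) + pscale (of_nat n * s) ((R c d ^^ n) (R e g f))"
    unfolding Suc by (cases n) (simp_all add: R_add R_pscale)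
  finally show ?case by (simp add: pscale_left_add distrib_right add.assoc)
qed simp

lemma R_bracket:
  assumes "a \<noteq> d \<or> b \<noteq> c"
  shows "R a b (R c d f) = R c d (R a b f) + pscale (of_int (un a d)) (R c b f) - pscale (of_int (un b c)) (R a d f)"
  using R_commute[of a b c d f] by (simp add: algebra_simps)

lemma R_cartan:
  assumes f: "f \<in> wsp i j k" and "a \<noteq> A0" "b \<noteq> A0" "a \<noteq> b"
  shows "\<exists>s. R a b ((R b a ^^ n) f) = (R b a ^^ n) (R a b f) + pscale s ((R b a ^^ (n - 1)) f)"
proof (induct n)
  case 0
  then show ?case by (intro exI[of _ 0]) simp
next
  case (Suc n)
  then obtain s where s: "R a b ((R b a ^^ n) f) = (R b a ^^ n) (R a b f) + pscale s ((R b a ^^ (n - 1)) f)" by blast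
  let ?X = "(R b a ^^ n) f"
  obtain p q where pq: "R b b ?X = pscale p ?X" "R a a ?X = pscale q ?X"
    using R_diag[OF R_pow_wsp[OF f, where a = b and b = a and n = n]] by blast
  have "R a b (R b a ?X) = R b a (R a b ?X) + pscale (p - q) ?X"
    using R_commute[of a b b a ?X] pq by (simp add: un_def algebra_simps pscale_def Const_def single_diff)
  moreover have "R b a (R a b ?X) = (R b a ^^ Suc n) (R a b f) + pscale (if n = 0 then 0 else s) ?X"
  proof (cases n)
    case (Suc m)
    then show ?thesis unfolding s by (simp add: R_add R_pscale)
  qed simp
  ultimately have "R a b ((R b a ^^ Suc n) f) = (R b a ^^ Suc n) (R a b f) + pscale ((if n = 0 then 0 else s) + (p - q)) ?X"
    by (simp add: pscale_left_add add.assoc)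
  then show ?case by (intro exI[of _ "(if n = 0 then 0 else s) + (p - q)"]) simp
qed

definition Q :: "moment_polynomial set \<Rightarrow> moment_polynomial set" where
  "Q Z = spn {lw a b c z | a b c z. z \<in> Z}"

definition weighted :: "moment_polynomial set \<Rightarrow> bool" where
  "weighted Z \<longleftrightarrow> (\<forall>z\<in>Z. \<exists>i j k. z \<in> wsp i j k)"

lemma lw_wsp: "f \<in> wsp i j k \<Longrightarrow> lw a b c f \<in> wsp (i + int a + int b) (j - int a + int c) (k - int b - int c)"
proof -
  assume f: "f \<in> wsp i j k"
  have "(R A3 A2 ^^ c) f \<in> wsp i (j + int c) (k - int c)"
    by (rule wsp_cast[OF R_pow_wsp[OF f, where a = A3 and b = A2 and n = c]]) (simp_all add: un_def)
  then have "(R A3 A1 ^^ b) ((R A3 A2 ^^ c) f) \<in> wsp (i + int b) (j + int c) (k - int b - int c)"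
    by (intro wsp_cast[OF R_pow_wsp[where a = A3 and b = A1 and n = b]]) (simp_all add: un_def)
  then show ?thesis unfolding lw_def
    by (intro wsp_cast[OF R_pow_wsp[where a = A2 and b = A1 and n = a]]) (simp_all add: un_def)
qed

lemma lw_in_Q: "f \<in> spn Z \<Longrightarrow> lw a b c f \<in> Q Z"
  unfolding Q_def by (rule span_image[of "lw a b c"]) (auto simp: lw_add lw_pscale intro!: pvs.span_base)

lemma Q_base: "z \<in> Z \<Longrightarrow> lw a b c z \<in> Q Z"
  by (rule lw_in_Q[OF pvs.span_base])

lemma Q_mem: "z \<in> Z \<Longrightarrow> z \<in> Q Z"
  using Q_base[of z Z 0 0 0] by (simp add: lw_def)

lemma Q_subspace: "pvs.subspace (Q Z)" by (simp add: Q_def pvs.subspace_span)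

lemmas Q_add = pvs.subspace_add[OF Q_subspace] and Q_scale = pvs.subspace_scale[OF Q_subspace]
  and Q_diff = pvs.subspace_diff[OF Q_subspace]

lemma Q_closed:
  assumes "\<And>x y z w. w \<in> Z \<Longrightarrow> R a b (lw x y z w) \<in> Q Z" and "f \<in> Q Z"
  shows "R a b f \<in> Q Z"
  unfolding Q_def
  by (rule span_image[of "R a b", OF R_add R_pscale _ assms(2)[unfolded Q_def]]) (use assms(1) in \<open>auto simp: Q_def\<close>)

lemma lw_R21: "R A2 A1 (lw a b c f) = lw (Suc a) b c f"
  by (simp add: lw_def)

lemma lw_R31: "R A3 A1 (lw a b c f) = lw a (Suc b) c f"
  by (simp add: lw_def R_comm_pow)

lemma lw_R32: "R A3 A2 (lw a b c f) = lw a b (Suc c) f - pscale (of_nat a) (lw (a - 1) (Suc b) c f)"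
proof -
  have "R A3 A2 ((R A2 A1 ^^ a) h) = (R A2 A1 ^^ a) (R A3 A2 h) + pscale (of_nat a * (- 1)) ((R A2 A1 ^^ (a - 1)) (R A3 A1 h))" for h
    by (rule R_pow_bracket) (simp_all add: R_bracket[of A3 A1 A2 A2] un_def R_comm pscale_m1)
  note br = this
  define X where "X = (R A3 A1 ^^ b) ((R A3 A2 ^^ c) f)"
  have 1: "R A3 A2 X = (R A3 A1 ^^ b) ((R A3 A2 ^^ Suc c) f)" unfolding X_def by (subst R_comm_pow) simp_all
  have 2: "R A3 A1 X = (R A3 A1 ^^ Suc b) ((R A3 A2 ^^ c) f)" by (simp add: X_def)
  have 3: "R A3 A2 (lw a b c f) = R A3 A2 ((R A2 A1 ^^ a) X)" by (simp add: lw_def X_def)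
  show ?thesis unfolding 3 br 1 2 by (simp add: lw_def)
qed

lemma lw_R12:
  assumes f: "f \<in> wsp i j k"
  shows "\<exists>s. R A1 A2 (lw a b c f) = lw a b c (R A1 A2 f) + pscale (of_nat b) (lw a (b - 1) (Suc c) f) + pscale s (lw (a - 1) b c f)"
proof -
  let ?Y = "(R A3 A1 ^^ b) ((R A3 A2 ^^ c) f)"
  have Y: "?Y \<in> wsp (i + int b) (j + int c) (k - int b - int c)"
    using lw_wsp[OF f, of 0 b c] by (simp add: lw_def)
  obtain s where s: "R A1 A2 ((R A2 A1 ^^ a) ?Y) = (R A2 A1 ^^ a) (R A1 A2 ?Y) + pscale s ((R A2 A1 ^^ (a - 1)) ?Y)"
    using R_cartan[OF Y, of A1 A2 a] by auto
  have "R A1 A2 ((R A3 A1 ^^ b) h) = (R A3 A1 ^^ b) (R A1 A2 h) + pscale (of_nat b * 1) ((R A3 A1 ^^ (b - 1)) (R A3 A2 h))" for h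
    by (rule R_pow_bracket) (simp_all add: R_bracket[of A1 A1 A2 A3] un_def R_comm)
  then have "R A1 A2 ?Y = (R A3 A1 ^^ b) ((R A3 A2 ^^ c) (R A1 A2 f)) + pscale (of_nat b) ((R A3 A1 ^^ (b - 1)) ((R A3 A2 ^^ Suc c) f))"
    by (simp add: R_comm_pow)
  then show ?thesis using s
    by (intro exI[of _ s]) (simp add: lw_def pow_add pow_pscale)
qed

lemma lw_R23:
  assumes f: "f \<in> wsp i j k"
  shows "\<exists>s. R A2 A3 (lw a b c f) = lw a b c (R A2 A3 f) - pscale (of_nat b) (lw (Suc a) (b - 1) c f) + pscale s (lw a b (c - 1) f)"
proof -
  obtain s where s: "R A2 A3 ((R A3 A2 ^^ c) f) = (R A3 A2 ^^ c) (R A2 A3 f) + pscale s ((R A3 A2 ^^ (c - 1)) f)"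
    using R_cartan[OF f, of A2 A3 c] by auto
  have "R A2 A3 ((R A3 A1 ^^ b) h) = (R A3 A1 ^^ b) (R A2 A3 h) + pscale (of_nat b * (- 1)) ((R A3 A1 ^^ (b - 1)) (R A2 A1 h))" for h
    by (rule R_pow_bracket) (simp_all add: R_bracket[of A2 A1 A3 A3] un_def R_comm pscale_m1)
  then have "R A2 A3 ((R A3 A1 ^^ b) ((R A3 A2 ^^ c) f)) = (R A3 A1 ^^ b) ((R A3 A2 ^^ c) (R A2 A3 f)) +
      pscale s ((R A3 A1 ^^ b) ((R A3 A2 ^^ (c - 1)) f)) - pscale (of_nat b) (R A2 A1 ((R A3 A1 ^^ (b - 1)) ((R A3 A2 ^^ c) f)))"
    by (simp add: s pow_add pow_pscale R_comm_pow[of A2 A1 A1 A3])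
  then show ?thesis
    by (intro exI[of _ s]) (simp add: lw_def R_comm_pow[of A2 A1 A3 A2] pow_add pow_minus pow_pscale pow_shift)
qed

lemma lw_D3: "D3 (lw a b c f) = lw a b c (D3 f)"
  by (simp add: lw_def R_comm_pow)

lemma D_pow_lower:
  "D1 ((R A2 A1 ^^ a) h) = (R A2 A1 ^^ a) (D1 h) + pscale (of_nat a) ((R A2 A1 ^^ (a - 1)) (D2 h))"
  "D1 ((R A3 A1 ^^ a) h) = (R A3 A1 ^^ a) (D1 h) + pscale (of_nat a) ((R A3 A1 ^^ (a - 1)) (D3 h))"
  "D2 ((R A3 A2 ^^ a) h) = (R A3 A2 ^^ a) (D2 h) + pscale (of_nat a) ((R A3 A2 ^^ (a - 1)) (D3 h))"
proof -
  have b: "D1 (R A2 A1 h) = R A2 A1 (D1 h) + pscale 1 (D2 h)" "D1 (R A3 A1 h) = R A3 A1 (D1 h) + pscale 1 (D3 h)"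
    "D2 (R A3 A2 h) = R A3 A2 (D2 h) + pscale 1 (D3 h)" for h
    using R_bracket_D[of A2 A1 h] R_bracket_D[of A3 A1 h] R_bracket_D[of A3 A2 h] by simp_all
  have c: "D2 (R A2 A1 h) = R A2 A1 (D2 h)" "D3 (R A3 A1 h) = R A3 A1 (D3 h)" "D3 (R A3 A2 h) = R A3 A2 (D3 h)" for h
    by (rule R_comm, simp, simp)+
  show "D1 ((R A2 A1 ^^ a) h) = (R A2 A1 ^^ a) (D1 h) + pscale (of_nat a) ((R A2 A1 ^^ (a - 1)) (D2 h))"
    using R_pow_bracket[OF b(1) c(1), of a h] by simp
  show "D1 ((R A3 A1 ^^ a) h) = (R A3 A1 ^^ a) (D1 h) + pscale (of_nat a) ((R A3 A1 ^^ (a - 1)) (D3 h))"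
    using R_pow_bracket[OF b(2) c(2), of a h] by simp
  show "D2 ((R A3 A2 ^^ a) h) = (R A3 A2 ^^ a) (D2 h) + pscale (of_nat a) ((R A3 A2 ^^ (a - 1)) (D3 h))"
    using R_pow_bracket[OF b(3) c(3), of a h] by simp
qed

lemma lw_D2: "D2 (lw a b c f) = lw a b c (D2 f) + pscale (of_nat c) (lw a b (c - 1) (D3 f))"
  by (simp add: lw_def R_comm_pow D_pow_lower pow_add pow_pscale)

lemma lw_D1: "D1 (lw a b c f) = lw a b c (D1 f) + pscale (of_nat b) (lw a (b - 1) c (D3 f)) + pscale (of_nat a) (D2 (lw (a - 1) b c f))"
proof -
  have "(R A2 A1 ^^ n) (D2 h) = D2 ((R A2 A1 ^^ n) h)" for n h by (rule R_comm_pow[symmetric]) auto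
  then show ?thesis by (simp add: lw_def R_comm_pow D_pow_lower pow_add pow_pscale)
qed

lemma Q_cmp:
  assumes Z: "weighted Z" and f: "f \<in> Q Z"
  shows "cmp i j k f \<in> spn {lw a b c z | a b c z. z \<in> Z \<and> lw a b c z \<in> wsp i j k}"
proof (rule span_image[of "cmp i j k", OF cmp_add cmp_pscale _ f[unfolded Q_def]])
  fix f assume "f \<in> {lw a b c z | a b c z. z \<in> Z}"
  then obtain a b c z where f: "f = lw a b c z" "z \<in> Z" by blast
  then obtain i' j' k' where w: "f \<in> wsp i' j' k'" using Z lw_wsp unfolding weighted_def by blast
  show "cmp i j k f \<in> spn {lw a b c z | a b c z. z \<in> Z \<and> lw a b c z \<in> wsp i j k}"
  proof (cases "(i', j', k') = (i, j, k)")
    case True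
    then show ?thesis using w f cmp_id[OF w] by (auto intro!: pvs.span_base)
  next
    case False
    then show ?thesis using cmp_other[OF w False] by (simp add: pvs.span_zero)
  qed
qed

lemma Q_forms: "weighted Z \<Longrightarrow> Q Z \<subseteq> forms 5"
proof -
  assume Z: "weighted Z"
  have "{lw a b c z | a b c z. z \<in> Z} \<subseteq> forms 5"
    using Z lw_wsp wsp_forms unfolding weighted_def by blast
  then show ?thesis unfolding Q_def by (rule pvs.span_minimal[OF _ subspace_forms])
qed

lemma Q_gstab:
  assumes Z: "weighted Z" and r: "\<And>z. z \<in> Z \<Longrightarrow> R A1 A2 z \<in> spn Z" "\<And>z. z \<in> Z \<Longrightarrow> R A2 A3 z \<in> spn Z"
  shows "gstab (Q Z)"
proof -
  have w: "\<exists>i j k. z \<in> wsp i j k" if "z \<in> Z" for z using Z that by (auto simp: weighted_def)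
  have l: "R A2 A1 f \<in> Q Z" "R A3 A1 f \<in> Q Z" "R A3 A2 f \<in> Q Z" if "f \<in> Q Z" for f
    by (rule Q_closed[OF _ that], simp add: lw_R21 lw_R31 lw_R32 Q_base Q_diff Q_scale)+
  have u12: "R A1 A2 f \<in> Q Z" if "f \<in> Q Z" for f
  proof (rule Q_closed[OF _ that])
    fix x y z w assume h: "w \<in> Z"
    then obtain i j k where "w \<in> wsp i j k" using w by blast
    from lw_R12[OF this, of x y z] show "R A1 A2 (lw x y z w) \<in> Q Z"
      using r(1)[OF h] pvs.span_base[OF h] by (auto intro!: Q_add Q_scale lw_in_Q)
  qed
  have u23: "R A2 A3 f \<in> Q Z" if "f \<in> Q Z" for f
  proof (rule Q_closed[OF _ that])
    fix x y z w assume h: "w \<in> Z"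
    then obtain i j k where "w \<in> wsp i j k" using w by blast
    from lw_R23[OF this, of x y z] show "R A2 A3 (lw x y z w) \<in> Q Z"
      using r(2)[OF h] pvs.span_base[OF h] by (auto intro!: Q_add Q_diff Q_scale lw_in_Q)
  qed
  have u13: "R A1 A3 f \<in> Q Z" if "f \<in> Q Z" for f
  proof -
    have "R A1 A3 f = R A2 A3 (R A1 A2 f) - R A1 A2 (R A2 A3 f)"
      using R_commute[of A1 A2 A2 A3 f] by (simp add: un_def algebra_simps)
    then show ?thesis using u12 u23 that Q_diff by metis
  qed
  have "R a b f \<in> Q Z" if "f \<in> Q Z" "a \<noteq> A0" "b \<noteq> A0" "a \<noteq> b" for f a b
    using that l u12 u23 u13 by (cases a; cases b) auto
  moreover have "cmp i j k f \<in> Q Z" if "f \<in> Q Z" for f i j k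
    using Q_cmp[OF Z that, of i j k] pvs.span_mono[of "{lw a b c z | a b c z. z \<in> Z \<and> lw a b c z \<in> wsp i j k}" "{lw a b c z | a b c z. z \<in> Z}"]
    by (auto simp: Q_def)
  ultimately show ?thesis using Q_subspace Q_forms[OF Z] by (auto simp: gstab_def)
qed

lemma Q_astab:
  assumes Z: "weighted Z" and r: "\<And>z. z \<in> Z \<Longrightarrow> R A1 A2 z \<in> spn Z" "\<And>z. z \<in> Z \<Longrightarrow> R A2 A3 z \<in> spn Z"
    and d: "\<And>z a. z \<in> Z \<Longrightarrow> a \<noteq> A0 \<Longrightarrow> R a A0 z \<in> spn Z"
  shows "astab (Q Z)"
proof -
  have d3: "D3 f \<in> Q Z" if "f \<in> Q Z" for f
    by (rule Q_closed[OF _ that]) (simp add: lw_D3 lw_in_Q d)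
  have d2: "D2 f \<in> Q Z" if "f \<in> Q Z" for f
    by (rule Q_closed[OF _ that]) (simp add: lw_D2 lw_in_Q d Q_add Q_scale)
  have d1: "D1 f \<in> Q Z" if "f \<in> Q Z" for f
    by (rule Q_closed[OF _ that]) (simp add: lw_D1 lw_in_Q d Q_add Q_scale d2 Q_base)
  have "R a A0 f \<in> Q Z" if "f \<in> Q Z" "a \<noteq> A0" for f a
    using that d1 d2 d3 by (cases a) auto
  then show ?thesis using Q_gstab[OF Z r] by (auto simp: astab_def)
qed

definition Wg :: "moment_polynomial \<Rightarrow> moment_polynomial set" where
  "Wg v = Q {F3 z y x v | x y z. True}"

definition Lm :: "moment_polynomial \<Rightarrow> moment_polynomial set" where
  "Lm v = Q {v}"

lemma Lm_gstab: "v \<in> wsp i j k \<Longrightarrow> hw v \<Longrightarrow> gstab (Lm v)"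
  unfolding Lm_def by (rule Q_gstab) (auto simp: weighted_def hw_def pvs.span_zero)

lemma F3_D:
  "D1 (F3 a b c v) = F3 a b (Suc c) v" "D2 (F3 a b c v) = F3 a (Suc b) c v" "D3 (F3 a b c v) = F3 (Suc a) b c v"
  by (simp_all add: F3_def R_comm_pow)

lemma F3_R12: "hw v \<Longrightarrow> R A1 A2 (F3 a b c v) = - pscale (of_nat b) (F3 a (b - 1) (Suc c) v)"
  using R_pow_D[of A1 A2 b "(D1 ^^ c) v"] hw_D1_pow[of v c]
  by (simp add: F3_def R_comm_pow[of A1 A0 A2 A3] hw_def pow_uminus pow_pscale)

lemma F3_R23: "hw v \<Longrightarrow> R A2 A3 (F3 a b c v) = - pscale (of_nat a) (F3 (a - 1) (Suc b) c v)"
proof -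
  assume v: "hw v"
  have "R A2 A3 ((D2 ^^ b) ((D1 ^^ c) v)) = 0" using v by (simp add: R_comm_pow hw_def)
  then show ?thesis using R_pow_D[of A2 A3 a "(D2 ^^ b) ((D1 ^^ c) v)"] by (simp add: F3_def)
qed

lemma Wg_astab: "v \<in> wsp i j k \<Longrightarrow> hw v \<Longrightarrow> astab (Wg v)"
proof -
  assume v: "v \<in> wsp i j k" "hw v"
  let ?Z = "{F3 z y x v | x y z. True}"
  have b: "F3 a b c v \<in> spn ?Z" for a b c by (rule pvs.span_base) blast
  show ?thesis unfolding Wg_def
  proof (rule Q_astab)
    show "weighted ?Z" using F3_wsp[OF v(1)] unfolding weighted_def by blast
    show "R A1 A2 z \<in> spn ?Z" if "z \<in> ?Z" for z
      using that b by (auto simp: F3_R12[OF v(2)] intro!: pvs.span_neg pvs.span_scale)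
    show "R A2 A3 z \<in> spn ?Z" if "z \<in> ?Z" for z
      using that b by (auto simp: F3_R23[OF v(2)] intro!: pvs.span_neg pvs.span_scale)
    show "R a A0 z \<in> spn ?Z" if "z \<in> ?Z" "a \<noteq> A0" for z a
      using that b by (cases a) (auto simp: F3_D)
  qed
qed

lemma F3_vanish:
  assumes v: "hw v" and z: "(D3 ^^ 4) v = 0" and n: "4 \<le> a + b + c"
  shows "F3 a b c v = 0"
proof -
  have s23: "F3 (a - 1) (Suc b) c v = 0" if "F3 a b c v = 0" "0 < a" for a b c
  proof -
    have "pscale (of_nat a) (F3 (a - 1) (Suc b) c v) = 0" using F3_R23[OF v, of a b c] that(1) by simp
    then show ?thesis using that(2) by (simp add: pvs.scale_eq_0_iff)
  qed
  have s12: "F3 a (b - 1) (Suc c) v = 0" if "F3 a b c v = 0" "0 < b" for a b c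
  proof -
    have "pscale (of_nat b) (F3 a (b - 1) (Suc c) v) = 0" using F3_R12[OF v, of a b c] that(1) by simp
    then show ?thesis using that(2) by (simp add: pvs.scale_eq_0_iff)
  qed
  have base: "F3 m 0 0 v = 0" if "4 \<le> m" for m
  proof -
    have "(D3 ^^ (m - 4 + 4)) v = (D3 ^^ (m - 4)) ((D3 ^^ 4) v)" by (simp only: funpow_add o_apply)
    then show ?thesis using that z by (simp add: F3_def)
  qed
  have st1: "F3 (m - b) b 0 v = 0" if "4 \<le> m" "b \<le> m" for m b
    using that(2)
  proof (induct b)
    case 0 then show ?case using base that by simp
  next
    case (Suc b)
    then show ?case using s23[of "m - b" b 0] by simp
  qed
  have "F3 a (m - c) c v = 0" if "4 \<le> a + m" "c \<le> m" for a m c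
    using that(2)
  proof (induct c)
    case 0 then show ?case using st1[of "a + m" m] that by simp
  next
    case (Suc c)
    then show ?case using s12[of a "m - c" c] by simp
  qed
  from this[of a "b + c" c] n show ?thesis by simp
qed

subsection \<open>The symmetries of the regular tetrahedron\<close>

lemma pt_centred:
  assumes "\<And>l. (\<Sum>k\<in>UNIV. X $ k $ l) = 0"
  shows "pt X I = of_real (1 / 40) * (\<Sum>k\<in>UNIV. meval (($) (X $ k)) I) +
    of_real (9 / 40) * (\<Sum>k\<in>UNIV. meval (\<lambda>l. - of_real (1 / 3) * X $ k $ l) I)"
proof -
  have "of_real (1 / 3) * (\<Sum>j\<in>UNIV - {k}. X $ j $ l) = - of_real (1 / 3) * X $ k $ l" for k l
    using assms[of l] by (simp add: sum_diff1)
  then show ?thesis by (simp only: pt_def cub_def)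
qed

lemma ell_symmetry:
  assumes f: "f \<in> forms 5" and p: "bij p" and X: "\<And>k l. xact A 0 X0 $ k $ l = X0 $ p k $ l"
  shows "ip (act A 0 f) (ell ^ 5) = ip f (ell ^ 5)"
proof -
  have s0: "(\<Sum>k\<in>UNIV. X0 $ k $ l) = 0" for l
    using three_cases[of l] by (elim disjE) (simp_all add: X0_def em_def sum_4)
  have s1: "(\<Sum>k\<in>UNIV. xact A 0 X0 $ k $ l) = 0" for l
    unfolding X using sum.reindex_bij_betw[OF p, of "\<lambda>k. X0 $ k $ l"] s0 by simp
  have x: "($) (xact A 0 X0 $ k) = ($) (X0 $ p k)" for k by (rule ext) (rule X)
  have "pt (xact A 0 X0) I = pt X0 I" for I
    unfolding pt_centred[of "xact A 0 X0", OF s1] pt_centred[of X0, OF s0] X x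
    using sum.reindex_bij_betw[OF p, of "\<lambda>k. meval (($) (X0 $ k)) I"]
      sum.reindex_bij_betw[OF p, of "\<lambda>k. meval (\<lambda>l. - of_real (1 / 3) * X0 $ k $ l) I"] by simp
  then have "pt (xact A 0 X0) = pt X0" by (rule ext)
  then have "peval id (pt X0) (act A 0 f) = peval id (pt X0) f" by (simp add: pt_act)
  then show ?thesis using ip_ell[OF f] ip_ell[OF act_forms[OF f]] peval_p0[OF f] peval_p0[OF act_forms[OF f]] by simp
qed

lemma ell_signs:
  assumes f: "f \<in> wsp i j k" and nn: "0 \<le> i" "0 \<le> j" "0 \<le> k" and odd: "odd (i + j) \<or> odd (j + k)"
  shows "ip f (ell ^ 5) = 0"
proof -
  have main: "ip f (ell ^ 5) = 0" if t: "t $ 1 ^ nat i * t $ 2 ^ nat j * t $ 3 ^ nat k = - 1"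
    "bij p" "\<And>k l. of_real (t $ l) * X0 $ k $ l = X0 $ p k $ l" for t and p :: "4 \<Rightarrow> 4"
  proof -
    have "ip (act (diag_mat t) 0 f) (ell ^ 5) = ip f (ell ^ 5)"
    proof (rule ell_symmetry[OF wsp_forms[OF f] t(2)])
      show "xact (diag_mat t) 0 X0 $ k $ l = X0 $ p k $ l" for k l
        unfolding t(3)[symmetric] using three_cases[of l] by (elim disjE) (simp_all add: xact_def diag_mat_def sum_3)
    qed
    then have e: "- ip f (ell ^ 5) = ip f (ell ^ 5)"
      by (simp add: act_diag_wsp[OF f] t(1) ip_pscale_left ip_uminus_left del: of_real_mult of_real_power)
    have "2 * ip f (ell ^ 5) = 0" by (metis e mult_2 add.right_inverse)
    then show ?thesis by simp
  qed
  define p12 :: "4 \<Rightarrow> 4" where "p12 k = (if k = 1 then 2 else if k = 2 then 1 else if k = 3 then 4 else 3)" for k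
  define p23 :: "4 \<Rightarrow> 4" where "p23 k = (if k = 1 then 4 else if k = 4 then 1 else if k = 2 then 3 else 2)" for k
  have b: "bij p12" "bij p23"
    by (rule involuntory_imp_bij, use exhaust_4 in \<open>force simp: p12_def p23_def\<close>)+
  from odd show ?thesis
  proof
    assume "odd (i + j)"
    then have "odd (nat i + nat j)" using nn by (metis even_nat_iff nat_add_distrib add_nonneg_nonneg)
    then have "(- 1 :: real) ^ (nat i + nat j) = - 1" by simp
    then show ?thesis
      by (intro main[of "\<chi> l. if l = 3 then 1 else - 1" p12] b)
        (use exhaust_4 three_cases in \<open>auto simp: power_add X0_def p12_def em_def\<close>)
  next
    assume "odd (j + k)"
    then have "odd (nat j + nat k)" using nn by (metis even_nat_iff nat_add_distrib add_nonneg_nonneg)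
    then have "(- 1 :: real) ^ (nat j + nat k) = - 1" by simp
    then show ?thesis
      by (intro main[of "\<chi> l. if l = 1 then 1 else - 1" p23] b)
        (use exhaust_4 three_cases in \<open>auto simp: power_add X0_def p23_def em_def\<close>)
  qed
qed

definition pmat :: "(3 \<Rightarrow> 3) \<Rightarrow> real^3^3" where
  "pmat s = (\<chi> l k. of_bool (k = s l))"

lemma wsp_eigen:
  assumes g: "g \<in> forms 5" and nn: "0 \<le> i" "0 \<le> j" "0 \<le> k"
    and e: "\<And>t. act (diag_mat t) 0 g = pscale (of_real (t $ 1 ^ nat i * t $ 2 ^ nat j * t $ 3 ^ nat k)) g"
  shows "g \<in> wsp i j k"
proof -
  have l: "lkp (act (diag_mat t) 0 g) m = lkp g m * of_real (t $ 1 ^ nat (wt m A1) * t $ 2 ^ nat (wt m A2) * t $ 3 ^ nat (wt m A3))" for t m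
    unfolding act_diag lookup_sum by (auto simp: lookup_single "when_def" sum.delta in_keys_iff)
  have q: "t $ 1 ^ nat (wt m A1) * t $ 2 ^ nat (wt m A2) * t $ 3 ^ nat (wt m A3) = t $ 1 ^ nat i * t $ 2 ^ nat j * t $ 3 ^ nat k"
    if "m \<in> kys g" for m and t :: "real^3"
  proof -
    have "lkp g m * of_real (t $ 1 ^ nat (wt m A1) * t $ 2 ^ nat (wt m A2) * t $ 3 ^ nat (wt m A3)) =
      of_real (t $ 1 ^ nat i * t $ 2 ^ nat j * t $ 3 ^ nat k) * lkp g m"
      using arg_cong[OF e[of t], of "\<lambda>h. lkp h m"] unfolding l lookup_pscale .
    then show ?thesis using that by (simp add: in_keys_iff del: of_real_mult of_real_power)
  qed
  have "wt m A1 = i \<and> wt m A2 = j \<and> wt m A3 = k" if m: "m \<in> kys g" for m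
  proof -
    have two: "(2::real) ^ a = 2 ^ b \<longleftrightarrow> a = b" for a b by simp
    have "nat (wt m A1) = nat i" using q[OF m, of "\<chi> l. if l = 1 then 2 else 1"] by (simp add: two)
    moreover have "nat (wt m A2) = nat j" using q[OF m, of "\<chi> l. if l = 2 then 2 else 1"] by (simp add: two)
    moreover have "nat (wt m A3) = nat k" using q[OF m, of "\<chi> l. if l = 3 then 2 else 1"] by (simp add: two)
    ultimately show ?thesis using nn wt_nonneg[of m] by (metis int_nat_eq nat_eq_iff2 nat_0_le)
  qed
  then show ?thesis using g by (simp add: wsp_def)
qed

definition sw3 :: "3 \<Rightarrow> 3 \<Rightarrow> 3 \<Rightarrow> 3" where
  "sw3 a b l = (if l = a then b else if l = b then a else l)"

lemma pmat_commute: "pmat s ** diag_mat t = diag_mat (\<chi> l. t $ s l) ** pmat s"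
proof -
  have "(pmat s ** diag_mat t) $ i $ j = (diag_mat (\<chi> l. t $ s l) ** pmat s) $ i $ j" for i j
  proof -
    have "(pmat s ** diag_mat t) $ i $ j = (\<Sum>k\<in>UNIV. of_bool (k = s i) * (if k = j then t $ k else 0))"
      by (simp add: matrix_matrix_mult_def pmat_def diag_mat_def)
    also have "\<dots> = of_bool (j = s i) * t $ j" by (simp add: if_distrib sum.delta cong: if_cong)
    also have "\<dots> = t $ s i * of_bool (j = s i)" by (cases "j = s i") simp_all
    also have "\<dots> = (\<Sum>k\<in>UNIV. (if k = i then t $ s i * of_bool (j = s i) else 0))" by simp
    also have "\<dots> = (\<Sum>k\<in>UNIV. (if i = k then t $ s i else 0) * of_bool (j = s k))" by (rule sum.cong) auto
    finally show ?thesis by (simp add: matrix_matrix_mult_def pmat_def diag_mat_def)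
  qed
  then show ?thesis by (simp add: vec_eq_iff)
qed

lemma act_pmat_wsp:
  assumes f: "f \<in> wsp i j k" and nn: "0 \<le> i" "0 \<le> j" "0 \<le> k"
  shows "act (pmat (sw3 1 2)) 0 f \<in> wsp j i k" "act (pmat (sw3 2 3)) 0 f \<in> wsp i k j"
proof -
  have "act (diag_mat t) 0 (act (pmat s) 0 f) = pscale (of_real (t $ s 1 ^ nat i * t $ s 2 ^ nat j * t $ s 3 ^ nat k)) (act (pmat s) 0 f)" for t s
  proof -
    have "act (diag_mat t) 0 (act (pmat s) 0 f) = act (pmat s) 0 (act (diag_mat (\<chi> l. t $ s l)) 0 f)"
      by (simp add: act_act pmat_commute)
    then show ?thesis by (simp add: act_diag_wsp[OF f] act_pscale del: of_real_mult of_real_power)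
  qed
  note e = this
  show "act (pmat (sw3 1 2)) 0 f \<in> wsp j i k"
    by (rule wsp_eigen[OF act_forms[OF wsp_forms[OF f]] nn(2,1,3)]) (use e[of _ "sw3 1 2"] in \<open>simp add: sw3_def mult_ac\<close>)
  show "act (pmat (sw3 2 3)) 0 f \<in> wsp i k j"
    by (rule wsp_eigen[OF act_forms[OF wsp_forms[OF f]] nn(1,3,2)]) (use e[of _ "sw3 2 3"] in \<open>simp add: sw3_def mult_ac\<close>)
qed

lemma pmat_square: "pmat (sw3 a b) ** pmat (sw3 a b) = mat 1"
proof -
  have i: "sw3 a b (sw3 a b l) = l" for l by (auto simp: sw3_def)
  have "(pmat (sw3 a b) ** pmat (sw3 a b)) $ i $ j = mat 1 $ i $ j" for i j
  proof -
    have "(pmat (sw3 a b) ** pmat (sw3 a b)) $ i $ j = (\<Sum>k\<in>UNIV. of_bool (k = sw3 a b i) * of_bool (j = sw3 a b k))"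
      by (simp add: matrix_matrix_mult_def pmat_def)
    also have "\<dots> = (\<Sum>k\<in>UNIV. if k = sw3 a b i then of_bool (j = i) else 0)"
      by (rule sum.cong) (auto simp: i)
    also have "\<dots> = of_bool (j = i)" by simp
    finally show ?thesis by (auto simp: mat_def)
  qed
  then show ?thesis by (simp add: vec_eq_iff)
qed

lemma pmat_invertible: "invertible (pmat (sw3 a b))"
  using pmat_square unfolding invertible_def by blast

lemma act_pmat_ell:
  assumes "f \<in> forms 5" "(a, b) = (1, 2) \<or> (a, b) = (2, 3)"
  shows "ip (act (pmat (sw3 a b)) 0 f) (ell ^ 5) = ip f (ell ^ 5)"
proof -
  define p :: "4 \<Rightarrow> 4" where "p k = (if k = em a then em b else if k = em b then em a else k)" for k
  have "bij p" by (rule involuntory_imp_bij) (auto simp: p_def)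
  then show ?thesis
  proof (rule ell_symmetry[OF assms(1)])
    fix k l
    have "of_real (pmat (sw3 a b) $ l $ j) * X0 $ k $ j = (if j = sw3 a b l then X0 $ k $ j else 0)" for j
      by (simp add: pmat_def)
    then have "xact (pmat (sw3 a b)) 0 X0 $ k $ l = X0 $ k $ sw3 a b l" by (simp add: xact_def)
    then show "xact (pmat (sw3 a b)) 0 X0 $ k $ l = X0 $ p k $ l"
      using assms(2) exhaust_4[of k] three_cases[of l] by (elim disjE) (simp_all add: X0_def sw3_def p_def em_def)
  qed
qed

lemma ell_sorted:
  assumes W: "astab W" and z: "\<And>i j k f. f \<in> W \<Longrightarrow> f \<in> wsp i j k \<Longrightarrow> 0 \<le> i \<Longrightarrow> i \<le> j \<Longrightarrow> j \<le> k \<Longrightarrow> even (i + j) \<Longrightarrow> even (j + k) \<Longrightarrow> ip f (ell ^ 5) = 0"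
    and f: "f \<in> W"
  shows "ip f (ell ^ 5) = 0"
proof -
  have aW: "act (pmat (sw3 a b)) 0 f \<in> W" if "f \<in> W" for f a b
  proof -
    have "act (pmat (sw3 a b)) 0 ` W \<subseteq> W"
      using astab_aff_submodule[OF W] pmat_invertible unfolding aff_submodule_def by blast
    then show ?thesis using that by blast
  qed
  have w: "ip f (ell ^ 5) = 0" if "f \<in> W" "f \<in> wsp i j k" for f i j k
    using that
  proof (induct "nat (2 * i + j)" arbitrary: f i j k rule: less_induct)
    case less
    show ?case
    proof (cases "f = 0")
      case False
      have nn: "0 \<le> i" "0 \<le> j" "0 \<le> k" using wsp_nonneg[OF less(3) False] by auto
      consider "odd (i + j) \<or> odd (j + k)" | "j < i" | "k < j" | "i \<le> j" "j \<le> k" "even (i + j)" "even (j + k)" by linarith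
      then show ?thesis
      proof cases
        case 1
        then show ?thesis using ell_signs[OF less(3) nn] by blast
      next
        case 2
        have "ip (act (pmat (sw3 1 2)) 0 f) (ell ^ 5) = 0"
          by (rule less(1)[OF _ aW[OF less(2)] act_pmat_wsp(1)[OF less(3) nn]]) (use 2 nn in auto)
        then show ?thesis using act_pmat_ell[OF wsp_forms[OF less(3)], of 1 2] by simp
      next
        case 3
        have "ip (act (pmat (sw3 2 3)) 0 f) (ell ^ 5) = 0"
          by (rule less(1)[OF _ aW[OF less(2)] act_pmat_wsp(2)[OF less(3) nn]]) (use 3 nn in auto)
        then show ?thesis using act_pmat_ell[OF wsp_forms[OF less(3)], of 2 3] by simp
      next
        case 4
        then show ?thesis using z[OF less(2,3) nn(1)] by blast
      qed
    qed simp
  qed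
  have "f \<in> forms 5" using W f by (auto simp: astab_def gstab_def)
  then have "ip f (ell ^ 5) = (\<Sum>x\<in>wts. ip (case x of (i, j, k) \<Rightarrow> cmp i j k f) (ell ^ 5))"
    by (subst cmp_sum_wts[of f]) (auto simp: ip_sum_left)
  also have "\<dots> = 0"
  proof (rule sum.neutral, clarify)
    fix i j k
    have "cmp i j k f \<in> W" using W f by (auto simp: astab_def gstab_def)
    then show "ip (cmp i j k f) (ell ^ 5) = 0" using w cmp_wsp[OF \<open>f \<in> forms 5\<close>] by blast
  qed
  finally show ?thesis .
qed

subsection \<open>Membership of the two quintics\<close>

definition nn :: moment_polynomial where "nn = pv n344"
definition kk :: moment_polynomial where "kk = pv k235"

lemma nn_wsp: "nn \<in> wsp 3 4 4" unfolding nn_def by (rule pv_wsp[OF n_weight])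
lemma kk_wsp: "kk \<in> wsp 2 3 5" unfolding kk_def by (rule pv_wsp[OF k_weight])

lemmas nn_nil = word_nil[OF inw_good[OF n_weight], folded nn_def] and kk_nil = word_nil[OF inw_good[OF k_weight], folded kk_def]
lemmas nn_ell = word_ell[OF n_weight, folded nn_def] and kk_ell = word_ell[OF k_weight, folded kk_def]

lemma nn_hw: "hw nn" using nn_nil[OF n_nil1] nn_nil[OF n_nil2] by (simp add: hw_def)
lemma kk_hw: "hw kk" using kk_nil[OF k_nil1] kk_nil[OF k_nil2] by (simp add: hw_def)

lemma nn_D1: "D1 (D1 (D1 nn)) = 0" using nn_nil[OF n_nil3] by simp
lemma kk_D1: "D1 kk = 0" using kk_nil[OF k_nil3] by simp
lemma nn_D3: "(D3 ^^ 4) nn = 0" using nn_nil[OF n_nil4] by (simp add: eval_nat_numeral)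
lemma kk_D3: "(D3 ^^ 4) kk = 0" using kk_nil[OF k_nil4] by (simp add: eval_nat_numeral)

definition words_n :: "int \<Rightarrow> int \<Rightarrow> int \<Rightarrow> int \<Rightarrow> int \<Rightarrow> int \<Rightarrow> bool" where
  "words_n a b c x y z \<longleftrightarrow> (a,b,c,x,y,z) = (0,0,0,1,0,0) \<or> (a,b,c,x,y,z) = (0,0,0,0,1,1) \<or> (a,b,c,x,y,z) = (0,0,1,0,2,0) \<or>
    (a,b,c,x,y,z) = (1,0,0,1,0,1) \<or> (a,b,c,x,y,z) = (1,0,1,1,1,0) \<or> (a,b,c,x,y,z) = (0,1,0,1,1,0) \<or> (a,b,c,x,y,z) = (2,0,1,2,0,0) \<or>
    (a,b,c,x,y,z) = (1,1,0,2,0,0) \<or> (a,b,c,x,y,z) = (0,0,0,1,2,0) \<or> (a,b,c,x,y,z) = (1,0,0,2,1,0) \<or> (a,b,c,x,y,z) = (2,0,0,3,0,0) \<or>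
    (a,b,c,x,y,z) = (0,0,0,3,0,0)"

definition words_k :: "int \<Rightarrow> int \<Rightarrow> int \<Rightarrow> int \<Rightarrow> int \<Rightarrow> bool" where
  "words_k a b c y z \<longleftrightarrow> (a,b,c,y,z) = (0,0,1,0,0) \<or> (a,b,c,y,z) = (1,0,1,0,1) \<or> (a,b,c,y,z) = (1,0,2,1,0) \<or>
    (a,b,c,y,z) = (0,1,0,0,1) \<or> (a,b,c,y,z) = (0,1,1,1,0) \<or> (a,b,c,y,z) = (0,0,0,1,1) \<or> (a,b,c,y,z) = (0,0,1,2,0)"

fun sorted_even :: "int \<Rightarrow> int \<Rightarrow> int \<Rightarrow> bool" where
  "sorted_even i j k = (0 \<le> i \<and> i \<le> j \<and> j \<le> k \<and> (i + j) mod 2 = 0 \<and> (j + k) mod 2 = 0)"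

lemma words_n_all:
  "list_all (\<lambda>x. list_all (\<lambda>y. list_all (\<lambda>z. if x + y + z \<le> 3 then list_all (\<lambda>a. list_all (\<lambda>b. list_all (\<lambda>c.
     if sorted_even (3 - x + a + b) (4 - y - a + c) (4 - z - b - c) then words_n a b c x y z else True)
     [0,1,2,3,4]) [0,1,2,3,4]) [0,1,2,3,4] else True) [0,1,2,3]) [0,1,2,3]) [0,1,2,3]"
  by code_simp

lemma words_k_all:
  "list_all (\<lambda>y. list_all (\<lambda>z. if y + z \<le> 3 then list_all (\<lambda>a. list_all (\<lambda>b. list_all (\<lambda>c.
     if sorted_even (2 + a + b) (3 - y - a + c) (5 - z - b - c) then words_k a b c y z else True)
     [0,1,2,3,4,5]) [0,1,2,3]) [0,1,2,3] else True) [0,1,2,3]) [0,1,2,3]"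
  by code_simp

lemma wsp_unique: "f \<in> wsp i j k \<Longrightarrow> f \<in> wsp i' j' k' \<Longrightarrow> f \<noteq> 0 \<Longrightarrow> i = i' \<and> j = j' \<and> k = k'"
proof -
  assume f: "f \<in> wsp i j k" "f \<in> wsp i' j' k'" "f \<noteq> 0"
  then obtain m where "m \<in> kys f" by (metis ex_in_conv keys_eq_empty)
  then show ?thesis using f by (auto simp: wsp_def)
qed

lemma Wg_in_V:
  assumes v: "v \<in> wsp i0 j0 k0" "hw v"
    and g: "\<And>a b c x y z. sorted_even (i0 - int x + int a + int b) (j0 - int y - int a + int c) (k0 - int z - int b - int c) \<Longrightarrow>
      lw a b c (F3 z y x v) \<noteq> 0 \<Longrightarrow> ip (lw a b c (F3 z y x v)) (ell ^ 5) = 0"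
  shows "Wg v \<subseteq> V"
proof (rule astab_in_V[OF Wg_astab[OF v]])
  let ?Z = "{F3 z y x v | x y z. True}"
  have Z: "weighted ?Z" using F3_wsp[OF v(1)] unfolding weighted_def by blast
  fix f assume "f \<in> Wg v"
  then show "ip f (ell ^ 5) = 0"
  proof (rule ell_sorted[OF Wg_astab[OF v], rotated])
    fix i j k f
    assume f: "f \<in> Wg v" "f \<in> wsp i j k" and s: "0 \<le> i" "i \<le> j" "j \<le> k" "even (i + j)" "even (j + k)"
    have "f \<in> spn {lw a b c z | a b c z. z \<in> ?Z \<and> lw a b c z \<in> wsp i j k}"
      using Q_cmp[OF Z f(1)[unfolded Wg_def], of i j k] cmp_id[OF f(2)] by simp
    moreover have "{lw a b c z | a b c z. z \<in> ?Z \<and> lw a b c z \<in> wsp i j k} \<subseteq> {f. ip f (ell ^ 5) = 0}"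
    proof clarify
      fix a b c x y z assume w: "lw a b c (F3 z y x v) \<in> wsp i j k"
      show "ip (lw a b c (F3 z y x v)) (ell ^ 5) = 0"
      proof (cases "lw a b c (F3 z y x v) = 0")
        case False
        have "i0 - int x + int a + int b = i \<and> j0 - int y - int a + int c = j \<and> k0 - int z - int b - int c = k"
          by (rule wsp_unique[OF lw_wsp[OF F3_wsp[OF v(1)]] w False])
        then show ?thesis using s by (intro g False) (auto simp: even_iff_mod_2_eq_zero)
      qed simp
    qed
    moreover have "pvs.subspace {f. ip f (ell ^ 5) = 0}"
      by (auto simp: pvs.subspace_def ip_add_left ip_pscale_left)
    ultimately show "ip f (ell ^ 5) = 0" using pvs.span_minimal by blast
  qed
qed

lemma Wg_nn: "Wg nn \<subseteq> V"
proof (rule Wg_in_V[OF nn_wsp nn_hw])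
  fix a b c x y z
  assume s: "sorted_even (3 - int x + int a + int b) (4 - int y - int a + int c) (4 - int z - int b - int c)"
    and nz: "lw a b c (F3 z y x nn) \<noteq> 0"
  have "F3 z y x nn \<noteq> 0" using nz by auto
  then have le: "x + y + z \<le> 3" using F3_vanish[OF nn_hw nn_D3, of z y x] by (cases "x + y + z \<le> 3") auto
  have "int x \<in> set [0,1,2,3]" "int y \<in> set [0,1,2,3]" "int z \<in> set [0,1,2,3]" using le by (simp, linarith)+
  moreover have "int a \<in> set [0,1,2,3,4]" "int b \<in> set [0,1,2,3,4]" "int c \<in> set [0,1,2,3,4]"
    using s le by (simp, linarith)+
  moreover have "int x + int y + int z \<le> 3" using le by simp
  ultimately have "words_n (int a) (int b) (int c) (int x) (int y) (int z)"
    using words_n_all s unfolding list_all_iff by (metis (no_types, lifting))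
  then show "ip (lw a b c (F3 z y x nn)) (ell ^ 5) = 0"
    using nn_ell[OF n_ev1] nn_ell[OF n_ev2] nn_ell[OF n_ev3] nn_ell[OF n_ev4] nn_ell[OF n_ev5] nn_ell[OF n_ev6] nn_ell[OF n_ev7]
      nn_ell[OF n_ev8] nn_ell[OF n_ev9] nn_nil[OF n_nil3] nn_nil[OF n_nil5]
    by (auto simp: words_n_def lw_def F3_def eval_nat_numeral)
qed

lemma Wg_kk: "Wg kk \<subseteq> V"
proof (rule Wg_in_V[OF kk_wsp kk_hw])
  fix a b c x y z
  assume s: "sorted_even (2 - int x + int a + int b) (3 - int y - int a + int c) (5 - int z - int b - int c)"
    and nz: "lw a b c (F3 z y x kk) \<noteq> 0"
  have F: "F3 z y x kk \<noteq> 0" using nz by auto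
  have x: "x = 0"
  proof (rule ccontr)
    assume "x \<noteq> 0"
    then have "F3 z y x kk = 0" using kk_D1 by (cases x) (simp_all add: F3_def pow_shift)
    then show False using F by simp
  qed
  have le: "y + z \<le> 3" using F3_vanish[OF kk_hw kk_D3, of z y x] F by (cases "y + z \<le> 3") auto
  have "int y \<in> set [0,1,2,3]" "int z \<in> set [0,1,2,3]" using le by (simp, linarith)+
  moreover have "int a \<in> set [0,1,2,3]" "int b \<in> set [0,1,2,3]" "int c \<in> set [0,1,2,3,4,5]"
    using s le x by (simp, linarith)+
  moreover have "int y + int z \<le> 3" using le by simp
  ultimately have "words_k (int a) (int b) (int c) (int y) (int z)"
    using words_k_all s x unfolding list_all_iff by (metis (no_types, lifting) add.right_neutral diff_0_right of_nat_0)
  then show "ip (lw a b c (F3 z y x kk)) (ell ^ 5) = 0"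
    using kk_ell[OF k_ev1] kk_ell[OF k_ev2] kk_ell[OF k_ev3] kk_ell[OF k_ev4] kk_ell[OF k_ev5] kk_ell[OF k_ev6] kk_ell[OF k_ev7]
    by (auto simp: words_k_def lw_def F3_def eval_nat_numeral x)
qed

section \<open>Irreducible modules\<close>

lemma gstab_forms: "gstab (forms 5)"
  unfolding gstab_def using subspace_forms R_forms cmp_wsp wsp_forms by blast

lemma gstabD:
  assumes "gstab W"
  shows "pvs.subspace W" "f \<in> W \<Longrightarrow> f \<in> forms 5" "f \<in> W \<Longrightarrow> cmp i j k f \<in> W"
    "f \<in> W \<Longrightarrow> a \<noteq> A0 \<Longrightarrow> b \<noteq> A0 \<Longrightarrow> a \<noteq> b \<Longrightarrow> R a b f \<in> W"
  using assms by (auto simp: gstab_def)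

lemma gstab_pow: "gstab W \<Longrightarrow> f \<in> W \<Longrightarrow> a \<noteq> A0 \<Longrightarrow> b \<noteq> A0 \<Longrightarrow> a \<noteq> b \<Longrightarrow> (R a b ^^ n) f \<in> W"
  by (induct n) (simp_all add: gstabD(4))

lemma gstab_lw: "gstab W \<Longrightarrow> f \<in> W \<Longrightarrow> lw a b c f \<in> W"
  unfolding lw_def by (intro gstab_pow) simp_all

lemma Lm_least: "gstab W \<Longrightarrow> v \<in> W \<Longrightarrow> Lm v \<subseteq> W"
  unfolding Lm_def Q_def by (rule pvs.span_minimal) (auto intro: gstab_lw gstabD(1))

lemma Lm_self: "v \<in> Lm v"
  unfolding Lm_def by (rule Q_mem) simp

lemma gstab_int: "gstab U \<Longrightarrow> gstab W \<Longrightarrow> gstab (U \<inter> W)"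
  unfolding gstab_def using pvs.subspace_inter by blast

lemma astab_int: "astab U \<Longrightarrow> astab W \<Longrightarrow> astab (U \<inter> W)"
  unfolding astab_def using gstab_int by blast

lemma gstab_ssum: "gstab U \<Longrightarrow> gstab W \<Longrightarrow> gstab (ssum U W)"
proof -
  assume U: "gstab U" and W: "gstab W"
  have 1: "pvs.subspace (ssum U W)" by (rule subspace_ssum[OF gstabD(1)[OF U] gstabD(1)[OF W]])
  have 2: "ssum U W \<subseteq> forms 5"
    using gstabD(2)[OF U] gstabD(2)[OF W] pvs.subspace_add[OF subspace_forms] by (auto simp: ssum_def)
  have 3: "cmp i j k f \<in> ssum U W" if "f \<in> ssum U W" for f i j k
    using that gstabD(3)[OF U] gstabD(3)[OF W] unfolding ssum_def by (auto simp: cmp_add) blast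
  have 4: "R a b f \<in> ssum U W" if m: "f \<in> ssum U W" and n: "a \<noteq> A0" "b \<noteq> A0" "a \<noteq> b" for f a b
  proof -
    obtain x y where xy: "f = x + y" "x \<in> U" "y \<in> W" using m unfolding ssum_def by blast
    have "R a b f = R a b x + R a b y" "R a b x \<in> U" "R a b y \<in> W"
      using xy gstabD(4)[OF U xy(2) n] gstabD(4)[OF W xy(3) n] by (simp_all add: R_add)
    then show ?thesis unfolding ssum_def by blast
  qed
  show ?thesis unfolding gstab_def using 1 2 3 4 by blast
qed

lemma gstab_zero: "gstab {0}"
  unfolding gstab_def using pvs.subspace_0[OF subspace_forms] by (simp add: pvs.subspace_single_0)

lemma gstab_lsum: "\<forall>U\<in>set Us. gstab U \<Longrightarrow> gstab (lsum Us)"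
  by (induct Us) (simp_all add: gstab_zero gstab_ssum)

lemma ip_cmp: "ip (cmp i j k f) g = ip f (cmp i j k g)"
  unfolding ip_def
  by (rule sum.mono_neutral_cong_left) (auto simp: lookup_cmp in_keys_iff split: if_splits)

lemma perp_gstab:
  assumes W: "gstab W" and S: "gstab S"
  shows "gstab {g \<in> W. \<forall>s\<in>S. ip s g = 0}"
proof -
  have "pvs.subspace {g \<in> W. \<forall>s\<in>S. ip s g = 0}"
    using gstabD(1)[OF W] by (auto simp: pvs.subspace_def ip_add_right ip_pscale_right)
  moreover have "ip s (cmp i j k g) = 0" if "\<forall>s\<in>S. ip s g = 0" "s \<in> S" for g s i j k
    using that gstabD(3)[OF S, of s i j k] by (simp flip: ip_cmp)
  moreover have "ip s (R a b g) = 0" if "\<forall>s\<in>S. ip s g = 0" "s \<in> S" "a \<noteq> A0" "b \<noteq> A0" "a \<noteq> b" for g s a b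
    using that gstabD(4)[OF S that(2) that(4) that(3)] by (simp flip: ip_R)
  ultimately show ?thesis using W unfolding gstab_def by blast
qed

lemma hw_R13: "hw u \<Longrightarrow> R A1 A3 u = 0"
  using R_commute[of A1 A2 A2 A3 u] by (simp add: un_def hw_def)

lemma hw_perp_word:
  assumes v: "v \<in> wsp i j k" and u: "u \<in> wsp i' j' k'" "hw u" and n: "(i, j, k) \<noteq> (i', j', k')"
  shows "ip (lw a b c v) u = 0"
proof (cases a)
  case (Suc m)
  then show ?thesis using u(2) by (simp add: lw_def ip_R hw_def)
next
  case a: 0
  show ?thesis
  proof (cases b)
    case (Suc m)
    then show ?thesis using hw_R13[OF u(2)] by (simp add: a lw_def ip_R)
  next
    case b: 0
    show ?thesis
    proof (cases c)
      case (Suc m)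
      then show ?thesis using u(2) by (simp add: a b lw_def ip_R hw_def)
    next
      case 0
      then show ?thesis using wsp_orth[OF v u(1) n] by (simp add: a b lw_def)
    qed
  qed
qed

lemma Lm_hw_perp:
  assumes "v \<in> wsp i j k" "u \<in> wsp i' j' k'" "hw u" "(i, j, k) \<noteq> (i', j', k')" "x \<in> Lm v"
  shows "ip x u = 0"
  by (rule ip_span[OF _ assms(5)[unfolded Lm_def Q_def]]) (use hw_perp_word[OF assms(1-4)] in auto)

lemma Lm_perp:
  assumes v: "v \<in> wsp i j k" "hw v" and u: "u \<in> wsp i' j' k'" "hw u" and n: "(i, j, k) \<noteq> (i', j', k')"
  shows "perp (Lm v) (Lm u)"
proof -
  let ?P = "{g \<in> forms 5. \<forall>s\<in>Lm v. ip s g = 0}"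
  have "u \<in> ?P" using wsp_forms[OF u(1)] Lm_hw_perp[OF v(1) u n] by blast
  then have "Lm u \<subseteq> ?P" by (rule Lm_least[OF perp_gstab[OF gstab_forms Lm_gstab[OF v]]])
  then show ?thesis unfolding perp_def by blast
qed

lemma gstab_hw:
  assumes W: "gstab W" and f: "f \<in> W" "f \<noteq> 0"
  shows "\<exists>g i j k. g \<in> W \<and> g \<in> wsp i j k \<and> g \<noteq> 0 \<and> hw g"
proof -
  have fo: "f \<in> forms 5" by (rule gstabD(2)[OF W f(1)])
  have "\<exists>i j k. cmp i j k f \<noteq> 0"
  proof (rule ccontr)
    assume "\<not> ?thesis"
    then have "(\<Sum>(i, j, k)\<in>wts. cmp i j k f) = 0" by (intro sum.neutral) auto
    then show False using cmp_sum_wts[OF fo] f(2) by simp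
  qed
  then obtain i j k where "cmp i j k f \<noteq> 0" by blast
  from exists_hw[OF W gstabD(3)[OF W f(1)] cmp_wsp[OF fo] this] show ?thesis by blast
qed

text \<open>The ordered words of a fixed weight are parametrized by their exponent of \<open>R A3 A1\<close>.\<close>

lemma Lm_weight_space:
  assumes v: "v \<in> wsp i j k" and w: "i' = i + int p" "j' = j - int p + int q" "k' = k - int q"
  shows "Lm v \<inter> wsp i' j' k' = spn {lw (p - b) b (q - b) v | b. b \<le> p \<and> b \<le> q}" (is "_ = spn ?G")
proof (intro equalityI subsetI)
  fix x assume x: "x \<in> Lm v \<inter> wsp i' j' k'"
  have "weighted {v}" using v by (auto simp: weighted_def)
  from Q_cmp[OF this, of x i' j' k'] x cmp_id
  have "x \<in> spn {lw a b c z | a b c z. z \<in> {v} \<and> lw a b c z \<in> wsp i' j' k'}" by (auto simp: Lm_def)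
  moreover have "{lw a b c z | a b c z. z \<in> {v} \<and> lw a b c z \<in> wsp i' j' k'} \<subseteq> insert 0 ?G"
  proof clarsimp
    fix a b c assume h: "lw a b c v \<in> wsp i' j' k'" "lw a b c v \<noteq> 0"
    have "i + int a + int b = i' \<and> j - int a + int c = j' \<and> k - int b - int c = k'"
      by (rule wsp_unique[OF lw_wsp[OF v] h])
    then have "a = p - b" "c = q - b" "b \<le> p" "b \<le> q" using w by linarith+
    then show "\<exists>b'. lw a b c v = lw (p - b') b' (q - b') v \<and> b' \<le> p \<and> b' \<le> q" by blast
  qed
  ultimately have "x \<in> spn (insert 0 ?G)" using pvs.span_mono by blast
  then show "x \<in> spn ?G" by simp
next
  fix x assume x: "x \<in> spn ?G"
  have "?G \<subseteq> Lm v" unfolding Lm_def using Q_base[of v "{v}"] by blast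
  moreover have "?G \<subseteq> wsp i' j' k'"
  proof clarify
    fix b assume "b \<le> p" "b \<le> q"
    then show "lw (p - b) b (q - b) v \<in> wsp i' j' k'"
      by (intro wsp_cast[OF lw_wsp[OF v]]) (simp_all add: w of_nat_diff)
  qed
  moreover have "pvs.subspace (Lm v)" unfolding Lm_def by (rule Q_subspace)
  ultimately show "x \<in> Lm v \<inter> wsp i' j' k'"
    using x pvs.span_minimal[of ?G "Lm v"] pvs.span_minimal[OF _ subspace_wsp, of ?G i' j' k'] by blast
qed

lemma Lm_top:
  assumes v: "v \<in> wsp i j k" and x: "x \<in> Lm v" "x \<in> wsp i j k"
  shows "\<exists>t. x = pscale t v"
proof -
  have "{lw (0 - b) b (0 - b) v | b. b \<le> 0 \<and> b \<le> 0} = {v}" by (auto simp: lw_def)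
  then have "x \<in> spn {v}" using Lm_weight_space[OF v, of i 0 j 0 k] x by auto
  then show ?thesis by (auto simp: pvs.span_singleton)
qed

lemma Lm_weights:
  assumes v: "v \<in> wsp i j k" and x: "x \<in> Lm v" "x \<in> wsp i' j' k'" "x \<noteq> 0"
  shows "i \<le> i'" "k' \<le> k" "i' + j' + k' = i + j + k"
proof -
  have "weighted {v}" using v by (auto simp: weighted_def)
  from Q_cmp[OF this, of x i' j' k'] x cmp_id
  have m: "x \<in> spn {lw a b c z | a b c z. z \<in> {v} \<and> lw a b c z \<in> wsp i' j' k'}" by (auto simp: Lm_def)
  have "\<exists>a b c. lw a b c v \<in> wsp i' j' k' \<and> lw a b c v \<noteq> 0"
  proof (rule ccontr)
    assume "\<not> ?thesis"
    then have "{lw a b c z | a b c z. z \<in> {v} \<and> lw a b c z \<in> wsp i' j' k'} \<subseteq> {0}" by auto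
    then have "x \<in> spn {0}" using m pvs.span_mono by blast
    then show False using x(3) by (simp add: pvs.span_singleton)
  qed
  then obtain a b c where h: "lw a b c v \<in> wsp i' j' k'" "lw a b c v \<noteq> 0" by blast
  have "i + int a + int b = i' \<and> j - int a + int c = j' \<and> k - int b - int c = k'"
    by (rule wsp_unique[OF lw_wsp[OF v] h])
  then show "i \<le> i'" "k' \<le> k" "i' + j' + k' = i + j + k" by linarith+
qed

lemma Lm_irreducible:
  assumes v: "v \<in> wsp i j k" "hw v" "v \<noteq> 0"
  shows "gl_irreducible (Lm v)"
proof -
  have g: "gstab (Lm v)" by (rule Lm_gstab[OF v(1,2)])
  have "U = Lm v" if U: "gl_submodule U" "U \<subseteq> Lm v" "U \<noteq> {0}" for U
  proof -
    have gU: "gstab U" by (rule gl_submodule_gstab[OF U(1)]) (use U(2) gstabD(2)[OF g] in blast)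
    obtain f where "f \<in> U" "f \<noteq> 0" using U(3) pvs.subspace_0[OF gstabD(1)[OF gU]] by blast
    from gstab_hw[OF gU this] obtain u i' j' k' where u: "u \<in> U" "u \<in> wsp i' j' k'" "u \<noteq> 0" "hw u" by blast
    have uL: "u \<in> Lm v" using u(1) U(2) by blast
    have "(i, j, k) = (i', j', k')"
    proof (rule ccontr)
      assume "(i, j, k) \<noteq> (i', j', k')"
      from Lm_hw_perp[OF v(1) u(2,4) this uL] show False using u(3) by (simp add: ip_self_eq_0)
    qed
    then obtain t where t: "u = pscale t v" using Lm_top[OF v(1) uL] u(2) by auto
    then have "t \<noteq> 0" using u(3) by auto
    then have "v = pscale (inverse t) u" using t by simp
    then have "v \<in> U" using pvs.subspace_scale[OF gstabD(1)[OF gU] u(1)] by simp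
    then show ?thesis using Lm_least[OF gU] U(2) by blast
  qed
  then show ?thesis unfolding gl_irreducible_def
    using gstab_gl_submodule[OF g] Lm_self[of v] v(3) by blast
qed

subsection \<open>Highest weights\<close>

lemma T_fixed:
  assumes ab: "a \<noteq> A0" "a \<noteq> b" and f: "f \<in> forms d" "R a b f = 0"
  shows "T a b t f = f"
proof -
  obtain P where P: "\<And>t. T a b t f = poly P (Const (of_real t))" "coeff P 0 = f"
    using T_poly[OF ab f(1)] by auto
  have F: "coeff P k \<in> forms d" for k
  proof (cases "k \<le> degree P")
    case True
    have "(\<Sum>k\<le>degree P. pscale (of_real t ^ k) (coeff P k)) \<in> forms d" for t :: real
      unfolding poly_as_pscale[symmetric] P(1)[symmetric] T_def by (rule act_forms[OF f(1)])
    then show ?thesis by (rule coeffs_in_subspace[OF subspace_forms _ True])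
  qed (simp add: coeff_eq_0 pvs.subspace_0[OF subspace_forms])
  have "coeff P (Suc k) = 0" for k
  proof (induct k)
    case 0
    then show ?case using T_coeff_rec[OF ab P(1) F, of 0] f(2) P(2) by simp
  next
    case (Suc k)
    have "pscale (of_nat (Suc (Suc k))) (coeff P (Suc (Suc k))) = 0"
      using T_coeff_rec[OF ab P(1) F, of "Suc k"] Suc by simp
    then show ?case by (metis of_nat_neq_0 pvs.scale_eq_0_iff)
  qed
  then have "P = [:f:]" by (intro poly_eqI) (metis P(2) coeff_pCons_0 coeff_pCons_Suc coeff_0 not0_implies_Suc)
  then show ?thesis by (simp add: P(1))
qed

lemma hw_unitriangular:
  assumes f: "f \<in> forms 5" "hw f" and A: "upper_unitriangular A"
  shows "act A 0 f = f"
proof -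
  have fix_: "act (TA A2 A3 t) 0 f = f" "act (TA A1 A3 t) 0 f = f" "act (TA A1 A2 t) 0 f = f" for t
    using T_fixed[OF _ _ f(1), of A2 A3 t] T_fixed[OF _ _ f(1), of A1 A3 t] T_fixed[OF _ _ f(1), of A1 A2 t] f(2) hw_R13[OF f(2)]
    by (simp_all add: T_def TA_gl hw_def)
  have "A $ l $ m = (TA A2 A3 (A $ 2 $ 3) ** (TA A1 A3 (A $ 1 $ 3) ** TA A1 A2 (A $ 1 $ 2))) $ l $ m" for l m
    using A three_cases[of l] three_cases[of m] unfolding upper_unitriangular_def
    by (elim disjE) (simp_all add: matrix_matrix_mult_def TA_def sum_3)
  then have e: "A = TA A2 A3 (A $ 2 $ 3) ** (TA A1 A3 (A $ 1 $ 3) ** TA A1 A2 (A $ 1 $ 2))"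
    unfolding vec_eq_iff by blast
  have "act A 0 f = act (TA A2 A3 (A $ 2 $ 3) ** (TA A1 A3 (A $ 1 $ 3) ** TA A1 A2 (A $ 1 $ 2))) 0 f"
    by (rule arg_cong[OF e])
  also have "\<dots> = act (TA A1 A2 (A $ 1 $ 2)) 0 (act (TA A1 A3 (A $ 1 $ 3)) 0 (act (TA A2 A3 (A $ 2 $ 3)) 0 f))"
    by (simp add: act_act matrix_mul_assoc)
  finally show ?thesis by (simp add: fix_)
qed

lemma Lm_type:
  assumes v: "v \<in> wsp (int a) (int b) (int c)" "hw v" "v \<noteq> 0" and d: "has_dim (Lm v) n"
  shows "gl_irreducible_of_type (Lm v) (vector [a, b, c], n)"
proof -
  have e: "(\<Prod>i\<in>UNIV. (t $ i) ^ (vector [a, b, c] $ i)) = t $ 1 ^ a * t $ 2 ^ b * t $ 3 ^ c" for t :: "real^3"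
    unfolding UNIV_3 by (simp add: vector_3 mult.assoc)
  have "has_weight v (vector [a, b, c])"
    unfolding has_weight_def e by (simp add: act_diag_wsp[OF v(1)] del: of_real_mult of_real_power)
  then have "has_highest_weight (Lm v) (vector [a, b, c])"
    unfolding has_highest_weight_def using Lm_self v(3) hw_unitriangular[OF wsp_forms[OF v(1)] v(2)] by blast
  then show ?thesis using Lm_irreducible[OF v] has_dim_dim[OF d] by (simp add: gl_irreducible_of_type_def)
qed

subsection \<open>Dimensions\<close>

lemma has_dim_image:
  assumes U: "has_dim U n" and add: "\<And>f g. p (f + g) = p f + p g" and sc: "\<And>t f. p (pscale t f) = pscale t (p f)"
    and inv: "\<And>f. p (p f) = f"
  shows "has_dim (p ` U) n"
proof -
  interpret vp: vector_space_pair "pscale :: complex \<Rightarrow> moment_polynomial \<Rightarrow> _" "pscale :: complex \<Rightarrow> moment_polynomial \<Rightarrow> _"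
    by unfold_locales
  have lin: "Vector_Spaces.linear pscale pscale p" by unfold_locales (simp_all add: add sc)
  have inj: "inj p" by (rule injI) (metis inv)
  obtain B where B: "finite B" "\<not> pvs.dependent B" "card B = n" "spn B = U" using U by (auto simp: has_dim_def)
  have "\<not> pvs.dependent (p ` B)" by (rule vp.linear_independent_injective_image[OF lin B(2) inj_on_subset[OF inj subset_UNIV]])
  moreover have "card (p ` B) = n" using card_image[OF inj_on_subset[OF inj subset_UNIV]] B(3) by simp
  moreover have "spn (p ` B) = p ` U" using vp.linear_span_image[OF lin, of B] B(4) by simp
  ultimately show ?thesis unfolding has_dim_def using B(1) by (intro exI[of _ "p ` B"]) simp
qed

lemma pmat_involution: "act (pmat (sw3 a b)) 0 (act (pmat (sw3 a b)) 0 f) = f"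
  by (simp add: act_act pmat_square act_id)

lemma weight_space_swap:
  assumes M: "gstab M" and nn: "0 \<le> i" "0 \<le> j" "0 \<le> k" and d: "has_dim (M \<inter> wsp i j k) n"
  shows "has_dim (M \<inter> wsp j i k) n" "has_dim (M \<inter> wsp i k j) n"
proof -
  have aM: "act (pmat (sw3 a b)) 0 f \<in> M" if "f \<in> M" for f a b
  proof -
    have "act (pmat (sw3 a b)) 0 ` M \<subseteq> M"
      using gstab_gl_submodule[OF M] pmat_invertible unfolding gl_submodule_def by blast
    then show ?thesis using that by blast
  qed
  have im: "act (pmat (sw3 a b)) 0 ` (M \<inter> W) = M \<inter> W'"
    if "\<And>f. f \<in> W \<Longrightarrow> act (pmat (sw3 a b)) 0 f \<in> W'" "\<And>f. f \<in> W' \<Longrightarrow> act (pmat (sw3 a b)) 0 f \<in> W" for a b W W'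
  proof (intro equalityI subsetI)
    fix x assume x: "x \<in> M \<inter> W'"
    have "x = act (pmat (sw3 a b)) 0 (act (pmat (sw3 a b)) 0 x)" by (simp add: pmat_involution)
    moreover have "act (pmat (sw3 a b)) 0 x \<in> M \<inter> W" using x aM that(2) by blast
    ultimately show "x \<in> act (pmat (sw3 a b)) 0 ` (M \<inter> W)" by blast
  qed (use aM that(1) in blast)
  note di = has_dim_image[OF d, of "act (pmat (sw3 1 2)) 0", OF act_add act_pscale pmat_involution]
    has_dim_image[OF d, of "act (pmat (sw3 2 3)) 0", OF act_add act_pscale pmat_involution]
  show "has_dim (M \<inter> wsp j i k) n"
    using di(1) im[of "wsp i j k" 1 2 "wsp j i k"] act_pmat_wsp(1)[OF _ nn] act_pmat_wsp(1)[OF _ nn(2,1,3)] by simp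
  show "has_dim (M \<inter> wsp i k j) n"
    using di(2) im[of "wsp i j k" 2 3 "wsp i k j"] act_pmat_wsp(2)[OF _ nn] act_pmat_wsp(2)[OF _ nn(1,3,2)] by simp
qed

lemma indep_weight_spaces:
  "distinct ws \<Longrightarrow> indep (map (\<lambda>(i, j, k). M \<inter> wsp i j k) ws)" if M: "pvs.subspace M"
proof (induct ws)
  case (Cons w ws)
  obtain i j k where w: "w = (i, j, k)" by (cases w) auto
  have s: "pvs.subspace (M \<inter> wsp i j k)" for i j k using M subspace_wsp by (rule pvs.subspace_inter)
  have "perp (M \<inter> wsp i j k) (lsum (map (\<lambda>(i, j, k). M \<inter> wsp i j k) ws))"
  proof (rule perp_lsum, clarsimp)
    fix i' j' k' assume "(i', j', k') \<in> set ws"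
    then have "(i, j, k) \<noteq> (i', j', k')" using Cons(2) w by auto
    then show "perp (M \<inter> wsp i j k) (M \<inter> wsp i' j' k')" using wsp_orth unfolding perp_def by blast
  qed
  moreover have "pvs.subspace (lsum (map (\<lambda>(i, j, k). M \<inter> wsp i j k) ws))"
    by (rule subspace_lsum) (auto simp: s)
  ultimately have "(M \<inter> wsp i j k) \<inter> lsum (map (\<lambda>(i, j, k). M \<inter> wsp i j k) ws) = {0}"
    using perp_int[OF s] by blast
  then show ?case using Cons w by simp
qed simp

lemma dim_by_weights:
  assumes M: "gstab M" and d: "distinct ws" and N: "\<And>i j k. has_dim (M \<inter> wsp i j k) (N (i, j, k))"
    and z: "\<And>w. w \<notin> set ws \<Longrightarrow> N w = 0"
  shows "has_dim M (sum_list (map N ws))"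
proof -
  let ?U = "\<lambda>(i, j, k). M \<inter> wsp i j k"
  have sub: "\<forall>U\<in>set (map ?U ws). pvs.subspace U"
    using pvs.subspace_inter[OF gstabD(1)[OF M] subspace_wsp] by auto
  have "lsum (map ?U ws) = M"
  proof
    show "lsum (map ?U ws) \<subseteq> M" by (rule lsum_subset[OF gstabD(1)[OF M]]) auto
    show "M \<subseteq> lsum (map ?U ws)"
    proof
      fix x assume x: "x \<in> M"
      have "cmp i j k x \<in> lsum (map ?U ws)" for i j k
      proof (cases "(i, j, k) \<in> set ws")
        case True
        have "cmp i j k x \<in> M \<inter> wsp i j k" using gstabD(2,3)[OF M x] cmp_wsp by blast
        then show ?thesis using True by (intro lsum_member[OF sub, of "?U (i, j, k)"]) auto
      next
        case False
        have "M \<inter> wsp i j k = {0}" using N[of i j k] z[OF False] has_dim_0_iff by simp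
        then have "cmp i j k x = 0" using gstabD(2,3)[OF M x] cmp_wsp by blast
        then show ?thesis using pvs.subspace_0[OF subspace_lsum[OF sub]] by simp
      qed
      then have "(\<Sum>(i, j, k)\<in>wts. cmp i j k x) \<in> lsum (map ?U ws)"
        by (intro pvs.subspace_sum[OF subspace_lsum[OF sub]]) auto
      then show "x \<in> lsum (map ?U ws)" using cmp_sum_wts[OF gstabD(2)[OF M x]] by simp
    qed
  qed
  moreover have "list_all2 has_dim (map ?U ws) (map N ws)"
    using N by (auto simp: list_all2_conv_all_nth split: prod.split)
  ultimately show ?thesis using has_dim_lsum indep_weight_spaces[OF gstabD(1)[OF M] d] by metis
qed

lemma sort3:
  fixes i j k :: int
  assumes s: "\<And>i j k. 0 \<le> i \<Longrightarrow> i \<le> j \<Longrightarrow> j \<le> k \<Longrightarrow> P i j k"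
    and sw: "\<And>i j k. 0 \<le> i \<Longrightarrow> 0 \<le> j \<Longrightarrow> 0 \<le> k \<Longrightarrow> P i j k \<Longrightarrow> P j i k \<and> P i k j"
    and nn: "0 \<le> i" "0 \<le> j" "0 \<le> k"
  shows "P i j k"
proof -
  consider "i \<le> j" "j \<le> k" | "j \<le> i" "i \<le> k" | "i \<le> k" "k \<le> j" | "k \<le> j" "j \<le> i" | "j \<le> k" "k \<le> i" | "k \<le> i" "i \<le> j"
    by linarith
  then show ?thesis
  proof cases
    case 1
    then show ?thesis using s nn by blast
  next
    case 2
    then have "P j i k" using s nn by blast
    then show ?thesis using sw nn by blast
  next
    case 3
    then have "P i k j" using s nn by blast
    then show ?thesis using sw nn by blast
  next
    case 4
    then have "P k j i" using s nn by blast
    then have "P j k i" using sw nn by blast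
    then have "P j i k" using sw nn by blast
    then show ?thesis using sw nn by blast
  next
    case 5
    then have "P j k i" using s nn by blast
    then have "P j i k" using sw nn by blast
    then show ?thesis using sw nn by blast
  next
    case 6
    then have "P k i j" using s nn by blast
    then have "P i k j" using sw nn by blast
    then show ?thesis using sw nn by blast
  qed
qed

definition wbox :: "(int \<times> int \<times> int) list" where
  "wbox = List.product [0,1,2,3,4,5] (List.product [0,1,2,3,4,5] [0,1,2,3,4,5])"

definition mlt :: "int \<Rightarrow> (int \<Rightarrow> int \<Rightarrow> nat) \<Rightarrow> int \<times> int \<times> int \<Rightarrow> nat" where
  "mlt s D = (\<lambda>(i, j, k). if i + j + k = s then D (min i (min j k)) (max i (max j k)) else 0)"

lemma Lm_dim:
  assumes v: "v \<in> wsp i0 j0 k0" "hw v" and b: "0 \<le> i0" "k0 \<le> 5" and D: "\<And>a b. D a b \<noteq> 0 \<Longrightarrow> i0 \<le> a \<and> b \<le> k0"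
    and e: "\<And>i j k. i0 \<le> i \<Longrightarrow> i \<le> j \<Longrightarrow> j \<le> k \<Longrightarrow> k \<le> k0 \<Longrightarrow> i + j + k = i0 + j0 + k0 \<Longrightarrow> has_dim (Lm v \<inter> wsp i j k) (D i k)"
  shows "has_dim (Lm v) (sum_list (map (mlt (i0 + j0 + k0) D) wbox))"
proof (rule dim_by_weights[OF Lm_gstab[OF v]])
  show "distinct wbox" unfolding wbox_def by (intro distinct_product) simp_all
  have z: "has_dim (Lm v \<inter> wsp i j k) 0" if "\<not> (i0 \<le> i \<and> k \<le> k0 \<and> i + j + k = i0 + j0 + k0)" for i j k
  proof -
    have "Lm v \<inter> wsp i j k \<subseteq> {0}" using Lm_weights[OF v(1), of _ i j k] that by blast
    moreover have "0 \<in> Lm v \<inter> wsp i j k"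
      using pvs.subspace_0[OF gstabD(1)[OF Lm_gstab[OF v]]] pvs.subspace_0[OF subspace_wsp] by blast
    ultimately have "Lm v \<inter> wsp i j k = {0}" by blast
    then show ?thesis using has_dim_0 by simp
  qed
  show "has_dim (Lm v \<inter> wsp i j k) (mlt (i0 + j0 + k0) D (i, j, k))" for i j k
  proof (cases "0 \<le> i \<and> 0 \<le> j \<and> 0 \<le> k")
    case True
    show ?thesis
    proof (rule sort3[where P = "\<lambda>i j k. has_dim (Lm v \<inter> wsp i j k) (mlt (i0 + j0 + k0) D (i, j, k))"])
      fix i j k :: int assume h: "0 \<le> i" "i \<le> j" "j \<le> k"
      have m: "mlt (i0 + j0 + k0) D (i, j, k) = (if i + j + k = i0 + j0 + k0 then D i k else 0)"
        using h by (simp add: mlt_def min_def max_def)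
      show "has_dim (Lm v \<inter> wsp i j k) (mlt (i0 + j0 + k0) D (i, j, k))"
      proof (cases "i0 \<le> i \<and> k \<le> k0 \<and> i + j + k = i0 + j0 + k0")
        case True
        then show ?thesis using e[of i j k] h m by simp
      next
        case False
        then have "mlt (i0 + j0 + k0) D (i, j, k) = 0" using D[of i k] m by auto
        then show ?thesis using z[OF False] by simp
      qed
    next
      fix i j k :: int
      assume h: "0 \<le> i" "0 \<le> j" "0 \<le> k" "has_dim (Lm v \<inter> wsp i j k) (mlt (i0 + j0 + k0) D (i, j, k))"
      have "mlt s D (j, i, k) = mlt s D (i, j, k)" "mlt s D (i, k, j) = mlt s D (i, j, k)" for s
        by (simp_all add: mlt_def min.left_commute min.commute max.left_commute max.commute ac_simps)
      then show "has_dim (Lm v \<inter> wsp j i k) (mlt (i0 + j0 + k0) D (j, i, k)) \<and> has_dim (Lm v \<inter> wsp i k j) (mlt (i0 + j0 + k0) D (i, k, j))"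
        using weight_space_swap[OF Lm_gstab[OF v] h] by simp
    qed (use True in auto)
  next
    case False
    then have "Lm v \<inter> wsp i j k \<subseteq> {0}" using wsp_nonneg by blast
    then have "Lm v \<inter> wsp i j k = {0}"
      using pvs.subspace_0[OF gstabD(1)[OF Lm_gstab[OF v]]] pvs.subspace_0[OF subspace_wsp] by blast
    moreover have "mlt (i0 + j0 + k0) D (i, j, k) = 0"
    proof -
      have "\<not> i0 \<le> min i (min j k)" using False b(1) by auto
      then have "D (min i (min j k)) (max i (max j k)) = 0" using D[of "min i (min j k)" "max i (max j k)"] by blast
      then show ?thesis by (simp add: mlt_def)
    qed
    ultimately show ?thesis using has_dim_0 by simp
  qed
  show "mlt (i0 + j0 + k0) D w = 0" if "w \<notin> set wbox" for w
  proof (rule ccontr)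
    obtain i j k where w: "w = (i, j, k)" by (cases w) auto
    assume "mlt (i0 + j0 + k0) D w \<noteq> 0"
    then have "D (min i (min j k)) (max i (max j k)) \<noteq> 0" by (auto simp: mlt_def w split: if_splits)
    then have "i0 \<le> min i (min j k) \<and> max i (max j k) \<le> k0" by (rule D)
    then have "i \<in> {0..5}" "j \<in> {0..5}" "k \<in> {0..5}" using b by auto
    moreover have s5: "set [0,1,2,3,4,5::int] = {0..5}" by auto
    have "set wbox = {0..5} \<times> {0..5} \<times> {0..5}" by (simp only: wbox_def set_product s5)
    ultimately have "w \<in> set wbox" by (simp add: w)
    then show False using that by simp
  qed
qed

subsection \<open>Weight spaces of the twelve modules\<close>

lemma lower_nonzero: "v \<in> wsp i j k \<Longrightarrow> v \<noteq> 0 \<Longrightarrow> wc i j k a < wc i j k b \<Longrightarrow> R b a v \<noteq> 0"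
  using R_inj_weight by blast

lemma lower_zero:
  assumes v: "v \<in> wsp i j k" "R a b v = 0" and e: "wc i j k a = wc i j k b"
  shows "R b a v = 0"
proof -
  have "nrm (R b a v) = 0" using nrm_R[OF v(1), of a b] v(2) e by (simp add: nrm_def)
  then show ?thesis by (simp add: nrm_eq_0)
qed

lemma ws00:
  assumes v: "v \<in> wsp i j k" "hw v" "v \<noteq> 0"
  shows "has_dim (Lm v \<inter> wsp i j k) 1"
proof -
  have "{lw (0 - b) b (0 - b) v | b. b \<le> 0 \<and> b \<le> 0} = {v}" by (auto simp: lw_def)
  then have "Lm v \<inter> wsp i j k = spn {v}" using Lm_weight_space[OF v(1), of i 0 j 0 k] by simp
  then show ?thesis using has_dim_1[OF v(3)] by simp
qed

lemma ws10:
  assumes v: "v \<in> wsp i j k" "hw v" "v \<noteq> 0" and l: "i < j" and e: "i' = i + 1" "j' = j - 1" "k' = k"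
  shows "has_dim (Lm v \<inter> wsp i' j' k') 1"
proof -
  have "{lw (1 - b) b (0 - b) v | b. b \<le> 1 \<and> b \<le> 0} = {R A2 A1 v}" by (auto simp: lw_def)
  then have "Lm v \<inter> wsp i' j' k' = spn {R A2 A1 v}" using Lm_weight_space[OF v(1), of i' 1 j' 0 k'] e by simp
  moreover have "R A2 A1 v \<noteq> 0" by (rule lower_nonzero[OF v(1,3)]) (use l in \<open>simp add: wc_def\<close>)
  ultimately show ?thesis using has_dim_1 by simp
qed

lemma ws01:
  assumes v: "v \<in> wsp i j k" "hw v" "v \<noteq> 0" and l: "j < k" and e: "i' = i" "j' = j + 1" "k' = k - 1"
  shows "has_dim (Lm v \<inter> wsp i' j' k') 1"
proof -
  have "{lw (0 - b) b (1 - b) v | b. b \<le> 0 \<and> b \<le> 1} = {R A3 A2 v}" by (auto simp: lw_def)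
  then have "Lm v \<inter> wsp i' j' k' = spn {R A3 A2 v}" using Lm_weight_space[OF v(1), of i' 0 j' 1 k'] e by simp
  moreover have "R A3 A2 v \<noteq> 0" by (rule lower_nonzero[OF v(1,3)]) (use l in \<open>simp add: wc_def\<close>)
  ultimately show ?thesis using has_dim_1 by simp
qed

text \<open>Applying both raising operators to a relation between the two words shows that it is trivial.\<close>

lemma ws11:
  assumes v: "v \<in> wsp i j k" "hw v" "v \<noteq> 0" and l: "i < j" "j < k" and e: "i' = i + 1" "j' = j" "k' = k - 1"
  shows "has_dim (Lm v \<inter> wsp i' j' k') 2"
proof -
  let ?X = "R A2 A1 (R A3 A2 v)" and ?Y = "R A3 A1 v"
  have "{lw (1 - b) b (1 - b) v | b. b \<le> 1 \<and> b \<le> 1} = {lw 1 0 1 v, lw 0 1 0 v}"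
  proof (intro equalityI subsetI)
    fix x assume "x \<in> {lw (1 - b) b (1 - b) v | b. b \<le> 1 \<and> b \<le> 1}"
    then obtain b :: nat where b: "x = lw (1 - b) b (1 - b) v" "b \<le> 1" by blast
    then have "b = 0 \<or> b = 1" by linarith
    then show "x \<in> {lw 1 0 1 v, lw 0 1 0 v}" using b(1) by auto
  next
    fix x assume "x \<in> {lw 1 0 1 v, lw 0 1 0 v}"
    then have "x = lw (1 - 0) 0 (1 - 0) v \<or> x = lw (1 - 1) 1 (1 - 1) v" by simp
    then show "x \<in> {lw (1 - b) b (1 - b) v | b. b \<le> 1 \<and> b \<le> 1}" by (metis (mono_tags, lifting) mem_Collect_eq le_refl zero_le)
  qed
  moreover have "lw 1 0 1 v = ?X" "lw 0 1 0 v = ?Y" by (simp_all add: lw_def)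
  ultimately have W: "Lm v \<inter> wsp i' j' k' = spn {?X, ?Y}" using Lm_weight_space[OF v(1), of i' 1 j' 1 k'] e by simp
  have r: "R A1 A2 v = 0" "R A2 A3 v = 0" using v(2) by (auto simp: hw_def)
  have n: "R A3 A2 v \<noteq> 0" "R A2 A1 v \<noteq> 0"
    using lower_nonzero[OF v(1,3), of A2 A3] lower_nonzero[OF v(1,3), of A1 A2] l by (simp_all add: wc_def)
  have w: "R A3 A2 v \<in> wsp i (j + 1) (k - 1)" by (rule R_wsp'[OF v(1)]) (simp_all add: un_def)
  have a1: "R A1 A2 ?X = pscale (of_int (j + 1 - i)) (R A3 A2 v)"
    using R_commute[of A1 A2 A2 A1 "R A3 A2 v"] R_comm[of A1 A2 A2 A3 v] r R_diag[OF w, of A1] R_diag[OF w, of A2]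
    by (simp add: un_def pvs.scale_left_diff_distrib algebra_simps)
  have a2: "R A1 A2 ?Y = R A3 A2 v"
    using R_commute[of A1 A2 A3 A1 v] r by (simp add: un_def)
  have b1: "R A2 A3 ?X = pscale (of_int (k - j)) (R A2 A1 v)"
  proof -
    have "R A2 A3 (R A3 A2 v) = pscale (of_int (k - j)) v"
      using R_commute[of A2 A3 A3 A2 v] r R_diag[OF v(1), of A2] R_diag[OF v(1), of A3]
      by (simp add: un_def pvs.scale_left_diff_distrib algebra_simps)
    then show ?thesis using R_comm[of A2 A1 A3 A2 "R A3 A2 v"] by (simp add: R_pscale)
  qed
  have b2: "R A2 A3 ?Y = - R A2 A1 v"
    using R_commute[of A2 A3 A3 A1 v] r by (simp add: un_def algebra_simps)
  show ?thesis unfolding W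
  proof (rule has_dim_2)
    fix s t assume st: "pscale s ?X + pscale t ?Y = 0"
    have "R A1 A2 (pscale s ?X + pscale t ?Y) = pscale (s * of_int (j + 1 - i) + t) (R A3 A2 v)"
      by (simp only: R_add R_pscale a1 a2 pvs.scale_left_distrib pvs.scale_scale)
    then have 1: "s * of_int (j + 1 - i) + t = 0" using st n(1) by (simp del: of_int_add of_int_diff)
    have "R A2 A3 (pscale s ?X + pscale t ?Y) = pscale (s * of_int (k - j) - t) (R A2 A1 v)"
      by (simp only: R_add R_pscale b1 b2 pvs.scale_left_diff_distrib pvs.scale_scale pvs.scale_minus_right) simp
    then have 2: "s * of_int (k - j) - t = 0" using st n(2) by (simp del: of_int_add of_int_diff)
    have "s * of_int (j + 1 - i + (k - j)) = s * of_int (j + 1 - i) + s * of_int (k - j)"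
      by (simp only: of_int_add distrib_left)
    also have "\<dots> = (s * of_int (j + 1 - i) + t) + (s * of_int (k - j) - t)"
      by (simp add: algebra_simps del: of_int_add of_int_diff)
    also have "\<dots> = 0" by (simp only: 1 2 add_0_left)
    finally have "s * of_int (j + 1 - i + (k - j)) = 0" .
    moreover have "j + 1 - i + (k - j) \<noteq> 0" using l by linarith
    ultimately have "s = 0" by (metis mult_eq_0_iff of_int_eq_0_iff)
    then show "s = 0 \<and> t = 0" using 2 by simp
  qed
qed

lemma ws21:
  assumes v: "v \<in> wsp i j k" "hw v" "v \<noteq> 0" and l: "i + 1 < j" "j = k" and e: "i' = i + 2" "j' = j - 1" "k' = k - 1"
  shows "has_dim (Lm v \<inter> wsp i' j' k') 1"
proof -
  let ?Y = "lw 1 1 0 v"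
  have z: "lw 2 0 1 v = 0" using lower_zero[OF v(1), of A2 A3] v(2) l by (simp add: lw_def hw_def wc_def)
  have "{lw (2 - b) b (1 - b) v | b. b \<le> 2 \<and> b \<le> 1} \<subseteq> {0, ?Y}"
  proof
    fix x assume "x \<in> {lw (2 - b) b (1 - b) v | b. b \<le> 2 \<and> b \<le> 1}"
    then obtain b :: nat where b: "x = lw (2 - b) b (1 - b) v" "b \<le> 1" by blast
    then have "b = 0 \<or> b = 1" by linarith
    then show "x \<in> {0, ?Y}" using b(1) z by auto
  qed
  moreover have "?Y \<in> {lw (2 - b) b (1 - b) v | b. b \<le> 2 \<and> b \<le> 1}" by (rule CollectI, rule exI[of _ 1]) simp
  ultimately have "spn {lw (2 - b) b (1 - b) v | b. b \<le> 2 \<and> b \<le> 1} = spn {?Y}"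
    by (metis (no_types, lifting) empty_subsetI insert_subset pvs.span_insert_0 pvs.span_mono subset_antisym)
  then have W: "Lm v \<inter> wsp i' j' k' = spn {?Y}" using Lm_weight_space[OF v(1), of i' 2 j' 1 k'] e by simp
  have n: "R A3 A1 v \<noteq> 0" by (rule lower_nonzero[OF v(1,3)]) (use l in \<open>simp add: wc_def\<close>)
  have w: "R A3 A1 v \<in> wsp (i + 1) j (k - 1)" by (rule R_wsp'[OF v(1)]) (simp_all add: un_def)
  have "R A2 A1 (R A3 A1 v) \<noteq> 0" by (rule lower_nonzero[OF w n]) (use l in \<open>simp add: wc_def\<close>)
  then have "?Y \<noteq> 0" by (simp add: lw_def)
  then show ?thesis unfolding W by (rule has_dim_1)
qed

lemma ws12:
  assumes v: "v \<in> wsp i j k" "hw v" "v \<noteq> 0" and l: "j + 1 < k" "i = j" and e: "i' = i + 1" "j' = j + 1" "k' = k - 2"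
  shows "has_dim (Lm v \<inter> wsp i' j' k') 1"
proof -
  let ?Y = "lw 0 1 1 v"
  have z: "R A2 A1 v = 0" using lower_zero[OF v(1), of A1 A2] v(2) l by (simp add: hw_def wc_def)
  have "lw 1 0 0 v = 0" using z by (simp add: lw_def)
  then have "lw 1 0 1 v = lw 0 1 0 v" using lw_R32[of 1 0 0 v] by simp
  moreover have "lw 1 0 2 v = R A3 A2 (lw 1 0 1 v) + ?Y" using lw_R32[of 1 0 1 v] by (simp add: numeral_2_eq_2)
  moreover have "R A3 A2 (lw 0 1 0 v) = ?Y" using lw_R32[of 0 1 0 v] by simp
  ultimately have q: "lw 1 0 2 v = ?Y + ?Y" by simp
  have "{lw (1 - b) b (2 - b) v | b. b \<le> 1 \<and> b \<le> 2} \<subseteq> {?Y + ?Y, ?Y}"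
  proof
    fix x assume "x \<in> {lw (1 - b) b (2 - b) v | b. b \<le> 1 \<and> b \<le> 2}"
    then obtain b :: nat where b: "x = lw (1 - b) b (2 - b) v" "b \<le> 1" by blast
    then have "b = 0 \<or> b = 1" by linarith
    then show "x \<in> {?Y + ?Y, ?Y}" using b(1) q by auto
  qed
  moreover have "{?Y + ?Y, ?Y} \<subseteq> spn {?Y}"
  proof -
    have y: "?Y \<in> spn {?Y}" by (rule pvs.span_base) simp
    have "?Y + ?Y \<in> spn {?Y}" by (rule pvs.span_add[OF y y])
    then show ?thesis using y by blast
  qed
  ultimately have "spn {lw (1 - b) b (2 - b) v | b. b \<le> 1 \<and> b \<le> 2} \<subseteq> spn {?Y}"
    by (intro pvs.span_minimal[OF _ pvs.subspace_span]) blast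
  moreover have "?Y \<in> {lw (1 - b) b (2 - b) v | b. b \<le> 1 \<and> b \<le> 2}" by (rule CollectI, rule exI[of _ 1]) simp
  then have "spn {?Y} \<subseteq> spn {lw (1 - b) b (2 - b) v | b. b \<le> 1 \<and> b \<le> 2}" by (intro pvs.span_mono) blast
  ultimately have W: "Lm v \<inter> wsp i' j' k' = spn {?Y}" using Lm_weight_space[OF v(1), of i' 1 j' 2 k'] e by simp
  have n: "R A3 A2 v \<noteq> 0" by (rule lower_nonzero[OF v(1,3)]) (use l in \<open>simp add: wc_def\<close>)
  have w: "R A3 A2 v \<in> wsp i (j + 1) (k - 1)" by (rule R_wsp'[OF v(1)]) (simp_all add: un_def)
  have "R A3 A1 (R A3 A2 v) \<noteq> 0" by (rule lower_nonzero[OF w n]) (use l in \<open>simp add: wc_def\<close>)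
  then have "?Y \<noteq> 0" by (simp add: lw_def)
  then show ?thesis unfolding W by (rule has_dim_1)
qed

lemma dim_344:
  assumes v: "v \<in> wsp 3 4 4" "hw v" "v \<noteq> 0"
  shows "has_dim (Lm v) 3"
proof -
  let ?D = "\<lambda>a b. if a = 3 \<and> b = 4 then 1 else 0"
  have "has_dim (Lm v) (sum_list (map (mlt (3 + 4 + 4) ?D) wbox))"
  proof (rule Lm_dim[OF v(1,2)])
    fix i j k :: int assume "3 \<le> i" "i \<le> j" "j \<le> k" "k \<le> 4" "i + j + k = 3 + 4 + 4"
    then have "(i = 3 \<and> j = 4 \<and> k = 4)" by presburger
    moreover
    have "has_dim (Lm v \<inter> wsp 3 4 4) 1" using ws00[OF v] by simp
    ultimately show "has_dim (Lm v \<inter> wsp i j k) (?D i k)" by (elim disjE conjE) simp_all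
  qed (simp_all split: if_splits)
  moreover have "sum_list (map (mlt (3 + 4 + 4) ?D) wbox) = 3" by code_simp
  ultimately show ?thesis by simp
qed

lemma dim_334:
  assumes v: "v \<in> wsp 3 3 4" "hw v" "v \<noteq> 0"
  shows "has_dim (Lm v) 3"
proof -
  let ?D = "\<lambda>a b. if a = 3 \<and> b = 4 then 1 else 0"
  have "has_dim (Lm v) (sum_list (map (mlt (3 + 3 + 4) ?D) wbox))"
  proof (rule Lm_dim[OF v(1,2)])
    fix i j k :: int assume "3 \<le> i" "i \<le> j" "j \<le> k" "k \<le> 4" "i + j + k = 3 + 3 + 4"
    then have "(i = 3 \<and> j = 3 \<and> k = 4)" by presburger
    moreover
    have "has_dim (Lm v \<inter> wsp 3 3 4) 1" using ws00[OF v] by simp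
    ultimately show "has_dim (Lm v \<inter> wsp i j k) (?D i k)" by (elim disjE conjE) simp_all
  qed (simp_all split: if_splits)
  moreover have "sum_list (map (mlt (3 + 3 + 4) ?D) wbox) = 3" by code_simp
  ultimately show ?thesis by simp
qed

lemma dim_244:
  assumes v: "v \<in> wsp 2 4 4" "hw v" "v \<noteq> 0"
  shows "has_dim (Lm v) 6"
proof -
  let ?D = "\<lambda>a b. if a = 2 \<and> b = 4 then 1 else if a = 3 \<and> b = 4 then 1 else 0"
  have "has_dim (Lm v) (sum_list (map (mlt (2 + 4 + 4) ?D) wbox))"
  proof (rule Lm_dim[OF v(1,2)])
    fix i j k :: int assume "2 \<le> i" "i \<le> j" "j \<le> k" "k \<le> 4" "i + j + k = 2 + 4 + 4"
    then have "(i = 2 \<and> j = 4 \<and> k = 4) \<or> (i = 3 \<and> j = 3 \<and> k = 4)" by presburger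
    moreover
    have "has_dim (Lm v \<inter> wsp 2 4 4) 1" using ws00[OF v] by simp
    moreover
    have "has_dim (Lm v \<inter> wsp 3 3 4) 1" by (rule ws10[OF v]) simp_all
    ultimately show "has_dim (Lm v \<inter> wsp i j k) (?D i k)" by (elim disjE conjE) simp_all
  qed (simp_all split: if_splits)
  moreover have "sum_list (map (mlt (2 + 4 + 4) ?D) wbox) = 6" by code_simp
  ultimately show ?thesis by simp
qed

lemma dim_234:
  assumes v: "v \<in> wsp 2 3 4" "hw v" "v \<noteq> 0"
  shows "has_dim (Lm v) 8"
proof -
  let ?D = "\<lambda>a b. if a = 2 \<and> b = 4 then 1 else if a = 3 \<and> b = 3 then 2 else 0"
  have "has_dim (Lm v) (sum_list (map (mlt (2 + 3 + 4) ?D) wbox))"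
  proof (rule Lm_dim[OF v(1,2)])
    fix i j k :: int assume "2 \<le> i" "i \<le> j" "j \<le> k" "k \<le> 4" "i + j + k = 2 + 3 + 4"
    then have "(i = 2 \<and> j = 3 \<and> k = 4) \<or> (i = 3 \<and> j = 3 \<and> k = 3)" by presburger
    moreover
    have "has_dim (Lm v \<inter> wsp 2 3 4) 1" using ws00[OF v] by simp
    moreover
    have "has_dim (Lm v \<inter> wsp 3 3 3) 2" by (rule ws11[OF v]) simp_all
    ultimately show "has_dim (Lm v \<inter> wsp i j k) (?D i k)" by (elim disjE conjE) simp_all
  qed (simp_all split: if_splits)
  moreover have "sum_list (map (mlt (2 + 3 + 4) ?D) wbox) = 8" by code_simp
  ultimately show ?thesis by simp
qed

lemma dim_144:
  assumes v: "v \<in> wsp 1 4 4" "hw v" "v \<noteq> 0"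
  shows "has_dim (Lm v) 10"
proof -
  let ?D = "\<lambda>a b. if a = 1 \<and> b = 4 then 1 else if a = 2 \<and> b = 4 then 1 else if a = 3 \<and> b = 3 then 1 else 0"
  have "has_dim (Lm v) (sum_list (map (mlt (1 + 4 + 4) ?D) wbox))"
  proof (rule Lm_dim[OF v(1,2)])
    fix i j k :: int assume "1 \<le> i" "i \<le> j" "j \<le> k" "k \<le> 4" "i + j + k = 1 + 4 + 4"
    then have "(i = 1 \<and> j = 4 \<and> k = 4) \<or> (i = 2 \<and> j = 3 \<and> k = 4) \<or> (i = 3 \<and> j = 3 \<and> k = 3)" by presburger
    moreover
    have "has_dim (Lm v \<inter> wsp 1 4 4) 1" using ws00[OF v] by simp
    moreover
    have "has_dim (Lm v \<inter> wsp 2 3 4) 1" by (rule ws10[OF v]) simp_all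
    moreover
    have "has_dim (Lm v \<inter> wsp 3 3 3) 1" by (rule ws21[OF v]) simp_all
    ultimately show "has_dim (Lm v \<inter> wsp i j k) (?D i k)" by (elim disjE conjE) simp_all
  qed (simp_all split: if_splits)
  moreover have "sum_list (map (mlt (1 + 4 + 4) ?D) wbox) = 10" by code_simp
  ultimately show ?thesis by simp
qed

lemma dim_134:
  assumes v: "v \<in> wsp 1 3 4" "hw v" "v \<noteq> 0"
  shows "has_dim (Lm v) 15"
proof -
  let ?D = "\<lambda>a b. if a = 1 \<and> b = 4 then 1 else if a = 2 \<and> b = 4 then 1 else if a = 2 \<and> b = 3 then 2 else 0"
  have "has_dim (Lm v) (sum_list (map (mlt (1 + 3 + 4) ?D) wbox))"
  proof (rule Lm_dim[OF v(1,2)])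
    fix i j k :: int assume "1 \<le> i" "i \<le> j" "j \<le> k" "k \<le> 4" "i + j + k = 1 + 3 + 4"
    then have "(i = 1 \<and> j = 3 \<and> k = 4) \<or> (i = 2 \<and> j = 2 \<and> k = 4) \<or> (i = 2 \<and> j = 3 \<and> k = 3)" by presburger
    moreover
    have "has_dim (Lm v \<inter> wsp 1 3 4) 1" using ws00[OF v] by simp
    moreover
    have "has_dim (Lm v \<inter> wsp 2 2 4) 1" by (rule ws10[OF v]) simp_all
    moreover
    have "has_dim (Lm v \<inter> wsp 2 3 3) 2" by (rule ws11[OF v]) simp_all
    ultimately show "has_dim (Lm v \<inter> wsp i j k) (?D i k)" by (elim disjE conjE) simp_all
  qed (simp_all split: if_splits)
  moreover have "sum_list (map (mlt (1 + 3 + 4) ?D) wbox) = 15" by code_simp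
  ultimately show ?thesis by simp
qed

lemma dim_223:
  assumes v: "v \<in> wsp 2 2 3" "hw v" "v \<noteq> 0"
  shows "has_dim (Lm v) 3"
proof -
  let ?D = "\<lambda>a b. if a = 2 \<and> b = 3 then 1 else 0"
  have "has_dim (Lm v) (sum_list (map (mlt (2 + 2 + 3) ?D) wbox))"
  proof (rule Lm_dim[OF v(1,2)])
    fix i j k :: int assume "2 \<le> i" "i \<le> j" "j \<le> k" "k \<le> 3" "i + j + k = 2 + 2 + 3"
    then have "(i = 2 \<and> j = 2 \<and> k = 3)" by presburger
    moreover
    have "has_dim (Lm v \<inter> wsp 2 2 3) 1" using ws00[OF v] by simp
    ultimately show "has_dim (Lm v \<inter> wsp i j k) (?D i k)" by (elim disjE conjE) simp_all
  qed (simp_all split: if_splits)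
  moreover have "sum_list (map (mlt (2 + 2 + 3) ?D) wbox) = 3" by code_simp
  ultimately show ?thesis by simp
qed

lemma dim_233:
  assumes v: "v \<in> wsp 2 3 3" "hw v" "v \<noteq> 0"
  shows "has_dim (Lm v) 3"
proof -
  let ?D = "\<lambda>a b. if a = 2 \<and> b = 3 then 1 else 0"
  have "has_dim (Lm v) (sum_list (map (mlt (2 + 3 + 3) ?D) wbox))"
  proof (rule Lm_dim[OF v(1,2)])
    fix i j k :: int assume "2 \<le> i" "i \<le> j" "j \<le> k" "k \<le> 3" "i + j + k = 2 + 3 + 3"
    then have "(i = 2 \<and> j = 3 \<and> k = 3)" by presburger
    moreover
    have "has_dim (Lm v \<inter> wsp 2 3 3) 1" using ws00[OF v] by simp
    ultimately show "has_dim (Lm v \<inter> wsp i j k) (?D i k)" by (elim disjE conjE) simp_all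
  qed (simp_all split: if_splits)
  moreover have "sum_list (map (mlt (2 + 3 + 3) ?D) wbox) = 3" by code_simp
  ultimately show ?thesis by simp
qed

lemma dim_224:
  assumes v: "v \<in> wsp 2 2 4" "hw v" "v \<noteq> 0"
  shows "has_dim (Lm v) 6"
proof -
  let ?D = "\<lambda>a b. if a = 2 \<and> b = 4 then 1 else if a = 2 \<and> b = 3 then 1 else 0"
  have "has_dim (Lm v) (sum_list (map (mlt (2 + 2 + 4) ?D) wbox))"
  proof (rule Lm_dim[OF v(1,2)])
    fix i j k :: int assume "2 \<le> i" "i \<le> j" "j \<le> k" "k \<le> 4" "i + j + k = 2 + 2 + 4"
    then have "(i = 2 \<and> j = 2 \<and> k = 4) \<or> (i = 2 \<and> j = 3 \<and> k = 3)" by presburger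
    moreover
    have "has_dim (Lm v \<inter> wsp 2 2 4) 1" using ws00[OF v] by simp
    moreover
    have "has_dim (Lm v \<inter> wsp 2 3 3) 1" by (rule ws01[OF v]) simp_all
    ultimately show "has_dim (Lm v \<inter> wsp i j k) (?D i k)" by (elim disjE conjE) simp_all
  qed (simp_all split: if_splits)
  moreover have "sum_list (map (mlt (2 + 2 + 4) ?D) wbox) = 6" by code_simp
  ultimately show ?thesis by simp
qed

lemma dim_225:
  assumes v: "v \<in> wsp 2 2 5" "hw v" "v \<noteq> 0"
  shows "has_dim (Lm v) 10"
proof -
  let ?D = "\<lambda>a b. if a = 2 \<and> b = 5 then 1 else if a = 2 \<and> b = 4 then 1 else if a = 3 \<and> b = 3 then 1 else 0"
  have "has_dim (Lm v) (sum_list (map (mlt (2 + 2 + 5) ?D) wbox))"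
  proof (rule Lm_dim[OF v(1,2)])
    fix i j k :: int assume "2 \<le> i" "i \<le> j" "j \<le> k" "k \<le> 5" "i + j + k = 2 + 2 + 5"
    then have "(i = 2 \<and> j = 2 \<and> k = 5) \<or> (i = 2 \<and> j = 3 \<and> k = 4) \<or> (i = 3 \<and> j = 3 \<and> k = 3)" by presburger
    moreover
    have "has_dim (Lm v \<inter> wsp 2 2 5) 1" using ws00[OF v] by simp
    moreover
    have "has_dim (Lm v \<inter> wsp 2 3 4) 1" by (rule ws01[OF v]) simp_all
    moreover
    have "has_dim (Lm v \<inter> wsp 3 3 3) 1" by (rule ws12[OF v]) simp_all
    ultimately show "has_dim (Lm v \<inter> wsp i j k) (?D i k)" by (elim disjE conjE) simp_all
  qed (simp_all split: if_splits)
  moreover have "sum_list (map (mlt (2 + 2 + 5) ?D) wbox) = 10" by code_simp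
  ultimately show ?thesis by simp
qed

lemma dim_235:
  assumes v: "v \<in> wsp 2 3 5" "hw v" "v \<noteq> 0"
  shows "has_dim (Lm v) 15"
proof -
  let ?D = "\<lambda>a b. if a = 2 \<and> b = 5 then 1 else if a = 2 \<and> b = 4 then 1 else if a = 3 \<and> b = 4 then 2 else 0"
  have "has_dim (Lm v) (sum_list (map (mlt (2 + 3 + 5) ?D) wbox))"
  proof (rule Lm_dim[OF v(1,2)])
    fix i j k :: int assume "2 \<le> i" "i \<le> j" "j \<le> k" "k \<le> 5" "i + j + k = 2 + 3 + 5"
    then have "(i = 2 \<and> j = 3 \<and> k = 5) \<or> (i = 2 \<and> j = 4 \<and> k = 4) \<or> (i = 3 \<and> j = 3 \<and> k = 4)" by presburger
    moreover
    have "has_dim (Lm v \<inter> wsp 2 3 5) 1" using ws00[OF v] by simp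
    moreover
    have "has_dim (Lm v \<inter> wsp 2 4 4) 1" by (rule ws01[OF v]) simp_all
    moreover
    have "has_dim (Lm v \<inter> wsp 3 3 4) 2" by (rule ws11[OF v]) simp_all
    ultimately show "has_dim (Lm v \<inter> wsp i j k) (?D i k)" by (elim disjE conjE) simp_all
  qed (simp_all split: if_splits)
  moreover have "sum_list (map (mlt (2 + 3 + 5) ?D) wbox) = 15" by code_simp
  ultimately show ?thesis by simp
qed

subsection \<open>Highest weight vectors\<close>

definition n334 :: moment_polynomial where "n334 = pscale 2 (D2 nn) + R A2 A1 (D1 nn)"
definition n234 :: moment_polynomial where "n234 = D1 n334"
definition k234 :: moment_polynomial where "k234 = pscale 3 (D3 kk) + R A3 A2 (D2 kk)"
definition k233 :: moment_polynomial where "k233 = pscale 2 (D3 k234) + R A3 A2 (D2 k234)"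

definition hwv :: "moment_polynomial set \<Rightarrow> moment_polynomial \<times> int \<times> int \<times> int \<Rightarrow> bool" where
  "hwv W = (\<lambda>(v, i, j, k). v \<in> W \<and> v \<in> wsp i j k \<and> hw v \<and> v \<noteq> 0)"

definition nvs :: "(moment_polynomial \<times> int \<times> int \<times> int) list" where
  "nvs = [(n334, 3, 3, 4), (nn, 3, 4, 4), (D1 nn, 2, 4, 4), (n234, 2, 3, 4), (D1 (D1 nn), 1, 4, 4), (D2 (D1 (D1 nn)), 1, 3, 4)]"

definition kvs :: "(moment_polynomial \<times> int \<times> int \<times> int) list" where
  "kvs = [(D3 (D3 (D2 kk)), 2, 2, 3), (k233, 2, 3, 3), (D3 (D2 kk), 2, 2, 4), (k234, 2, 3, 4), (D2 kk, 2, 2, 5), (kk, 2, 3, 5)]"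

lemma astabD: "astab W \<Longrightarrow> f \<in> W \<Longrightarrow> a \<noteq> A0 \<Longrightarrow> a \<noteq> b \<Longrightarrow> R a b f \<in> W"
  by (cases "b = A0") (auto simp: astab_def gstab_def)

lemma hwD: "hw f \<Longrightarrow> R A1 A2 f = 0" "hw f \<Longrightarrow> R A2 A3 f = 0"
  by (simp_all add: hw_def)

lemma Wg_self: "v \<in> Wg v"
proof -
  have "v = F3 0 0 0 v" by (simp add: F3_def)
  then have "v \<in> {F3 z y x v | x y z. True}" by blast
  then show ?thesis unfolding Wg_def by (rule Q_mem)
qed

lemma raise_lower:
  assumes f: "f \<in> wsp i j k" and r: "R a b f = 0" and "a \<noteq> b"
  shows "R a b (R b a f) = pscale (of_int (wc i j k b - wc i j k a)) f"
  using R_commute[of a b b a f] r R_diag[OF f, of a] R_diag[OF f, of b] assms(3)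
  by (simp add: un_def wc_def pvs.scale_left_diff_distrib algebra_simps)

lemma n_wsp: "D1 nn \<in> wsp 2 4 4" "D1 (D1 nn) \<in> wsp 1 4 4" "D2 (D1 (D1 nn)) \<in> wsp 1 3 4" "n334 \<in> wsp 3 3 4" "n234 \<in> wsp 2 3 4"
proof -
  show 1: "D1 nn \<in> wsp 2 4 4" by (rule R_wsp'[OF nn_wsp]) (simp_all add: un_def)
  show 2: "D1 (D1 nn) \<in> wsp 1 4 4" by (rule R_wsp'[OF 1]) (simp_all add: un_def)
  show "D2 (D1 (D1 nn)) \<in> wsp 1 3 4" by (rule R_wsp'[OF 2]) (simp_all add: un_def)
  have a: "D2 nn \<in> wsp 3 3 4" by (rule R_wsp'[OF nn_wsp]) (simp_all add: un_def)
  have b: "R A2 A1 (D1 nn) \<in> wsp 3 3 4" by (rule R_wsp'[OF 1]) (simp_all add: un_def)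
  show 3: "n334 \<in> wsp 3 3 4" unfolding n334_def
    by (rule pvs.subspace_add[OF subspace_wsp pvs.subspace_scale[OF subspace_wsp a] b])
  show "n234 \<in> wsp 2 3 4" unfolding n234_def by (rule R_wsp'[OF 3]) (simp_all add: un_def)
qed

lemma n_hw: "hw (D1 nn)" "hw (D1 (D1 nn))" "hw (D2 (D1 (D1 nn)))" "hw n334" "hw n234"
proof -
  show 1: "hw (D1 nn)" using hw_D1_pow[OF nn_hw, of 1] by simp
  show 2: "hw (D1 (D1 nn))" using hw_D1_pow[OF 1, of 1] by simp
  show "hw (D2 (D1 (D1 nn)))" using hw_D2_pow[OF 2 nn_D1, of 1] by simp
  have "R A1 A2 (D2 nn) = - D1 nn" using R_bracket_D[of A1 A2 nn] hwD(1)[OF nn_hw] by simp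
  moreover have "R A1 A2 (R A2 A1 (D1 nn)) = pscale 2 (D1 nn)"
    using raise_lower[OF n_wsp(1) hwD(1)[OF 1]] by (simp add: wc_def)
  ultimately have "R A1 A2 n334 = 0" by (simp add: n334_def R_add R_pscale)
  moreover have "R A2 A3 n334 = 0"
    using R_comm[of A2 A0 A3 A2 nn] R_comm[of A2 A1 A3 A2 "D1 nn"] hwD(2)[OF nn_hw] hwD(2)[OF 1]
    by (simp add: n334_def R_add R_pscale)
  ultimately show 3: "hw n334" by (simp add: hw_def)
  show "hw n234" using hw_D1_pow[OF 3, of 1] by (simp add: n234_def)
qed

lemma n134_nonzero: "D2 (D1 (D1 nn)) \<noteq> 0"
  using word_nonzero[OF n_weight n_nonzero] by (simp add: nn_def)

lemma D1_n234: "D1 n234 = pscale 4 (D2 (D1 (D1 nn)))"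
proof -
  have b: "D1 (R A2 A1 h) = R A2 A1 (D1 h) + D2 h" for h using D_pow_lower(1)[of 1 h] by simp
  have c: "D1 (D2 h) = D2 (D1 h)" for h by (rule R_comm) auto
  have "D1 n234 = pscale 2 (D2 (D1 (D1 nn))) + D2 (D1 (D1 nn)) + D2 (D1 (D1 nn))"
    by (simp add: n234_def n334_def R_add R_pscale b c nn_D1)
  moreover have "pscale 2 f + f + f = pscale 4 f" for f :: moment_polynomial
    by (rule poly_mapping_eqI) (simp only: lookup_add lookup_pscale, simp)
  ultimately show ?thesis by simp
qed

lemma nvs_hwv: "\<forall>x\<in>set nvs. hwv (Wg nn) x"
proof -
  note st = astabD[OF Wg_astab[OF nn_wsp nn_hw]]
  have s: "pvs.subspace (Wg nn)" using Wg_astab[OF nn_wsp nn_hw] by (simp add: astab_def gstab_def)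
  have m: "nn \<in> Wg nn" by (rule Wg_self)
  have m334: "n334 \<in> Wg nn" unfolding n334_def
    by (intro pvs.subspace_add[OF s] pvs.subspace_scale[OF s] st m) simp_all
  have "D1 (D1 nn) \<noteq> 0" using n134_nonzero by auto
  moreover have "D1 nn \<noteq> 0" using \<open>D1 (D1 nn) \<noteq> 0\<close> by auto
  moreover have "nn \<noteq> 0" using \<open>D1 nn \<noteq> 0\<close> by auto
  moreover have "n234 \<noteq> 0" using D1_n234 n134_nonzero by auto
  moreover have "n334 \<noteq> 0" using \<open>n234 \<noteq> 0\<close> by (auto simp: n234_def)
  moreover have "D1 nn \<in> Wg nn" "D1 (D1 nn) \<in> Wg nn" "D2 (D1 (D1 nn)) \<in> Wg nn" "n234 \<in> Wg nn"
    using st m m334 by (simp_all add: n234_def)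
  ultimately show ?thesis using m m334 n_wsp n_hw nn_wsp nn_hw n134_nonzero by (simp add: nvs_def hwv_def)
qed

lemma k_wsp: "D2 kk \<in> wsp 2 2 5" "D3 (D2 kk) \<in> wsp 2 2 4" "D3 (D3 (D2 kk)) \<in> wsp 2 2 3" "k234 \<in> wsp 2 3 4" "k233 \<in> wsp 2 3 3"
proof -
  show 1: "D2 kk \<in> wsp 2 2 5" by (rule R_wsp'[OF kk_wsp]) (simp_all add: un_def)
  show 2: "D3 (D2 kk) \<in> wsp 2 2 4" by (rule R_wsp'[OF 1]) (simp_all add: un_def)
  show "D3 (D3 (D2 kk)) \<in> wsp 2 2 3" by (rule R_wsp'[OF 2]) (simp_all add: un_def)
  have a: "D3 kk \<in> wsp 2 3 4" by (rule R_wsp'[OF kk_wsp]) (simp_all add: un_def)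
  have b: "R A3 A2 (D2 kk) \<in> wsp 2 3 4" by (rule R_wsp'[OF 1]) (simp_all add: un_def)
  show 3: "k234 \<in> wsp 2 3 4" unfolding k234_def
    by (rule pvs.subspace_add[OF subspace_wsp pvs.subspace_scale[OF subspace_wsp a] b])
  have a: "D3 k234 \<in> wsp 2 3 3" by (rule R_wsp'[OF 3]) (simp_all add: un_def)
  have d: "D2 k234 \<in> wsp 2 2 4" by (rule R_wsp'[OF 3]) (simp_all add: un_def)
  have b: "R A3 A2 (D2 k234) \<in> wsp 2 3 3" by (rule R_wsp'[OF d]) (simp_all add: un_def)
  show "k233 \<in> wsp 2 3 3" unfolding k233_def
    by (rule pvs.subspace_add[OF subspace_wsp pvs.subspace_scale[OF subspace_wsp a] b])
qed

lemma k_hw1: "hw (D2 kk)" "D1 (D2 kk) = 0" "D2 (D2 kk) = 0"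
proof -
  show 1: "hw (D2 kk)" "D1 (D2 kk) = 0" using hw_D2_pow[OF kk_hw kk_D1, of 1] by simp_all
  have h: "hw (D2 (D2 kk))" using hw_D2_pow[OF 1, of 1] by simp
  have w: "D2 (D2 kk) \<in> wsp 2 1 5" by (rule R_wsp'[OF k_wsp(1)]) (simp_all add: un_def)
  show "D2 (D2 kk) = 0"
  proof (rule ccontr)
    assume "D2 (D2 kk) \<noteq> 0"
    from hw_dominant(2)[OF w h this] show False by simp
  qed
qed

lemma D2_R32: "D2 (R A3 A2 h) = R A3 A2 (D2 h) + D3 h"
  using D_pow_lower(3)[of 1 h] by simp

lemma D2_D3: "D2 (D3 h) = D3 (D2 h)"
  by (rule R_comm) auto

lemma D2_k234: "D2 k234 = pscale 4 (D3 (D2 kk))"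
proof -
  have "D2 k234 = pscale 3 (D3 (D2 kk)) + D3 (D2 kk)"
    by (simp add: k234_def R_add R_pscale D2_R32 D2_D3 k_hw1(3))
  moreover have "pscale 3 f + f = pscale 4 f" for f :: moment_polynomial
    by (rule poly_mapping_eqI) (simp add: lookup_add)
  ultimately show ?thesis by simp
qed

lemma D2_k233: "D2 k233 = pscale 12 (D3 (D3 (D2 kk)))"
proof -
  have z: "D2 (D2 k234) = 0" by (simp add: D2_k234 R_pscale D2_D3 k_hw1(3))
  have "D2 k233 = pscale 2 (D3 (D2 k234)) + D3 (D2 k234)"
    by (simp add: k233_def R_add R_pscale D2_R32 D2_D3 z)
  then have "D2 k233 = pscale 8 (D3 (D3 (D2 kk))) + pscale 4 (D3 (D3 (D2 kk)))"
    by (simp add: D2_k234 R_pscale)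
  moreover have "pscale 8 f + pscale 4 f = pscale 12 f" for f :: moment_polynomial
    by (rule poly_mapping_eqI) (simp add: lookup_add)
  ultimately show ?thesis by simp
qed

lemma k_hw: "hw (D3 (D2 kk))" "hw (D3 (D3 (D2 kk)))" "hw k234" "hw k233" "D1 k234 = 0"
proof -
  show 1: "hw (D3 (D2 kk))" using hw_D3_pow[OF k_hw1, of 1] by simp
  show "hw (D3 (D3 (D2 kk)))" using hw_D3_pow[OF k_hw1, of 2] by (simp add: numeral_2_eq_2)
  have c: "R A1 A2 (D3 h) = D3 (R A1 A2 h)" "R A1 A2 (R A3 A2 h) = R A3 A2 (R A1 A2 h)"
    "D1 (D3 h) = D3 (D1 h)" "D1 (R A3 A2 h) = R A3 A2 (D1 h)" for h
    by (rule R_comm, simp, simp)+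
  have "R A2 A3 (D3 kk) = - D2 kk" using R_bracket_D[of A2 A3 kk] hwD(2)[OF kk_hw] by simp
  moreover have "R A2 A3 (R A3 A2 (D2 kk)) = pscale 3 (D2 kk)"
    using raise_lower[OF k_wsp(1) hwD(2)[OF k_hw1(1)]] by (simp add: wc_def)
  ultimately have "R A2 A3 k234 = 0" by (simp add: k234_def R_add R_pscale)
  moreover have "R A1 A2 k234 = 0"
    by (simp add: k234_def R_add R_pscale c hwD(1)[OF kk_hw] hwD(1)[OF k_hw1(1)])
  ultimately show 2: "hw k234" by (simp add: hw_def)
  show d: "D1 k234 = 0" by (simp add: k234_def R_add R_pscale c kk_D1 k_hw1(2))
  have h: "hw (D2 k234)" using hw_D2_pow[OF 2 d, of 1] by simp
  have w: "D2 k234 \<in> wsp 2 2 4" by (rule R_wsp'[OF k_wsp(4)]) (simp_all add: un_def)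
  have "R A2 A3 (D3 k234) = - D2 k234" using R_bracket_D[of A2 A3 k234] hwD(2)[OF 2] by simp
  moreover have "R A2 A3 (R A3 A2 (D2 k234)) = pscale 2 (D2 k234)"
    using raise_lower[OF w hwD(2)[OF h]] by (simp add: wc_def)
  ultimately have "R A2 A3 k233 = 0" by (simp add: k233_def R_add R_pscale)
  moreover have "R A1 A2 k233 = 0"
    by (simp add: k233_def R_add R_pscale c hwD(1)[OF 2] hwD(1)[OF h])
  ultimately show "hw k233" by (simp add: hw_def)
qed

lemma k223_nonzero: "D3 (D3 (D2 kk)) \<noteq> 0"
  using word_nonzero[OF k_weight k_nonzero] by (simp add: kk_def)

lemma kvs_hwv: "\<forall>x\<in>set kvs. hwv (Wg kk) x"
proof -
  note st = astabD[OF Wg_astab[OF kk_wsp kk_hw]]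
  have s: "pvs.subspace (Wg kk)" using Wg_astab[OF kk_wsp kk_hw] by (simp add: astab_def gstab_def)
  have m: "kk \<in> Wg kk" by (rule Wg_self)
  have m234: "k234 \<in> Wg kk" unfolding k234_def
    by (intro pvs.subspace_add[OF s] pvs.subspace_scale[OF s] st m) simp_all
  have m233: "k233 \<in> Wg kk" unfolding k233_def
    by (intro pvs.subspace_add[OF s] pvs.subspace_scale[OF s] st m234) simp_all
  have "D3 (D2 kk) \<noteq> 0" using k223_nonzero by auto
  moreover have "D2 kk \<noteq> 0" using \<open>D3 (D2 kk) \<noteq> 0\<close> by auto
  moreover have "kk \<noteq> 0" using \<open>D2 kk \<noteq> 0\<close> by auto
  moreover have "k233 \<noteq> 0" using D2_k233 k223_nonzero by auto
  moreover have "k234 \<noteq> 0" using D2_k234 \<open>D3 (D2 kk) \<noteq> 0\<close> by auto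
  moreover have "D2 kk \<in> Wg kk" "D3 (D2 kk) \<in> Wg kk" "D3 (D3 (D2 kk)) \<in> Wg kk" using st m by simp_all
  ultimately show ?thesis using m m234 m233 k_wsp k_hw k_hw1(1) kk_wsp kk_hw k223_nonzero by (simp add: kvs_def hwv_def)
qed

subsection \<open>Independence and completeness\<close>

abbreviation Ls :: "(moment_polynomial \<times> int \<times> int \<times> int) list \<Rightarrow> moment_polynomial set list" where
  "Ls us \<equiv> map (\<lambda>u. Lm (fst u)) us"

lemma hwv_gstab: "hwv W (v, i, j, k) \<Longrightarrow> gstab (Lm v)"
  using Lm_gstab by (auto simp: hwv_def)

lemma Ls_gstab: "\<forall>x\<in>set us. hwv W x \<Longrightarrow> \<forall>U\<in>set (Ls us). gstab U"
  using hwv_gstab by force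

lemma Ls_subspace: "\<forall>x\<in>set us. hwv W x \<Longrightarrow> \<forall>U\<in>set (Ls us). pvs.subspace U"
  using Ls_gstab gstabD(1) by blast

lemma perp_Ls:
  assumes "hwv W (v, w)" "\<forall>x\<in>set us. hwv W x" "w \<notin> snd ` set us"
  shows "perp (Lm v) (lsum (Ls us))"
proof (rule perp_lsum, intro ballI)
  fix U assume "U \<in> set (Ls us)"
  then obtain u w' where u: "(u, w') \<in> set us" "U = Lm u" by auto
  have n: "w \<noteq> w'" using u(1) assms(3) by force
  have "hwv W (u, w')" using assms(2) u(1) by blast
  then show "perp (Lm v) U" using assms(1) n unfolding u(2)
    by (cases w; cases w') (auto simp: hwv_def intro!: Lm_perp)
qed

lemma indep_Cons_perp:
  assumes "\<forall>x\<in>set ((v, w) # us). hwv W x" "w \<notin> snd ` set us" "indep (Ls us)"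
  shows "indep (Ls ((v, w) # us))"
proof -
  have h: "hwv W (v, w)" "\<forall>x\<in>set us. hwv W x" using assms(1) by simp_all
  have "perp (Lm v) (lsum (Ls us))" by (rule perp_Ls[OF h assms(2)])
  moreover have "pvs.subspace (Lm v)" by (simp add: Lm_def Q_subspace)
  moreover have "pvs.subspace (lsum (Ls us))" by (rule subspace_lsum[OF Ls_subspace[OF h(2)]])
  ultimately have "Lm v \<inter> lsum (Ls us) = {0}" by (intro perp_int)
  then show ?thesis using assms(3) by simp
qed

lemma indep_distinct: "\<forall>x\<in>set us. hwv W x \<Longrightarrow> distinct (map snd us) \<Longrightarrow> indep (Ls us)"
proof (induct us)
  case (Cons u us)
  obtain v w where u: "u = (v, w)" using surj_pair[of u] by blast
  show ?case unfolding u by (rule indep_Cons_perp[of v w us W]) (use Cons u in auto)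
qed simp

lemma indep_Cons_same:
  assumes h: "hwv W (v, w)" "hwv W (u, w)" "\<forall>x\<in>set (us @ us'). hwv W x" and n: "w \<notin> snd ` set (us @ us')"
    and vu: "v \<notin> Lm u" and i: "indep (Ls (us @ (u, w) # us'))"
  shows "indep (Ls ((v, w) # us @ (u, w) # us'))"
proof -
  let ?Z = "lsum (Ls (us @ us'))"
  obtain i j k where w: "w = (i, j, k)" by (cases w) auto
  have g: "gstab (Lm v)" "gstab (Lm u)" using hwv_gstab h(1,2) w by blast+
  have Zg: "pvs.subspace ?Z" by (rule subspace_lsum[OF Ls_subspace[OF h(3)]])
  have p: "perp (Lm v) ?Z" "perp (Lm u) ?Z" using perp_Ls[OF h(1,3) n] perp_Ls[OF h(2,3) n] .
  have e: "lsum (Ls (us @ (u, w) # us')) = ssum (Lm u) ?Z"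
    by (simp add: lsum_append ssum_left_commute)
  have "Lm v \<inter> Lm u = {0}"
  proof -
    have "gl_submodule (Lm v \<inter> Lm u)" by (rule gstab_gl_submodule[OF gstab_int[OF g]])
    moreover have "gl_irreducible (Lm v)" using Lm_irreducible h(1) by (auto simp: hwv_def w)
    ultimately have "Lm v \<inter> Lm u = {0} \<or> Lm v \<inter> Lm u = Lm v" unfolding gl_irreducible_def by blast
    then show ?thesis using Lm_self[of v] vu by blast
  qed
  moreover have "x \<in> Lm u" if x: "x \<in> Lm v" "x \<in> ssum (Lm u) ?Z" for x
  proof -
    obtain a z where az: "x = a + z" "a \<in> Lm u" "z \<in> ?Z" using x(2) by (auto simp: ssum_def)
    have "ip z z = ip x z - ip a z" using az(1) by (simp add: ip_add_left)
    also have "\<dots> = 0" using p az x(1) by (simp add: perp_def)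
    finally show ?thesis using az by (simp add: ip_self_eq_0)
  qed
  moreover have "0 \<in> Lm v \<inter> ssum (Lm u) ?Z"
    using pvs.subspace_0[OF gstabD(1)[OF g(1)]] pvs.subspace_0[OF subspace_ssum[OF gstabD(1)[OF g(2)] Zg]] by blast
  ultimately have "Lm v \<inter> ssum (Lm u) ?Z = {0}" by blast
  then show ?thesis using i e by simp
qed

lemma hwv_fst: "hwv W x \<Longrightarrow> fst x \<in> W"
  by (cases x) (simp add: hwv_def)

lemma hwv_mono: "W \<subseteq> W' \<Longrightarrow> hwv W x \<Longrightarrow> hwv W' x"
  by (auto simp: hwv_def split: prod.splits)

lemma all_hwv: "\<forall>x\<in>set (nvs @ kvs). hwv V x"
  using nvs_hwv kvs_hwv hwv_mono[OF Wg_nn] hwv_mono[OF Wg_kk] by auto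

lemma n234_notin: "n234 \<notin> Lm k234"
proof
  assume "n234 \<in> Lm k234"
  then obtain t where t: "n234 = pscale t k234" using Lm_top[OF k_wsp(4)] n_wsp(5) by blast
  have "D1 n234 = D1 (pscale t k234)" by (rule arg_cong[OF t])
  also have "\<dots> = pscale t (D1 k234)" by (rule R_pscale)
  also have "\<dots> = 0" by (simp only: k_hw(5) pvs.scale_zero_right)
  finally have "D1 n234 = 0" .
  then show False using D1_n234 n134_nonzero by simp
qed

lemma indep_all: "indep (Ls (nvs @ kvs))"
proof -
  let ?a = "[(D1 (D1 nn), 1, 4, 4), (D2 (D1 (D1 nn)), 1, 3, 4), (D3 (D3 (D2 kk)), 2, 2, 3), (k233, 2, 3, 3), (D3 (D2 kk), 2, 2, 4)]
    :: (moment_polynomial \<times> int \<times> int \<times> int) list"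
  let ?b = "[(D2 kk, 2, 2, 5), (kk, 2, 3, 5)] :: (moment_polynomial \<times> int \<times> int \<times> int) list"
  let ?u = "(k234, 2, 3, 4) :: moment_polynomial \<times> int \<times> int \<times> int"
  have h: "\<forall>x\<in>set ((n334, 3, 3, 4) # (nn, 3, 4, 4) # (D1 nn, 2, 4, 4) # (n234, 2, 3, 4) # ?a @ ?u # ?b). hwv V x"
    using all_hwv by (simp add: nvs_def kvs_def)
  have 1: "indep (Ls (?a @ ?u # ?b))" by (rule indep_distinct[of _ V]) (use h in auto)
  have 2: "indep (Ls ((n234, 2, 3, 4) # ?a @ ?u # ?b))"
    by (rule indep_Cons_same[where W = V, OF _ _ _ _ n234_notin 1]) (use h in auto)
  have 3: "indep (Ls ((D1 nn, 2, 4, 4) # (n234, 2, 3, 4) # ?a @ ?u # ?b))"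
    by (rule indep_Cons_perp[where W = V, OF _ _ 2]) (use h in auto)
  have 4: "indep (Ls ((nn, 3, 4, 4) # (D1 nn, 2, 4, 4) # (n234, 2, 3, 4) # ?a @ ?u # ?b))"
    by (rule indep_Cons_perp[where W = V, OF _ _ 3]) (use h in auto)
  have 5: "indep (Ls ((n334, 3, 3, 4) # (nn, 3, 4, 4) # (D1 nn, 2, 4, 4) # (n234, 2, 3, 4) # ?a @ ?u # ?b))"
    by (rule indep_Cons_perp[where W = V, OF h _ 4]) auto
  then show ?thesis by (simp add: nvs_def kvs_def)
qed

lemma nvs_types: "list_all2 gl_irreducible_of_type (Ls nvs)
    [(vector [3,3,4], 3), (vector [3,4,4], 3), (vector [2,4,4], 6), (vector [2,3,4], 8), (vector [1,4,4], 10), (vector [1,3,4], 15)]"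
  and kvs_types: "list_all2 gl_irreducible_of_type (Ls kvs)
    [(vector [2,2,3], 3), (vector [2,3,3], 3), (vector [2,2,4], 6), (vector [2,3,4], 8), (vector [2,2,5], 10), (vector [2,3,5], 15)]"
  and nvs_dims: "list_all2 has_dim (Ls nvs) [3, 3, 6, 8, 10, 15]" and kvs_dims: "list_all2 has_dim (Ls kvs) [3, 3, 6, 8, 10, 15]"
proof -
  have n: "hwv (Wg nn) x" if "x \<in> set nvs" for x using nvs_hwv that by blast
  have k: "hwv (Wg kk) x" if "x \<in> set kvs" for x using kvs_hwv that by blast
  note nh = n[unfolded nvs_def hwv_def] and kh = k[unfolded kvs_def hwv_def]
  have ty: "gl_irreducible_of_type (Lm v) (vector [a, b, c], d)"
    if "v \<in> wsp i j k \<and> hw v \<and> v \<noteq> 0" "has_dim (Lm v) d" "i = int a" "j = int b" "k = int c" for v a b c d i j k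
    using Lm_type[of v a b c d] that by simp
  have N: "n334 \<in> wsp 3 3 4 \<and> hw n334 \<and> n334 \<noteq> 0" "nn \<in> wsp 3 4 4 \<and> hw nn \<and> nn \<noteq> 0"
    "D1 nn \<in> wsp 2 4 4 \<and> hw (D1 nn) \<and> D1 nn \<noteq> 0" "n234 \<in> wsp 2 3 4 \<and> hw n234 \<and> n234 \<noteq> 0"
    "D1 (D1 nn) \<in> wsp 1 4 4 \<and> hw (D1 (D1 nn)) \<and> D1 (D1 nn) \<noteq> 0"
    "D2 (D1 (D1 nn)) \<in> wsp 1 3 4 \<and> hw (D2 (D1 (D1 nn))) \<and> D2 (D1 (D1 nn)) \<noteq> 0"
    using nvs_hwv by (simp_all add: nvs_def hwv_def)
  have K: "D3 (D3 (D2 kk)) \<in> wsp 2 2 3 \<and> hw (D3 (D3 (D2 kk))) \<and> D3 (D3 (D2 kk)) \<noteq> 0"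
    "k233 \<in> wsp 2 3 3 \<and> hw k233 \<and> k233 \<noteq> 0" "D3 (D2 kk) \<in> wsp 2 2 4 \<and> hw (D3 (D2 kk)) \<and> D3 (D2 kk) \<noteq> 0"
    "k234 \<in> wsp 2 3 4 \<and> hw k234 \<and> k234 \<noteq> 0" "D2 kk \<in> wsp 2 2 5 \<and> hw (D2 kk) \<and> D2 kk \<noteq> 0"
    "kk \<in> wsp 2 3 5 \<and> hw kk \<and> kk \<noteq> 0"
    using kvs_hwv by (simp_all add: kvs_def hwv_def)
  have dN: "has_dim (Lm n334) 3" "has_dim (Lm nn) 3" "has_dim (Lm (D1 nn)) 6" "has_dim (Lm n234) 8"
    "has_dim (Lm (D1 (D1 nn))) 10" "has_dim (Lm (D2 (D1 (D1 nn)))) 15"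
    using N dim_334 dim_344 dim_244 dim_234 dim_144 dim_134 by blast+
  have dK: "has_dim (Lm (D3 (D3 (D2 kk)))) 3" "has_dim (Lm k233) 3" "has_dim (Lm (D3 (D2 kk))) 6" "has_dim (Lm k234) 8"
    "has_dim (Lm (D2 kk)) 10" "has_dim (Lm kk) 15"
    using K dim_223 dim_233 dim_224 dim_234 dim_225 dim_235 by blast+
  show "list_all2 has_dim (Ls nvs) [3, 3, 6, 8, 10, 15]" "list_all2 has_dim (Ls kvs) [3, 3, 6, 8, 10, 15]"
    using dN dK by (simp_all add: nvs_def kvs_def)
  have tN: "gl_irreducible_of_type (Lm n334) (vector [3,3,4], 3)" "gl_irreducible_of_type (Lm nn) (vector [3,4,4], 3)"
    "gl_irreducible_of_type (Lm (D1 nn)) (vector [2,4,4], 6)" "gl_irreducible_of_type (Lm n234) (vector [2,3,4], 8)"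
    "gl_irreducible_of_type (Lm (D1 (D1 nn))) (vector [1,4,4], 10)" "gl_irreducible_of_type (Lm (D2 (D1 (D1 nn)))) (vector [1,3,4], 15)"
    by (rule ty[OF N(1) dN(1)], simp_all) (rule ty[OF N(2) dN(2)], simp_all, rule ty[OF N(3) dN(3)], simp_all,
      rule ty[OF N(4) dN(4)], simp_all, rule ty[OF N(5) dN(5)], simp_all, rule ty[OF N(6) dN(6)], simp_all)
  have tK: "gl_irreducible_of_type (Lm (D3 (D3 (D2 kk)))) (vector [2,2,3], 3)" "gl_irreducible_of_type (Lm k233) (vector [2,3,3], 3)"
    "gl_irreducible_of_type (Lm (D3 (D2 kk))) (vector [2,2,4], 6)" "gl_irreducible_of_type (Lm k234) (vector [2,3,4], 8)"
    "gl_irreducible_of_type (Lm (D2 kk)) (vector [2,2,5], 10)" "gl_irreducible_of_type (Lm kk) (vector [2,3,5], 15)"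
    by (rule ty[OF K(1) dK(1)], simp_all) (rule ty[OF K(2) dK(2)], simp_all, rule ty[OF K(3) dK(3)], simp_all,
      rule ty[OF K(4) dK(4)], simp_all, rule ty[OF K(5) dK(5)], simp_all, rule ty[OF K(6) dK(6)], simp_all)
  show "list_all2 gl_irreducible_of_type (Ls nvs)
    [(vector [3,3,4], 3), (vector [3,4,4], 3), (vector [2,4,4], 6), (vector [2,3,4], 8), (vector [1,4,4], 10), (vector [1,3,4], 15)]"
    using tN by (simp add: nvs_def)
  show "list_all2 gl_irreducible_of_type (Ls kvs)
    [(vector [2,2,3], 3), (vector [2,3,3], 3), (vector [2,2,4], 6), (vector [2,3,4], 8), (vector [2,2,5], 10), (vector [2,3,5], 15)]"
    using tK by (simp add: kvs_def)
qed

lemma V_gstab: "gstab V"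
  using V_astab by (simp add: astab_def)

lemma V_eq: "V = lsum (Ls (nvs @ kvs))"
proof
  let ?S = "lsum (Ls (nvs @ kvs))"
  have sub: "pvs.subspace ?S" by (rule subspace_lsum[OF Ls_subspace[OF all_hwv]])
  have gS: "gstab ?S" by (rule gstab_lsum[OF Ls_gstab[OF all_hwv]])
  have mem: "v \<in> ?S" if "(v, w) \<in> set (nvs @ kvs)" for v w
    by (rule lsum_member[OF Ls_subspace[OF all_hwv] _ Lm_self]) (use that in force)
  show "?S \<subseteq> V"
  proof (rule lsum_subset[OF V_subspace], intro ballI)
    fix U assume "U \<in> set (Ls (nvs @ kvs))"
    then obtain x where x: "x \<in> set (nvs @ kvs)" "U = Lm (fst x)" by auto
    have "fst x \<in> V" by (rule hwv_fst) (use all_hwv x(1) in blast)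
    then show "U \<subseteq> V" unfolding x(2) by (rule Lm_least[OF V_gstab])
  qed
  show "V \<subseteq> ?S"
  proof
    fix f assume f: "f \<in> V"
    have "list_all2 has_dim (Ls (nvs @ kvs)) ([3, 3, 6, 8, 10, 15] @ [3, 3, 6, 8, 10, 15])"
      using list_all2_appendI[OF nvs_dims kvs_dims] by simp
    from has_dim_lsum[OF this indep_all] obtain B where B: "finite B" "spn B = ?S" by (auto simp: has_dim_def)
    obtain s where s: "s \<in> ?S" "\<forall>b\<in>?S. ip b (f - s) = 0" using orthogonal_projection[OF B(1), of f] B(2) by auto
    let ?M = "{g \<in> V. \<forall>b\<in>?S. ip b g = 0}"
    have gM: "gstab ?M" by (rule perp_gstab[OF V_gstab gS])
    have "s \<in> V" using s(1) \<open>?S \<subseteq> V\<close> by blast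
    then have fs: "f - s \<in> ?M" using s(2) pvs.subspace_diff[OF V_subspace f] by simp
    have "f - s = 0"
    proof (rule ccontr)
      assume "f - s \<noteq> 0"
      from gstab_hw[OF gM fs this] obtain g i j k where g: "g \<in> ?M" "g \<in> wsp i j k" "g \<noteq> 0" "hw g" by blast
      have gV: "g \<in> V" using g(1) by simp
      have gH: "g \<in> Hsp i j k" using gV g by (simp add: Hsp_def)
      have "g \<in> ?S"
      proof (cases "(i, j, k) = (2, 3, 4)")
        case True
        have h: "hwv V (n234, 2, 3, 4)" "hwv V (k234, 2, 3, 4)" using all_hwv by (simp_all add: nvs_def kvs_def)
        have m: "n234 \<in> ?S" "k234 \<in> ?S"
          by (rule mem[of _ "(2, 3, 4)"], simp add: nvs_def kvs_def)+
        have "n234 \<in> Hsp 2 3 4" "k234 \<in> Hsp 2 3 4" "k234 \<noteq> 0" using h by (simp_all add: hwv_def Hsp_def)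
        moreover have "D1 n234 \<noteq> 0" using D1_n234 n134_nonzero by simp
        ultimately obtain a b where "g = pscale a n234 + pscale b k234"
          using hw_mult_234[OF _ _ _ k_hw(5)] gH True by blast
        then show ?thesis using pvs.subspace_add[OF sub] pvs.subspace_scale[OF sub] m by simp
      next
        case False
        have "\<forall>w\<in>{(3,3,4), (3,4,4), (2,4,4), (2,3,4), (1,4,4), (1,3,4), (2,2,3), (2,3,3), (2,2,4), (2,2,5), (2,3,5)}.
            \<exists>v. (v, w) \<in> set (nvs @ kvs)"
          by (simp add: nvs_def kvs_def ex_disj_distrib)
        then obtain v where v: "(v, i, j, k) \<in> set (nvs @ kvs)"
          using hw_weights[OF gV g(2,4,3)] by blast
        have "hwv V (v, i, j, k)" using all_hwv v by blast
        then have "v \<in> Hsp i j k" "v \<noteq> 0" by (simp_all add: hwv_def Hsp_def)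
        then obtain t where "g = pscale t v" using hw_mult[OF _ _ gH False] by blast
        then show ?thesis using pvs.subspace_scale[OF sub mem[OF v]] by simp
      qed
      then have "ip g g = 0" using g(1) by simp
      then show False using g(3) by (simp add: ip_self_eq_0)
    qed
    then show "f \<in> ?S" using s(1) by simp
  qed
qed

subsection \<open>The affine module structure\<close>

lemma Wg_word:
  assumes v: "v \<in> wsp i0 j0 k0" and f: "f \<in> Wg v" "f \<in> wsp i j k" "f \<noteq> 0"
  shows "\<exists>x y z. F3 z y x v \<noteq> 0 \<and> i0 - int x \<le> i \<and> i + j + k = i0 + j0 + k0 - int x - int y - int z"
proof -
  let ?Z = "{F3 z y x v | x y z. True}"
  have Z: "weighted ?Z" using F3_wsp[OF v] unfolding weighted_def by blast
  have m: "f \<in> spn {lw a b c z | a b c z. z \<in> ?Z \<and> lw a b c z \<in> wsp i j k}"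
    using Q_cmp[OF Z f(1)[unfolded Wg_def], of i j k] cmp_id[OF f(2)] by simp
  have "\<exists>a b c x y z. lw a b c (F3 z y x v) \<in> wsp i j k \<and> lw a b c (F3 z y x v) \<noteq> 0"
  proof (rule ccontr)
    assume "\<not> ?thesis"
    then have "{lw a b c z | a b c z. z \<in> ?Z \<and> lw a b c z \<in> wsp i j k} \<subseteq> {0}" by auto
    then have "f \<in> spn {0}" using m pvs.span_mono by blast
    then show False using f(3) by (simp add: pvs.span_singleton)
  qed
  then obtain a b c x y z where h: "lw a b c (F3 z y x v) \<in> wsp i j k" "lw a b c (F3 z y x v) \<noteq> 0" by blast
  have "i0 - int x + int a + int b = i \<and> j0 - int y - int a + int c = j \<and> k0 - int z - int b - int c = k"
    by (rule wsp_unique[OF lw_wsp[OF F3_wsp[OF v]] h])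
  moreover have "F3 z y x v \<noteq> 0" using h(2) by auto
  ultimately have "F3 z y x v \<noteq> 0 \<and> i0 - int x \<le> i \<and> i + j + k = i0 + j0 + k0 - int x - int y - int z" by auto
  then show ?thesis by blast
qed

lemma Wg_nn_weights: "f \<in> Wg nn \<Longrightarrow> f \<in> wsp i j k \<Longrightarrow> f \<noteq> 0 \<Longrightarrow> 8 \<le> i + j + k"
proof -
  assume "f \<in> Wg nn" "f \<in> wsp i j k" "f \<noteq> 0"
  from Wg_word[OF nn_wsp this] obtain x y z where h: "F3 z y x nn \<noteq> 0" "i + j + k = 3 + 4 + 4 - int x - int y - int z" by blast
  have "\<not> 4 \<le> z + y + x" using F3_vanish[OF nn_hw nn_D3] h(1) by blast
  then show ?thesis using h(2) by linarith
qed

lemma Wg_kk_weights: "f \<in> Wg kk \<Longrightarrow> f \<in> wsp i j k \<Longrightarrow> f \<noteq> 0 \<Longrightarrow> 2 \<le> i"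
proof -
  assume "f \<in> Wg kk" "f \<in> wsp i j k" "f \<noteq> 0"
  from Wg_word[OF kk_wsp this] obtain x y z where h: "F3 z y x kk \<noteq> 0" "2 - int x \<le> i" by blast
  have "x = 0"
  proof (rule ccontr)
    assume "x \<noteq> 0"
    then have "F3 z y x kk = 0" using kk_D1 by (cases x) (simp_all add: F3_def pow_shift)
    then show False using h(1) by simp
  qed
  then show ?thesis using h(2) by simp
qed

lemma T_inv_in:
  assumes W: "astab W" "W \<subseteq> V" and f: "f \<in> W" "f \<noteq> 0"
  shows "\<exists>g\<in>W. g \<noteq> 0 \<and> hw g \<and> D3 g = 0 \<and> (g \<in> wsp 1 3 4 \<or> g \<in> wsp 2 2 3)"
proof -
  have gW: "gstab W" using W(1) by (simp add: astab_def)
  from gstab_hw[OF gW f] obtain h i j k where h: "h \<in> W" "h \<in> wsp i j k" "h \<noteq> 0" by blast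
  from exists_T_inv_hw[OF W(1) h] obtain g i' j' k' where
    g: "g \<in> W" "g \<in> wsp i' j' k'" "g \<noteq> 0" "hw g" "D3 g = 0" by blast
  have "g \<in> V" using g(1) W(2) by blast
  from T_inv_hw[OF this g(2,4,5,3)] have "g \<in> wsp 1 3 4 \<or> g \<in> wsp 2 2 3" using g(2) by auto
  then show ?thesis using g by blast
qed

lemma Wg_disjoint: "Wg nn \<inter> Wg kk = {0}"
proof -
  have s: "astab (Wg nn \<inter> Wg kk)" by (rule astab_int[OF Wg_astab[OF nn_wsp nn_hw] Wg_astab[OF kk_wsp kk_hw]])
  have "f = 0" if f: "f \<in> Wg nn \<inter> Wg kk" for f
  proof (rule ccontr)
    assume "f \<noteq> 0"
    have "Wg nn \<inter> Wg kk \<subseteq> V" using Wg_nn by blast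
    from T_inv_in[OF s this f \<open>f \<noteq> 0\<close>] obtain g where
      g: "g \<in> Wg nn" "g \<in> Wg kk" "g \<noteq> 0" "g \<in> wsp 1 3 4 \<or> g \<in> wsp 2 2 3" by blast
    from g(4) show False
    proof
      assume "g \<in> wsp 1 3 4"
      from Wg_kk_weights[OF g(2) this g(3)] show False by simp
    next
      assume "g \<in> wsp 2 2 3"
      from Wg_nn_weights[OF g(1) this g(3)] show False by simp
    qed
  qed
  moreover have "pvs.subspace (Wg nn \<inter> Wg kk)" using s by (simp add: astab_def gstab_def)
  ultimately show ?thesis using pvs.subspace_0 by blast
qed

lemma lsum_nvs: "lsum (Ls nvs) = Wg nn" and lsum_kvs: "lsum (Ls kvs) = Wg kk"
proof -
  have A: "astab (Wg nn)" "astab (Wg kk)" using Wg_astab[OF nn_wsp nn_hw] Wg_astab[OF kk_wsp kk_hw] .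
  then have G: "gstab (Wg nn)" "gstab (Wg kk)" by (simp_all add: astab_def)
  have sub: "lsum (Ls us) \<subseteq> W" if "gstab W" "\<forall>x\<in>set us. hwv W x" for us W
  proof (rule lsum_subset[OF gstabD(1)[OF that(1)]], intro ballI)
    fix U assume "U \<in> set (Ls us)"
    then obtain x where x: "x \<in> set us" "U = Lm (fst x)" by auto
    have "fst x \<in> W" by (rule hwv_fst) (use that(2) x(1) in blast)
    then show "U \<subseteq> W" unfolding x(2) by (rule Lm_least[OF that(1)])
  qed
  have n: "lsum (Ls nvs) \<subseteq> Wg nn" and k: "lsum (Ls kvs) \<subseteq> Wg kk"
    using sub[OF G(1) nvs_hwv] sub[OF G(2) kvs_hwv] .
  have V: "V = ssum (lsum (Ls nvs)) (lsum (Ls kvs))" unfolding V_eq by (simp add: lsum_append)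
  have "x \<in> lsum (Ls nvs)" if x: "x \<in> Wg nn" for x
  proof -
    have "x \<in> V" using x Wg_nn by blast
    then have "x \<in> ssum (lsum (Ls nvs)) (lsum (Ls kvs))" by (rule V[THEN equalityD1, THEN subsetD])
    then obtain a b where ab: "x = a + b" "a \<in> lsum (Ls nvs)" "b \<in> lsum (Ls kvs)" unfolding ssum_def by blast
    have "x - a \<in> Wg nn" by (rule pvs.subspace_diff[OF gstabD(1)[OF G(1)] x]) (use ab(2) n in blast)
    moreover have "x - a = b" using ab(1) by simp
    ultimately have "b = 0" using Wg_disjoint ab(3) k by auto
    then show ?thesis using ab by simp
  qed
  then show "lsum (Ls nvs) = Wg nn" using n by blast
  have "x \<in> lsum (Ls kvs)" if x: "x \<in> Wg kk" for x
  proof -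
    have "x \<in> V" using x Wg_kk by blast
    then have "x \<in> ssum (lsum (Ls nvs)) (lsum (Ls kvs))" by (rule V[THEN equalityD1, THEN subsetD])
    then obtain a b where ab: "x = a + b" "a \<in> lsum (Ls nvs)" "b \<in> lsum (Ls kvs)" unfolding ssum_def by blast
    have "x - b \<in> Wg kk" by (rule pvs.subspace_diff[OF gstabD(1)[OF G(2)] x]) (use ab(3) k in blast)
    moreover have "x - b = a" using ab(1) by simp
    ultimately have "a = 0" using Wg_disjoint ab(2) n by auto
    then show ?thesis using ab by simp
  qed
  then show "lsum (Ls kvs) = Wg kk" using k by blast
qed

lemma direct_sum_two:
  assumes "direct_sum W [W1, W2]"
  shows "W1 \<subseteq> W" "W2 \<subseteq> W" "W1 \<inter> W2 = {0}"
proof -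
  have s: "pvs.subspace W1" "pvs.subspace W2" using assms by (auto simp: direct_sum_def)
  have "W = lsum [W1, W2]" using assms unfolding direct_sum_def lsum_eq by blast
  then have W: "W = ssum W1 W2" by simp
  show "W1 \<subseteq> W" "W2 \<subseteq> W" unfolding W using ssum_left[OF s(2)] ssum_right[OF s(1)] by blast+
  have u: "\<forall>u. (\<forall>i<length [W1, W2]. u i \<in> [W1, W2] ! i) \<and> (\<Sum>i<length [W1, W2]. u i) = 0 \<longrightarrow> (\<forall>i<length [W1, W2]. u i = 0)"
    using assms unfolding direct_sum_def by blast
  have "x = 0" if x: "x \<in> W1" "x \<in> W2" for x
  proof -
    let ?u = "\<lambda>i::nat. if i = 0 then x else - x"
    have A: "\<forall>i<length [W1, W2]. ?u i \<in> [W1, W2] ! i"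
      using x pvs.subspace_neg[OF s(2) x(2)] by (auto simp: less_Suc_eq)
    have B: "(\<Sum>i<length [W1, W2]. ?u i) = 0" by (simp add: lessThan_Suc)
    have "\<forall>i<length [W1, W2]. ?u i = 0" by (rule u[THEN spec, of ?u, THEN mp, OF conjI[OF A B]])
    then have "0 < length [W1, W2] \<longrightarrow> ?u 0 = 0" by (rule spec)
    then show ?thesis by simp
  qed
  then show "W1 \<inter> W2 = {0}" using s pvs.subspace_0 by blast
qed

text \<open>Every nonzero submodule contains the translation invariant highest weight vector, which is unique up to scalars.\<close>

lemma indecomposable:
  assumes W: "astab W" "W \<subseteq> V" "W \<noteq> {0}" and c: "(i, j, k) = (1, 3, 4) \<or> (i, j, k) = (2, 2, 3)"
    and u: "\<And>g. g \<in> W \<Longrightarrow> g \<noteq> 0 \<Longrightarrow> g \<in> wsp 1 3 4 \<or> g \<in> wsp 2 2 3 \<Longrightarrow> g \<in> wsp i j k"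
  shows "aff_indecomposable W"
proof -
  have fo: "W \<subseteq> forms 5" using W(1) by (simp add: astab_def gstab_def)
  have "W1 = {0} \<or> W2 = {0}" if d: "aff_submodule W1" "aff_submodule W2" "direct_sum W [W1, W2]" for W1 W2
  proof (rule ccontr)
    assume n: "\<not> (W1 = {0} \<or> W2 = {0})"
    note ds = direct_sum_two[OF d(3)]
    have ex: "\<exists>g\<in>X. g \<noteq> 0 \<and> hw g \<and> D3 g = 0 \<and> g \<in> wsp i j k" if X: "aff_submodule X" "X \<subseteq> W" "X \<noteq> {0}" for X
    proof -
      have "0 \<in> X" using X(1) pvs.subspace_0 by (auto simp: aff_submodule_def)
      then obtain f where f: "f \<in> X" "f \<noteq> 0" using X(3) by blast
      have a: "astab X" by (rule aff_submodule_astab[OF X(1)]) (use X(2) fo in blast)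
      have "X \<subseteq> V" using X(2) W(2) by blast
      from T_inv_in[OF a this f] show ?thesis using u X(2) by blast
    qed
    obtain g where g: "g \<in> W1" "g \<noteq> 0" "hw g" "D3 g = 0" "g \<in> wsp i j k" using ex[OF d(1) ds(1)] n by blast
    obtain h where h: "h \<in> W2" "h \<noteq> 0" "hw h" "D3 h = 0" "h \<in> wsp i j k" using ex[OF d(2) ds(2)] n by blast
    obtain t where "g = pscale t h" using T_inv_unique[OF g(5,3,4) h(5,3,4,2) c] by blast
    then have "g \<in> W2" using d(2) h(1) pvs.subspace_scale by (auto simp: aff_submodule_def)
    then show False using g(1,2) ds(3) by blast
  qed
  then show ?thesis unfolding aff_indecomposable_def using astab_aff_submodule[OF W(1)] W(3) by blast
qed

lemma Wg_nn_indecomposable: "aff_indecomposable (Wg nn)"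
proof (rule indecomposable[OF Wg_astab[OF nn_wsp nn_hw] Wg_nn, of 1 3 4])
  have "nn \<in> Wg nn" "nn \<noteq> 0" using nvs_hwv by (simp_all add: nvs_def hwv_def)
  then show "Wg nn \<noteq> {0}" by blast
  show "g \<in> wsp 1 3 4" if "g \<in> Wg nn" "g \<noteq> 0" "g \<in> wsp 1 3 4 \<or> g \<in> wsp 2 2 3" for g
    using Wg_nn_weights[OF that(1) _ that(2), of 2 2 3] that(3) by auto
qed simp

lemma Wg_kk_indecomposable: "aff_indecomposable (Wg kk)"
proof (rule indecomposable[OF Wg_astab[OF kk_wsp kk_hw] Wg_kk, of 2 2 3])
  have "kk \<in> Wg kk" "kk \<noteq> 0" using kvs_hwv by (simp_all add: kvs_def hwv_def)
  then show "Wg kk \<noteq> {0}" by blast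
  show "g \<in> wsp 2 2 3" if "g \<in> Wg kk" "g \<noteq> 0" "g \<in> wsp 1 3 4 \<or> g \<in> wsp 2 2 3" for g
    using Wg_kk_weights[OF that(1) _ that(2), of 1 3 4] that(3) by auto
qed simp

theorem proposition6p7:
  shows "aff_submodule vanishing_quintics \<and> pvs.dim vanishing_quintics = 90 \<and>
    (\<exists>V1 V2 Us1 Us2.
       direct_sum vanishing_quintics [V1, V2] \<and>
       aff_indecomposable V1 \<and> pvs.dim V1 = 45 \<and>
       aff_indecomposable V2 \<and> pvs.dim V2 = 45 \<and>
       direct_sum V1 Us1 \<and> direct_sum V2 Us2 \<and>
       direct_sum vanishing_quintics (Us1 @ Us2) \<and> length (Us1 @ Us2) = 12 \<and>
       list_all2 gl_irreducible_of_type Us1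
         [(vector [3,3,4], 3), (vector [3,4,4], 3), (vector [2,4,4], 6),
          (vector [2,3,4], 8), (vector [1,4,4], 10), (vector [1,3,4], 15)] \<and>
       list_all2 gl_irreducible_of_type Us2
         [(vector [2,2,3], 3), (vector [2,3,3], 3), (vector [2,2,4], 6),
          (vector [2,3,4], 8), (vector [2,2,5], 10), (vector [2,3,5], 15)])"
proof -
  have sub: "\<forall>U\<in>set (Ls nvs @ Ls kvs). pvs.subspace U" using Ls_subspace[OF all_hwv] by simp
  have ind: "indep (Ls nvs @ Ls kvs)" using indep_all by simp
  note i = indep_append[OF sub ind]
  have V: "V = lsum (Ls nvs @ Ls kvs)" using V_eq by simp
  have V2: "V = lsum [Wg nn, Wg kk]" using V by (simp add: lsum_append lsum_nvs lsum_kvs)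
  have "direct_sum V [Wg nn, Wg kk]"
    unfolding V2
  proof (rule direct_sum_lsum)
    show "\<forall>U\<in>set [Wg nn, Wg kk]. pvs.subspace U" by (simp add: Wg_def Q_subspace)
    show "indep [Wg nn, Wg kk]" using Wg_disjoint pvs.subspace_0[of "Wg kk"] by (simp add: Wg_def Q_subspace)
  qed
  moreover have "direct_sum (Wg nn) (Ls nvs)" "direct_sum (Wg kk) (Ls kvs)"
    using direct_sum_lsum[of "Ls nvs"] direct_sum_lsum[of "Ls kvs"] sub i by (simp_all add: lsum_nvs lsum_kvs)
  moreover have "direct_sum V (Ls nvs @ Ls kvs)" unfolding V using direct_sum_lsum[OF sub ind] .
  moreover have dn: "has_dim (Wg nn) 45" "has_dim (Wg kk) 45"
    using has_dim_lsum[OF nvs_dims] has_dim_lsum[OF kvs_dims] i by (simp_all add: lsum_nvs lsum_kvs)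
  moreover have "pvs.dim (Wg nn) = 45" "pvs.dim (Wg kk) = 45" using dn has_dim_dim by blast+
  moreover have "pvs.dim V = 90"
  proof -
    have "has_dim (ssum (Wg nn) (Wg kk)) (45 + 45)" by (rule has_dim_ssum[OF dn Wg_disjoint])
    then show ?thesis using has_dim_dim[of V 90] V2 by simp
  qed
  moreover have "length (Ls nvs @ Ls kvs) = 12" by (simp add: nvs_def kvs_def)
  ultimately show ?thesis
    using V_aff_submodule Wg_nn_indecomposable Wg_kk_indecomposable nvs_types kvs_types by blast
qed

end
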